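(* Let $k\ge0$, $\sigma\ge k+1.5$, and take stabilisation parameters $\lambda_{i,y}=\lambda_{x,j}=0$ for $i,j=0,1,\dots,N-1$ and $\lambda_{N,y}=\lambda_{x,N}=\sqrt\varepsilon$. Let $\mathbf w=(u,p,q)$, $p=\varepsilon u_x$, $q=\varepsilon u_y$, where $u$ solves the problem and satisfies the regularity assumption, and let $\mathbf W=(U,P,Q)\in\mathcal V_N^3$ be the LDG solution on the layer-adapted mesh. Then there is $C>0$ independent of $\varepsilon$ and $N$ such that $$|||\mathbf w-\mathbf W|||_E\le\begin{cases}C[\varepsilon^{1/4}(N^{-1}\ln N)^{k+1}+N^{-(k+1)}],&\text{for the S-mesh},\\ CN^{-(k+1)},&\text{for the BS-mesh and the B-type mesh}.\end{cases}$$
   Context: Problem: $0<\varepsilon\ll1$, $\Omega=(0,1)^2$, $b$ smooth on $\overline\Omega$ with $b\ge2\beta^2>0$ for a constant $\beta>0$, $f$ given, and $u$ solves $-\varepsilon\Delta u+bu=f$ in $\Omega$, $u=0$ on $\partial\Omega$. Standing regularity assumption: $u=S+\sum_{m=1}^4W_m+\sum_{m=1}^4Z_m$ where, for all $0\le i,j\le k+2$ and a constant $C$ independent of $\varepsilon$: $|\partial_x^i\partial_y^jS|\le C$; $|\partial_x^i\partial_y^jW_1|\le C\varepsilon^{-i/2}e^{-\beta x/\sqrt\varepsilon}$, $|\partial_x^i\partial_y^jW_2|\le C\varepsilon^{-j/2}e^{-\beta y/\sqrt\varepsilon}$, $|\partial_x^i\partial_y^jW_3|\le C\varepsilon^{-i/2}e^{-\beta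 (1-x)/\sqrt\varepsilon}$, $|\partial_x^i\partial_y^jW_4|\le C\varepsilon^{-j/2}e^{-\beta (1-y)/\sqrt\varepsilon}$; $|\partial_x^i\partial_y^jZ_m|\le C\varepsilon^{-(i+j)/2}e^{-\beta(d_m(x)+d'_m(y))/\sqrt\varepsilon}$ with $(d_m,d'_m)$ the distances to the corresponding corner, e.g. $Z_1$: $e^{-\beta(x+y)/\sqrt\varepsilon}$ (and $Z_2,Z_3,Z_4$ analogously for the corners $(1,0),(1,1),(0,1)$). Mesh: $N\ge4$ a multiple of $4$, $\sqrt\varepsilon\le N^{-1}$, $\varepsilon$ small so that $\tau:=\frac{\sigma\sqrt\varepsilon}{\beta}\varphi(1/4)\le1/4$. $\varphi$ is one of: S-mesh $\varphi(t)=4t\ln N$; BS-mesh $\varphi(t)=-\ln[1-4(1-N^{-1})t]$; B-type mesh $\varphi(t)=-\ln[1-4(1-\sqrt\varepsilon)t]$. Mesh points $x_i=\frac{\sigma\sqrt\varepsilon}{\beta}\varphi(i/N)$ ($0\le i\le N/4$), $x_i=\tau+2(1-2\tau)(i/N-1/4)$ ($N/4<i<3N/4$), $x_i=1-\frac{\sigma\sqrt\varepsilon}{\beta}\varphi(1-i/N)$ ($3N/4\le i\le N$), and $y_j=x_j$; tensor-product mesh with elements $K_{ij}=I_i\times J_j$, $I_i=(x_{i-1},x_i)$, $J_j=(y_{j-1},y_j)$. LDG method: $\mathcal V_N=\{v\in L^2(\Omega):v|_{K_{ij}}\in\mathcal Q^k(K_{ij})\}$ ($\mathcal Q^k$ =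 polynomials of degree $\le k$ in each variable). Traces $v^\pm_{i,y}=\lim_{x\to x_i^\pm}v(x,y)$, $v^\pm_{x,j}=\lim_{y\to y_j^\pm}v(x,y)$; jumps $[\![v]\!]_{i,y}=v^+_{i,y}-v^-_{i,y}$ ($1\le i\le N-1$), $[\![v]\!]_{0,y}=v^+_{0,y}$, $[\![v]\!]_{N,y}=-v^-_{N,y}$, and analogously $[\![v]\!]_{x,j}$. $(\cdot,\cdot)$ is the broken $L^2(\Omega)$ inner product (derivatives taken elementwise), $\langle\cdot,\cdot\rangle_{J_j}$, $\langle\cdot,\cdot\rangle_{I_i}$ are $L^2$ inner products on edges. For $\mathbf W=(U,P,Q)$, $\mathbf z=(v,s,r)$ define $B(\mathbf W;\mathbf z)=T_1+T_2+T_3+T_4$ with $T_1=\varepsilon^{-1}(P,s)+\varepsilon^{-1}(Q,r)+(bU,v)$; $T_2=(U,s_x)+\sum_{j=1}^N\sum_{i=1}^{N-1}\langle U^-_{i,y},[\![s]\!]_{i,y}\rangle_{J_j}+(U,r_y)+\sum_{i=1}^N\sum_{j=1}^{N-1}\langle U^-_{x,j},[\![r]\!]_{x,j}\rangle_{I_i}$; $T_3=(P,v_x)+\sum_{j=1}^N[\sum_{i=0}^{N-1}\langle P^+_{i,y},[\![v]\!]_{i,y}\rangle_{J_j}-\langle P^-_{N,y},v^-_{N,y}\rangle_{J_j}]+(Q,v_y)+\sum_{i=1}^N[\sum_{j=0}^{N-1}\langle Q^+_{x,j},[\![v]\!]_{x,j}\rangle_{I_i}-\langle Q^-_{x,N},v^-_{x,N}\rangle_{I_i}]$;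 $T_4=\sum_{j=1}^N\sum_{i=0}^N\langle\lambda_{i,y}[\![U]\!]_{i,y},[\![v]\!]_{i,y}\rangle_{J_j}+\sum_{i=1}^N\sum_{j=0}^N\langle\lambda_{x,j}[\![U]\!]_{x,j},[\![v]\!]_{x,j}\rangle_{I_i}$, with stabilisation parameters $\lambda\ge0$. The LDG solution $\mathbf W\in\mathcal V_N^3$ satisfies $B(\mathbf W;\mathbf z)=(f,v)$ for all $\mathbf z=(v,s,r)\in\mathcal V_N^3$. Energy norm: $|||\mathbf w|||_E^2=\varepsilon^{-1}\|p\|^2+\varepsilon^{-1}\|q\|^2+\|b^{1/2}u\|^2+\sum_{j=1}^N\sum_{i=0}^N\int_{J_j}\lambda_{i,y}[\![u]\!]_{i,y}^2dy+\sum_{i=1}^N\sum_{j=0}^N\int_{I_i}\lambda_{x,j}[\![u]\!]_{x,j}^2dx$. *)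

theory Defs
  imports "HOL-Analysis.Analysis"
begin

definition pdx :: "(real \<Rightarrow> real \<Rightarrow> real) \<Rightarrow> real \<Rightarrow> real \<Rightarrow> real" where
  "pdx g = (\<lambda>x y. deriv (\<lambda>t. g t y) x)"

definition pdy :: "(real \<Rightarrow> real \<Rightarrow> real) \<Rightarrow> real \<Rightarrow> real \<Rightarrow> real" where
  "pdy g = (\<lambda>x y. deriv (\<lambda>t. g x t) y)"

definition pd :: "nat \<Rightarrow> nat \<Rightarrow> (real \<Rightarrow> real \<Rightarrow> real) \<Rightarrow> real \<Rightarrow> real \<Rightarrow> real" where
  "pd i j g = (pdx ^^ i) ((pdy ^^ j) g)"

definition in_open_sq :: "real \<Rightarrow> real \<Rightarrow> bool" where
  "in_open_sq x y \<longleftrightarrow> 0 < x \<and> x < 1 \<and> 0 < y \<and> y < 1"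

definition in_closed_sq :: "real \<Rightarrow> real \<Rightarrow> bool" where
  "in_closed_sq x y \<longleftrightarrow> 0 \<le> x \<and> x \<le> 1 \<and> 0 \<le> y \<and> y \<le> 1"

definition C_mixed :: "nat \<Rightarrow> (real \<Rightarrow> real \<Rightarrow> real) \<Rightarrow> bool" where
  "C_mixed n g \<longleftrightarrow> (\<forall>x y. in_open_sq x y \<longrightarrow>
      (\<forall>i<n. \<forall>j\<le>n. (\<lambda>t. pd i j g t y) differentiable (at x)) \<and>
      (\<forall>j<n. (\<lambda>t. pd 0 j g x t) differentiable (at y)) \<and>
      (\<forall>i\<le>n. \<forall>j\<le>n. continuous (at (x, y)) (\<lambda>z. pd i j g (fst z) (snd z))))"

definition smooth_closed :: "(real \<Rightarrow> real \<Rightarrow> real) \<Rightarrow> bool" where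
  "smooth_closed g \<longleftrightarrow> (\<forall>n. C_mixed n g) \<and>
     (\<forall>i j. \<exists>h. continuous_on (cbox (0,0) (1,1)) h \<and>
            (\<forall>x y. in_open_sq x y \<longrightarrow> h (x, y) = pd i j g x y)) \<and>
     continuous_on (cbox (0,0) (1,1)) (\<lambda>z. g (fst z) (snd z))"

definition solves_problem ::
  "real \<Rightarrow> (real \<Rightarrow> real \<Rightarrow> real) \<Rightarrow> (real \<Rightarrow> real \<Rightarrow> real) \<Rightarrow> (real \<Rightarrow> real \<Rightarrow> real) \<Rightarrow> bool" where
  "solves_problem \<epsilon> b f u \<longleftrightarrow>
     C_mixed 2 u \<and>
     continuous_on (cbox (0,0) (1,1)) (\<lambda>z. u (fst z) (snd z)) \<and>
     (\<forall>x y. in_open_sq x y \<longrightarrow> - \<epsilon> * (pd 2 0 u x y + pd 0 2 u x y) + b x y * u x y = f x y) \<and>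
     (\<forall>x y. in_closed_sq x y \<and> (x = 0 \<or> x = 1 \<or> y = 0 \<or> y = 1) \<longrightarrow> u x y = 0)"

definition regularity ::
  "nat \<Rightarrow> real \<Rightarrow> real \<Rightarrow> real \<Rightarrow> (real \<Rightarrow> real \<Rightarrow> real) \<Rightarrow> (real \<Rightarrow> real \<Rightarrow> real)
   \<Rightarrow> (nat \<Rightarrow> real \<Rightarrow> real \<Rightarrow> real) \<Rightarrow> (nat \<Rightarrow> real \<Rightarrow> real \<Rightarrow> real) \<Rightarrow> bool" where
  "regularity k \<beta> C0 \<epsilon> u S W Z \<longleftrightarrow>
     (\<forall>x y. in_closed_sq x y \<longrightarrow>
        u x y = S x y + (\<Sum>m=1..4. W m x y) + (\<Sum>m=1..4. Z m x y)) \<and>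
     C_mixed (k+2) S \<and> (\<forall>m\<in>{1..4}. C_mixed (k+2) (W m) \<and> C_mixed (k+2) (Z m)) \<and>
     (\<forall>i\<le>k+2. \<forall>j\<le>k+2. \<forall>x y. in_open_sq x y \<longrightarrow>
        \<bar>pd i j S x y\<bar> \<le> C0 \<and>
        \<bar>pd i j (W 1) x y\<bar> \<le> C0 * \<epsilon> powr (- real i / 2) * exp (- \<beta> * x / sqrt \<epsilon>) \<and>
        \<bar>pd i j (W 2) x y\<bar> \<le> C0 * \<epsilon> powr (- real j / 2) * exp (- \<beta> * y / sqrt \<epsilon>) \<and>
        \<bar>pd i j (W 3) x y\<bar> \<le> C0 * \<epsilon> powr (- real i / 2) * exp (- \<beta> * (1 - x) / sqrt \<epsilon>) \<and>
        \<bar>pd i j (W 4) x y\<bar> \<le> C0 * \<epsilon> powr (- real j / 2) * exp (- \<beta> * (1 - y) / sqrt \<epsilon>) \<and>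
        \<bar>pd i j (Z 1) x y\<bar> \<le> C0 * \<epsilon> powr (- real (i + j) / 2) * exp (- \<beta> * (x + y) / sqrt \<epsilon>) \<and>
        \<bar>pd i j (Z 2) x y\<bar> \<le> C0 * \<epsilon> powr (- real (i + j) / 2) * exp (- \<beta> * ((1 - x) + y) / sqrt \<epsilon>) \<and>
        \<bar>pd i j (Z 3) x y\<bar> \<le> C0 * \<epsilon> powr (- real (i + j) / 2) * exp (- \<beta> * ((1 - x) + (1 - y)) / sqrt \<epsilon>) \<and>
        \<bar>pd i j (Z 4) x y\<bar> \<le> C0 * \<epsilon> powr (- real (i + j) / 2) * exp (- \<beta> * (x + (1 - y)) / sqrt \<epsilon>))"

datatype meshtype = S_mesh | BS_mesh | B_mesh

definition mesh_phi :: "meshtype \<Rightarrow> nat \<Rightarrow> real \<Rightarrow> real \<Rightarrow> real" where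
  "mesh_phi mt N \<epsilon> t = (case mt of
       S_mesh \<Rightarrow> 4 * t * ln (real N)
     | BS_mesh \<Rightarrow> - ln (1 - 4 * (1 - 1 / real N) * t)
     | B_mesh \<Rightarrow> - ln (1 - 4 * (1 - sqrt \<epsilon>) * t))"

definition mesh_tau :: "meshtype \<Rightarrow> real \<Rightarrow> real \<Rightarrow> real \<Rightarrow> nat \<Rightarrow> real" where
  "mesh_tau mt \<sigma> \<beta> \<epsilon> N = \<sigma> * sqrt \<epsilon> / \<beta> * mesh_phi mt N \<epsilon> (1/4)"

definition mesh_pt :: "meshtype \<Rightarrow> real \<Rightarrow> real \<Rightarrow> real \<Rightarrow> nat \<Rightarrow> nat \<Rightarrow> real" where
  "mesh_pt mt \<sigma> \<beta> \<epsilon> N i =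
     (if 4 * i \<le> N then \<sigma> * sqrt \<epsilon> / \<beta> * mesh_phi mt N \<epsilon> (real i / real N)
      else if 4 * i < 3 * N then
        mesh_tau mt \<sigma> \<beta> \<epsilon> N + 2 * (1 - 2 * mesh_tau mt \<sigma> \<beta> \<epsilon> N) * (real i / real N - 1/4)
      else 1 - \<sigma> * sqrt \<epsilon> / \<beta> * mesh_phi mt N \<epsilon> (1 - real i / real N))"

text \<open>xs are the mesh points x_0..x_N (also used as y_j = x_j).  Membership in V_N:
  on each open element K_ij the function is a polynomial of degree \<le> k in each variable.\<close>
definition in_VN :: "nat \<Rightarrow> (nat \<Rightarrow> real) \<Rightarrow> nat \<Rightarrow> (real \<Rightarrow> real \<Rightarrow> real) \<Rightarrow> bool" where
  "in_VN k xs N v \<longleftrightarrow> (\<forall>i\<in>{1..N}. \<forall>j\<in>{1..N}. \<exists>c :: nat \<Rightarrow> nat \<Rightarrow> real.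
      \<forall>x y. xs (i-1) < x \<and> x < xs i \<and> xs (j-1) < y \<and> y < xs j \<longrightarrow>
        v x y = (\<Sum>a\<le>k. \<Sum>b\<le>k. c a b * x ^ a * y ^ b))"

definition bip :: "(nat \<Rightarrow> real) \<Rightarrow> nat \<Rightarrow> (real \<Rightarrow> real \<Rightarrow> real) \<Rightarrow> (real \<Rightarrow> real \<Rightarrow> real) \<Rightarrow> real" where
  "bip xs N g h = (\<Sum>i=1..N. \<Sum>j=1..N.
      integral (cbox (xs (i-1), xs (j-1)) (xs i, xs j)) (\<lambda>z. g (fst z) (snd z) * h (fst z) (snd z)))"

definition eip :: "(nat \<Rightarrow> real) \<Rightarrow> nat \<Rightarrow> (real \<Rightarrow> real) \<Rightarrow> (real \<Rightarrow> real) \<Rightarrow> real" where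
  "eip xs j a c = integral {xs (j-1)..xs j} (\<lambda>t. a t * c t)"

definition trxp :: "(nat \<Rightarrow> real) \<Rightarrow> (real \<Rightarrow> real \<Rightarrow> real) \<Rightarrow> nat \<Rightarrow> real \<Rightarrow> real" where
  "trxp xs v i y = Lim (at_right (xs i)) (\<lambda>t. v t y)"
definition trxm :: "(nat \<Rightarrow> real) \<Rightarrow> (real \<Rightarrow> real \<Rightarrow> real) \<Rightarrow> nat \<Rightarrow> real \<Rightarrow> real" where
  "trxm xs v i y = Lim (at_left (xs i)) (\<lambda>t. v t y)"
definition tryp :: "(nat \<Rightarrow> real) \<Rightarrow> (real \<Rightarrow> real \<Rightarrow> real) \<Rightarrow> real \<Rightarrow> nat \<Rightarrow> real" where
  "tryp xs v x j = Lim (at_right (xs j)) (\<lambda>t. v x t)"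
definition trym :: "(nat \<Rightarrow> real) \<Rightarrow> (real \<Rightarrow> real \<Rightarrow> real) \<Rightarrow> real \<Rightarrow> nat \<Rightarrow> real" where
  "trym xs v x j = Lim (at_left (xs j)) (\<lambda>t. v x t)"

definition jmpx :: "(nat \<Rightarrow> real) \<Rightarrow> nat \<Rightarrow> (real \<Rightarrow> real \<Rightarrow> real) \<Rightarrow> nat \<Rightarrow> real \<Rightarrow> real" where
  "jmpx xs N v i y = (if i = 0 then trxp xs v 0 y
                      else if i = N then - trxm xs v N y
                      else trxp xs v i y - trxm xs v i y)"
definition jmpy :: "(nat \<Rightarrow> real) \<Rightarrow> nat \<Rightarrow> (real \<Rightarrow> real \<Rightarrow> real) \<Rightarrow> real \<Rightarrow> nat \<Rightarrow> real" where
  "jmpy xs N v x j = (if j = 0 then tryp xs v x 0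
                      else if j = N then - trym xs v x N
                      else tryp xs v x j - trym xs v x j)"

type_synonym fun2 = "real \<Rightarrow> real \<Rightarrow> real"

text \<open>The LDG bilinear form B(W; z) = T1 + T2 + T3 + T4.  lv i = lambda_{i,y}, lh j = lambda_{x,j}.\<close>
definition LDG_B :: "real \<Rightarrow> fun2 \<Rightarrow> (nat \<Rightarrow> real) \<Rightarrow> (nat \<Rightarrow> real) \<Rightarrow> (nat \<Rightarrow> real) \<Rightarrow> nat
    \<Rightarrow> fun2 \<times> fun2 \<times> fun2 \<Rightarrow> fun2 \<times> fun2 \<times> fun2 \<Rightarrow> real" where
  "LDG_B \<epsilon> b lv lh xs N W z = (case W of (U, P, Q) \<Rightarrow> case z of (v, s, r) \<Rightarrow>
     let T1 = bip xs N P s / \<epsilon> + bip xs N Q r / \<epsilon> + bip xs N (\<lambda>x y. b x y * U x y) v;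
         T2 = bip xs N U (pdx s)
              + (\<Sum>j=1..N. \<Sum>i=1..N-1. eip xs j (trxm xs U i) (jmpx xs N s i))
              + bip xs N U (pdy r)
              + (\<Sum>i=1..N. \<Sum>j=1..N-1. eip xs i (\<lambda>x. trym xs U x j) (\<lambda>x. jmpy xs N r x j));
         T3 = bip xs N P (pdx v)
              + (\<Sum>j=1..N. (\<Sum>i=0..N-1. eip xs j (trxp xs P i) (jmpx xs N v i))
                           - eip xs j (trxm xs P N) (trxm xs v N))
              + bip xs N Q (pdy v)
              + (\<Sum>i=1..N. (\<Sum>j=0..N-1. eip xs i (\<lambda>x. tryp xs Q x j) (\<lambda>x. jmpy xs N v x j))
                           - eip xs i (\<lambda>x. trym xs Q x N) (\<lambda>x. trym xs v x N));
         T4 = (\<Sum>j=1..N. \<Sum>i=0..N. eip xs j (\<lambda>y. lv i * jmpx xs N U i y) (jmpx xs N v i))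
              + (\<Sum>i=1..N. \<Sum>j=0..N. eip xs i (\<lambda>x. lh j * jmpy xs N U x j) (\<lambda>x. jmpy xs N v x j))
     in T1 + T2 + T3 + T4)"

definition is_LDG_solution :: "nat \<Rightarrow> real \<Rightarrow> fun2 \<Rightarrow> fun2 \<Rightarrow> (nat \<Rightarrow> real) \<Rightarrow> (nat \<Rightarrow> real)
    \<Rightarrow> (nat \<Rightarrow> real) \<Rightarrow> nat \<Rightarrow> fun2 \<Rightarrow> fun2 \<Rightarrow> fun2 \<Rightarrow> bool" where
  "is_LDG_solution k \<epsilon> b f lv lh xs N U P Q \<longleftrightarrow>
     in_VN k xs N U \<and> in_VN k xs N P \<and> in_VN k xs N Q \<and>
     (\<forall>v s r. in_VN k xs N v \<and> in_VN k xs N s \<and> in_VN k xs N r \<longrightarrow>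
        LDG_B \<epsilon> b lv lh xs N (U, P, Q) (v, s, r) = bip xs N f v)"

definition energy_norm :: "real \<Rightarrow> fun2 \<Rightarrow> (nat \<Rightarrow> real) \<Rightarrow> (nat \<Rightarrow> real) \<Rightarrow> (nat \<Rightarrow> real) \<Rightarrow> nat
    \<Rightarrow> fun2 \<Rightarrow> fun2 \<Rightarrow> fun2 \<Rightarrow> real" where
  "energy_norm \<epsilon> b lv lh xs N u p q = sqrt (
      bip xs N p p / \<epsilon> + bip xs N q q / \<epsilon> + bip xs N (\<lambda>x y. b x y * u x y) u
      + (\<Sum>j=1..N. \<Sum>i=0..N. integral {xs (j-1)..xs j} (\<lambda>y. lv i * (jmpx xs N u i y)\<^sup>2))
      + (\<Sum>i=1..N. \<Sum>j=0..N. integral {xs (i-1)..xs i} (\<lambda>x. lh j * (jmpy xs N u x j)\<^sup>2)))"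

definition stab :: "real \<Rightarrow> nat \<Rightarrow> nat \<Rightarrow> real" where
  "stab \<epsilon> N i = (if i = N then sqrt \<epsilon> else 0)"

definition err_bound :: "meshtype \<Rightarrow> nat \<Rightarrow> real \<Rightarrow> nat \<Rightarrow> real" where
  "err_bound mt k \<epsilon> N = (case mt of
       S_mesh \<Rightarrow> \<epsilon> powr (1/4) * (ln (real N) / real N) ^ (k+1) + 1 / real N ^ (k+1)
     | _ \<Rightarrow> 1 / real N ^ (k+1))"

end

theory Submission
  imports Defs "Jordan_Normal_Form.Determinant"
begin

text \<open>
  The solution is compared with projections chosen so that the flux terms of the scheme become
  exact: \<open>u\<close> is projected by the right Gauss-Radau projection in both variables, \<open>p = \<epsilon> u\<^sub>x\<close> by the left
  Gauss-Radau projection in \<open>x\<close> combined with the \<open>L\<^sup>2\<close> projection in \<open>y\<close>, and \<open>q\<close> symmetrically.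
  Orthogonality and interpolation at the upwind end points give
  \<open>T\<^sub>2(\<Pi> u; s) = - (\<pi>\<^sub>y u\<^sub>x, s)\<close> with \<open>\<pi>\<^sub>y\<close> the one-dimensional projection in \<open>y\<close>, while \<open>T\<^sub>3(\<Pi> p; v)\<close> equals
  \<open>- (p\<^sub>x, v)\<close> up to a term on the edge \<open>x = 1\<close>, which the stabilisation with weight \<open>\<surd>\<epsilon>\<close> absorbs.
  Testing with the discrete error, where \<open>T\<^sub>2\<close> and \<open>T\<^sub>3\<close> cancel, leaves only pairings with
  projection errors, and Young's inequality bounds the energy norm by the cellwise maxima of these errors.

  On a cell of width \<open>h\<close> the error of a layer component in its own variable is at most a constant times
  \<open>min 1 ((h / \<surd>\<epsilon>)\<^sup>k\<^sup>+\<^sup>1)\<close> times the exponential at the end of the cell nearest to the layer; the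
  smooth component contributes \<open>h\<^sup>k\<^sup>+\<^sup>1\<close>.  The squares of these bounds, weighted with the cell widths,
  are summed on each of the three meshes; the layer region has width of order \<open>\<surd>\<epsilon>\<close> up to logarithms,
  which is the source of the factor \<open>\<epsilon>\<^sup>1\<^sup>/\<^sup>4\<close> on the S-mesh.
\<close>

text \<open>The alternating fluxes dictate the projections: the flux of \<open>u\<close> is a trace
  from the left, matched by the right Radau projection, and the flux of \<open>p\<close> a trace
  from the right, matched by the left one. The exception is the edge x = 1, where only the inner
  trace of \<open>p\<close> is available. The mismatch there is sqrt \<epsilon> times a projection
  error, and a weight sqrt \<epsilon> on that edge balances both sides of Young's inequality. No
  superconvergence is used: the projections of \<open>ux\<close> and of p / \<epsilon> are both
  compared with \<open>ux\<close> itself, and the resulting factor 1 / sqrt \<epsilon> is paid for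
  by the weight 1 / \<epsilon> of the flux part of the energy norm. The regularity bounds hold in
  the open square only, whereas the projections need values on the boundary. The components and
  their first derivatives are therefore extended continuously, and second derivatives occur only
  under integrals. On the S-mesh, counting all layer cells with the full width of the layer region
  would cost a further logarithm; summing the decay of the exponential as a geometric series avoids
  it.\<close>

text \<open>Turns unisolvence into a two-sided inverse. Both sides are used later: the left inverse
  gives reproduction of polynomials, the right inverse gives preservation of the prescribed
  functionals.\<close>

lemma matrix_inverse_exists:
  fixes M :: "nat \<Rightarrow> nat \<Rightarrow> real"
  assumes inj: "\<And>c. (\<And>i. i < n \<Longrightarrow> (\<Sum>j<n. M i j * c j) = 0) \<Longrightarrow> (\<And>j. j < n \<Longrightarrow> c j = 0)"
  shows "\<exists>A. (\<forall>i<n. \<forall>j<n. (\<Sum>l<n. A i l * M l j) = of_bool (i = j)) \<and>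
             (\<forall>i<n. \<forall>j<n. (\<Sum>l<n. M i l * A l j) = of_bool (i = j))"
proof -
  define X where "X = Matrix.mat n n (\<lambda>(i, j). M i j)"
  have X: "X \<in> carrier_mat n n" by (simp add: X_def)
  have "Determinant.det X \<noteq> 0"
  proof
    assume "Determinant.det X = 0"
    then obtain v where v: "v \<in> carrier_vec n" "v \<noteq> 0\<^sub>v n" "X *\<^sub>v v = 0\<^sub>v n"
      using det_0_iff_vec_prod_zero_field[OF X] by auto
    have z: "(\<Sum>j<n. M i j * vec_index v j) = 0" if "i < n" for i
    proof -
      have "vec_index (X *\<^sub>v v) i = 0" using v that by simp
      then show ?thesis
        using that v(1) by (simp add: X_def scalar_prod_def lessThan_atLeast0)
    qed
    have "vec_index v j = 0" if "j < n" for j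
      using inj[of "vec_index v", OF z that] .
    then have "v = 0\<^sub>v n" using v(1) by (intro eq_vecI) auto
    with v show False by simp
  qed
  then obtain Y where Y: "Y \<in> carrier_mat n n" "Y * X = 1\<^sub>m n" "X * Y = 1\<^sub>m n"
    using det_non_zero_imp_unit[OF X, of n]
    unfolding Units_def ring_mat_def by auto
  define A where "A i j = index_mat Y (i, j)" for i j
  have "(\<Sum>l<n. A i l * M l j) = of_bool (i = j)" if "i < n" "j < n" for i j
  proof -
    have "index_mat (Y * X) (i, j) = of_bool (i = j)" using Y that by simp
    then show ?thesis
      using that Y(1) X by (simp add: X_def A_def scalar_prod_def lessThan_atLeast0)
  qed
  moreover have "(\<Sum>l<n. M i l * A l j) = of_bool (i = j)" if "i < n" "j < n" for i j
  proof -
    have "index_mat (X * Y) (i, j) = of_bool (i = j)" using Y that by simp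
    then show ?thesis
      using that Y(1) X by (simp add: X_def A_def scalar_prod_def lessThan_atLeast0)
  qed
  ultimately show ?thesis by blast
qed

section \<open>Polynomial projections on an interval\<close>

text \<open>A triple \<open>(a, b, w)\<close> encodes, for each \<open>m\<close>, the functional \<open>g \<mapsto> a\<^sub>m g(0) + b\<^sub>m g(1) + \<integral> w\<^sub>m g\<close> on \<open>[0,1]\<close>, which
  returns the coefficient of \<open>s\<^sup>m\<close> of the projected polynomial.  Gauss-Radau and \<open>L\<^sup>2\<close> projections
  both have this form, with \<open>w\<^sub>m\<close> polynomial, so that projections in different variables commute by Fubini.\<close>

type_synonym kern = "(nat \<Rightarrow> real) \<times> (nat \<Rightarrow> real) \<times> (nat \<Rightarrow> real \<Rightarrow> real)"

definition mcoef :: "kern \<Rightarrow> nat \<Rightarrow> (real \<Rightarrow> real) \<Rightarrow> real" where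
  "mcoef K m g = fst K m * g 0 + fst (snd K) m * g 1 + integral {0..1} (\<lambda>t. snd (snd K) m t * g t)"

definition rproj :: "nat \<Rightarrow> kern \<Rightarrow> (real \<Rightarrow> real) \<Rightarrow> real \<Rightarrow> real" where
  "rproj k K g s = (\<Sum>m\<le>k. mcoef K m g * s ^ m)"

definition kern_cont :: "kern \<Rightarrow> bool" where
  "kern_cont K \<longleftrightarrow> (\<forall>m. continuous_on {0..1} (snd (snd K) m))"

definition kern_ok :: "nat \<Rightarrow> kern \<Rightarrow> bool" where
  "kern_ok k K \<longleftrightarrow> kern_cont K \<and>
     (\<forall>p. degree p \<le> k \<longrightarrow> (\<forall>m\<le>k. mcoef K m (poly p) = coeff p m))"

lemma kern_cont_integrable:
  assumes "kern_cont K" "continuous_on {0..1} g"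
  shows "(\<lambda>t. snd (snd K) m t * g t) integrable_on {0..1}"
  using assms unfolding kern_cont_def
  by (intro integrable_continuous_interval continuous_intros) auto

lemma mcoef_cong: "(\<And>t. t \<in> {0..1} \<Longrightarrow> g t = h t) \<Longrightarrow> mcoef K m g = mcoef K m h"
proof -
  assume "\<And>t. t \<in> {0..1} \<Longrightarrow> g t = h t"
  moreover from this have "integral {0..1} (\<lambda>t. snd (snd K) m t * g t) = integral {0..1} (\<lambda>t. snd (snd K) m t * h t)"
    by (intro integral_cong) auto
  ultimately show ?thesis by (simp add: mcoef_def)
qed

lemma mcoef_add:
  assumes "kern_cont K" "continuous_on {0..1} g" "continuous_on {0..1} h"
  shows "mcoef K m (\<lambda>t. g t + h t) = mcoef K m g + mcoef K m h"
  using kern_cont_integrable[OF assms(1,2), of m] kern_cont_integrable[OF assms(1,3), of m]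
  by (simp add: mcoef_def distrib_left integral_add algebra_simps)

lemma mcoef_cmult:
  "mcoef K m (\<lambda>t. c * g t) = c * mcoef K m g"
proof -
  have "integral {0..1} (\<lambda>t. snd (snd K) m t * (c * g t)) = c * integral {0..1} (\<lambda>t. snd (snd K) m t * g t)"
    by (simp add: mult.left_commute)
  then show ?thesis by (simp add: mcoef_def algebra_simps)
qed

lemma mcoef_diff:
  assumes "kern_cont K" "continuous_on {0..1} g" "continuous_on {0..1} h"
  shows "mcoef K m (\<lambda>t. g t - h t) = mcoef K m g - mcoef K m h"
  using mcoef_add[OF assms(1,2), of "\<lambda>t. - 1 * h t" m] mcoef_cmult[of K m "-1" h] assms(3)
  by (simp add: continuous_intros)

lemma mcoef_sum:
  assumes "kern_cont K" "\<And>i. i \<in> I \<Longrightarrow> continuous_on {0..1} (g i)" "finite I"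
  shows "mcoef K m (\<lambda>t. \<Sum>i\<in>I. g i t) = (\<Sum>i\<in>I. mcoef K m (g i))"
  using assms(3,2)
proof (induction I rule: finite_induct)
  case empty
  then show ?case by (simp add: mcoef_def)
next
  case (insert i I)
  then have "continuous_on {0..1} (\<lambda>t. \<Sum>i\<in>I. g i t)" by (intro continuous_intros) auto
  with insert show ?case by (simp add: mcoef_add[OF assms(1)])
qed

lemma mcoef_bound:
  assumes "kern_cont K"
  shows "\<exists>C\<ge>0. \<forall>g M. continuous_on {0..1} g \<and> (\<forall>t\<in>{0..1}. \<bar>g t\<bar> \<le> M) \<longrightarrow> \<bar>mcoef K m g\<bar> \<le> C * M"
proof -
  have "compact (snd (snd K) m ` {0..1})"
    using assms unfolding kern_cont_def by (intro compact_continuous_image) auto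
  then obtain B where B: "\<And>t. t \<in> {0..1} \<Longrightarrow> \<bar>snd (snd K) m t\<bar> \<le> B"
    using compact_imp_bounded bounded_iff by (metis image_eqI real_norm_def)
  have B0: "0 \<le> B" using B[of 0] by force
  have "\<bar>mcoef K m g\<bar> \<le> (\<bar>fst K m\<bar> + \<bar>fst (snd K) m\<bar> + B) * M"
    if g: "continuous_on {0..1} g" and M: "\<forall>t\<in>{0..1}. \<bar>g t\<bar> \<le> M" for g M
  proof -
    have "norm (integral {0..1} (\<lambda>t. snd (snd K) m t * g t)) \<le> integral {0..1::real} (\<lambda>t. B * M)"
      using B M B0 kern_cont_integrable[OF assms g, of m]
      by (intro integral_norm_bound_integral) (auto simp: abs_mult intro!: mult_mono)
    moreover have "\<bar>fst K m * g 0\<bar> \<le> \<bar>fst K m\<bar> * M" "\<bar>fst (snd K) m * g 1\<bar> \<le> \<bar>fst (snd K) m\<bar> * M"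
      using M by (auto simp: abs_mult intro!: mult_left_mono)
    ultimately show ?thesis unfolding mcoef_def by (simp add: algebra_simps)
  qed
  then show ?thesis using B0 by (intro exI[of _ "\<bar>fst K m\<bar> + \<bar>fst (snd K) m\<bar> + B"]) auto
qed

lemma rproj_bound:
  assumes "kern_cont K"
  shows "\<exists>C\<ge>0. \<forall>g M. \<forall>s\<in>{0..1}. continuous_on {0..1} g \<and> (\<forall>t\<in>{0..1}. \<bar>g t\<bar> \<le> M) \<longrightarrow>
     \<bar>rproj k K g s\<bar> \<le> C * M"
proof -
  have "\<forall>m. \<exists>C\<ge>0. \<forall>g M. continuous_on {0..1} g \<and> (\<forall>t\<in>{0..1}. \<bar>g t\<bar> \<le> M) \<longrightarrow> \<bar>mcoef K m g\<bar> \<le> C * M"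
    using mcoef_bound[OF assms] by blast
  then obtain C where C: "\<And>m. 0 \<le> C m"
    "\<And>m g M. continuous_on {0..1} g \<Longrightarrow> (\<forall>t\<in>{0..1}. \<bar>g t\<bar> \<le> M) \<Longrightarrow> \<bar>mcoef K m g\<bar> \<le> C m * M"
    by metis
  have "\<bar>rproj k K g s\<bar> \<le> (\<Sum>m\<le>k. C m) * M"
    if "continuous_on {0..1} g" "\<forall>t\<in>{0..1}. \<bar>g t\<bar> \<le> M" "s \<in> {0..1}" for g M s
  proof -
    have "0 \<le> M" using that(2) by force
    have "\<bar>rproj k K g s\<bar> \<le> (\<Sum>m\<le>k. \<bar>mcoef K m g * s ^ m\<bar>)"
      unfolding rproj_def by (rule sum_abs)
    also have "\<dots> \<le> (\<Sum>m\<le>k. C m * M)"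
    proof (rule sum_mono)
      fix m
      have "\<bar>s ^ m\<bar> \<le> 1" using that(3) by (simp add: power_le_one)
      then have "\<bar>mcoef K m g\<bar> * \<bar>s ^ m\<bar> \<le> (C m * M) * 1"
        using C(2)[OF that(1,2), of m] C(1)[of m] \<open>0 \<le> M\<close> by (intro mult_mono) auto
      then show "\<bar>mcoef K m g * s ^ m\<bar> \<le> C m * M" by (simp add: abs_mult)
    qed
    finally show ?thesis by (simp add: sum_distrib_right)
  qed
  then show ?thesis using C(1) by (intro exI[of _ "\<Sum>m\<le>k. C m"]) (auto intro: sum_nonneg)
qed

lemma poly_altdef_le: "degree p \<le> k \<Longrightarrow> poly p x = (\<Sum>m\<le>k. coeff p m * x ^ m)"
  for x :: "'a :: comm_ring_1"
  unfolding poly_altdef by (rule sum.mono_neutral_left) (auto simp: coeff_eq_0)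

lemma rproj_poly:
  assumes "kern_ok k K" "degree p \<le> k" shows "rproj k K (poly p) s = poly p s"
  using assms by (simp add: rproj_def kern_ok_def poly_altdef_le)

text \<open>\<open>B\<close> lists the k + 1 functionals that the projection has to preserve, for
  instance moments and one point value. Their matrix on the monomials is injective by unisolvence,
  and its inverse recombines them into functionals that return coefficients.\<close>

lemma kern_exists:
  assumes B: "kern_cont B"
    and inj: "\<And>p. degree p \<le> k \<Longrightarrow> (\<And>l. l \<le> k \<Longrightarrow> mcoef B l (poly p) = 0) \<Longrightarrow> p = 0"
  shows "\<exists>K. kern_ok k K \<and>
     (\<forall>g l. continuous_on {0..1} g \<and> l \<le> k \<longrightarrow> mcoef B l (rproj k K g) = mcoef B l g)"
proof -
  define M where "M l m = mcoef B l (\<lambda>t. t ^ m)" for l m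
  have lin: "mcoef B l (\<lambda>t. \<Sum>m\<le>k. c m * t ^ m) = (\<Sum>m\<le>k. M l m * c m)" for l c
    unfolding M_def by (subst mcoef_sum[OF B]) (auto intro!: continuous_intros simp: mcoef_cmult mult.commute)
  have "\<exists>A. (\<forall>i<Suc k. \<forall>j<Suc k. (\<Sum>l<Suc k. A i l * M l j) = of_bool (i = j)) \<and>
            (\<forall>i<Suc k. \<forall>j<Suc k. (\<Sum>l<Suc k. M i l * A l j) = of_bool (i = j))"
  proof (rule matrix_inverse_exists)
    fix c j assume c: "\<And>i. i < Suc k \<Longrightarrow> (\<Sum>j<Suc k. M i j * c j) = 0" and j: "j < Suc k"
    define p where "p = (\<Sum>m\<le>k. monom (c m) m)"
    have dp: "degree p \<le> k" unfolding p_def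
      by (intro degree_sum_le) (auto intro: order.trans[OF degree_monom_le])
    have pp: "poly p = (\<lambda>t. \<Sum>m\<le>k. c m * t ^ m)"
      by (auto simp: p_def poly_sum poly_monom)
    have "p = 0"
      using c by (intro inj[OF dp]) (simp add: pp lin lessThan_Suc_atMost)
    moreover have "coeff p j = c j"
      using j by (simp add: p_def coeff_sum if_distrib[of "\<lambda>x. x = _"] cong: if_cong)
    ultimately show "c j = 0" by simp
  qed
  then obtain A where
    AM: "\<And>i j. i \<le> k \<Longrightarrow> j \<le> k \<Longrightarrow> (\<Sum>l\<le>k. A i l * M l j) = of_bool (i = j)" and
    MA: "\<And>i j. i \<le> k \<Longrightarrow> j \<le> k \<Longrightarrow> (\<Sum>l\<le>k. M i l * A l j) = of_bool (i = j)"
    unfolding lessThan_Suc_atMost by (metis le_imp_less_Suc)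
  \<comment> \<open>The coefficient functionals are the combinations of those in \<open>B\<close>
    with the rows of the inverse matrix, so they are again point values at 0 and 1 plus a continuous
    weight.\<close>
  define K :: kern where "K = (\<lambda>m. \<Sum>l\<le>k. A m l * fst B l, \<lambda>m. \<Sum>l\<le>k. A m l * fst (snd B) l,
     \<lambda>m t. \<Sum>l\<le>k. A m l * snd (snd B) l t)"
  have Kc: "kern_cont K"
    using B unfolding kern_cont_def K_def by (auto intro!: continuous_intros)
  have mK: "mcoef K m g = (\<Sum>l\<le>k. A m l * mcoef B l g)" if g: "continuous_on {0..1} g" for m g
  proof -
    have "integral {0..1} (\<lambda>t. snd (snd K) m t * g t) =
        (\<Sum>l\<le>k. integral {0..1} (\<lambda>t. A m l * (snd (snd B) l t * g t)))"
      unfolding K_def snd_conv sum_distrib_right mult.assoc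
      using kern_cont_integrable[OF B g] by (intro integral_sum) (auto intro!: integrable_on_mult_right)
    then show ?thesis
      by (simp add: mcoef_def K_def sum_distrib_right sum.distrib distrib_left mult.assoc)
  qed
  have powc: "continuous_on {0..1} (\<lambda>t::real. t ^ m)" for m by (intro continuous_intros)
  have "mcoef K m (poly p) = coeff p m" if "degree p \<le> k" "m \<le> k" for p m
  proof -
    have pp: "poly p = (\<lambda>t. \<Sum>m\<le>k. coeff p m * t ^ m)"
      using poly_altdef_le[OF that(1)] by blast
    have "mcoef K m (poly p) = (\<Sum>l\<le>k. A m l * (\<Sum>j\<le>k. M l j * coeff p j))"
      by (subst mK) (auto simp: pp lin intro!: continuous_intros)
    also have "\<dots> = (\<Sum>j\<le>k. (\<Sum>l\<le>k. A m l * M l j) * coeff p j)"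
      unfolding sum_distrib_left sum_distrib_right by (subst sum.swap) (simp add: mult.assoc)
    also have "\<dots> = (\<Sum>j\<le>k. of_bool (m = j) * coeff p j)"
      using AM that by (intro sum.cong) auto
    finally show ?thesis using that by (simp add: of_bool_def if_distrib[of "\<lambda>x. x * _"] cong: if_cong)
  qed
  then have "kern_ok k K" using Kc by (auto simp: kern_ok_def)
  moreover have "mcoef B l (rproj k K g) = mcoef B l g" if "continuous_on {0..1} g" "l \<le> k" for g l
  proof -
    have "mcoef B l (rproj k K g) = (\<Sum>m\<le>k. M l m * mcoef K m g)"
      using lin[of l "\<lambda>m. mcoef K m g"] by (simp add: rproj_def[abs_def])
    also have "\<dots> = (\<Sum>j\<le>k. (\<Sum>m\<le>k. M l m * A m j) * mcoef B j g)"
      unfolding mK[OF that(1)] sum_distrib_left sum_distrib_right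
      by (subst sum.swap) (simp add: mult.assoc)
    also have "\<dots> = (\<Sum>j\<le>k. of_bool (l = j) * mcoef B j g)"
      using MA that by (intro sum.cong) auto
    finally show ?thesis using that by (simp add: of_bool_def if_distrib[of "\<lambda>x. x * _"] cong: if_cong)
  qed
  ultimately show ?thesis by blast
qed

text \<open>The weight may vanish at the end points, as the weight \<bar>t - c\<bar> of the Radau
  case does.\<close>

lemma poly_sq_integral_zero:
  fixes p :: "real poly"
  assumes "continuous_on {0..1} w" "\<And>t. t \<in> {0<..<1} \<Longrightarrow> w t > 0" "\<And>t. t \<in> {0..1} \<Longrightarrow> w t \<ge> 0"
    and "integral {0..1} (\<lambda>t. w t * (poly p t)\<^sup>2) = 0"
  shows "p = 0"
proof (rule ccontr)
  assume "p \<noteq> 0"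
  have c: "continuous_on {0..1} (\<lambda>t. w t * (poly p t)\<^sup>2)" using assms(1) by (intro continuous_intros)
  have z: "w t * (poly p t)\<^sup>2 = 0" if "t \<in> {0..1}" for t
  proof -
    have "(\<lambda>t. w t * (poly p t)\<^sup>2) integrable_on cbox 0 1"
      using c by (auto intro: integrable_continuous_real)
    then have "((\<lambda>t. w t * (poly p t)\<^sup>2) has_integral 0) (cbox 0 1)"
      using assms(4) by (metis box_real(2) integrable_integral)
    then show ?thesis
      using has_integral_0_cbox_imp_0[of 0 1 "\<lambda>t. w t * (poly p t)\<^sup>2" t] c assms(3) that by auto
  qed
  have "poly p t = 0" if "t \<in> {0<..<1}" for t using z[of t] assms(2)[OF that] that by auto
  then have "{0<..<1::real} \<subseteq> {t. poly p t = 0}" by auto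
  moreover have "infinite {0<..<1::real}" by simp
  ultimately show False using poly_roots_finite[OF \<open>p \<noteq> 0\<close>] finite_subset by blast
qed

lemma integral_poly_mult_zero:
  fixes q :: "real poly" and w :: "real \<Rightarrow> real"
  assumes "continuous_on {0..1} w" "\<And>l. l < n \<Longrightarrow> integral {0..1} (\<lambda>t. t ^ l * w t) = 0" "degree q < n"
  shows "integral {0..1} (\<lambda>t. w t * poly q t) = 0"
proof -
  have "integral {0..1} (\<lambda>t. w t * poly q t) = integral {0..1} (\<lambda>t. \<Sum>l\<le>degree q. coeff q l * (t ^ l * w t))"
    by (intro integral_cong) (simp add: poly_altdef sum_distrib_left sum_distrib_right mult_ac)
  also have "\<dots> = (\<Sum>l\<le>degree q. integral {0..1} (\<lambda>t. coeff q l * (t ^ l * w t)))"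
    using assms(1) by (intro integral_sum integrable_continuous_interval continuous_intros) auto
  also have "\<dots> = 0" using assms(2,3) by (intro sum.neutral) auto
  finally show ?thesis .
qed

text \<open>Unisolvence: if the value at \<open>c\<close> vanishes, the polynomial splits off the
  factor t - c, and the quotient \<open>q\<close> has degree below \<open>k\<close>. The vanishing
  moments then allow testing with \<open>q\<close>, which leaves the integral of \<bar>t - c\<bar>
  times the square of \<open>q\<close>.\<close>

lemma radau_exists:
  assumes "c = 0 \<or> c = (1::real)"
  shows "\<exists>K. kern_ok k K \<and> (\<forall>g. continuous_on {0..1} g \<longrightarrow> rproj k K g c = g c \<and>
     (\<forall>l<k. integral {0..1} (\<lambda>t. t ^ l * (g t - rproj k K g t)) = 0))"
proof -
  define B :: kern where "B = (\<lambda>l. of_bool (l = k \<and> c = 0), \<lambda>l. of_bool (l = k \<and> c = 1),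
      \<lambda>l t. if l = k then 0 else t ^ l)"
  have "continuous_on {0..1} (\<lambda>t::real. if l = k then 0 else t ^ l)" for l
    by (cases "l = k") (auto intro!: continuous_intros)
  then have B: "kern_cont B" unfolding kern_cont_def B_def by simp
  have Bl: "mcoef B l g = integral {0..1} (\<lambda>t. t ^ l * g t)" if "l < k" for l g
    using that by (simp add: mcoef_def B_def)
  have Bk: "mcoef B k g = g c" for g using assms by (auto simp: mcoef_def B_def)
  have "\<exists>K. kern_ok k K \<and>
     (\<forall>g l. continuous_on {0..1} g \<and> l \<le> k \<longrightarrow> mcoef B l (rproj k K g) = mcoef B l g)"
  proof (rule kern_exists[OF B])
    fix p assume dp: "degree p \<le> k" and z: "\<And>l. l \<le> k \<Longrightarrow> mcoef B l (poly p) = 0"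
    show "p = 0"
    proof (rule ccontr)
      assume "p \<noteq> 0"
      have "poly p c = 0" using z[of k] by (simp add: Bk)
      then obtain q where q: "p = [:-c, 1:] * q" by (metis dvdE poly_eq_0_iff_dvd)
      with \<open>p \<noteq> 0\<close> have "q \<noteq> 0" by auto
      then have "degree p = Suc (degree q)"
        unfolding q by (subst degree_mult_eq) auto
      then have "degree q < k" using dp by simp
      have "integral {0..1} (\<lambda>t. poly p t * poly q t) = 0"
      proof (rule integral_poly_mult_zero[where n = k])
        show "integral {0..1} (\<lambda>t. t ^ l * poly p t) = 0" if "l < k" for l
          using z[of l] that by (simp add: Bl)
      qed (use \<open>degree q < k\<close> in \<open>auto intro!: continuous_intros\<close>)
      \<comment> \<open>The sign makes the linear factor nonnegative on [0,1] for either end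
        point.\<close>
      then have "integral {0..1} (\<lambda>t. (if c = 0 then 1 else -1) * (poly p t * poly q t)) = 0"
        by (subst integral_mult_right) simp
      moreover have "(if c = 0 then 1 else -1) * (poly p t * poly q t) = \<bar>t - c\<bar> * (poly q t)\<^sup>2"
        if "t \<in> {0..1}" for t
        using assms that by (auto simp: q power2_eq_square algebra_simps)
      ultimately have "integral {0..1} (\<lambda>t. \<bar>t - c\<bar> * (poly q t)\<^sup>2) = 0"
        using integral_cong[of "{0..1}" "\<lambda>t. (if c = 0 then 1 else -1) * (poly p t * poly q t)"
          "\<lambda>t. \<bar>t - c\<bar> * (poly q t)\<^sup>2"] by metis
      then have "q = 0" using assms
        by (intro poly_sq_integral_zero[where w = "\<lambda>t. \<bar>t - c\<bar>"]) (auto intro!: continuous_intros)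
      with \<open>q \<noteq> 0\<close> show False by simp
    qed
  qed
  then obtain K where K: "kern_ok k K"
    "\<And>g l. continuous_on {0..1} g \<Longrightarrow> l \<le> k \<Longrightarrow> mcoef B l (rproj k K g) = mcoef B l g" by blast
  have "integral {0..1} (\<lambda>t. t ^ l * (g t - rproj k K g t)) = 0"
    if "continuous_on {0..1} g" "l < k" for g l
  proof -
    have "continuous_on {0..1} (rproj k K g)" unfolding rproj_def[abs_def] by (intro continuous_intros)
    then have "integral {0..1} (\<lambda>t. t ^ l * (g t - rproj k K g t)) = mcoef B l g - mcoef B l (rproj k K g)"
      unfolding Bl[OF that(2)] using that(1)
      by (subst integral_diff[symmetric])
        (auto simp: right_diff_distrib intro!: integrable_continuous_interval continuous_intros)
    then show ?thesis using K(2)[OF that(1), of l] that by simp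
  qed
  moreover have "rproj k K g c = g c" if "continuous_on {0..1} g" for g
    using K(2)[OF that, of k] by (simp add: Bk)
  ultimately show ?thesis using K(1) by blast
qed

lemma L2_exists:
  shows "\<exists>K. kern_ok k K \<and> (\<forall>g. continuous_on {0..1} g \<longrightarrow>
     (\<forall>l\<le>k. integral {0..1} (\<lambda>t. t ^ l * (g t - rproj k K g t)) = 0))"
proof -
  define B :: kern where "B = (\<lambda>l. 0, \<lambda>l. 0, \<lambda>l t. t ^ l)"
  have B: "kern_cont B" unfolding kern_cont_def B_def by (auto intro!: continuous_intros)
  have Bl: "mcoef B l g = integral {0..1} (\<lambda>t. t ^ l * g t)" for l g
    by (simp add: mcoef_def B_def)
  have "\<exists>K. kern_ok k K \<and>
     (\<forall>g l. continuous_on {0..1} g \<and> l \<le> k \<longrightarrow> mcoef B l (rproj k K g) = mcoef B l g)"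
  proof (rule kern_exists[OF B])
    fix p assume dp: "degree p \<le> k" and z: "\<And>l. l \<le> k \<Longrightarrow> mcoef B l (poly p) = 0"
    have "integral {0..1} (\<lambda>t. poly p t * poly p t) = 0"
    proof (rule integral_poly_mult_zero[where n = "Suc k"])
      show "integral {0..1} (\<lambda>t. t ^ l * poly p t) = 0" if "l < Suc k" for l
        using z[of l] that by (simp add: Bl)
    qed (use dp in \<open>auto intro!: continuous_intros\<close>)
    then show "p = 0"
      by (intro poly_sq_integral_zero[where w = "\<lambda>t. 1"]) (auto simp: power2_eq_square intro!: continuous_intros)
  qed
  then obtain K where K: "kern_ok k K"
    "\<And>g l. continuous_on {0..1} g \<Longrightarrow> l \<le> k \<Longrightarrow> mcoef B l (rproj k K g) = mcoef B l g" by blast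
  have "integral {0..1} (\<lambda>t. t ^ l * (g t - rproj k K g t)) = 0"
    if "continuous_on {0..1} g" "l \<le> k" for g l
  proof -
    have "continuous_on {0..1} (rproj k K g)" unfolding rproj_def[abs_def] by (intro continuous_intros)
    then have "integral {0..1} (\<lambda>t. t ^ l * (g t - rproj k K g t)) = mcoef B l g - mcoef B l (rproj k K g)"
      unfolding Bl using that(1)
      by (subst integral_diff[symmetric])
        (auto simp: right_diff_distrib intro!: integrable_continuous_interval continuous_intros)
    then show ?thesis using K(2)[OF that(1), of l] that by simp
  qed
  then show ?thesis using K(1) by blast
qed

section \<open>Scaling of the projections to an arbitrary interval\<close>

lemma integral_affine_unit:
  fixes f :: "real \<Rightarrow> real"
  assumes "a < b" "continuous_on {a..b} f"
  shows "integral {a..b} f = (b - a) * integral {0..1} (\<lambda>t. f (a + (b - a) * t))"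
proof -
  have "(f has_integral integral {a..b} f) (cbox a b)"
    using assms by (simp add: integrable_integral integrable_continuous_interval)
  from has_integral_affinity'[OF this, of "b - a" a] assms(1)
  have "((\<lambda>x. f (a + (b - a) * x)) has_integral (integral {a..b} f / (b - a))) {0..1}"
    by (simp add: divide_simps add.commute)
  then show ?thesis using assms(1) by (simp add: integral_unique)
qed

text \<open>Every cell uses the pullback of one fixed kernel on [0,1]; the stability constant is
  therefore independent of the cell width, hence of the mesh and of \<epsilon>.\<close>

definition proj :: "nat \<Rightarrow> kern \<Rightarrow> real \<Rightarrow> real \<Rightarrow> (real \<Rightarrow> real) \<Rightarrow> real \<Rightarrow> real" where
  "proj k K a b g x = rproj k K (\<lambda>t. g (a + (b - a) * t)) ((x - a) / (b - a))"

lemma affine_unit_mem: "a < b \<Longrightarrow> t \<in> {0..1} \<Longrightarrow> a + (b - a) * t \<in> {a..b}" for a b t :: real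
proof -
  assume "a < b" "t \<in> {0..1}"
  then have "(b - a) * t \<le> (b - a) * 1" "0 \<le> (b - a) * t" by (auto intro!: mult_left_mono)
  then show ?thesis by simp
qed

lemma affine_unit_inv_mem: "a < b \<Longrightarrow> x \<in> {a..b} \<Longrightarrow> (x - a) / (b - a) \<in> {0..1}" for a b x :: real
  by (auto simp: divide_simps)

lemma continuous_on_affine_unit:
  fixes g :: "real \<Rightarrow> real"
  assumes "a < b" "continuous_on {a..b} g"
  shows "continuous_on {0..1} (\<lambda>t. g (a + (b - a) * t))"
  by (rule continuous_on_compose2[OF assms(2)]) (use affine_unit_mem[OF assms(1)] in \<open>auto intro!: continuous_intros\<close>)

lemma proj_cong:
  assumes "a < b" "\<And>t. t \<in> {a..b} \<Longrightarrow> g t = h t"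
  shows "proj k K a b g x = proj k K a b h x"
proof -
  have "mcoef K m (\<lambda>t. g (a + (b - a) * t)) = mcoef K m (\<lambda>t. h (a + (b - a) * t))" for m
    by (rule mcoef_cong) (rule assms(2)[OF affine_unit_mem[OF assms(1)]])
  then show ?thesis by (simp add: proj_def rproj_def)
qed

lemma proj_cmult: "proj k K a b (\<lambda>t. c * g t) x = c * proj k K a b g x"
  by (simp add: proj_def rproj_def mcoef_cmult sum_distrib_left mult.assoc)

lemma proj_sum:
  assumes "kern_cont K" "a < b" "\<And>i. i \<in> I \<Longrightarrow> continuous_on {a..b} (g i)" "finite I"
  shows "proj k K a b (\<lambda>t. \<Sum>i\<in>I. g i t) x = (\<Sum>i\<in>I. proj k K a b (g i) x)"
proof -
  have "mcoef K m (\<lambda>t. \<Sum>i\<in>I. g i (a + (b - a) * t)) = (\<Sum>i\<in>I. mcoef K m (\<lambda>t. g i (a + (b - a) * t)))" for m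
    using assms by (intro mcoef_sum) (auto intro: continuous_on_affine_unit)
  then show ?thesis
    unfolding proj_def rproj_def by (simp add: sum_distrib_right) (rule sum.swap)
qed

lemma proj_diff:
  assumes "kern_cont K" "a < b" "continuous_on {a..b} g" "continuous_on {a..b} h"
  shows "proj k K a b (\<lambda>t. g t - h t) x = proj k K a b g x - proj k K a b h x"
  unfolding proj_def rproj_def
  using mcoef_diff[OF assms(1) continuous_on_affine_unit[OF assms(2,3)] continuous_on_affine_unit[OF assms(2,4)]]
  by (simp add: left_diff_distrib sum_subtractf)

lemma proj_is_poly: "\<exists>q. degree q \<le> k \<and> (\<forall>x. proj k K a b g x = poly q x)"
proof -
  let ?s = "[:- a / (b - a), 1 / (b - a):]"
  let ?q = "\<Sum>m\<le>k. Polynomial.smult (mcoef K m (\<lambda>t. g (a + (b - a) * t))) (?s ^ m)"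
  have "degree (?s ^ m) \<le> m" for m
    by (rule order.trans[OF degree_power_le]) auto
  then have "degree ?q \<le> k"
    by (intro degree_sum_le) (auto intro: order.trans[OF degree_smult_le] order.trans)
  moreover have "proj k K a b g x = poly ?q x" for x
    by (simp add: proj_def rproj_def poly_sum poly_power diff_divide_distrib)
  ultimately show ?thesis by blast
qed

lemma continuous_on_proj [continuous_intros]:
  "continuous_on A f \<Longrightarrow> continuous_on A (\<lambda>x. proj k K a b g (f x))"
  unfolding proj_def rproj_def divide_inverse by (intro continuous_intros)

lemma proj_poly:
  assumes "kern_ok k K" "a < b" "degree p \<le> k"
  shows "proj k K a b (poly p) x = poly p x"
proof -
  let ?q = "p \<circ>\<^sub>p [:a, b - a:]"
  have "degree ?q \<le> k" using assms(2,3) by (simp add: degree_pcompose)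
  moreover have "(\<lambda>t. poly p (a + (b - a) * t)) = poly ?q" by (auto simp: poly_pcompose mult.commute)
  ultimately have "proj k K a b (poly p) x = poly ?q ((x - a) / (b - a))"
    unfolding proj_def using rproj_poly[OF assms(1)] by simp
  also have "\<dots> = poly p x" using assms(2) by (simp add: poly_pcompose)
  finally show ?thesis .
qed

text \<open>The bound on \<open>g\<close> is asked for in the open interval only, since the
  regularity assumption says nothing about the boundary of the square; continuity transfers it to
  the end points.\<close>

definition proj_stable :: "nat \<Rightarrow> kern \<Rightarrow> real \<Rightarrow> bool" where
  "proj_stable k K C \<longleftrightarrow> 0 \<le> C \<and> (\<forall>a b g M x. a < b \<and> continuous_on {a..b} g \<and> (\<forall>t\<in>{a<..<b}. \<bar>g t\<bar> \<le> M)
     \<and> x \<in> {a..b} \<longrightarrow> \<bar>proj k K a b g x\<bar> \<le> C * M)"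

lemma le_on_closed_of_open:
  fixes g :: "real \<Rightarrow> real"
  assumes "a < b" "continuous_on {a..b} g" "\<And>t. t \<in> {a<..<b} \<Longrightarrow> \<bar>g t\<bar> \<le> M" "t \<in> {a..b}"
  shows "\<bar>g t\<bar> \<le> M"
proof -
  have cl: "closure {a<..<b} = {a..b}" using assms(1) by simp
  have "continuous_on (closure {a<..<b}) (\<lambda>t. \<bar>g t\<bar>)"
    unfolding cl using assms(2) by (intro continuous_intros)
  then show ?thesis
    by (rule continuous_le_on_closure[of "{a<..<b}"]) (use assms cl in auto)
qed

lemma proj_stable_exists:
  assumes "kern_cont K" shows "\<exists>C. proj_stable k K C"
proof -
  obtain C where C: "0 \<le> C" "\<And>g M s. s \<in> {0..1} \<Longrightarrow> continuous_on {0..1} g \<Longrightarrow>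
      (\<forall>t\<in>{0..1}. \<bar>g t\<bar> \<le> M) \<Longrightarrow> \<bar>rproj k K g s\<bar> \<le> C * M"
    using rproj_bound[OF assms, of k] by metis
  have "proj_stable k K C"
    unfolding proj_stable_def proj_def
  proof (intro conjI allI impI)
    fix a b :: real and g :: "real \<Rightarrow> real" and M x
    assume *: "a < b \<and> continuous_on {a..b} g \<and> (\<forall>t\<in>{a<..<b}. \<bar>g t\<bar> \<le> M) \<and> x \<in> {a..b}"
    then have ab: "a < b" and g: "continuous_on {a..b} g" and x: "x \<in> {a..b}" by auto
    have M: "\<bar>g t\<bar> \<le> M" if "t \<in> {a..b}" for t
      by (rule le_on_closed_of_open[OF ab g _ that]) (use * in blast)
    show "\<bar>rproj k K (\<lambda>t. g (a + (b - a) * t)) ((x - a) / (b - a))\<bar> \<le> C * M"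
      by (rule C(2)[OF affine_unit_inv_mem[OF ab x] continuous_on_affine_unit[OF ab g]])
        (use M affine_unit_mem[OF ab] in auto)
  qed (rule C(1))
  then show ?thesis ..
qed

text \<open>n = k for the Radau projections, n = k + 1 for the \<open>L2\<close> projection.\<close>

definition proj_moments :: "nat \<Rightarrow> nat \<Rightarrow> kern \<Rightarrow> bool" where
  "proj_moments n k K \<longleftrightarrow> (\<forall>g. continuous_on {0..1} g \<longrightarrow>
     (\<forall>l<n. integral {0..1} (\<lambda>t. t ^ l * (g t - rproj k K g t)) = 0))"

lemma proj_orthogonal:
  assumes "proj_moments n k K" "a < b" "continuous_on {a..b} g" "degree q < n"
  shows "integral {a..b} (\<lambda>x. (g x - proj k K a b g x) * poly q x) = 0"
proof -
  let ?G = "\<lambda>t. g (a + (b - a) * t)" and ?q = "q \<circ>\<^sub>p [:a, b - a:]"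
  have cG: "continuous_on {0..1} ?G" using assms by (intro continuous_on_affine_unit)
  have "integral {a..b} (\<lambda>x. (g x - proj k K a b g x) * poly q x) =
    (b - a) * integral {0..1} (\<lambda>t. (?G t - rproj k K ?G t) * poly ?q t)"
    using assms(2) by (subst integral_affine_unit)
      (auto intro!: continuous_intros assms(3) simp: poly_pcompose mult.commute, simp add: proj_def mult.commute)
  also have "integral {0..1} (\<lambda>t. (?G t - rproj k K ?G t) * poly ?q t) = 0"
  proof (rule integral_poly_mult_zero[where n = n])
    show "continuous_on {0..1} (\<lambda>t. ?G t - rproj k K ?G t)"
      unfolding rproj_def using cG by (intro continuous_intros)
    show "degree ?q < n" using assms(2,4) by (simp add: degree_pcompose)
  qed (use assms(1) cG in \<open>auto simp: proj_moments_def\<close>)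
  finally show ?thesis by simp
qed

text \<open>The projection reproduces the Taylor polynomial at the midpoint, so its error on
  \<open>g\<close> is its error on the Taylor remainder, which stability controls. The factorial is
  dropped and the distance to the midpoint is estimated by the whole width.\<close>

lemma proj_error:
  assumes K: "kern_ok k K" and C: "proj_stable k K C" and ab: "a < b"
    and g: "continuous_on {a..b} g"
    and f0: "\<And>x. x \<in> {a<..<b} \<Longrightarrow> f 0 x = g x"
    and df: "\<And>m x. m \<le> k \<Longrightarrow> x \<in> {a<..<b} \<Longrightarrow> (f m has_real_derivative f (Suc m) x) (at x)"
    and D: "\<And>x. x \<in> {a<..<b} \<Longrightarrow> \<bar>f (Suc k) x\<bar> \<le> D"
    and x: "x \<in> {a..b}"
  shows "\<bar>g x - proj k K a b g x\<bar> \<le> (1 + C) * ((b - a) ^ Suc k * D)"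
proof -
  define w where "w = (a + b) / 2"
  have w: "w \<in> {a<..<b}" using ab by (auto simp: w_def)
  have D0: "0 \<le> D" using D[OF w] by linarith
  define p where "p = (\<Sum>i\<le>k. Polynomial.smult (f i w / fact i) ([:- w, 1:] ^ i))"
  have pp: "poly p z = (\<Sum>i\<le>k. f i w * (z - w) ^ i / fact i)" for z
    by (simp add: p_def poly_sum poly_power)
  have "degree ([:- w, 1:] ^ i) \<le> i" for i by (rule order.trans[OF degree_power_le]) auto
  then have dp: "degree p \<le> k" unfolding p_def
    by (intro degree_sum_le) (auto intro: order.trans[OF degree_smult_le] order.trans)
  have tay: "\<bar>g z - poly p z\<bar> \<le> (b - a) ^ Suc k * D" if z: "z \<in> {a<..<b}" for z
  proof -
    have "norm (f 0 z - (\<Sum>i\<le>k. f i w * (z - w) ^ i / fact i)) \<le> D * norm (z - w) ^ Suc k / fact k"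
      using w z D df by (intro field_Taylor[where S = "{a<..<b}"])
        (auto intro: has_field_derivative_at_within)
    also have "\<dots> \<le> D * (b - a) ^ Suc k / 1"
      using w z D0 by (intro frac_le mult_left_mono power_mono mult_nonneg_nonneg) (auto simp: fact_ge_1)
    finally show ?thesis using f0[OF z] by (simp add: pp mult.commute)
  qed
  have cont: "continuous_on {a..b} (\<lambda>z. g z - poly p z)" using g by (intro continuous_intros)
  have "g x - proj k K a b g x = (g x - poly p x) - proj k K a b (\<lambda>z. g z - poly p z) x"
    using K by (subst proj_diff) (auto simp: kern_ok_def ab g proj_poly[OF K ab dp] intro!: continuous_intros)
  moreover have "\<bar>g x - poly p x\<bar> \<le> (b - a) ^ Suc k * D"
    using le_on_closed_of_open[OF ab cont tay x] .
  moreover have "\<bar>proj k K a b (\<lambda>z. g z - poly p z) x\<bar> \<le> C * ((b - a) ^ Suc k * D)"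
    using C ab cont tay x unfolding proj_stable_def by blast
  ultimately show ?thesis by (simp add: algebra_simps)
qed

section \<open>Tensor products of projections\<close>

abbreviation (input) swp :: "(real \<Rightarrow> real \<Rightarrow> real) \<Rightarrow> real \<Rightarrow> real \<Rightarrow> real" where
  "swp g \<equiv> (\<lambda>x y. g y x)"

definition cont2 :: "real set \<Rightarrow> real set \<Rightarrow> (real \<Rightarrow> real \<Rightarrow> real) \<Rightarrow> bool" where
  "cont2 X Y g \<longleftrightarrow> continuous_on (X \<times> Y) (\<lambda>z. g (fst z) (snd z))"

lemma cont2_subset: "cont2 X Y g \<Longrightarrow> X' \<subseteq> X \<Longrightarrow> Y' \<subseteq> Y \<Longrightarrow> cont2 X' Y' g"
  unfolding cont2_def by (erule continuous_on_subset) (rule Sigma_mono)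

lemma cont2_compose:
  assumes "cont2 X Y g" "continuous_on A p" "continuous_on A q" "\<And>z. z \<in> A \<Longrightarrow> p z \<in> X" "\<And>z. z \<in> A \<Longrightarrow> q z \<in> Y"
  shows "continuous_on A (\<lambda>z. g (p z) (q z))"
proof -
  have *: "continuous_on A (\<lambda>z. (p z, q z))" using assms(2,3) by (rule continuous_on_Pair)
  have **: "(\<lambda>z. (p z, q z)) ` A \<subseteq> X \<times> Y" using assms(4,5) by blast
  from continuous_on_compose2[OF assms(1)[unfolded cont2_def] * **] show ?thesis
    unfolding fst_conv snd_conv .
qed

lemma cont2_swp:
  assumes "cont2 X Y g" shows "cont2 Y X (swp g)"
  unfolding cont2_def
  by (rule cont2_compose[OF assms, where p = snd and q = fst]) (auto intro: continuous_on_fst continuous_on_snd continuous_on_id)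

lemma cont2_slice_x:
  assumes "cont2 X Y g" "y \<in> Y" shows "continuous_on X (\<lambda>x. g x y)"
  by (rule cont2_compose[OF assms(1), where p = "\<lambda>x. x" and q = "\<lambda>_. y"]) (use assms(2) in auto)

lemma cont2_slice_y:
  assumes "cont2 X Y g" "x \<in> X" shows "continuous_on Y (g x)"
  by (rule cont2_compose[OF assms(1), where p = "\<lambda>_. x" and q = "\<lambda>x. x"]) (use assms(2) in auto)

lemma cont2_intros:
  "cont2 X Y g \<Longrightarrow> cont2 X Y h \<Longrightarrow> cont2 X Y (\<lambda>x y. g x y + h x y)"
  "cont2 X Y g \<Longrightarrow> cont2 X Y h \<Longrightarrow> cont2 X Y (\<lambda>x y. g x y - h x y)"
  "cont2 X Y g \<Longrightarrow> cont2 X Y h \<Longrightarrow> cont2 X Y (\<lambda>x y. g x y * h x y)"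
  "cont2 X Y (\<lambda>x y. c)"
  unfolding cont2_def by (auto intro!: continuous_intros)

lemma cont2_sum:
  "(\<And>i. i \<in> I \<Longrightarrow> cont2 X Y (g i)) \<Longrightarrow> cont2 X Y (\<lambda>x y. \<Sum>i\<in>I. g i x y)"
  unfolding cont2_def by (intro continuous_intros)

lemma integral_slice_continuous:
  assumes "cont2 {a..b} Y g" shows "continuous_on Y (\<lambda>y. integral {a..b} (\<lambda>x. g x y))"
proof -
  have "continuous_on (Y \<times> cbox a b) (\<lambda>(y, x). g x y)"
    unfolding split_beta by (intro cont2_compose[OF assms]) (auto intro!: continuous_intros)
  from integral_continuous_on_param[OF this] show ?thesis by simp
qed

lemma integral_swap_cont2:
  assumes "cont2 {a..b} {c..d} g"
  shows "integral {a..b} (\<lambda>x. integral {c..d} (\<lambda>y. g x y)) = integral {c..d} (\<lambda>y. integral {a..b} (\<lambda>x. g x y))"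
proof -
  have "continuous_on (cbox (a, c) (b, d)) (\<lambda>(x, y). g x y)"
    using assms unfolding cont2_def split_beta by (simp add: cbox_Pair_eq)
  from integral_swap_continuous[OF this] show ?thesis by simp
qed

lemma mcoef_cont2:
  assumes K: "kern_cont K" and g: "cont2 {0..1} Y g"
  shows "continuous_on Y (\<lambda>y. mcoef K m (\<lambda>t. g t y))"
proof -
  have k: "continuous_on {0..1} (snd (snd K) m)" using K by (simp add: kern_cont_def)
  have "cont2 {0..1} Y (\<lambda>t y. snd (snd K) m t)"
    unfolding cont2_def
    by (rule continuous_on_compose2[OF k, of _ fst]) (auto intro: continuous_on_fst continuous_on_id)
  from integral_slice_continuous[OF cont2_intros(3)[OF this g]]
  have i: "continuous_on Y (\<lambda>y. integral {0..1} (\<lambda>t. snd (snd K) m t * g t y))" .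
  have e: "continuous_on Y (g 0)" "continuous_on Y (g 1)" using cont2_slice_y[OF g] by auto
  show ?thesis
    unfolding mcoef_def by (intro continuous_on_add continuous_on_mult_left i e)
qed

text \<open>Point evaluations commute with each other and with the integrals by linearity; Fubini is
  needed only for the product of the two integral parts.\<close>

lemma mcoef_swap:
  assumes K: "kern_cont K" and K': "kern_cont K'" and g: "cont2 {0..1} {0..1} g"
  shows "mcoef K m (\<lambda>t. mcoef K' n (\<lambda>r. g t r)) = mcoef K' n (\<lambda>r. mcoef K m (\<lambda>t. g t r))"
proof -
  define \<kappa> where "\<kappa> = snd (snd K) m"
  define \<kappa>' where "\<kappa>' = snd (snd K') n"
  have k: "continuous_on {0..1} \<kappa>" "continuous_on {0..1} \<kappa>'"
    using K K' by (auto simp: kern_cont_def \<kappa>_def \<kappa>'_def)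
  have k2: "cont2 {0..1} {0..1} (\<lambda>t r. \<kappa> t)" "cont2 {0..1} {0..1} (\<lambda>t r. \<kappa>' r)"
    unfolding cont2_def by (auto intro!: continuous_on_compose2[OF k(1)] continuous_on_compose2[OF k(2)] continuous_intros)
  have sl: "continuous_on {0..1} (\<lambda>t. g t r)" "continuous_on {0..1} (g r)" if "r \<in> {0..1}" for r
    using cont2_slice_x[OF g that] cont2_slice_y[OF g that] .
  have ig: "continuous_on {0..1} (\<lambda>t. integral {0..1} (\<lambda>r. \<kappa>' r * g t r))"
    using integral_slice_continuous[OF cont2_swp[OF cont2_intros(3)[OF k2(2) g]]] .
  have ig': "continuous_on {0..1} (\<lambda>r. integral {0..1} (\<lambda>t. \<kappa> t * g t r))"
    using integral_slice_continuous[OF cont2_intros(3)[OF k2(1) g]] .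
  have sw: "integral {0..1} (\<lambda>t. \<kappa> t * integral {0..1} (\<lambda>r. \<kappa>' r * g t r)) =
        integral {0..1} (\<lambda>r. \<kappa>' r * integral {0..1} (\<lambda>t. \<kappa> t * g t r))"
  proof -
    have c: "\<kappa> t * (\<kappa>' r * g t r) = \<kappa>' r * (\<kappa> t * g t r)" for t r by simp
    have "integral {0..1} (\<lambda>t. integral {0..1} (\<lambda>r. \<kappa> t * (\<kappa>' r * g t r))) =
        integral {0..1} (\<lambda>r. integral {0..1} (\<lambda>t. \<kappa>' r * (\<kappa> t * g t r)))"
      using integral_swap_cont2[OF cont2_intros(3)[OF k2(1) cont2_intros(3)[OF k2(2) g]]] unfolding c .
    then show ?thesis by simp
  qed
  have e1: "integral {0..1} (\<lambda>t. \<kappa> t * (A * g t 0 + B * g t 1 + integral {0..1} (\<lambda>r. \<kappa>' r * g t r))) =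
     A * integral {0..1} (\<lambda>t. \<kappa> t * g t 0) + B * integral {0..1} (\<lambda>t. \<kappa> t * g t 1) +
     integral {0..1} (\<lambda>t. \<kappa> t * integral {0..1} (\<lambda>r. \<kappa>' r * g t r))" for A B
  proof -
    have "integral {0..1} (\<lambda>t. \<kappa> t * (A * g t 0 + B * g t 1 + integral {0..1} (\<lambda>r. \<kappa>' r * g t r))) =
      integral {0..1} (\<lambda>t. A * (\<kappa> t * g t 0) + B * (\<kappa> t * g t 1) + \<kappa> t * integral {0..1} (\<lambda>r. \<kappa>' r * g t r))"
      by (simp add: algebra_simps)
    also have "\<dots> = integral {0..1} (\<lambda>t. A * (\<kappa> t * g t 0) + B * (\<kappa> t * g t 1)) +
        integral {0..1} (\<lambda>t. \<kappa> t * integral {0..1} (\<lambda>r. \<kappa>' r * g t r))"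
      using k ig by (intro integral_add integrable_continuous_interval continuous_intros sl) auto
    also have "integral {0..1} (\<lambda>t. A * (\<kappa> t * g t 0) + B * (\<kappa> t * g t 1)) =
        integral {0..1} (\<lambda>t. A * (\<kappa> t * g t 0)) + integral {0..1} (\<lambda>t. B * (\<kappa> t * g t 1))"
      using k by (intro integral_add integrable_continuous_interval continuous_intros sl) auto
    finally show ?thesis by simp
  qed
  have e2: "integral {0..1} (\<lambda>t. \<kappa>' t * (A * g 0 t + B * g 1 t + integral {0..1} (\<lambda>r. \<kappa> r * g r t))) =
     A * integral {0..1} (\<lambda>t. \<kappa>' t * g 0 t) + B * integral {0..1} (\<lambda>t. \<kappa>' t * g 1 t) +
     integral {0..1} (\<lambda>t. \<kappa>' t * integral {0..1} (\<lambda>r. \<kappa> r * g r t))" for A B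
  proof -
    have "integral {0..1} (\<lambda>t. \<kappa>' t * (A * g 0 t + B * g 1 t + integral {0..1} (\<lambda>r. \<kappa> r * g r t))) =
      integral {0..1} (\<lambda>t. A * (\<kappa>' t * g 0 t) + B * (\<kappa>' t * g 1 t) + \<kappa>' t * integral {0..1} (\<lambda>r. \<kappa> r * g r t))"
      by (simp add: algebra_simps)
    also have "\<dots> = integral {0..1} (\<lambda>t. A * (\<kappa>' t * g 0 t) + B * (\<kappa>' t * g 1 t)) +
        integral {0..1} (\<lambda>t. \<kappa>' t * integral {0..1} (\<lambda>r. \<kappa> r * g r t))"
      using k ig' by (intro integral_add integrable_continuous_interval continuous_intros sl) auto
    also have "integral {0..1} (\<lambda>t. A * (\<kappa>' t * g 0 t) + B * (\<kappa>' t * g 1 t)) =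
        integral {0..1} (\<lambda>t. A * (\<kappa>' t * g 0 t)) + integral {0..1} (\<lambda>t. B * (\<kappa>' t * g 1 t))"
      using k by (intro integral_add integrable_continuous_interval continuous_intros sl) auto
    finally show ?thesis by simp
  qed
  show ?thesis
    unfolding mcoef_def \<kappa>_def[symmetric] \<kappa>'_def[symmetric] e1 e2 sw
    by (simp add: algebra_simps)
qed

lemma rproj_swap:
  assumes K: "kern_cont K" and K': "kern_cont K'" and g: "cont2 {0..1} {0..1} g"
  shows "rproj k K (\<lambda>t. rproj k K' (g t) r) s = rproj k K' (\<lambda>r. rproj k K (\<lambda>t. g t r) s) r"
proof -
  have c: "continuous_on {0..1} (\<lambda>t. mcoef K' n (g t) * r ^ n)" for n
    using mcoef_cont2[OF K' cont2_swp[OF g], of n] by (intro continuous_intros) simp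
  have c': "continuous_on {0..1} (\<lambda>r. mcoef K m (\<lambda>t. g t r) * s ^ m)" for m
    using mcoef_cont2[OF K g, of m] by (intro continuous_intros) simp
  have e1: "mcoef K m (\<lambda>t. \<Sum>n\<le>k. mcoef K' n (g t) * r ^ n) = (\<Sum>n\<le>k. mcoef K m (\<lambda>t. mcoef K' n (g t)) * r ^ n)" for m
    by (subst mcoef_sum[OF K]) (use c in \<open>auto simp: mult.commute[of _ "r ^ _"] mcoef_cmult\<close>)
  have e2: "mcoef K' n (\<lambda>r. \<Sum>m\<le>k. mcoef K m (\<lambda>t. g t r) * s ^ m) =
      (\<Sum>m\<le>k. mcoef K' n (\<lambda>r. mcoef K m (\<lambda>t. g t r)) * s ^ m)" for n
    by (subst mcoef_sum[OF K']) (use c' in \<open>auto simp: mult.commute[of _ "s ^ _"] mcoef_cmult\<close>)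
  show ?thesis
    unfolding rproj_def e1 e2 mcoef_swap[OF K K' g] sum_distrib_right
    by (subst sum.swap) (simp add: mult_ac)
qed

section \<open>Projections in one of two variables\<close>

definition projx :: "nat \<Rightarrow> kern \<Rightarrow> real \<Rightarrow> real \<Rightarrow> (real \<Rightarrow> real \<Rightarrow> real) \<Rightarrow> real \<Rightarrow> real \<Rightarrow> real" where
  "projx k K a b g x y = proj k K a b (\<lambda>t. g t y) x"

definition projy :: "nat \<Rightarrow> kern \<Rightarrow> real \<Rightarrow> real \<Rightarrow> (real \<Rightarrow> real \<Rightarrow> real) \<Rightarrow> real \<Rightarrow> real \<Rightarrow> real" where
  "projy k K c d g x y = proj k K c d (\<lambda>t. g x t) y"

lemma projy_swp: "projy k K c d g x y = projx k K c d (swp g) y x"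
  by (simp add: projx_def projy_def)

text \<open>In the projected variable the result is a polynomial, hence \<open>X\<close> is
  arbitrary and not tied to the cell.\<close>

lemma cont2_projx:
  assumes "kern_cont K" "a < b" "cont2 {a..b} Y g"
  shows "cont2 X Y (projx k K a b g)"
proof -
  have "cont2 {0..1} Y (\<lambda>t y. g (a + (b - a) * t) y)"
    unfolding cont2_def using affine_unit_mem[OF assms(2)]
    by (intro cont2_compose[OF assms(3)]) (auto intro!: continuous_intros)
  from mcoef_cont2[OF assms(1) this]
  have *: "continuous_on (X \<times> Y) (\<lambda>z. mcoef K m (\<lambda>t. g (a + (b - a) * t) (snd z)))" for m
    by (rule continuous_on_compose2) (auto intro!: continuous_intros)
  show ?thesis
    unfolding cont2_def projx_def proj_def rproj_def divide_inverse
    by (intro continuous_intros *)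
qed

lemma cont2_projy:
  assumes "kern_cont K" "c < d" "cont2 X {c..d} g"
  shows "cont2 X Y (projy k K c d g)"
  using cont2_swp[OF cont2_projx[OF assms(1,2) cont2_swp[OF assms(3)], of Y]]
  unfolding projy_swp[abs_def] .

lemma proj_commute:
  assumes K: "kern_cont K" and K': "kern_cont K'" and "a < b" "c < d" and g: "cont2 {a..b} {c..d} g"
  shows "projx k K a b (projy k K' c d g) x y = projy k K' c d (projx k K a b g) x y"
proof -
  have "cont2 {0..1} {0..1} (\<lambda>t r. g (a + (b - a) * t) (c + (d - c) * r))"
    unfolding cont2_def using affine_unit_mem[OF assms(3)] affine_unit_mem[OF assms(4)]
    by (intro cont2_compose[OF g]) (auto intro!: continuous_intros)
  then show ?thesis unfolding projx_def projy_def proj_def by (rule rproj_swap[OF K K'])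
qed

definition isQ :: "nat \<Rightarrow> (real \<Rightarrow> real \<Rightarrow> real) \<Rightarrow> bool" where
  "isQ k F \<longleftrightarrow> (\<exists>c. \<forall>x y. F x y = (\<Sum>a\<le>k. \<Sum>b\<le>k. c a b * x ^ a * y ^ b))"

lemma isQ_tensor:
  assumes "\<And>m. m \<le> k \<Longrightarrow> degree (p m) \<le> k" "\<And>n. n \<le> k \<Longrightarrow> degree (q n) \<le> k"
    and F: "\<And>x y. F x y = (\<Sum>m\<le>k. \<Sum>n\<le>k. C m n * poly (p m) x * poly (q n) y)"
  shows "isQ k F"
proof -
  have "F x y = (\<Sum>a\<le>k. \<Sum>b\<le>k. (\<Sum>m\<le>k. \<Sum>n\<le>k. C m n * coeff (p m) a * coeff (q n) b) * x ^ a * y ^ b)" for x y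
  proof -
    have "F x y = (\<Sum>m\<le>k. \<Sum>n\<le>k. \<Sum>a\<le>k. \<Sum>b\<le>k. C m n * coeff (p m) a * coeff (q n) b * x ^ a * y ^ b)"
      unfolding F
      by (intro sum.cong refl)
        (simp add: poly_altdef_le[OF assms(1)] poly_altdef_le[OF assms(2)] sum_distrib_left sum_distrib_right mult_ac)
    also have "\<dots> = (\<Sum>m\<le>k. \<Sum>a\<le>k. \<Sum>n\<le>k. \<Sum>b\<le>k. C m n * coeff (p m) a * coeff (q n) b * x ^ a * y ^ b)"
      by (rule sum.cong[OF refl], rule sum.swap)
    also have "\<dots> = (\<Sum>a\<le>k. \<Sum>m\<le>k. \<Sum>n\<le>k. \<Sum>b\<le>k. C m n * coeff (p m) a * coeff (q n) b * x ^ a * y ^ b)"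
      by (rule sum.swap)
    also have "\<dots> = (\<Sum>a\<le>k. \<Sum>m\<le>k. \<Sum>b\<le>k. \<Sum>n\<le>k. C m n * coeff (p m) a * coeff (q n) b * x ^ a * y ^ b)"
      by (rule sum.cong[OF refl], rule sum.cong[OF refl], rule sum.swap)
    also have "\<dots> = (\<Sum>a\<le>k. \<Sum>b\<le>k. \<Sum>m\<le>k. \<Sum>n\<le>k. C m n * coeff (p m) a * coeff (q n) b * x ^ a * y ^ b)"
      by (rule sum.cong[OF refl], rule sum.swap)
    finally show ?thesis by (simp add: sum_distrib_right)
  qed
  then show ?thesis unfolding isQ_def
    by (intro exI[of _ "\<lambda>a b. \<Sum>m\<le>k. \<Sum>n\<le>k. C m n * coeff (p m) a * coeff (q n) b"] allI)
qed

lemma isQ_projx_projy: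
  assumes K: "kern_cont K" and K': "kern_cont K'" and "a < b" "c < d" and g: "cont2 {a..b} {c..d} g"
  shows "isQ k (projx k K a b (projy k K' c d g))"
proof -
  define s where "s m = [:- a / (b - a), 1 / (b - a):] ^ m" for m
  define r where "r m = [:- c / (d - c), 1 / (d - c):] ^ m" for m
  have deg: "degree (s m) \<le> m" "degree (r m) \<le> m" for m
    unfolding s_def r_def by (auto intro!: order.trans[OF degree_power_le])
  have cG: "cont2 {0..1} {0..1} (\<lambda>t r. g (a + (b - a) * t) (c + (d - c) * r))"
    unfolding cont2_def using affine_unit_mem[OF assms(3)] affine_unit_mem[OF assms(4)]
    by (intro cont2_compose[OF g]) (auto intro!: continuous_intros)
  define C where "C m n = mcoef K m (\<lambda>t. mcoef K' n (\<lambda>r. g (a + (b - a) * t) (c + (d - c) * r)))" for m n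
  have mc: "mcoef K m (\<lambda>t. \<Sum>n\<le>k. mcoef K' n (\<lambda>r. g (a + (b - a) * t) (c + (d - c) * r)) * z ^ n) =
      (\<Sum>n\<le>k. C m n * z ^ n)" for m z
  proof -
    have "continuous_on {0..1} (\<lambda>t. mcoef K' n (\<lambda>r. g (a + (b - a) * t) (c + (d - c) * r)) * z ^ n)" for n
      using mcoef_cont2[OF K' cont2_swp[OF cG], of n] by (intro continuous_intros) simp
    then show ?thesis
      by (subst mcoef_sum[OF K]) (auto simp: mult.commute[of _ "z ^ _"] mcoef_cmult C_def)
  qed
  have ps: "poly (s m) x = ((x - a) / (b - a)) ^ m" "poly (r m) x = ((x - c) / (d - c)) ^ m" for m x
    by (simp_all add: s_def r_def poly_power diff_divide_distrib)
  have "projx k K a b (projy k K' c d g) x y =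
      (\<Sum>m\<le>k. \<Sum>n\<le>k. C m n * poly (s m) x * poly (r n) y)" for x y
    unfolding projx_def projy_def proj_def rproj_def mc ps sum_distrib_right
    by (intro sum.cong refl) (simp only: mult_ac)
  then show ?thesis
    by (intro isQ_tensor[where p = s and q = r] order.trans[OF deg(1)] order.trans[OF deg(2)])
qed

text \<open>The projection acts in the other variable, with \<open>x\<close> as a parameter, so
  differentiation passes through the point values and under the integral. This is what makes the
  derivative of the projected solution the projection of \<open>ux\<close>. One-sided derivatives at
  0 and 1 are included.\<close>

lemma projy_has_derivative:
  assumes K: "kern_cont K" and "c < d" and sub: "{c..d} \<subseteq> {0..1}"
    and u: "cont2 {0..1} {0..1} u" and ux: "cont2 {0..1} {0..1} ux"
    and d: "\<And>x y. x \<in> {0..1} \<Longrightarrow> y \<in> {0..1} \<Longrightarrow> ((\<lambda>t. u t y) has_real_derivative ux x y) (at x within {0..1})"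
    and x: "x \<in> {0..1}"
  shows "((\<lambda>t. projy k K c d u t y) has_real_derivative projy k K c d ux x y) (at x within {0..1})"
proof -
  have mem: "c + (d - c) * t \<in> {0..1}" if "t \<in> {0..1}" for t
    using affine_unit_mem[OF \<open>c < d\<close> that] sub by blast
  have k: "continuous_on {0..1} (snd (snd K) m)" for m using K by (simp add: kern_cont_def)
  have I: "((\<lambda>x. integral (cbox 0 1) (\<lambda>t. snd (snd K) m t * u x (c + (d - c) * t))) has_real_derivative
      integral (cbox 0 1) (\<lambda>t. snd (snd K) m t * ux x (c + (d - c) * t))) (at x within {0..1})" for m
  proof -
    have 1: "((\<lambda>x. snd (snd K) m t * u x (c + (d - c) * t)) has_real_derivative
        snd (snd K) m t * ux x (c + (d - c) * t)) (at x within {0..1})" if "x \<in> {0..1}" "t \<in> cbox 0 1" for x t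
      by (rule DERIV_cmult, rule d) (use that mem[of t] in auto)
    have 2: "(\<lambda>t. snd (snd K) m t * u x (c + (d - c) * t)) integrable_on cbox 0 1" if "x \<in> {0..1}" for x
    proof -
      have "continuous_on {0..1} (\<lambda>t. u x (c + (d - c) * t))"
        by (rule cont2_compose[OF u, where p = "\<lambda>_. x" and q = "\<lambda>t. c + (d - c) * t"])
          (auto intro!: mem that continuous_intros simp del: atLeastAtMost_iff)
      from continuous_on_mult[OF k this] show ?thesis by (simp add: integrable_continuous_interval)
    qed
    have 3: "continuous_on ({0..1} \<times> cbox 0 1) (\<lambda>z. snd (snd K) m (snd z))"
      by (rule continuous_on_compose2[OF k, of _ snd]) (auto intro: continuous_on_snd continuous_on_id)
    have 4: "continuous_on ({0..1} \<times> cbox 0 1) (\<lambda>z. ux (fst z) (c + (d - c) * snd z))"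
      by (rule cont2_compose[OF ux, where p = fst and q = "\<lambda>z. c + (d - c) * snd z"])
        (auto intro!: mem continuous_intros simp del: atLeastAtMost_iff)
    have 5: "continuous_on ({0..1} \<times> cbox 0 1) (\<lambda>(x, t). snd (snd K) m t * ux x (c + (d - c) * t))"
      unfolding split_beta by (rule continuous_on_mult[OF 3 4])
    show ?thesis
      by (rule leibniz_rule_field_derivative[where U = "{0..1}"
            and f = "\<lambda>x t. snd (snd K) m t * u x (c + (d - c) * t)"
            and fx = "\<lambda>x t. snd (snd K) m t * ux x (c + (d - c) * t)", OF 1 2 5 x]) auto
  qed
  have m: "((\<lambda>t. mcoef K m (\<lambda>r. u t (c + (d - c) * r))) has_real_derivative
      mcoef K m (\<lambda>r. ux x (c + (d - c) * r))) (at x within {0..1})" for m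
  proof -
    have c: "c + (d - c) * 0 \<in> {0..1}" "c + (d - c) * 1 \<in> {0..1}" using mem[of 0] mem[of 1] by auto
    show ?thesis unfolding mcoef_def
      by (rule DERIV_add[OF DERIV_add[OF DERIV_cmult[OF d[OF x c(1)]] DERIV_cmult[OF d[OF x c(2)]]] I[of m, unfolded box_real]])
  qed
  show ?thesis
    unfolding projy_def proj_def rproj_def
    by (rule DERIV_sum[where f = "\<lambda>t m. mcoef K m (\<lambda>r. u t (c + (d - c) * r)) * ((y - c) / (d - c)) ^ m"])
      (rule DERIV_cmult_right[OF m])
qed

section \<open>Fubini for bounded continuous functions on open rectangles\<close>

text \<open>Second derivatives of the solution are only known to be bounded and continuous in the
  open square, and mesh functions are only prescribed in open cells. This class covers both and
  still admits Fubini.\<close>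

definition bc2 :: "real set \<Rightarrow> real set \<Rightarrow> (real \<Rightarrow> real \<Rightarrow> real) \<Rightarrow> bool" where
  "bc2 X Y g \<longleftrightarrow> cont2 X Y g \<and> (\<exists>M. \<forall>x\<in>X. \<forall>y\<in>Y. \<bar>g x y\<bar> \<le> M)"

lemma bounded_continuous_integrable_lborel:
  fixes f :: "'a::euclidean_space \<Rightarrow> real"
  assumes "continuous_on (box a b) f" "\<And>z. z \<in> box a b \<Longrightarrow> \<bar>f z\<bar> \<le> M"
  shows "integrable lborel (\<lambda>z. indicator (box a b) z * f z)"
proof (rule integrableI_bounded_set[where A = "box a b" and B = M])
  have "(\<lambda>z. indicator (box a b) z *\<^sub>R f z) \<in> borel_measurable borel"
    using assms(1) by (intro borel_measurable_continuous_on_indicator) auto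
  then show "(\<lambda>z. indicator (box a b) z * f z) \<in> borel_measurable lborel" by simp
qed (use assms(2) emeasure_lborel_box_finite in \<open>auto simp: less_top\<close>)

lemma has_integral_box_indicator:
  fixes f :: "'a::euclidean_space \<Rightarrow> real"
  assumes "integrable lborel (\<lambda>z. indicator (box a b) z * f z)"
  shows "(f has_integral integral\<^sup>L lborel (\<lambda>z. indicator (box a b) z * f z)) (box a b)"
proof -
  have "(\<lambda>z. indicator (box a b) z * f z) = (\<lambda>z. if z \<in> box a b then f z else 0)"
    by (auto simp: indicator_def)
  then have "((\<lambda>z. if z \<in> box a b then f z else 0) has_integral
      integral\<^sup>L lborel (\<lambda>z. indicator (box a b) z * f z)) UNIV"
    using has_integral_integral_lborel[OF assms] by simp
  then show ?thesis by (simp only: has_integral_restrict_UNIV)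
qed

lemma bounded_continuous_integrable_on:
  fixes f :: "real \<Rightarrow> real"
  assumes "continuous_on {a<..<b} f" "\<And>z. z \<in> {a<..<b} \<Longrightarrow> \<bar>f z\<bar> \<le> M"
  shows "f integrable_on {a..b}"
    and "integral {a..b} f = integral\<^sup>L lborel (\<lambda>z. indicator {a<..<b} z * f z)"
    and "integrable lborel (\<lambda>z. indicator {a<..<b} z * f z)"
proof -
  have I: "integrable lborel (\<lambda>z. indicator {a<..<b} z * f z)"
    using bounded_continuous_integrable_lborel[of a b f M] assms by (simp add: box_real)
  then show "integrable lborel (\<lambda>z. indicator {a<..<b} z * f z)" .
  have h: "(f has_integral integral\<^sup>L lborel (\<lambda>z. indicator {a<..<b} z * f z)) {a<..<b}"
    using has_integral_box_indicator[of a b f] I by (simp add: box_real)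
  show "f integrable_on {a..b}"
    using has_integral_integrable[OF h] by (simp only: integrable_on_open_interval_real)
  show "integral {a..b} f = integral\<^sup>L lborel (\<lambda>z. indicator {a<..<b} z * f z)"
    using integral_unique[OF h] by (simp add: integral_open_interval_real)
qed

lemma box_Pair_real: "box (a, c) (b, d) = {a<..<b} \<times> {c<..<d::real}" for a :: real
  by (auto simp: mem_box Basis_prod_def)

lemma integral_eq_lebesgue_indicator:
  fixes h :: "real \<Rightarrow> real"
  assumes "integrable lborel (\<lambda>y. indicator {p<..<q} y * h y)"
  shows "h integrable_on {p..q}"
    and "integral {p..q} h = integral\<^sup>L lborel (\<lambda>y. indicator {p<..<q} y * h y)"
proof -
  have *: "(h has_integral integral\<^sup>L lborel (\<lambda>y. indicator {p<..<q} y * h y)) {p<..<q}"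
    using has_integral_box_indicator[of p q h] assms by (simp add: box_real)
  show "h integrable_on {p..q}"
    using has_integral_integrable[OF *] by (simp only: integrable_on_open_interval_real)
  show "integral {p..q} h = integral\<^sup>L lborel (\<lambda>y. indicator {p<..<q} y * h y)"
    using integral_unique[OF *] by (simp add: integral_open_interval_real)
qed

text \<open>Values on the boundary of the rectangle are arbitrary, so the integrals are compared
  through Lebesgue integrals with the indicator of the open rectangle, where Fubini for the product
  measure applies.\<close>

lemma box_fubini:
  assumes g: "bc2 {a<..<b} {c<..<d} g"
  shows "(\<lambda>z. g (fst z) (snd z)) integrable_on cbox (a, c) (b, d)"
    and "(\<lambda>y. integral {a..b} (\<lambda>x. g x y)) integrable_on {c..d}"
    and "integral (cbox (a, c) (b, d)) (\<lambda>z. g (fst z) (snd z)) =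
      integral {c..d} (\<lambda>y. integral {a..b} (\<lambda>x. g x y))"
proof -
  obtain M where gc: "cont2 {a<..<b} {c<..<d} g"
    and M: "\<And>x y. x \<in> {a<..<b} \<Longrightarrow> y \<in> {c<..<d} \<Longrightarrow> \<bar>g x y\<bar> \<le> M"
    using g unfolding bc2_def by blast
  let ?f = "\<lambda>z. g (fst z) (snd z)"
  let ?B = "box (a, c) (b, d)"
  let ?F = "\<lambda>x y. indicator {a<..<b} x * (indicator {c<..<d} y * g x y)"
  let ?I = "\<lambda>y. integral {a..b} (\<lambda>x. g x y)"
  have box: "?B = {a<..<b} \<times> {c<..<d}" by (rule box_Pair_real)
  have I: "integrable lborel (\<lambda>z. indicator ?B z * ?f z)"
    using gc M by (intro bounded_continuous_integrable_lborel[of _ _ _ M]) (auto simp: box cont2_def)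
  have eF: "(\<lambda>z. indicator ?B z * ?f z) = (\<lambda>(x, y). ?F x y)"
    by (auto simp: box indicator_def fun_eq_iff)
  note h = has_integral_box_indicator[OF I]
  show "?f integrable_on cbox (a, c) (b, d)"
    using has_integral_integrable[OF h] by (simp only: integrable_on_open_interval)
  have inner: "(\<integral>x. ?F x y \<partial>lborel) = indicator {c<..<d} y * ?I y" for y
  proof (cases "y \<in> {c<..<d}")
    case True
    have "integral {a..b} (\<lambda>x. g x y) = integral\<^sup>L lborel (\<lambda>x. indicator {a<..<b} x * g x y)"
      by (rule bounded_continuous_integrable_on(2)[OF cont2_slice_x[OF gc True] M[OF _ True]])
    then show ?thesis using True by simp
  qed simp
  have P: "integrable (lborel \<Otimes>\<^sub>M lborel) (\<lambda>(x, y). ?F x y)"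
    using I unfolding eF lborel_prod .
  have "integrable lborel (\<lambda>y. \<integral>x. ?F x y \<partial>lborel)"
    using lborel_pair.integrable_snd[OF P] .
  then have J: "integrable lborel (\<lambda>y. indicator {c<..<d} y * ?I y)"
    unfolding inner .
  have eq: "(\<integral>y. indicator {c<..<d} y * ?I y \<partial>lborel) = integral\<^sup>L lborel (\<lambda>z. indicator ?B z * ?f z)"
    using lborel_pair.integral_snd[OF P] unfolding inner eF lborel_prod .
  show "?I integrable_on {c..d}" by (rule integral_eq_lebesgue_indicator(1)[OF J])
  show "integral (cbox (a, c) (b, d)) ?f = integral {c..d} ?I"
    using integral_unique[OF h] integral_eq_lebesgue_indicator(2)[OF J] eq
    by (simp add: integral_open_interval)
qed

lemma bc2_swp: "bc2 X Y g \<Longrightarrow> bc2 Y X (swp g)"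
  unfolding bc2_def by (metis cont2_swp)

text \<open>Allows all terms in the y-direction to be obtained from those in the x-direction by
  reflection at the diagonal.\<close>

lemma box_integral_swp:
  assumes g: "bc2 {a<..<b} {c<..<d} g"
  shows "integral (cbox (c, a) (d, b)) (\<lambda>z. g (snd z) (fst z)) = integral (cbox (a, c) (b, d)) (\<lambda>z. g (fst z) (snd z))"
proof -
  let ?B = "box (a, c) (b, d)" and ?B' = "box (c, a) (d, b)"
  obtain M where gc: "cont2 {a<..<b} {c<..<d} g"
    and M: "\<And>x y. x \<in> {a<..<b} \<Longrightarrow> y \<in> {c<..<d} \<Longrightarrow> \<bar>g x y\<bar> \<le> M"
    using g unfolding bc2_def by blast
  have box: "?B = {a<..<b} \<times> {c<..<d}" by (rule box_Pair_real)
  let ?F = "\<lambda>x y. indicator {a<..<b} x * (indicator {c<..<d} y * g x y)"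
  have "integrable lborel (\<lambda>z. indicator ?B z * g (fst z) (snd z))"
    using gc M by (intro bounded_continuous_integrable_lborel[of _ _ _ M]) (auto simp: box cont2_def)
  moreover have eF: "(\<lambda>z. indicator ?B z * g (fst z) (snd z)) = (\<lambda>(x, y). ?F x y)"
    by (auto simp: box indicator_def fun_eq_iff)
  ultimately have P: "integrable (lborel \<Otimes>\<^sub>M lborel) (\<lambda>(x, y). ?F x y)"
    unfolding lborel_prod by simp
  have sl: "integral {c..d} (\<lambda>y. g x y) = integral\<^sup>L lborel (\<lambda>y. indicator {c<..<d} y * g x y)"
    if "x \<in> {a<..<b}" for x
    by (rule bounded_continuous_integrable_on(2)[OF cont2_slice_y[OF gc that] M[OF that]])
  have inner: "(\<integral>y. ?F x y \<partial>lborel) = indicator {a<..<b} x * integral {c..d} (\<lambda>y. g x y)" for x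
    using sl[of x] by (cases "x \<in> {a<..<b}") auto
  have inner': "(\<integral>x. ?F x y \<partial>lborel) = indicator {c<..<d} y * integral {a..b} (\<lambda>x. g x y)" for y
  proof (cases "y \<in> {c<..<d}")
    case True
    have "integral {a..b} (\<lambda>x. g x y) = integral\<^sup>L lborel (\<lambda>x. indicator {a<..<b} x * g x y)"
      by (rule bounded_continuous_integrable_on(2)[OF cont2_slice_x[OF gc True] M[OF _ True]])
    then show ?thesis using True by simp
  qed simp
  have J: "integrable lborel (\<lambda>y. indicator {c<..<d} y * integral {a..b} (\<lambda>x. g x y))"
    using lborel_pair.integrable_snd[OF P] unfolding inner' .
  have J': "integrable lborel (\<lambda>x. indicator {a<..<b} x * integral {c..d} (\<lambda>y. g x y))"
    using lborel_pair.integrable_fst[OF P] unfolding inner .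
  have "integral {c..d} (\<lambda>y. integral {a..b} (\<lambda>x. g x y)) = integral {a..b} (\<lambda>x. integral {c..d} (\<lambda>y. g x y))"
    unfolding integral_eq_lebesgue_indicator(2)[OF J] integral_eq_lebesgue_indicator(2)[OF J']
    using lborel_pair.integral_snd[OF P] lborel_pair.integral_fst[OF P] unfolding inner inner' by simp
  then show ?thesis
    using box_fubini(3)[OF g] box_fubini(3)[OF bc2_swp[OF g]] by simp
qed

text \<open>The derivative \<open>G'\<close> exists in the open interval only and need not be
  continuous. Integrability of its product with \<open>S\<close> is therefore a conclusion: it is
  the difference between the derivative of the product and a continuous function.\<close>

lemma integration_by_parts_open:
  fixes G S :: "real \<Rightarrow> real"
  assumes "a \<le> b" and G: "continuous_on {a..b} G" and S: "continuous_on {a..b} S" and S': "continuous_on {a..b} S'"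
    and dG: "\<And>x. x \<in> {a<..<b} \<Longrightarrow> (G has_real_derivative G' x) (at x)"
    and dS: "\<And>x. x \<in> {a<..<b} \<Longrightarrow> (S has_real_derivative S' x) (at x)"
  shows "(\<lambda>x. G' x * S x) integrable_on {a..b}"
    and "integral {a..b} (\<lambda>x. G x * S' x) + integral {a..b} (\<lambda>x. G' x * S x) = G b * S b - G a * S a"
proof -
  have "((\<lambda>x. G x * S' x + G' x * S x) has_integral (G b * S b - G a * S a)) {a..b}"
    using assms(1) by (intro fundamental_theorem_of_calculus_interior[of a b "\<lambda>x. G x * S x", simplified])
      (auto intro!: continuous_intros G S derivative_eq_intros dG dS
        simp: has_real_derivative_iff_has_vector_derivative[symmetric])
  moreover have i: "(\<lambda>x. G x * S' x) integrable_on {a..b}"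
    by (intro integrable_continuous_interval continuous_intros G S')
  ultimately have d: "((\<lambda>x. (G x * S' x + G' x * S x) - G x * S' x) has_integral
      (G b * S b - G a * S a) - integral {a..b} (\<lambda>x. G x * S' x)) {a..b}"
    by (intro has_integral_diff integrable_integral)
  then have d: "((\<lambda>x. G' x * S x) has_integral
      (G b * S b - G a * S a) - integral {a..b} (\<lambda>x. G x * S' x)) {a..b}" by simp
  then show "(\<lambda>x. G' x * S x) integrable_on {a..b}" by blast
  show "integral {a..b} (\<lambda>x. G x * S' x) + integral {a..b} (\<lambda>x. G' x * S x) = G b * S b - G a * S a"
    using integral_unique[OF d] by simp
qed

section \<open>Numerical fluxes\<close>

locale mesh =
  fixes xs :: "nat \<Rightarrow> real" and N :: nat
  assumes N1: "1 \<le> N" and x0: "xs 0 = 0" and xN: "xs N = 1"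
    and xs_step: "\<And>i. i < N \<Longrightarrow> xs i < xs (Suc i)"
begin

lemma xs_mono: "i \<le> j \<Longrightarrow> j \<le> N \<Longrightarrow> xs i \<le> xs j"
proof (induction j)
  case (Suc j)
  then show ?case using xs_step[of j] by (cases "i = Suc j") auto
qed simp

lemma xs_less: "i \<in> {1..N} \<Longrightarrow> xs (i - 1) < xs i"
  using xs_step[of "i - 1"] by (cases i) auto

lemma xs_mem: "i \<le> N \<Longrightarrow> xs i \<in> {0..1}"
  using xs_mono[of 0 i] xs_mono[of i N] by (simp add: x0 xN)

lemma cell_sub: "i \<in> {1..N} \<Longrightarrow> {xs (i - 1)..xs i} \<subseteq> {0..1}"
  using xs_mem[of i] xs_mem[of "i - 1"] by force

lemma cell_sub_open: "i \<in> {1..N} \<Longrightarrow> {xs (i - 1)<..<xs i} \<subseteq> {0<..<1}"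
  using xs_mem[of i] xs_mem[of "i - 1"] by force

lemma sum_split_last: "(\<Sum>i=1..N. f i) = (\<Sum>i=1..N-1. f i) + (f N :: real)"
  using N1 by (cases N) (auto simp: sum.cl_ivl_Suc)

lemma sum_split_first: "(\<Sum>i=1..N. f i) = f 1 + (\<Sum>i=1..N-1. f (i + 1) :: real)"
proof -
  have "(\<Sum>i=1..N. f i) = f 1 + (\<Sum>i=Suc 1..N. f i)" using N1 by (rule sum.atLeast_Suc_atMost)
  also have "(\<Sum>i=Suc 1..N. f i) = (\<Sum>i=1..N-1. f (Suc i))"
    using N1 sum.shift_bounds_cl_Suc_ivl[of f 1 "N - 1"] by simp
  finally show ?thesis by simp
qed

text \<open>Functions on the mesh are families indexed by the cell, here on one line and from
  \<open>PC\<close> on in two dimensions; values at mesh points are then two-sided without limits.\<close>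

definition flux_left :: "(nat \<Rightarrow> real \<Rightarrow> real) \<Rightarrow> (nat \<Rightarrow> real \<Rightarrow> real) \<Rightarrow> (nat \<Rightarrow> real \<Rightarrow> real) \<Rightarrow> real" where
  "flux_left G S S' = (\<Sum>i=1..N. integral {xs (i-1)..xs i} (\<lambda>x. G i x * S' i x)) +
     (\<Sum>i=1..N-1. G i (xs i) * (S (i + 1) (xs i) - S i (xs i)))"

text \<open>One line of the term \<open>T3\<close>: fluxes are traces from the right, except at
  \<open>xs N\<close>, where the cell to the left is the only one.\<close>

definition flux_right :: "(nat \<Rightarrow> real \<Rightarrow> real) \<Rightarrow> (nat \<Rightarrow> real \<Rightarrow> real) \<Rightarrow> (nat \<Rightarrow> real \<Rightarrow> real) \<Rightarrow> real" where
  "flux_right G V V' = (\<Sum>i=1..N. integral {xs (i-1)..xs i} (\<lambda>x. G i x * V' i x)) +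
     G 1 (xs 0) * V 1 (xs 0) + (\<Sum>i=1..N-1. G (i + 1) (xs i) * (V (i + 1) (xs i) - V i (xs i))) -
     G N (xs N) * V N (xs N)"

definition C1 :: "(nat \<Rightarrow> real \<Rightarrow> real) \<Rightarrow> (nat \<Rightarrow> real \<Rightarrow> real) \<Rightarrow> bool" where
  "C1 S S' \<longleftrightarrow> (\<forall>i\<in>{1..N}. continuous_on {xs (i-1)..xs i} (S i) \<and> continuous_on {xs (i-1)..xs i} (S' i) \<and>
     (\<forall>x\<in>{xs (i-1)<..<xs i}. (S i has_real_derivative S' i x) (at x)))"

lemma cell_by_parts:
  assumes S: "C1 S S'" and G: "\<And>i. i \<in> {1..N} \<Longrightarrow> continuous_on {xs (i-1)..xs i} (G i)"
    and dG: "\<And>i x. i \<in> {1..N} \<Longrightarrow> x \<in> {xs (i-1)<..<xs i} \<Longrightarrow> (G i has_real_derivative G' i x) (at x)"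
  shows "(\<Sum>i=1..N. integral {xs (i-1)..xs i} (\<lambda>x. G i x * S' i x)) =
    (\<Sum>i=1..N. G i (xs i) * S i (xs i)) - (\<Sum>i=1..N. G i (xs (i - 1)) * S i (xs (i - 1))) -
    (\<Sum>i=1..N. integral {xs (i-1)..xs i} (\<lambda>x. G' i x * S i x))"
proof -
  have "integral {xs (i-1)..xs i} (\<lambda>x. G i x * S' i x) =
    G i (xs i) * S i (xs i) - G i (xs (i - 1)) * S i (xs (i - 1)) -
    integral {xs (i-1)..xs i} (\<lambda>x. G' i x * S i x)" if i: "i \<in> {1..N}" for i
    using integration_by_parts_open(2)[OF less_imp_le[OF xs_less[OF i]] G[OF i], of "S i" "S' i" "G' i"]
      dG[OF i] S i unfolding C1_def by auto
  then show ?thesis by (simp add: sum_subtractf)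
qed

text \<open>Integration by parts in each cell leaves at an interior node the jump of the product
  \<open>U P\<close>. With the flux of \<open>U\<close> from the left and that of \<open>P\<close>
  from the right this is exactly the sum of the two flux terms, and the remaining end point terms
  are those of \<open>flux_right\<close>.\<close>

lemma flux_cancel:
  assumes U: "C1 U U'" and P: "C1 P P'"
  shows "flux_left U P P' + flux_right P U U' = 0"
proof -
  have "(\<Sum>i=1..N. integral {xs (i-1)..xs i} (\<lambda>x. U i x * P' i x)) =
    (\<Sum>i=1..N. U i (xs i) * P i (xs i)) - (\<Sum>i=1..N. U i (xs (i - 1)) * P i (xs (i - 1))) -
    (\<Sum>i=1..N. integral {xs (i-1)..xs i} (\<lambda>x. U' i x * P i x))"
    using U by (intro cell_by_parts[OF P]) (auto simp: C1_def)
  then show ?thesis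
    unfolding flux_left_def flux_right_def
    unfolding sum_split_last[of "\<lambda>i. U i (xs i) * P i (xs i)"] sum_split_first[of "\<lambda>i. U i (xs (i-1)) * P i (xs (i-1))"]
    by (simp add: algebra_simps sum_subtractf)
qed

text \<open>A continuous \<open>g\<close> has the same trace from both sides, so the node terms
  telescope; its zero end values supply the end fluxes that \<open>flux_left\<close> does not
  contain.\<close>

lemma flux_left_smooth:
  assumes S: "C1 S S'" and g: "continuous_on {0..1} g" "g 0 = 0" "g 1 = 0"
    and dg: "\<And>x. x \<in> {0<..<1} \<Longrightarrow> (g has_real_derivative g' x) (at x)"
  shows "flux_left (\<lambda>i. g) S S' = - (\<Sum>i=1..N. integral {xs (i-1)..xs i} (\<lambda>x. g' x * S i x))"
proof -
  have "(\<Sum>i=1..N. integral {xs (i-1)..xs i} (\<lambda>x. g x * S' i x)) =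
    (\<Sum>i=1..N. g (xs i) * S i (xs i)) - (\<Sum>i=1..N. g (xs (i - 1)) * S i (xs (i - 1))) -
    (\<Sum>i=1..N. integral {xs (i-1)..xs i} (\<lambda>x. g' x * S i x))"
    by (rule cell_by_parts[OF S continuous_on_subset[OF g(1) cell_sub] dg]) (use cell_sub_open in blast)+
  then show ?thesis
    unfolding flux_left_def
    unfolding sum_split_last[of "\<lambda>i. g (xs i) * S i (xs i)"] sum_split_first[of "\<lambda>i. g (xs (i-1)) * S i (xs (i-1))"]
    using g by (simp add: algebra_simps sum_subtractf x0 xN)
qed

text \<open>No boundary values of \<open>p\<close> are asked for, since this form carries its own
  end fluxes.\<close>

lemma flux_right_smooth:
  assumes V: "C1 V V'" and p: "continuous_on {0..1} p"
    and dp: "\<And>x. x \<in> {0<..<1} \<Longrightarrow> (p has_real_derivative p' x) (at x)"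
  shows "flux_right (\<lambda>i. p) V V' = - (\<Sum>i=1..N. integral {xs (i-1)..xs i} (\<lambda>x. p' x * V i x))"
proof -
  have "(\<Sum>i=1..N. integral {xs (i-1)..xs i} (\<lambda>x. p x * V' i x)) =
    (\<Sum>i=1..N. p (xs i) * V i (xs i)) - (\<Sum>i=1..N. p (xs (i - 1)) * V i (xs (i - 1))) -
    (\<Sum>i=1..N. integral {xs (i-1)..xs i} (\<lambda>x. p' x * V i x))"
    by (rule cell_by_parts[OF V continuous_on_subset[OF p(1) cell_sub] dp]) (use cell_sub_open in blast)+
  then show ?thesis
    unfolding flux_right_def
    unfolding sum_split_last[of "\<lambda>i. p (xs i) * V i (xs i)"] sum_split_first[of "\<lambda>i. p (xs (i-1)) * V i (xs (i-1))"]
    by (simp add: algebra_simps sum_subtractf x0 xN)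
qed

lemma flux_left_cong:
  assumes "\<And>i. i \<in> {1..N} \<Longrightarrow> integral {xs (i-1)..xs i} (\<lambda>x. G i x * S' i x) = integral {xs (i-1)..xs i} (\<lambda>x. H i x * S' i x)"
    and "\<And>i. i \<in> {1..N} \<Longrightarrow> G i (xs i) = H i (xs i)"
  shows "flux_left G S S' = flux_left H S S'"
proof -
  have "{1..N-1} \<subseteq> {1..N}" by auto
  then show ?thesis unfolding flux_left_def
    using assms by (intro arg_cong2[of _ _ _ _ "(+)"] sum.cong) auto
qed

text \<open>Agreement at left end points covers all fluxes from the right. The flux at
  \<open>xs N\<close> sits at the right end of the last cell, and its mismatch is the extra
  term.\<close>

lemma flux_right_cong:
  assumes "\<And>i. i \<in> {1..N} \<Longrightarrow> integral {xs (i-1)..xs i} (\<lambda>x. G i x * V' i x) = integral {xs (i-1)..xs i} (\<lambda>x. H i x * V' i x)"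
    and e: "\<And>i. i \<in> {1..N} \<Longrightarrow> G i (xs (i - 1)) = H i (xs (i - 1))"
  shows "flux_right G V V' = flux_right H V V' + (H N (xs N) - G N (xs N)) * V N (xs N)"
proof -
  have "(\<Sum>i=1..N. integral {xs (i-1)..xs i} (\<lambda>x. G i x * V' i x)) =
      (\<Sum>i=1..N. integral {xs (i-1)..xs i} (\<lambda>x. H i x * V' i x))"
    using assms(1) by (intro sum.cong) auto
  moreover have "G (i + 1) (xs i) = H (i + 1) (xs i)" if "i \<in> {0..N-1}" for i
    using e[of "i + 1"] that N1 by auto
  moreover from this[of 0] have "G 1 (xs 0) = H 1 (xs 0)" by simp
  ultimately show ?thesis unfolding flux_right_def by (simp add: algebra_simps)
qed

end

section \<open>Polynomials in two variables and bounded continuous functions\<close>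

lemma integral_cong_open:
  fixes f g :: "real \<Rightarrow> real"
  assumes "\<And>y. y \<in> {a<..<b} \<Longrightarrow> f y = g y"
  shows "integral {a..b} f = integral {a..b} g"
proof -
  have "integral {a<..<b} f = integral {a<..<b} g" using assms by (intro integral_cong)
  then show ?thesis by (simp add: integral_open_interval_real)
qed

lemma isQ_swp: "isQ k F \<Longrightarrow> isQ k (swp F)"
proof -
  assume "isQ k F"
  then obtain c where c: "\<And>x y. F x y = (\<Sum>a\<le>k. \<Sum>b\<le>k. c a b * x ^ a * y ^ b)" unfolding isQ_def by blast
  have "F y x = (\<Sum>a\<le>k. \<Sum>b\<le>k. c b a * x ^ a * y ^ b)" for x y
    unfolding c by (subst sum.swap) (simp add: mult_ac)
  then show ?thesis unfolding isQ_def by (intro exI[of _ "\<lambda>a b. c b a"]) simp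
qed

lemma isQ_diff: "isQ k F \<Longrightarrow> isQ k G \<Longrightarrow> isQ k (\<lambda>x y. F x y - G x y)"
proof -
  assume "isQ k F" "isQ k G"
  then obtain c d where "\<And>x y. F x y = (\<Sum>a\<le>k. \<Sum>b\<le>k. c a b * x ^ a * y ^ b)"
    "\<And>x y. G x y = (\<Sum>a\<le>k. \<Sum>b\<le>k. d a b * x ^ a * y ^ b)" unfolding isQ_def by blast
  then show ?thesis unfolding isQ_def
    by (intro exI[of _ "\<lambda>a b. c a b - d a b"]) (simp add: left_diff_distrib sum_subtractf)
qed

lemma isQ_slice_x: "isQ k F \<Longrightarrow> \<exists>p. degree p \<le> k \<and> (\<lambda>x. F x y) = poly p"
proof -
  assume "isQ k F"
  then obtain c where c: "\<And>x y. F x y = (\<Sum>a\<le>k. \<Sum>b\<le>k. c a b * x ^ a * y ^ b)" unfolding isQ_def by blast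
  let ?p = "\<Sum>a\<le>k. monom (\<Sum>b\<le>k. c a b * y ^ b) a"
  have "degree ?p \<le> k" by (intro degree_sum_le) (auto intro: order.trans[OF degree_monom_le])
  moreover have "(\<lambda>x. F x y) = poly ?p"
    by (auto simp: fun_eq_iff c poly_sum poly_monom sum_distrib_left sum_distrib_right mult_ac)
  ultimately show ?thesis by blast
qed

lemma isQ_slice_y: "isQ k F \<Longrightarrow> \<exists>p. degree p \<le> k \<and> F x = poly p"
proof -
  assume "isQ k F"
  from isQ_slice_x[OF isQ_swp[OF this], of x] show ?thesis by simp
qed

lemma isQ_cont: "isQ k F \<Longrightarrow> cont2 X Y F"
  unfolding isQ_def cont2_def by (auto intro!: continuous_intros)

lemma isQ_has_derivative:
  assumes "isQ k F" shows "((\<lambda>t. F t y) has_real_derivative pdx F x y) (at x)"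
proof -
  obtain p where "(\<lambda>x. F x y) = poly p" using isQ_slice_x[OF assms] by blast
  then have "((\<lambda>t. F t y) has_real_derivative poly (pderiv p) x) (at x)" by (simp add: poly_DERIV)
  then show ?thesis unfolding pdx_def using DERIV_imp_deriv by fastforce
qed

text \<open>For k = 0 the derivative is the zero polynomial, whose degree 0 is not below
  \<open>k\<close>; hence the second alternative.\<close>

lemma isQ_pdx_slice:
  assumes "isQ k F" shows "\<exists>p. (degree p < k \<or> p = 0) \<and> (\<lambda>x. pdx F x y) = poly p"
proof -
  obtain p where p: "degree p \<le> k" "(\<lambda>x. F x y) = poly p" using isQ_slice_x[OF assms] by blast
  have "pdx F x y = poly (pderiv p) x" for x
    unfolding pdx_def p(2) using poly_DERIV DERIV_imp_deriv by blast
  moreover have "degree (pderiv p) < k \<or> pderiv p = 0"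
    using p(1) by (cases "degree p") (auto simp: degree_pderiv pderiv_eq_0_iff)
  ultimately show ?thesis by blast
qed

lemma isQ_pdx: assumes "isQ k F" shows "isQ k (pdx F)"
proof -
  obtain c where c: "\<And>x y. F x y = (\<Sum>a\<le>k. \<Sum>b\<le>k. c a b * x ^ a * y ^ b)"
    using assms unfolding isQ_def by blast
  define d where "d a b = (if a < k then real (Suc a) * c (Suc a) b else 0)" for a b
  have "pdx F x y = (\<Sum>a\<le>k. \<Sum>b\<le>k. d a b * x ^ a * y ^ b)" for x y
  proof -
    have "((\<lambda>t. F t y) has_real_derivative (\<Sum>a\<le>k. \<Sum>b\<le>k. c a b * (real a * x ^ (a - 1)) * y ^ b)) (at x)"
      unfolding c by (auto intro!: derivative_eq_intros sum.cong)
    then have "pdx F x y = (\<Sum>a\<le>k. \<Sum>b\<le>k. c a b * (real a * x ^ (a - 1)) * y ^ b)"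
      unfolding pdx_def by (rule DERIV_imp_deriv)
    also have "\<dots> = (\<Sum>a<k. \<Sum>b\<le>k. real (Suc a) * c (Suc a) b * x ^ a * y ^ b)"
      unfolding lessThan_Suc_atMost[symmetric, of k] by (subst sum.lessThan_Suc_shift) (simp add: mult_ac)
    also have "\<dots> = (\<Sum>a\<le>k. \<Sum>b\<le>k. d a b * x ^ a * y ^ b)"
      by (simp add: lessThan_Suc_atMost[symmetric, of k] d_def)
    finally show ?thesis .
  qed
  then show ?thesis unfolding isQ_def by blast
qed

lemma bc2_intros:
  "bc2 X Y g \<Longrightarrow> bc2 X Y h \<Longrightarrow> bc2 X Y (\<lambda>x y. g x y + h x y)"
  "bc2 X Y g \<Longrightarrow> bc2 X Y h \<Longrightarrow> bc2 X Y (\<lambda>x y. g x y - h x y)"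
  "bc2 X Y g \<Longrightarrow> bc2 X Y h \<Longrightarrow> bc2 X Y (\<lambda>x y. g x y * h x y)"
  "bc2 X Y (\<lambda>x y. c)"
proof -
  show "bc2 X Y (\<lambda>x y. g x y + h x y)" if gh: "bc2 X Y g" "bc2 X Y h"
  proof -
    obtain M M' where "\<forall>x\<in>X. \<forall>y\<in>Y. \<bar>g x y\<bar> \<le> M" "\<forall>x\<in>X. \<forall>y\<in>Y. \<bar>h x y\<bar> \<le> M'"
      using gh unfolding bc2_def by blast
    then have "\<forall>x\<in>X. \<forall>y\<in>Y. \<bar>g x y + h x y\<bar> \<le> M + M'" by (smt (verit))
    then show ?thesis using gh cont2_intros(1) unfolding bc2_def by blast
  qed
  show "bc2 X Y (\<lambda>x y. g x y - h x y)" if gh: "bc2 X Y g" "bc2 X Y h"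
  proof -
    obtain M M' where "\<forall>x\<in>X. \<forall>y\<in>Y. \<bar>g x y\<bar> \<le> M" "\<forall>x\<in>X. \<forall>y\<in>Y. \<bar>h x y\<bar> \<le> M'"
      using gh unfolding bc2_def by blast
    then have "\<forall>x\<in>X. \<forall>y\<in>Y. \<bar>g x y - h x y\<bar> \<le> M + M'" by (smt (verit))
    then show ?thesis using gh cont2_intros(2) unfolding bc2_def by blast
  qed
  show "bc2 X Y (\<lambda>x y. g x y * h x y)" if gh: "bc2 X Y g" "bc2 X Y h"
  proof -
    obtain M M' where M: "\<forall>x\<in>X. \<forall>y\<in>Y. \<bar>g x y\<bar> \<le> M" "\<forall>x\<in>X. \<forall>y\<in>Y. \<bar>h x y\<bar> \<le> M'"
      using gh unfolding bc2_def by blast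
    have "\<bar>g x y * h x y\<bar> \<le> M * M'" if "x \<in> X" "y \<in> Y" for x y
      unfolding abs_mult using M that by (intro mult_mono) (auto intro: order.trans[OF abs_ge_zero])
    then show ?thesis using gh cont2_intros(3) unfolding bc2_def by blast
  qed
  show "bc2 X Y (\<lambda>x y. c)" unfolding bc2_def using cont2_intros(4) by blast
qed

lemma bc2_subset: "bc2 X Y g \<Longrightarrow> X' \<subseteq> X \<Longrightarrow> Y' \<subseteq> Y \<Longrightarrow> bc2 X' Y' g"
  unfolding bc2_def by (meson cont2_subset subsetD)

lemma bc2_cong: "bc2 X Y g \<Longrightarrow> (\<And>x y. x \<in> X \<Longrightarrow> y \<in> Y \<Longrightarrow> h x y = g x y) \<Longrightarrow> bc2 X Y h"
proof -
  assume g: "bc2 X Y g" and e: "\<And>x y. x \<in> X \<Longrightarrow> y \<in> Y \<Longrightarrow> h x y = g x y"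
  have "continuous_on (X \<times> Y) (\<lambda>z. h (fst z) (snd z)) = continuous_on (X \<times> Y) (\<lambda>z. g (fst z) (snd z))"
    by (rule continuous_on_cong) (use e in auto)
  with g e show ?thesis unfolding bc2_def cont2_def by fastforce
qed

lemma cont2_compact_bc2: "cont2 {a..b} {c..d} g \<Longrightarrow> bc2 {a..b} {c..d} g"
proof -
  assume g: "cont2 {a..b} {c..d} g"
  then have "compact ((\<lambda>z. g (fst z) (snd z)) ` ({a..b} \<times> {c..d}))"
    unfolding cont2_def by (intro compact_continuous_image compact_Times) auto
  then have "bounded ((\<lambda>z. g (fst z) (snd z)) ` ({a..b} \<times> {c..d}))" by (rule compact_imp_bounded)
  then obtain M where M: "\<And>v. v \<in> (\<lambda>z. g (fst z) (snd z)) ` ({a..b} \<times> {c..d}) \<Longrightarrow> norm v \<le> M"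
    unfolding bounded_iff by blast
  have "\<bar>g x y\<bar> \<le> M" if "x \<in> {a..b}" "y \<in> {c..d}" for x y
    using M[OF image_eqI[of _ _ "(x, y)"], of "g x y"] that by simp
  then show ?thesis using g unfolding bc2_def by blast
qed

section \<open>Piecewise functions on the mesh, their integrals and traces\<close>

context mesh
begin

definition PC :: "(real \<Rightarrow> real \<Rightarrow> real) \<Rightarrow> bool" where
  "PC g \<longleftrightarrow> (\<forall>i\<in>{1..N}. \<forall>j\<in>{1..N}. bc2 {xs (i-1)<..<xs i} {xs (j-1)<..<xs j} g)"

text \<open>Agreement is required in open cells only, because membership in the discrete space
  leaves the values on mesh lines free.\<close>

definition repr :: "(real \<Rightarrow> real \<Rightarrow> real) \<Rightarrow> (nat \<Rightarrow> nat \<Rightarrow> real \<Rightarrow> real \<Rightarrow> real) \<Rightarrow> bool" where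
  "repr v V \<longleftrightarrow> (\<forall>i\<in>{1..N}. \<forall>j\<in>{1..N}. \<forall>x\<in>{xs (i-1)<..<xs i}. \<forall>y\<in>{xs (j-1)<..<xs j}. v x y = V i j x y)"

definition VN :: "nat \<Rightarrow> (real \<Rightarrow> real \<Rightarrow> real) \<Rightarrow> (nat \<Rightarrow> nat \<Rightarrow> real \<Rightarrow> real \<Rightarrow> real) \<Rightarrow> bool" where
  "VN k v V \<longleftrightarrow> repr v V \<and> (\<forall>i\<in>{1..N}. \<forall>j\<in>{1..N}. isQ k (V i j))"

lemma VN_isQ: "VN k v V \<Longrightarrow> i \<in> {1..N} \<Longrightarrow> j \<in> {1..N} \<Longrightarrow> isQ k (V i j)"
  by (simp add: VN_def)

lemma in_VN_iff: "in_VN k xs N v \<longleftrightarrow> (\<exists>V. VN k v V)"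
proof
  assume v: "in_VN k xs N v"
  define P where "P i j F \<longleftrightarrow> isQ k F \<and> (\<forall>x\<in>{xs (i-1)<..<xs i}. \<forall>y\<in>{xs (j-1)<..<xs j}. v x y = F x y)" for i j F
  have ex: "\<exists>F. P i j F" if ij: "i \<in> {1..N}" "j \<in> {1..N}" for i j
  proof -
    from bspec[OF bspec[OF v[unfolded in_VN_def] ij(1)] ij(2)]
    obtain c where c: "\<forall>x y. xs (i-1) < x \<and> x < xs i \<and> xs (j-1) < y \<and> y < xs j \<longrightarrow>
        v x y = (\<Sum>a\<le>k. \<Sum>b\<le>k. c a b * x ^ a * y ^ b)" ..
    have "isQ k (\<lambda>x y. \<Sum>a\<le>k. \<Sum>b\<le>k. c a b * x ^ a * y ^ b)"
      unfolding isQ_def by (intro exI[of _ c] allI refl)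
    then have "P i j (\<lambda>x y. \<Sum>a\<le>k. \<Sum>b\<le>k. c a b * x ^ a * y ^ b)"
      unfolding P_def using c by simp
    then show ?thesis by (rule exI[of "P i j"])
  qed
  define V where "V i j = (SOME F. P i j F)" for i j
  have P: "P i j (V i j)" if "i \<in> {1..N}" "j \<in> {1..N}" for i j
    unfolding V_def by (rule someI_ex[OF ex[OF that]])
  have "VN k v V"
    unfolding VN_def repr_def using P[unfolded P_def] by blast
  then show "\<exists>V. VN k v V" by (rule exI[of "VN k v"])
next
  assume "\<exists>V. VN k v V"
  then obtain V where V: "VN k v V" ..
  show "in_VN k xs N v" unfolding in_VN_def
  proof (intro ballI)
    fix i j assume ij: "i \<in> {1..N}" "j \<in> {1..N}"
    from VN_isQ[OF V ij] obtain c where c: "\<forall>x y. V i j x y = (\<Sum>a\<le>k. \<Sum>b\<le>k. c a b * x ^ a * y ^ b)"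
      unfolding isQ_def ..
    have "v x y = V i j x y" if "xs (i-1) < x \<and> x < xs i \<and> xs (j-1) < y \<and> y < xs j" for x y
      using V ij that unfolding VN_def repr_def by simp
    with c show "\<exists>c. \<forall>x y. xs (i-1) < x \<and> x < xs i \<and> xs (j-1) < y \<and> y < xs j \<longrightarrow>
        v x y = (\<Sum>a\<le>k. \<Sum>b\<le>k. c a b * x ^ a * y ^ b)"
      by (intro exI[of _ c]) simp
  qed
qed

lemma VN_diff: "VN k v V \<Longrightarrow> VN k w W \<Longrightarrow> VN k (\<lambda>x y. v x y - w x y) (\<lambda>i j x y. V i j x y - W i j x y)"
  unfolding VN_def repr_def by (auto intro: isQ_diff)

lemma VN_swp: "VN k v V \<Longrightarrow> VN k (swp v) (\<lambda>i j. swp (V j i))"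
  unfolding VN_def repr_def by (auto intro: isQ_swp)

lemma repr_pdx:
  assumes "repr v V" shows "repr (pdx v) (\<lambda>i j. pdx (V i j))"
  unfolding repr_def pdx_def
proof (intro ballI)
  fix i j x y assume *: "i \<in> {1..N}" "j \<in> {1..N}" "x \<in> {xs (i-1)<..<xs i}" "y \<in> {xs (j-1)<..<xs j}"
  have "eventually (\<lambda>t. t \<in> {xs (i-1)<..<xs i}) (nhds x)"
    using * by (intro eventually_nhds_in_open) auto
  then have "eventually (\<lambda>t. v t y = V i j t y) (nhds x)"
    by eventually_elim (use assms * in \<open>auto simp: repr_def\<close>)
  then show "deriv (\<lambda>t. v t y) x = deriv (\<lambda>t. V i j t y) x" by (rule deriv_cong_ev) simp
qed

lemma VN_pdx: "VN k v V \<Longrightarrow> VN k (pdx v) (\<lambda>i j. pdx (V i j))"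
  unfolding VN_def using repr_pdx isQ_pdx by blast

lemma PC_repr:
  assumes "repr v V" "\<And>i j. i \<in> {1..N} \<Longrightarrow> j \<in> {1..N} \<Longrightarrow> cont2 {xs (i-1)..xs i} {xs (j-1)..xs j} (V i j)"
  shows "PC v"
  unfolding PC_def
proof (intro ballI)
  fix i j assume ij: "i \<in> {1..N}" "j \<in> {1..N}"
  have "bc2 {xs (i-1)<..<xs i} {xs (j-1)<..<xs j} (V i j)"
    by (rule bc2_subset[OF cont2_compact_bc2[OF assms(2)[OF ij]]]) auto
  then show "bc2 {xs (i-1)<..<xs i} {xs (j-1)<..<xs j} v"
    by (rule bc2_cong) (use assms(1) ij in \<open>auto simp: repr_def\<close>)
qed

lemma PC_VN: "VN k v V \<Longrightarrow> PC v"
  by (rule PC_repr[of v V]) (simp add: VN_def, rule isQ_cont[OF VN_isQ])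

lemma PC_bc2: "bc2 {0<..<1} {0<..<1} g \<Longrightarrow> PC g"
  unfolding PC_def using cell_sub_open by (meson bc2_subset)

lemma PC_cont2: "cont2 {0..1} {0..1} g \<Longrightarrow> PC g"
  by (rule PC_bc2[OF bc2_subset[OF cont2_compact_bc2]]) auto

lemma PC_intros:
  "PC g \<Longrightarrow> PC h \<Longrightarrow> PC (\<lambda>x y. g x y + h x y)"
  "PC g \<Longrightarrow> PC h \<Longrightarrow> PC (\<lambda>x y. g x y - h x y)"
  "PC g \<Longrightarrow> PC h \<Longrightarrow> PC (\<lambda>x y. g x y * h x y)"
  "PC (\<lambda>x y. c)"
  unfolding PC_def by (auto intro: bc2_intros)

lemma PC_swp: "PC g \<Longrightarrow> PC (swp g)"
  unfolding PC_def using bc2_swp by blast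

definition IP :: "(real \<Rightarrow> real \<Rightarrow> real) \<Rightarrow> real" where
  "IP g = (\<Sum>i=1..N. \<Sum>j=1..N. integral (cbox (xs (i-1), xs (j-1)) (xs i, xs j)) (\<lambda>z. g (fst z) (snd z)))"

lemma bip_IP: "bip xs N g h = IP (\<lambda>x y. g x y * h x y)"
  unfolding bip_def IP_def ..

lemma IP_integrable:
  assumes "PC g" "i \<in> {1..N}" "j \<in> {1..N}"
  shows "(\<lambda>z. g (fst z) (snd z)) integrable_on cbox (xs (i-1), xs (j-1)) (xs i, xs j)"
  using box_fubini(1) assms unfolding PC_def by blast

lemma IP_cong:
  assumes "\<And>i j x y. i \<in> {1..N} \<Longrightarrow> j \<in> {1..N} \<Longrightarrow> x \<in> {xs (i-1)<..<xs i} \<Longrightarrow> y \<in> {xs (j-1)<..<xs j} \<Longrightarrow> g x y = h x y"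
  shows "IP g = IP h"
proof -
  have "integral (cbox (xs (i-1), xs (j-1)) (xs i, xs j)) (\<lambda>z. g (fst z) (snd z)) =
      integral (cbox (xs (i-1), xs (j-1)) (xs i, xs j)) (\<lambda>z. h (fst z) (snd z))"
    if ij: "i \<in> {1..N}" "j \<in> {1..N}" for i j
  proof -
    have "integral (box (xs (i-1), xs (j-1)) (xs i, xs j)) (\<lambda>z. g (fst z) (snd z)) =
      integral (box (xs (i-1), xs (j-1)) (xs i, xs j)) (\<lambda>z. h (fst z) (snd z))"
      using assms[OF ij] by (intro integral_cong) (auto simp: box_Pair_real)
    then show ?thesis by (simp add: integral_open_interval)
  qed
  then show ?thesis unfolding IP_def by simp
qed

lemma IP_add: "PC g \<Longrightarrow> PC h \<Longrightarrow> IP (\<lambda>x y. g x y + h x y) = IP g + IP h"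
  unfolding IP_def sum.distrib[symmetric]
  by (intro sum.cong refl integral_add IP_integrable)

lemma IP_diff: "PC g \<Longrightarrow> PC h \<Longrightarrow> IP (\<lambda>x y. g x y - h x y) = IP g - IP h"
  unfolding IP_def sum_subtractf[symmetric]
  by (intro sum.cong refl integral_diff IP_integrable)

lemma IP_cmult: "IP (\<lambda>x y. c * g x y) = c * IP g"
  unfolding IP_def by (simp add: sum_distrib_left)

lemma IP_mono:
  assumes "PC g" "PC h" "\<And>i j x y. i \<in> {1..N} \<Longrightarrow> j \<in> {1..N} \<Longrightarrow> x \<in> {xs (i-1)<..<xs i} \<Longrightarrow> y \<in> {xs (j-1)<..<xs j} \<Longrightarrow> g x y \<le> h x y"
  shows "IP g \<le> IP h"
  unfolding IP_def
proof (intro sum_mono)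
  fix i j assume ij: "i \<in> {1..N}" "j \<in> {1..N}"
  have "integral (box (xs (i-1), xs (j-1)) (xs i, xs j)) (\<lambda>z. g (fst z) (snd z)) \<le>
      integral (box (xs (i-1), xs (j-1)) (xs i, xs j)) (\<lambda>z. h (fst z) (snd z))"
    using IP_integrable[OF assms(1) ij] IP_integrable[OF assms(2) ij] assms(3)[OF ij]
    by (intro integral_le) (auto simp: box_Pair_real[symmetric] integrable_on_open_interval, auto simp: box_Pair_real)
  then show "integral (cbox (xs (i-1), xs (j-1)) (xs i, xs j)) (\<lambda>z. g (fst z) (snd z)) \<le>
      integral (cbox (xs (i-1), xs (j-1)) (xs i, xs j)) (\<lambda>z. h (fst z) (snd z))"
    by (simp add: integral_open_interval)
qed

lemma IP_swp: "PC g \<Longrightarrow> IP (swp g) = IP g"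
proof -
  assume g: "PC g"
  have "IP (swp g) = (\<Sum>i=1..N. \<Sum>j=1..N. integral (cbox (xs (j-1), xs (i-1)) (xs j, xs i)) (\<lambda>z. g (fst z) (snd z)))"
    unfolding IP_def using g unfolding PC_def
    by (intro sum.cong refl box_integral_swp) blast
  then show ?thesis unfolding IP_def by (subst (asm) sum.swap) simp
qed

lemma IP_lines:
  assumes g: "PC g"
  shows "IP g = (\<Sum>j=1..N. integral {xs (j-1)..xs j} (\<lambda>y. \<Sum>i=1..N. integral {xs (i-1)..xs i} (\<lambda>x. g x y)))"
    and "\<And>j. j \<in> {1..N} \<Longrightarrow> (\<lambda>y. \<Sum>i=1..N. integral {xs (i-1)..xs i} (\<lambda>x. g x y)) integrable_on {xs (j-1)..xs j}"
proof -
  have b: "bc2 {xs (i-1)<..<xs i} {xs (j-1)<..<xs j} g" if "i \<in> {1..N}" "j \<in> {1..N}" for i j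
    using g that unfolding PC_def by blast
  show "(\<lambda>y. \<Sum>i=1..N. integral {xs (i-1)..xs i} (\<lambda>x. g x y)) integrable_on {xs (j-1)..xs j}"
    if "j \<in> {1..N}" for j
    by (intro integrable_sum box_fubini(2)[OF b] that) auto
  have "IP g = (\<Sum>i=1..N. \<Sum>j=1..N. integral {xs (j-1)..xs j} (\<lambda>y. integral {xs (i-1)..xs i} (\<lambda>x. g x y)))"
    unfolding IP_def by (intro sum.cong refl box_fubini(3)[OF b])
  also have "\<dots> = (\<Sum>j=1..N. \<Sum>i=1..N. integral {xs (j-1)..xs j} (\<lambda>y. integral {xs (i-1)..xs i} (\<lambda>x. g x y)))"
    by (rule sum.swap)
  also have "\<dots> = (\<Sum>j=1..N. integral {xs (j-1)..xs j} (\<lambda>y. \<Sum>i=1..N. integral {xs (i-1)..xs i} (\<lambda>x. g x y)))"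
    by (intro sum.cong refl integral_sum[symmetric] box_fubini(2)[OF b]) auto
  finally show "IP g = (\<Sum>j=1..N. integral {xs (j-1)..xs j} (\<lambda>y. \<Sum>i=1..N. integral {xs (i-1)..xs i} (\<lambda>x. g x y)))" .
qed

text \<open>The limit from the left only sees the open cell \<open>i\<close>, where \<open>v\<close>
  agrees with a function that is continuous up to the mesh line.\<close>

lemma trxm_eq:
  assumes "repr v V" "i \<in> {1..N}" "j \<in> {1..N}" "y \<in> {xs (j-1)<..<xs j}"
    and c: "continuous_on {xs (i-1)..xs i} (\<lambda>x. V i j x y)"
  shows "trxm xs v i y = V i j (xs i) y"
proof -
  note l = xs_less[OF assms(2)]
  have "((\<lambda>x. V i j x y) \<longlongrightarrow> V i j (xs i) y) (at_left (xs i))"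
    using c l unfolding continuous_on_def at_within_Icc_at_left[OF l, symmetric] by auto
  moreover have "eventually (\<lambda>x. V i j x y = v x y) (at_left (xs i))"
    using eventually_at_left_real[OF l]
    by eventually_elim (use assms in \<open>auto simp: repr_def\<close>)
  ultimately have "((\<lambda>x. v x y) \<longlongrightarrow> V i j (xs i) y) (at_left (xs i))"
    by (rule Lim_transform_eventually)
  then show ?thesis unfolding trxm_def by (intro tendsto_Lim) auto
qed

lemma trxp_eq:
  assumes "repr v V" "i \<in> {1..N}" "j \<in> {1..N}" "y \<in> {xs (j-1)<..<xs j}"
    and c: "continuous_on {xs (i-1)..xs i} (\<lambda>x. V i j x y)"
  shows "trxp xs v (i - 1) y = V i j (xs (i - 1)) y"
proof -
  note l = xs_less[OF assms(2)]
  have "((\<lambda>x. V i j x y) \<longlongrightarrow> V i j (xs (i-1)) y) (at_right (xs (i-1)))"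
    using c l unfolding continuous_on_def at_within_Icc_at_right[OF l, symmetric] by auto
  moreover have "eventually (\<lambda>x. V i j x y = v x y) (at_right (xs (i-1)))"
    using eventually_at_right_real[OF l]
    by eventually_elim (use assms in \<open>auto simp: repr_def\<close>)
  ultimately have "((\<lambda>x. v x y) \<longlongrightarrow> V i j (xs (i-1)) y) (at_right (xs (i-1)))"
    by (rule Lim_transform_eventually)
  then show ?thesis unfolding trxp_def by (intro tendsto_Lim) auto
qed

end

section \<open>Flux terms as integrals over lines\<close>

context mesh
begin

text \<open>Only the half of the flux term that belongs to the x-direction; the other half is this
  one applied to functions with exchanged arguments.\<close>

definition T2x :: "(real \<Rightarrow> real \<Rightarrow> real) \<Rightarrow> (real \<Rightarrow> real \<Rightarrow> real) \<Rightarrow> real" where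
  "T2x U s = bip xs N U (pdx s) + (\<Sum>j=1..N. \<Sum>i=1..N-1. eip xs j (trxm xs U i) (jmpx xs N s i))"

definition T3x :: "(real \<Rightarrow> real \<Rightarrow> real) \<Rightarrow> (real \<Rightarrow> real \<Rightarrow> real) \<Rightarrow> real" where
  "T3x P v = bip xs N P (pdx v) + (\<Sum>j=1..N. (\<Sum>i=0..N-1. eip xs j (trxp xs P i) (jmpx xs N v i))
                           - eip xs j (trxm xs P N) (trxm xs v N))"

definition edge :: "(real \<Rightarrow> real) \<Rightarrow> (real \<Rightarrow> real \<Rightarrow> real) \<Rightarrow> real" where
  "edge g v = (\<Sum>j=1..N. integral {xs (j-1)..xs j} (\<lambda>y. g y * trxm xs v N y))"

definition lineL :: "(nat \<Rightarrow> nat \<Rightarrow> real \<Rightarrow> real \<Rightarrow> real) \<Rightarrow> (nat \<Rightarrow> nat \<Rightarrow> real \<Rightarrow> real \<Rightarrow> real) \<Rightarrow> nat \<Rightarrow> real \<Rightarrow> real" where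
  "lineL U S j y = flux_left (\<lambda>i x. U i j x y) (\<lambda>i x. S i j x y) (\<lambda>i x. pdx (S i j) x y)"

definition lineR :: "(nat \<Rightarrow> nat \<Rightarrow> real \<Rightarrow> real \<Rightarrow> real) \<Rightarrow> (nat \<Rightarrow> nat \<Rightarrow> real \<Rightarrow> real \<Rightarrow> real) \<Rightarrow> nat \<Rightarrow> real \<Rightarrow> real" where
  "lineR P V j y = flux_right (\<lambda>i x. P i j x y) (\<lambda>i x. V i j x y) (\<lambda>i x. pdx (V i j) x y)"

lemma C1_VN:
  assumes "VN k v V" "j \<in> {1..N}"
  shows "C1 (\<lambda>i x. V i j x y) (\<lambda>i x. pdx (V i j) x y)"
  unfolding C1_def
proof (intro ballI conjI)
  fix i assume i: "i \<in> {1..N}"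
  note q = VN_isQ[OF assms(1) i assms(2)]
  show "continuous_on {xs (i-1)..xs i} (\<lambda>x. V i j x y)"
    by (rule cont2_slice_x[OF isQ_cont[OF q, where Y = UNIV] UNIV_I])
  show "continuous_on {xs (i-1)..xs i} (\<lambda>x. pdx (V i j) x y)"
    by (rule cont2_slice_x[OF isQ_cont[OF isQ_pdx[OF q], where Y = UNIV] UNIV_I])
qed (rule isQ_has_derivative[OF VN_isQ[OF assms(1) _ assms(2)]])

text \<open>Weaker than \<open>VN\<close> on purpose: functions projected in one variable only are
  not polynomial in the other, but must still pass through the reduction to lines.\<close>

definition famc :: "(nat \<Rightarrow> nat \<Rightarrow> real \<Rightarrow> real \<Rightarrow> real) \<Rightarrow> bool" where
  "famc U \<longleftrightarrow> (\<forall>i\<in>{1..N}. \<forall>j\<in>{1..N}. cont2 {xs (i-1)..xs i} {xs (j-1)..xs j} (U i j))"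

lemma famc_VN: "VN k v V \<Longrightarrow> famc V"
  unfolding famc_def by (intro ballI isQ_cont VN_isQ)

lemma famcD: "famc U \<Longrightarrow> i \<in> {1..N} \<Longrightarrow> j \<in> {1..N} \<Longrightarrow> cont2 {xs (i-1)..xs i} {xs (j-1)..xs j} (U i j)"
  unfolding famc_def by blast

lemma famc_left:
  assumes "famc U" "i \<in> {1..N}" "j \<in> {1..N}"
  shows "continuous_on {xs (j-1)..xs j} (U i j (xs (i-1)))"
  by (rule cont2_slice_y[OF famcD[OF assms]]) (use xs_less[OF assms(2)] in auto)

lemma famc_left_Suc:
  assumes "famc U" "i < N" "j \<in> {1..N}"
  shows "continuous_on {xs (j-1)..xs j} (U (i + 1) j (xs i))"
  using famc_left[OF assms(1) _ assms(3), of "i + 1"] assms(2) by simp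

lemma famc_right:
  assumes "famc U" "i \<in> {1..N}" "j \<in> {1..N}"
  shows "continuous_on {xs (j-1)..xs j} (U i j (xs i))"
  by (rule cont2_slice_y[OF famcD[OF assms]]) (use xs_less[OF assms(2)] in auto)

lemma cell_integral_continuous:
  assumes "famc U" "famc S" "j \<in> {1..N}"
  shows "continuous_on {xs (j-1)..xs j} (\<lambda>y. \<Sum>i=1..N. integral {xs (i-1)..xs i} (\<lambda>x. U i j x y * S i j x y))"
  by (rule continuous_on_sum) (rule integral_slice_continuous[OF cont2_intros(3)[OF famcD[OF assms(1) _ assms(3)] famcD[OF assms(2) _ assms(3)]]])

lemma jump_continuous:
  assumes "famc S" "i \<in> {1..N-1}" "j \<in> {1..N}"
  shows "continuous_on {xs (j-1)..xs j} (\<lambda>y. S (i + 1) j (xs i) y - S i j (xs i) y)"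
  by (rule continuous_on_diff[OF famc_left_Suc[OF assms(1) _ assms(3)] famc_right[OF assms(1) _ assms(3)]]) (use assms(2) in auto)

lemma left_jumps_continuous:
  assumes "famc U" "famc S" "i \<in> {1..N-1}" "j \<in> {1..N}"
  shows "continuous_on {xs (j-1)..xs j} (\<lambda>y. U i j (xs i) y * (S (i + 1) j (xs i) y - S i j (xs i) y))"
  by (rule continuous_on_mult[OF famc_right[OF assms(1) _ assms(4)] jump_continuous[OF assms(2-4)]]) (use assms(3) in auto)

lemma right_jumps_continuous:
  assumes "famc U" "famc S" "i \<in> {1..N-1}" "j \<in> {1..N}"
  shows "continuous_on {xs (j-1)..xs j} (\<lambda>y. U (i + 1) j (xs i) y * (S (i + 1) j (xs i) y - S i j (xs i) y))"
  by (rule continuous_on_mult[OF famc_left_Suc[OF assms(1) _ assms(4)] jump_continuous[OF assms(2-4)]]) (use assms(3) in auto)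

lemma lineL_continuous:
  assumes "famc U" "VN k s S" "j \<in> {1..N}"
  shows "continuous_on {xs (j-1)..xs j} (lineL U S j)"
proof -
  have "continuous_on {xs (j-1)..xs j} (\<lambda>y. lineL U S j y)"
    unfolding lineL_def flux_left_def
    by (rule continuous_on_add[OF cell_integral_continuous[OF assms(1) famc_VN[OF VN_pdx[OF assms(2)]] assms(3)]
          continuous_on_sum[OF left_jumps_continuous[OF assms(1) famc_VN[OF assms(2)] _ assms(3)]]])
  then show ?thesis .
qed

lemma edge_term_continuous:
  assumes "famc U" "famc S" "j \<in> {1..N}"
  shows "continuous_on {xs (j-1)..xs j} (\<lambda>y. U 1 j (xs 0) y * S 1 j (xs 0) y)"
    and "continuous_on {xs (j-1)..xs j} (\<lambda>y. U N j (xs N) y * S N j (xs N) y)"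
proof -
  show "continuous_on {xs (j-1)..xs j} (\<lambda>y. U 1 j (xs 0) y * S 1 j (xs 0) y)"
    using continuous_on_mult[OF famc_left_Suc[OF assms(1) _ assms(3)] famc_left_Suc[OF assms(2) _ assms(3)], of 0 0] N1 by simp
  show "continuous_on {xs (j-1)..xs j} (\<lambda>y. U N j (xs N) y * S N j (xs N) y)"
    by (rule continuous_on_mult[OF famc_right[OF assms(1) _ assms(3)] famc_right[OF assms(2) _ assms(3)]]) (use N1 in auto)
qed

lemma lineR_continuous:
  assumes "famc P" "VN k v V" "j \<in> {1..N}"
  shows "continuous_on {xs (j-1)..xs j} (lineR P V j)"
proof -
  note V = famc_VN[OF assms(2)]
  have "continuous_on {xs (j-1)..xs j} (\<lambda>y. lineR P V j y)"
    unfolding lineR_def flux_right_def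
    by (rule continuous_on_diff[OF continuous_on_add[OF continuous_on_add[OF cell_integral_continuous[OF assms(1) famc_VN[OF VN_pdx[OF assms(2)]] assms(3)]
          edge_term_continuous(1)[OF assms(1) V assms(3)]]
          continuous_on_sum[OF right_jumps_continuous[OF assms(1) V _ assms(3)]]] edge_term_continuous(2)[OF assms(1) V assms(3)]])
  then show ?thesis .
qed

lemma bip_lines:
  assumes "PC g" "PC h" "repr g G" "repr h H"
  shows "bip xs N g h = (\<Sum>j=1..N. integral {xs (j-1)..xs j} (\<lambda>y. \<Sum>i=1..N. integral {xs (i-1)..xs i} (\<lambda>x. G i j x y * H i j x y)))"
  unfolding bip_IP IP_lines(1)[OF PC_intros(3)[OF assms(1,2)]]
proof (intro sum.cong refl integral_cong_open)
  fix i j y assume "j \<in> {1..N}" "y \<in> {xs (j-1)<..<xs j}" "i \<in> {1..N}"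
  then show "g x y * h x y = G i j x y * H i j x y" if "x \<in> {xs (i-1)<..<xs i}" for x
    using assms(3,4) that by (simp add: repr_def)
qed

text \<open>Fubini in the cells and linearity on the edges collect everything that belongs to one
  value of \<open>y\<close>, so that identities for \<open>flux_left\<close> on a line can be
  integrated.\<close>

lemma T2x_lines:
  assumes U: "repr u U" "famc U" and s: "VN k s S"
  shows "T2x u s = (\<Sum>j=1..N. integral {xs (j-1)..xs j} (lineL U S j))"
proof -
  have S: "repr s S" "famc S" using s famc_VN by (auto simp: VN_def)
  have S': "repr (pdx s) (\<lambda>i j. pdx (S i j))" "famc (\<lambda>i j. pdx (S i j))"
    using VN_pdx[OF s] famc_VN[OF VN_pdx[OF s]] by (auto simp: VN_def)
  have PCU: "PC u" by (rule PC_repr[OF U(1) famcD[OF U(2)]])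
  have e: "eip xs j (trxm xs u i) (jmpx xs N s i) =
      integral {xs (j-1)..xs j} (\<lambda>y. U i j (xs i) y * (S (i + 1) j (xs i) y - S i j (xs i) y))"
    if ij: "i \<in> {1..N-1}" "j \<in> {1..N}" for i j
    unfolding eip_def
  proof (rule integral_cong_open)
    fix y assume y: "y \<in> {xs (j-1)<..<xs j}"
    then have y': "y \<in> {xs (j-1)..xs j}" by auto
    have i: "i \<in> {1..N}" "i + 1 \<in> {1..N}" using ij by auto
    have "trxm xs u i y = U i j (xs i) y"
      by (rule trxm_eq[OF U(1) i(1) ij(2) y]) (rule cont2_slice_x[OF famcD[OF U(2) i(1) ij(2)] y'])
    moreover have "trxm xs s i y = S i j (xs i) y"
      by (rule trxm_eq[OF S(1) i(1) ij(2) y]) (rule cont2_slice_x[OF famcD[OF S(2) i(1) ij(2)] y'])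
    moreover have "trxp xs s (i + 1 - 1) y = S (i + 1) j (xs (i + 1 - 1)) y"
      by (rule trxp_eq[OF S(1) i(2) ij(2) y]) (rule cont2_slice_x[OF famcD[OF S(2) i(2) ij(2)] y'])
    ultimately show "trxm xs u i y * jmpx xs N s i y = U i j (xs i) y * (S (i + 1) j (xs i) y - S i j (xs i) y)"
      using ij by (auto simp: jmpx_def)
  qed
  note cB = cell_integral_continuous[OF U(2) S'(2)]
  note cJ = left_jumps_continuous[OF U(2) S(2)]
  have cJs: "continuous_on {xs (j-1)..xs j} (\<lambda>y. \<Sum>i=1..N-1. U i j (xs i) y * (S (i + 1) j (xs i) y - S i j (xs i) y))"
    if j: "j \<in> {1..N}" for j
    by (rule continuous_on_sum[OF cJ[OF _ j]])
  have "integral {xs (j-1)..xs j} (lineL U S j) =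
     integral {xs (j-1)..xs j} (\<lambda>y. \<Sum>i=1..N. integral {xs (i-1)..xs i} (\<lambda>x. U i j x y * pdx (S i j) x y)) +
     (\<Sum>i=1..N-1. eip xs j (trxm xs u i) (jmpx xs N s i))"
    if j: "j \<in> {1..N}" for j
  proof -
    have "lineL U S j = (\<lambda>y. (\<Sum>i=1..N. integral {xs (i-1)..xs i} (\<lambda>x. U i j x y * pdx (S i j) x y)) +
       (\<Sum>i=1..N-1. U i j (xs i) y * (S (i + 1) j (xs i) y - S i j (xs i) y)))"
      unfolding lineL_def flux_left_def ..
    then have "integral {xs (j-1)..xs j} (lineL U S j) =
      integral {xs (j-1)..xs j} (\<lambda>y. \<Sum>i=1..N. integral {xs (i-1)..xs i} (\<lambda>x. U i j x y * pdx (S i j) x y)) +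
      integral {xs (j-1)..xs j} (\<lambda>y. \<Sum>i=1..N-1. U i j (xs i) y * (S (i + 1) j (xs i) y - S i j (xs i) y))"
      by (simp only: integral_add[OF integrable_continuous_interval[OF cB[OF j]] integrable_continuous_interval[OF cJs[OF j]]])
    also have "integral {xs (j-1)..xs j} (\<lambda>y. \<Sum>i=1..N-1. U i j (xs i) y * (S (i + 1) j (xs i) y - S i j (xs i) y)) =
      (\<Sum>i=1..N-1. integral {xs (j-1)..xs j} (\<lambda>y. U i j (xs i) y * (S (i + 1) j (xs i) y - S i j (xs i) y)))"
      by (rule integral_sum[OF _ integrable_continuous_interval[OF cJ[OF _ j]]]) auto
    also have "\<dots> = (\<Sum>i=1..N-1. eip xs j (trxm xs u i) (jmpx xs N s i))"
      by (rule sum.cong[OF refl]) (rule e[OF _ j, symmetric])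
    finally show ?thesis .
  qed
  then show ?thesis
    unfolding T2x_def bip_lines[OF PCU PC_VN[OF VN_pdx[OF s]] U(1) S'(1)] by (simp add: sum.distrib)
qed

lemma T3x_lines:
  assumes P: "repr p P" "famc P" and v: "VN k v V"
  shows "T3x p v = (\<Sum>j=1..N. integral {xs (j-1)..xs j} (lineR P V j))"
proof -
  have V: "repr v V" "famc V" using v famc_VN by (auto simp: VN_def)
  have V': "repr (pdx v) (\<lambda>i j. pdx (V i j))" "famc (\<lambda>i j. pdx (V i j))"
    using VN_pdx[OF v] famc_VN[OF VN_pdx[OF v]] by (auto simp: VN_def)
  have PCP: "PC p" by (rule PC_repr[OF P(1) famcD[OF P(2)]])
  have tl: "trxm xs w i y = W i j (xs i) y" if "repr w W" "famc W" "i \<in> {1..N}" "j \<in> {1..N}" "y \<in> {xs (j-1)<..<xs j}"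
    for w W i j y
    by (rule trxm_eq[OF that(1,3,4,5) cont2_slice_x[OF famcD[OF that(2-4)]]]) (use that(5) in auto)
  \<comment> \<open>The trace from the right at \<open>xs i\<close> is taken in cell
    \<open>i + 1\<close>.\<close>
  have tr: "trxp xs w i y = W (i + 1) j (xs i) y" if "repr w W" "famc W" "i < N" "j \<in> {1..N}" "y \<in> {xs (j-1)<..<xs j}"
    for w W i j y
    using trxp_eq[OF that(1) _ that(4,5), of "i + 1"] that cont2_slice_x[OF famcD[OF that(2) _ that(4)], of "i + 1" y]
    by simp
  define R where "R j y = P 1 j (xs 0) y * V 1 j (xs 0) y +
      (\<Sum>i=1..N-1. P (i + 1) j (xs i) y * (V (i + 1) j (xs i) y - V i j (xs i) y))" for j y
  have e0: "eip xs j (trxp xs p 0) (jmpx xs N v 0) = integral {xs (j-1)..xs j} (\<lambda>y. P 1 j (xs 0) y * V 1 j (xs 0) y)"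
    if j: "j \<in> {1..N}" for j
    unfolding eip_def
    by (rule integral_cong_open) (use tr[OF P _ j, of 0] tr[OF V _ j, of 0] N1 in \<open>auto simp: jmpx_def\<close>)
  have ei: "eip xs j (trxp xs p i) (jmpx xs N v i) =
      integral {xs (j-1)..xs j} (\<lambda>y. P (i + 1) j (xs i) y * (V (i + 1) j (xs i) y - V i j (xs i) y))"
    if j: "j \<in> {1..N}" and i: "i \<in> {1..N-1}" for i j
    unfolding eip_def
    by (rule integral_cong_open)
      (use tr[OF P _ j, of i] tr[OF V _ j, of i] tl[OF V _ j, of i] i in \<open>auto simp: jmpx_def\<close>)
  have eN: "eip xs j (trxm xs p N) (trxm xs v N) = integral {xs (j-1)..xs j} (\<lambda>y. P N j (xs N) y * V N j (xs N) y)"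
    if j: "j \<in> {1..N}" for j
    unfolding eip_def
    by (rule integral_cong_open) (use tl[OF P _ j, of N] tl[OF V _ j, of N] N1 in auto)
  have s0: "(\<Sum>i=0..N-1. f i) = f 0 + (\<Sum>i=1..N-1. f i)" for f :: "nat \<Rightarrow> real"
    using sum.atLeast_Suc_atMost[of 0 "N - 1" f] by simp
  note c0 = edge_term_continuous(1)[OF P(2) V(2)]
  note ci = right_jumps_continuous[OF P(2) V(2)]
  note cN = edge_term_continuous(2)[OF P(2) V(2)]
  note cB = cell_integral_continuous[OF P(2) V'(2)]
  have cR: "continuous_on {xs (j-1)..xs j} (R j)" if j: "j \<in> {1..N}" for j
  proof -
    have "continuous_on {xs (j-1)..xs j} (\<lambda>y. R j y)"
      unfolding R_def by (rule continuous_on_add[OF c0[OF j] continuous_on_sum[OF ci[OF _ j]]])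
    then show ?thesis .
  qed
  have eR: "(\<Sum>i=0..N-1. eip xs j (trxp xs p i) (jmpx xs N v i)) = integral {xs (j-1)..xs j} (R j)"
    if j: "j \<in> {1..N}" for j
  proof -
    have "(\<Sum>i=0..N-1. eip xs j (trxp xs p i) (jmpx xs N v i)) =
        integral {xs (j-1)..xs j} (\<lambda>y. P 1 j (xs 0) y * V 1 j (xs 0) y) +
        (\<Sum>i=1..N-1. integral {xs (j-1)..xs j} (\<lambda>y. P (i + 1) j (xs i) y * (V (i + 1) j (xs i) y - V i j (xs i) y)))"
      unfolding s0 using e0[OF j] ei[OF j] by simp
    also have "(\<Sum>i=1..N-1. integral {xs (j-1)..xs j} (\<lambda>y. P (i + 1) j (xs i) y * (V (i + 1) j (xs i) y - V i j (xs i) y))) =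
      integral {xs (j-1)..xs j} (\<lambda>y. \<Sum>i=1..N-1. P (i + 1) j (xs i) y * (V (i + 1) j (xs i) y - V i j (xs i) y))"
      by (rule integral_sum[OF _ integrable_continuous_interval[OF ci[OF _ j]], symmetric]) auto
    also have "integral {xs (j-1)..xs j} (\<lambda>y. P 1 j (xs 0) y * V 1 j (xs 0) y) + \<dots> = integral {xs (j-1)..xs j} (R j)"
      unfolding R_def
      by (rule integral_add[OF integrable_continuous_interval[OF c0[OF j]]
          integrable_continuous_interval[OF continuous_on_sum[OF ci[OF _ j]]], symmetric])
    finally show ?thesis .
  qed
  have "integral {xs (j-1)..xs j} (lineR P V j) =
     integral {xs (j-1)..xs j} (\<lambda>y. \<Sum>i=1..N. integral {xs (i-1)..xs i} (\<lambda>x. P i j x y * pdx (V i j) x y)) +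
     integral {xs (j-1)..xs j} (R j) - integral {xs (j-1)..xs j} (\<lambda>y. P N j (xs N) y * V N j (xs N) y)"
    if j: "j \<in> {1..N}" for j
  proof -
    have "lineR P V j = (\<lambda>y. (\<Sum>i=1..N. integral {xs (i-1)..xs i} (\<lambda>x. P i j x y * pdx (V i j) x y)) +
        R j y - P N j (xs N) y * V N j (xs N) y)"
      unfolding lineR_def flux_right_def R_def by (simp add: algebra_simps)
    then show ?thesis
      using integral_diff[OF integrable_continuous_interval[OF continuous_on_add[OF cB[OF j] cR[OF j]]]
          integrable_continuous_interval[OF cN[OF j]]]
        integral_add[OF integrable_continuous_interval[OF cB[OF j]] integrable_continuous_interval[OF cR[OF j]]]
      by simp
  qed
  then show ?thesis
    unfolding T3x_def bip_lines[OF PCP PC_VN[OF VN_pdx[OF v]] P(1) V'(1)] using eR eN by (simp add: sum.distrib sum_subtractf)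
qed

lemma T23x_cancel:
  assumes "VN k u U" "VN k p P"
  shows "T2x u p + T3x p u = 0"
proof -
  have U: "repr u U" "famc U" and P: "repr p P" "famc P" using assms famc_VN by (auto simp: VN_def)
  have "integral {xs (j-1)..xs j} (lineL U P j) + integral {xs (j-1)..xs j} (lineR P U j) = 0"
    if j: "j \<in> {1..N}" for j
  proof -
    have "integral {xs (j-1)..xs j} (lineL U P j) + integral {xs (j-1)..xs j} (lineR P U j) =
        integral {xs (j-1)..xs j} (\<lambda>y. lineL U P j y + lineR P U j y)"
      by (rule integral_add[OF integrable_continuous_interval[OF lineL_continuous[OF U(2) assms(2) j]]
          integrable_continuous_interval[OF lineR_continuous[OF P(2) assms(1) j]], symmetric])
    then show ?thesis
      unfolding lineL_def lineR_def flux_cancel[OF C1_VN[OF assms(1) j] C1_VN[OF assms(2) j]] by simp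
  qed
  then show ?thesis
    unfolding T2x_lines[OF U assms(2)] T3x_lines[OF P assms(1)] by (simp add: sum.distrib[symmetric])
qed

lemma cell_integral_diff:
  assumes "famc U" "famc W" "VN k s S" "i \<in> {1..N}" "j \<in> {1..N}" "y \<in> {xs (j-1)..xs j}"
  shows "integral {xs (i-1)..xs i} (\<lambda>x. (U i j x y - W i j x y) * pdx (S i j) x y) =
    integral {xs (i-1)..xs i} (\<lambda>x. U i j x y * pdx (S i j) x y) - integral {xs (i-1)..xs i} (\<lambda>x. W i j x y * pdx (S i j) x y)"
  unfolding left_diff_distrib
  by (rule integral_diff[OF integrable_continuous_interval[OF continuous_on_mult] integrable_continuous_interval[OF continuous_on_mult]];
      rule cont2_slice_x[OF famcD[OF assms(1,4,5)] assms(6)] cont2_slice_x[OF famcD[OF assms(2,4,5)] assms(6)]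
        cont2_slice_x[OF famcD[OF famc_VN[OF VN_pdx[OF assms(3)]] assms(4,5)] assms(6)])

lemma lineL_diff:
  assumes "famc U" "famc W" "VN k s S" "j \<in> {1..N}" "y \<in> {xs (j-1)..xs j}"
  shows "lineL (\<lambda>i j x y. U i j x y - W i j x y) S j y = lineL U S j y - lineL W S j y"
proof -
  have e: "(\<Sum>i=1..N. integral {xs (i-1)..xs i} (\<lambda>x. (U i j x y - W i j x y) * pdx (S i j) x y)) =
    (\<Sum>i=1..N. integral {xs (i-1)..xs i} (\<lambda>x. U i j x y * pdx (S i j) x y)) -
    (\<Sum>i=1..N. integral {xs (i-1)..xs i} (\<lambda>x. W i j x y * pdx (S i j) x y))"
    unfolding sum_subtractf[symmetric] by (rule sum.cong[OF refl cell_integral_diff[OF assms(1,2,3) _ assms(4,5)]])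
  show ?thesis
    unfolding lineL_def flux_left_def e unfolding left_diff_distrib sum_subtractf by simp
qed

lemma lineR_diff:
  assumes "famc U" "famc W" "VN k s S" "j \<in> {1..N}" "y \<in> {xs (j-1)..xs j}"
  shows "lineR (\<lambda>i j x y. U i j x y - W i j x y) S j y = lineR U S j y - lineR W S j y"
proof -
  have e: "(\<Sum>i=1..N. integral {xs (i-1)..xs i} (\<lambda>x. (U i j x y - W i j x y) * pdx (S i j) x y)) =
    (\<Sum>i=1..N. integral {xs (i-1)..xs i} (\<lambda>x. U i j x y * pdx (S i j) x y)) -
    (\<Sum>i=1..N. integral {xs (i-1)..xs i} (\<lambda>x. W i j x y * pdx (S i j) x y))"
    unfolding sum_subtractf[symmetric] by (rule sum.cong[OF refl cell_integral_diff[OF assms(1,2,3) _ assms(4,5)]])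
  show ?thesis
    unfolding lineR_def flux_right_def e unfolding left_diff_distrib sum_subtractf by simp
qed

lemma T2x_diff:
  assumes "VN k u U" "VN k w W" "VN k s S"
  shows "T2x (\<lambda>x y. u x y - w x y) s = T2x u s - T2x w s"
proof -
  have U: "repr u U" "famc U" and W: "repr w W" "famc W" using assms famc_VN by (auto simp: VN_def)
  have D: "repr (\<lambda>x y. u x y - w x y) (\<lambda>i j x y. U i j x y - W i j x y)" "famc (\<lambda>i j x y. U i j x y - W i j x y)"
    using VN_diff[OF assms(1,2)] famc_VN by (auto simp: VN_def)
  have "integral {xs (j-1)..xs j} (lineL (\<lambda>i j x y. U i j x y - W i j x y) S j) =
      integral {xs (j-1)..xs j} (lineL U S j) - integral {xs (j-1)..xs j} (lineL W S j)" if j: "j \<in> {1..N}" for j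
  proof -
    have "integral {xs (j-1)..xs j} (lineL (\<lambda>i j x y. U i j x y - W i j x y) S j) =
        integral {xs (j-1)..xs j} (\<lambda>y. lineL U S j y - lineL W S j y)"
      by (rule integral_cong) (rule lineL_diff[OF U(2) W(2) assms(3) j])
    then show ?thesis
      using integral_diff[OF integrable_continuous_interval[OF lineL_continuous[OF U(2) assms(3) j]]
          integrable_continuous_interval[OF lineL_continuous[OF W(2) assms(3) j]]] by simp
  qed
  then show ?thesis
    unfolding T2x_lines[OF U assms(3)] T2x_lines[OF W assms(3)] T2x_lines[OF D assms(3)]
    by (simp add: sum_subtractf)
qed

lemma T3x_diff:
  assumes "VN k u U" "VN k w W" "VN k s S"
  shows "T3x (\<lambda>x y. u x y - w x y) s = T3x u s - T3x w s"
proof -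
  have U: "repr u U" "famc U" and W: "repr w W" "famc W" using assms famc_VN by (auto simp: VN_def)
  have D: "repr (\<lambda>x y. u x y - w x y) (\<lambda>i j x y. U i j x y - W i j x y)" "famc (\<lambda>i j x y. U i j x y - W i j x y)"
    using VN_diff[OF assms(1,2)] famc_VN by (auto simp: VN_def)
  have "integral {xs (j-1)..xs j} (lineR (\<lambda>i j x y. U i j x y - W i j x y) S j) =
      integral {xs (j-1)..xs j} (lineR U S j) - integral {xs (j-1)..xs j} (lineR W S j)" if j: "j \<in> {1..N}" for j
  proof -
    have "integral {xs (j-1)..xs j} (lineR (\<lambda>i j x y. U i j x y - W i j x y) S j) =
        integral {xs (j-1)..xs j} (\<lambda>y. lineR U S j y - lineR W S j y)"
      by (rule integral_cong) (rule lineR_diff[OF U(2) W(2) assms(3) j])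
    then show ?thesis
      using integral_diff[OF integrable_continuous_interval[OF lineR_continuous[OF U(2) assms(3) j]]
          integrable_continuous_interval[OF lineR_continuous[OF W(2) assms(3) j]]] by simp
  qed
  then show ?thesis
    unfolding T3x_lines[OF U assms(3)] T3x_lines[OF W assms(3)] T3x_lines[OF D assms(3)]
    by (simp add: sum_subtractf)
qed

end

section \<open>Flux terms of the projected solution\<close>

definition radau :: "nat \<Rightarrow> real \<Rightarrow> kern \<Rightarrow> bool" where
  "radau k c K \<longleftrightarrow> kern_ok k K \<and> proj_moments k k K \<and> (\<forall>g. continuous_on {0..1} g \<longrightarrow> rproj k K g c = g c)"

definition L2kern :: "nat \<Rightarrow> kern \<Rightarrow> bool" where
  "L2kern k K \<longleftrightarrow> kern_ok k K \<and> proj_moments (Suc k) k K"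

lemma radau_right: "radau k 1 K \<Longrightarrow> a < b \<Longrightarrow> continuous_on {a..b} g \<Longrightarrow> proj k K a b g b = g b"
  using continuous_on_affine_unit[of a b g] by (simp add: radau_def proj_def)

lemma radau_left: "radau k 0 K \<Longrightarrow> a < b \<Longrightarrow> continuous_on {a..b} g \<Longrightarrow> proj k K a b g a = g a"
  using continuous_on_affine_unit[of a b g] by (simp add: radau_def proj_def)

lemma radau_cont: "radau k c K \<Longrightarrow> kern_cont K"
  by (simp add: radau_def kern_ok_def)

lemma L2kern_cont: "L2kern k K \<Longrightarrow> kern_cont K"
  by (simp add: L2kern_def kern_ok_def)

text \<open>Differentiation lowers the degree of the test function, so the moments below
  \<open>k\<close> of a Radau projection suffice.\<close>

lemma radau_orthogonal:
  assumes K: "radau k c K" and ab: "a < b" and g: "continuous_on {a..b} g" and F: "isQ k F"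
  shows "integral {a..b} (\<lambda>x. proj k K a b g x * pdx F x y) = integral {a..b} (\<lambda>x. g x * pdx F x y)"
proof -
  obtain p where p: "degree p < k \<or> p = 0" "(\<lambda>x. pdx F x y) = poly p" using isQ_pdx_slice[OF F] by blast
  have e: "pdx F x y = poly p x" for x using p(2) by (metis (full_types))
  have "integral {a..b} (\<lambda>x. (g x - proj k K a b g x) * poly p x) = 0"
    using p(1) proj_orthogonal[of k k K a b g p] K ab g by (auto simp: radau_def)
  moreover have "integral {a..b} (\<lambda>x. (g x - proj k K a b g x) * poly p x) =
      integral {a..b} (\<lambda>x. g x * poly p x) - integral {a..b} (\<lambda>x. proj k K a b g x * poly p x)"
    unfolding left_diff_distrib
    by (rule integral_diff) (auto intro!: integrable_continuous_interval continuous_intros g)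
  ultimately show ?thesis unfolding e by simp
qed

lemma L2kern_orthogonal:
  assumes K: "L2kern k K" and ab: "a < b" and g: "continuous_on {a..b} g" and F: "isQ k F"
  shows "integral {a..b} (\<lambda>y. (g y - proj k K a b g y) * F x y) = 0"
proof -
  obtain p where p: "degree p \<le> k" "F x = poly p" using isQ_slice_y[OF F] by blast
  show ?thesis unfolding p(2) using K p(1) by (intro proj_orthogonal[OF _ ab g]) (auto simp: L2kern_def)
qed

context mesh
begin

text \<open>At mesh points \<open>glob\<close> picks the cell to the left, an arbitrary choice: only open cells matter.\<close>

definition idx :: "real \<Rightarrow> nat" where "idx x = (LEAST i. x \<le> xs i)"

lemma idx_eq:
  assumes "i \<in> {1..N}" "x \<in> {xs (i-1)<..<xs i}" shows "idx x = i"
  unfolding idx_def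
proof (rule Least_equality)
  fix j assume j: "x \<le> xs j"
  show "i \<le> j"
  proof (rule ccontr)
    assume "\<not> i \<le> j"
    then have "xs j \<le> xs (i - 1)" using assms(1) by (intro xs_mono) auto
    with j assms(2) show False by auto
  qed
qed (use assms in auto)

definition glob :: "(nat \<Rightarrow> nat \<Rightarrow> real \<Rightarrow> real \<Rightarrow> real) \<Rightarrow> real \<Rightarrow> real \<Rightarrow> real" where
  "glob F x y = F (idx x) (idx y) x y"

lemma repr_glob: "repr (glob F) F"
  unfolding repr_def glob_def using idx_eq by auto

definition PU :: "nat \<Rightarrow> kern \<Rightarrow> (real \<Rightarrow> real \<Rightarrow> real) \<Rightarrow> nat \<Rightarrow> nat \<Rightarrow> real \<Rightarrow> real \<Rightarrow> real" where
  "PU k K u i j = projx k K (xs (i-1)) (xs i) (projy k K (xs (j-1)) (xs j) u)"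

definition PY :: "nat \<Rightarrow> kern \<Rightarrow> (real \<Rightarrow> real \<Rightarrow> real) \<Rightarrow> nat \<Rightarrow> nat \<Rightarrow> real \<Rightarrow> real \<Rightarrow> real" where
  "PY k K u i j = projy k K (xs (j-1)) (xs j) u"

text \<open>The \<open>L2\<close> projection in \<open>y\<close> is outermost: the difference to the
  Radau projection in \<open>x\<close> alone is then an \<open>L2\<close> projection error in
  \<open>y\<close>, orthogonal to everything the test function contributes.\<close>

definition PP :: "nat \<Rightarrow> kern \<Rightarrow> kern \<Rightarrow> (real \<Rightarrow> real \<Rightarrow> real) \<Rightarrow> nat \<Rightarrow> nat \<Rightarrow> real \<Rightarrow> real \<Rightarrow> real" where
  "PP k K K' p i j = projy k K' (xs (j-1)) (xs j) (projx k K (xs (i-1)) (xs i) p)"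

lemma cont2_cell:
  assumes "cont2 {0..1} {0..1} g" "i \<in> {1..N}" "j \<in> {1..N}"
  shows "cont2 {xs (i-1)..xs i} {xs (j-1)..xs j} g"
  by (rule cont2_subset[OF assms(1) cell_sub cell_sub]) (use assms in auto)

lemma VN_PU:
  assumes "kern_cont K" "cont2 {0..1} {0..1} u" shows "VN k (glob (PU k K u)) (PU k K u)"
  unfolding VN_def
proof (intro conjI ballI repr_glob)
  fix i j assume "i \<in> {1..N}" "j \<in> {1..N}"
  then show "isQ k (PU k K u i j)" unfolding PU_def
    by (intro isQ_projx_projy assms(1) xs_less cont2_cell[OF assms(2)])
qed

lemma VN_PP:
  assumes "kern_cont K" "kern_cont K'" "cont2 {0..1} {0..1} p" shows "VN k (glob (PP k K K' p)) (PP k K K' p)"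
  unfolding VN_def
proof (intro conjI ballI repr_glob)
  fix i j assume ij: "i \<in> {1..N}" "j \<in> {1..N}"
  have "isQ k (projx k K (xs (i-1)) (xs i) (projy k K' (xs (j-1)) (xs j) p))"
    using ij by (intro isQ_projx_projy assms xs_less cont2_cell[OF assms(3)])
  moreover have "projx k K (xs (i-1)) (xs i) (projy k K' (xs (j-1)) (xs j) p) = PP k K K' p i j"
    unfolding PP_def
    by (intro ext proj_commute assms xs_less ij cont2_cell[OF assms(3)])
  ultimately show "isQ k (PP k K K' p i j)" by simp
qed

lemma famc_PY:
  assumes "kern_cont K" "cont2 {0..1} {0..1} u" shows "famc (PY k K u)"
  unfolding famc_def PY_def
  by (intro ballI cont2_projy assms(1) xs_less cont2_cell[OF assms(2)])

lemma repr_PY: "repr (glob (PY k K u)) (PY k K u)"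
  by (rule repr_glob)

lemma PC_PY:
  assumes "kern_cont K" "cont2 {0..1} {0..1} u" shows "PC (glob (PY k K u))"
  by (rule PC_repr[OF repr_PY famcD[OF famc_PY[OF assms]]])

lemma cell_mem: "j \<in> {1..N} \<Longrightarrow> y \<in> {xs (j-1)..xs j} \<Longrightarrow> y \<in> {0..1}"
  using cell_sub by blast

text \<open>In a row of cells the projection in \<open>y\<close> of \<open>u\<close> is a function
  \<open>h\<close> that is smooth in \<open>x\<close> across all cells, and \<open>PU\<close> is its
  right Radau projection in \<open>x\<close>. Orthogonality and interpolation replace
  \<open>PU\<close> by \<open>h\<close>, which vanishes at both ends, and integration by parts
  finishes. The function \<open>w\<close> is any representative of the projection, so that the lemma
  also applies to reflected ones.\<close>

lemma T2x_projection:
  assumes K: "radau k 1 K" and u: "cont2 {0..1} {0..1} u" and ux: "cont2 {0..1} {0..1} ux"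
    and d: "\<And>x y. x \<in> {0..1} \<Longrightarrow> y \<in> {0..1} \<Longrightarrow> ((\<lambda>t. u t y) has_real_derivative ux x y) (at x within {0..1})"
    and bd: "\<And>y. y \<in> {0..1} \<Longrightarrow> u 0 y = 0" "\<And>y. y \<in> {0..1} \<Longrightarrow> u 1 y = 0"
    and s: "VN k s S" and w: "repr w (PU k K u)"
  shows "T2x w s = - bip xs N (glob (PY k K ux)) s"
proof -
  note Kc = radau_cont[OF K]
  have P: "VN k (glob (PU k K u)) (PU k K u)" by (rule VN_PU[OF Kc u])
  have line: "lineL (PU k K u) S j y = - (\<Sum>i=1..N. integral {xs (i-1)..xs i} (\<lambda>x. PY k K ux i j x y * S i j x y))"
    if j: "j \<in> {1..N}" for j y
  proof -
    define h where "h = projy k K (xs (j-1)) (xs j) u"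
    have cj: "{xs (j-1)..xs j} \<subseteq> {0..1}" by (rule cell_sub[OF j])
    have h: "cont2 {0..1} UNIV h" unfolding h_def
      by (rule cont2_projy[OF Kc xs_less[OF j] cont2_subset[OF u subset_refl cj]])
    have hc: "continuous_on {0..1} (\<lambda>x. h x y)" by (rule cont2_slice_x[OF h UNIV_I])
    have hi: "continuous_on {xs (i-1)..xs i} (\<lambda>x. h x y)" if "i \<in> {1..N}" for i
      by (rule continuous_on_subset[OF hc cell_sub[OF that]])
    have z: "h x y = 0" if "x = 0 \<or> x = 1" for x
    proof -
      \<comment> \<open>Zero is written as a multiple of a function so that homogeneity of the
        projection applies.\<close>
      have "h x y = proj k K (xs (j-1)) (xs j) (\<lambda>t. 0 * u x t) y"
        unfolding h_def projy_def
        by (rule proj_cong[OF xs_less[OF j]]) (use that bd cell_mem[OF j] in auto)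
      then show ?thesis unfolding proj_cmult by simp
    qed
    have "lineL (PU k K u) S j y = flux_left (\<lambda>i x. h x y) (\<lambda>i x. S i j x y) (\<lambda>i x. pdx (S i j) x y)"
      unfolding lineL_def
    proof (rule flux_left_cong)
      fix i assume i: "i \<in> {1..N}"
      show "integral {xs (i-1)..xs i} (\<lambda>x. PU k K u i j x y * pdx (S i j) x y) =
          integral {xs (i-1)..xs i} (\<lambda>x. h x y * pdx (S i j) x y)"
        unfolding PU_def h_def[symmetric] projx_def
        by (rule radau_orthogonal[OF K xs_less[OF i] hi[OF i] VN_isQ[OF s i j]])
      show "PU k K u i j (xs i) y = h (xs i) y"
        unfolding PU_def h_def[symmetric] projx_def by (rule radau_right[OF K xs_less[OF i] hi[OF i]])
    qed
    also have "\<dots> = - (\<Sum>i=1..N. integral {xs (i-1)..xs i} (\<lambda>x. projy k K (xs (j-1)) (xs j) ux x y * S i j x y))"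
    proof (rule flux_left_smooth[OF C1_VN[OF s j] hc])
      fix x :: real assume x: "x \<in> {0<..<1}"
      then have "((\<lambda>t. h t y) has_real_derivative projy k K (xs (j-1)) (xs j) ux x y) (at x within {0..1})"
        unfolding h_def by (intro projy_has_derivative[OF Kc xs_less[OF j] cj u ux d]) auto
      then show "((\<lambda>t. h t y) has_real_derivative projy k K (xs (j-1)) (xs j) ux x y) (at x)"
        using x by (simp add: at_within_Icc_at)
    qed (use z in auto)
    finally show ?thesis unfolding PY_def .
  qed
  have "T2x w s = (\<Sum>j=1..N. integral {xs (j-1)..xs j} (lineL (PU k K u) S j))"
    by (rule T2x_lines[OF w famc_VN[OF P] s])
  also have "\<dots> = (\<Sum>j=1..N. - integral {xs (j-1)..xs j} (\<lambda>y. \<Sum>i=1..N. integral {xs (i-1)..xs i} (\<lambda>x. PY k K ux i j x y * S i j x y)))"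
  proof (rule sum.cong[OF refl])
    fix j assume j: "j \<in> {1..N}"
    have "lineL (PU k K u) S j = (\<lambda>y. - (\<Sum>i=1..N. integral {xs (i-1)..xs i} (\<lambda>x. PY k K ux i j x y * S i j x y)))"
      by (rule ext) (rule line[OF j])
    then show "integral {xs (j-1)..xs j} (lineL (PU k K u) S j) = - integral {xs (j-1)..xs j} (\<lambda>y. \<Sum>i=1..N. integral {xs (i-1)..xs i} (\<lambda>x. PY k K ux i j x y * S i j x y))"
      by (simp only: integral_neg)
  qed
  also have "\<dots> = - bip xs N (glob (PY k K ux)) s"
  proof -
    have "repr s S" using s by (simp add: VN_def)
    from bip_lines[OF PC_PY[OF Kc ux] PC_VN[OF s] repr_PY this] show ?thesis unfolding sum_negf by simp
  qed
  finally show ?thesis .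
qed

lemma edge_VN:
  assumes "VN k v V"
  shows "edge g v = (\<Sum>j=1..N. integral {xs (j-1)..xs j} (\<lambda>y. g y * V N j (xs N) y))"
  unfolding edge_def
proof (rule sum.cong[OF refl], rule integral_cong_open)
  fix j y assume j: "j \<in> {1..N}" and y: "y \<in> {xs (j-1)<..<xs j}"
  have N: "N \<in> {1..N}" using N1 by simp
  have r: "repr v V" using assms by (simp add: VN_def)
  have "trxm xs v N y = V N j (xs N) y"
    by (rule trxm_eq[OF r N j y cont2_slice_x[OF isQ_cont[OF VN_isQ[OF assms N j], where Y = UNIV] UNIV_I]])
  then show "g y * trxm xs v N y = g y * V N j (xs N) y" by simp
qed

text \<open>Two reductions. The \<open>L2\<close> error in \<open>y\<close> is orthogonal to the
  derivatives, jumps and traces of \<open>v\<close>, all of degree at most \<open>k\<close> in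
  \<open>y\<close>, so the projection in \<open>y\<close> can be removed. The left Radau projection
  in \<open>x\<close> is then removed on each line, at the price of the flux at x = 1.\<close>

lemma T3x_projection:
  assumes K: "radau k 0 K" and K': "L2kern k K'" and p: "cont2 {0..1} {0..1} p"
    and d: "\<And>x y. x \<in> {0<..<1} \<Longrightarrow> y \<in> {0<..<1} \<Longrightarrow> ((\<lambda>t. p t y) has_real_derivative px x y) (at x)"
    and px: "bc2 {0<..<1} {0<..<1} px"
    and v: "VN k v V"
  shows "T3x (glob (PP k K K' p)) v = - bip xs N px v +
    edge (\<lambda>y. p 1 y - projx k K (xs (N-1)) 1 p 1 y) v"
proof -
  note Kc = radau_cont[OF K]
  note Kc' = L2kern_cont[OF K']
  have P: "VN k (glob (PP k K K' p)) (PP k K K' p)" by (rule VN_PP[OF Kc Kc' p])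
  define G where "G i = projx k K (xs (i-1)) (xs i) p" for i
  have G: "cont2 UNIV {0..1} (G i)" if "i \<in> {1..N}" for i
    unfolding G_def by (rule cont2_projx[OF Kc xs_less[OF that] cont2_subset[OF p cell_sub[OF that] subset_refl]])
  have Gc: "famc (\<lambda>i j. G i)"
    unfolding famc_def using cont2_subset[OF G subset_UNIV cell_sub] by blast
  \<comment> \<open>The part of the error due to the \<open>L2\<close> projection in
    \<open>y\<close>.\<close>
  define D where "D i j x y = G i x y - PP k K K' p i j x y" for i j x y
  have D: "famc D" unfolding famc_def D_def
    by (intro ballI cont2_intros famcD[OF Gc] famcD[OF famc_VN[OF P]])
  have ortho: "integral {xs (j-1)..xs j} (\<lambda>y. D i j x y * F x y) = 0"
    if "i \<in> {1..N}" "j \<in> {1..N}" "isQ k F" for i j x F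
  proof -
    have "continuous_on {xs (j-1)..xs j} (G i x)"
      by (rule continuous_on_subset[OF cont2_slice_y[OF G[OF that(1)] UNIV_I] cell_sub[OF that(2)]])
    from L2kern_orthogonal[OF K' xs_less[OF that(2)] this that(3)]
    show ?thesis unfolding D_def PP_def projy_def G_def .
  qed
  have A: "integral {xs (j-1)..xs j} (lineR (PP k K K' p) V j) = integral {xs (j-1)..xs j} (lineR (\<lambda>i j. G i) V j)"
    if j: "j \<in> {1..N}" for j
  proof -
    have N: "N \<in> {1..N}" "1 \<in> {1..N}" using N1 by auto
    have V: "famc V" "famc (\<lambda>i j. pdx (V i j))" using famc_VN[OF v] famc_VN[OF VN_pdx[OF v]] .
    \<comment> \<open>Orthogonality of \<open>D\<close> holds in \<open>y\<close> for fixed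
      \<open>x\<close>, so Fubini moves the integral over \<open>y\<close> inside.\<close>
    have "integral {xs (j-1)..xs j} (\<lambda>y. integral {xs (i-1)..xs i} (\<lambda>x. D i j x y * pdx (V i j) x y)) = 0"
      if i: "i \<in> {1..N}" for i
    proof -
      have c: "cont2 {xs (i-1)..xs i} {xs (j-1)..xs j} (\<lambda>x y. D i j x y * pdx (V i j) x y)"
        using cont2_intros(3)[OF famcD[OF D i j] famcD[OF V(2) i j]] .
      show ?thesis
        unfolding integral_swap_cont2[OF c, symmetric] ortho[OF i j isQ_pdx[OF VN_isQ[OF v i j]]] by simp
    qed
    moreover have "integral {xs (j-1)..xs j} (\<lambda>y. \<Sum>i=1..N. integral {xs (i-1)..xs i} (\<lambda>x. D i j x y * pdx (V i j) x y)) =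
        (\<Sum>i=1..N. integral {xs (j-1)..xs j} (\<lambda>y. integral {xs (i-1)..xs i} (\<lambda>x. D i j x y * pdx (V i j) x y)))"
      by (rule integral_sum, simp, rule integrable_continuous_interval)
        (rule integral_slice_continuous[OF cont2_intros(3)[OF famcD[OF D _ j] famcD[OF V(2) _ j]]])
    ultimately have 1: "integral {xs (j-1)..xs j} (\<lambda>y. \<Sum>i=1..N. integral {xs (i-1)..xs i} (\<lambda>x. D i j x y * pdx (V i j) x y)) = 0"
      by simp
    have 2: "integral {xs (j-1)..xs j} (\<lambda>y. D 1 j (xs 0) y * V 1 j (xs 0) y) = 0"
      by (rule ortho[OF N(2) j VN_isQ[OF v N(2) j]])
    have "integral {xs (j-1)..xs j} (\<lambda>y. D (i + 1) j (xs i) y * (V (i + 1) j (xs i) y - V i j (xs i) y)) = 0"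
      if i: "i \<in> {1..N-1}" for i
    proof -
      have i': "i + 1 \<in> {1..N}" "i \<in> {1..N}" using i by auto
      show ?thesis by (rule ortho[OF i'(1) j isQ_diff[OF VN_isQ[OF v i'(1) j] VN_isQ[OF v i'(2) j]]])
    qed
    moreover have "integral {xs (j-1)..xs j} (\<lambda>y. \<Sum>i=1..N-1. D (i + 1) j (xs i) y * (V (i + 1) j (xs i) y - V i j (xs i) y)) =
       (\<Sum>i=1..N-1. integral {xs (j-1)..xs j} (\<lambda>y. D (i + 1) j (xs i) y * (V (i + 1) j (xs i) y - V i j (xs i) y)))"
      by (rule integral_sum[OF _ integrable_continuous_interval[OF right_jumps_continuous[OF D V(1) _ j]]]) auto
    ultimately have 3: "integral {xs (j-1)..xs j} (\<lambda>y. \<Sum>i=1..N-1. D (i + 1) j (xs i) y * (V (i + 1) j (xs i) y - V i j (xs i) y)) = 0"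
      by simp
    have 4: "integral {xs (j-1)..xs j} (\<lambda>y. D N j (xs N) y * V N j (xs N) y) = 0"
      by (rule ortho[OF N(1) j VN_isQ[OF v N(1) j]])
    note c1 = cell_integral_continuous[OF D V(2) j]
    note c2 = edge_term_continuous(1)[OF D V(1) j]
    have c3: "continuous_on {xs (j-1)..xs j} (\<lambda>y. \<Sum>i=1..N-1. D (i + 1) j (xs i) y * (V (i + 1) j (xs i) y - V i j (xs i) y))"
      by (rule continuous_on_sum[OF right_jumps_continuous[OF D V(1) _ j]])
    note c4 = edge_term_continuous(2)[OF D V(1) j]
    note ii = integrable_continuous_interval
    have "integral {xs (j-1)..xs j} (lineR D V j) = 0"
      unfolding lineR_def flux_right_def
      unfolding integral_diff[OF ii[OF continuous_on_add[OF continuous_on_add[OF c1 c2] c3]] ii[OF c4]]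
        integral_add[OF ii[OF continuous_on_add[OF c1 c2]] ii[OF c3]] integral_add[OF ii[OF c1] ii[OF c2]] 1 2 3 4
      by simp
    moreover have "integral {xs (j-1)..xs j} (lineR D V j) =
        integral {xs (j-1)..xs j} (\<lambda>y. lineR (\<lambda>i j. G i) V j y - lineR (PP k K K' p) V j y)"
      unfolding D_def[abs_def] by (rule integral_cong) (rule lineR_diff[OF Gc famc_VN[OF P] v j])
    ultimately show ?thesis
      unfolding integral_diff[OF ii[OF lineR_continuous[OF Gc v j]] ii[OF lineR_continuous[OF famc_VN[OF P] v j]]] by simp
  qed
  \<comment> \<open>Only for \<open>y\<close> in the open row: \<open>px\<close> is a derivative of
    \<open>p\<close> in the open square only.\<close>
  have B: "lineR (\<lambda>i j. G i) V j y = - (\<Sum>i=1..N. integral {xs (i-1)..xs i} (\<lambda>x. px x y * v x y)) +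
      (p 1 y - G N 1 y) * V N j (xs N) y"
    if j: "j \<in> {1..N}" and y: "y \<in> {xs (j-1)<..<xs j}" for j y
  proof -
    have y01: "y \<in> {0<..<1}" using cell_sub_open[OF j] y by blast
    then have y01': "y \<in> {0..1}" by auto
    have pc: "continuous_on {0..1} (\<lambda>x. p x y)" by (rule cont2_slice_x[OF p y01'])
    have pi: "continuous_on {xs (i-1)..xs i} (\<lambda>x. p x y)" if "i \<in> {1..N}" for i
      by (rule continuous_on_subset[OF pc cell_sub[OF that]])
    have "lineR (\<lambda>i j. G i) V j y = flux_right (\<lambda>i x. p x y) (\<lambda>i x. V i j x y) (\<lambda>i x. pdx (V i j) x y) +
        (p (xs N) y - G N (xs N) y) * V N j (xs N) y"
      unfolding lineR_def
    proof (rule flux_right_cong)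
      fix i assume i: "i \<in> {1..N}"
      show "integral {xs (i-1)..xs i} (\<lambda>x. G i x y * pdx (V i j) x y) =
          integral {xs (i-1)..xs i} (\<lambda>x. p x y * pdx (V i j) x y)"
        unfolding G_def projx_def
        by (rule radau_orthogonal[OF K xs_less[OF i] pi[OF i] VN_isQ[OF v i j]])
      show "G i (xs (i-1)) y = p (xs (i-1)) y"
        unfolding G_def projx_def by (rule radau_left[OF K xs_less[OF i] pi[OF i]])
    qed
    also have "flux_right (\<lambda>i x. p x y) (\<lambda>i x. V i j x y) (\<lambda>i x. pdx (V i j) x y) =
        - (\<Sum>i=1..N. integral {xs (i-1)..xs i} (\<lambda>x. px x y * V i j x y))"
      by (rule flux_right_smooth[OF C1_VN[OF v j] pc d[OF _ y01]])
    also have "(\<Sum>i=1..N. integral {xs (i-1)..xs i} (\<lambda>x. px x y * V i j x y)) =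
        (\<Sum>i=1..N. integral {xs (i-1)..xs i} (\<lambda>x. px x y * v x y))"
    proof (rule sum.cong[OF refl], rule integral_cong_open)
      fix i x assume "i \<in> {1..N}" "x \<in> {xs (i-1)<..<xs i}"
      then show "px x y * V i j x y = px x y * v x y" using v j y unfolding VN_def repr_def by auto
    qed
    finally show ?thesis unfolding xN .
  qed
  have PCpv: "PC (\<lambda>x y. px x y * v x y)" by (rule PC_intros(3)[OF PC_bc2[OF px] PC_VN[OF v]])
  have N: "N \<in> {1..N}" using N1 by simp
  have tc: "continuous_on {xs (j-1)..xs j} (\<lambda>y. (p 1 y - G N 1 y) * V N j (xs N) y)" if j: "j \<in> {1..N}" for j
    by (intro continuous_on_mult continuous_on_diff famc_right[OF famc_VN[OF v] N j]
        continuous_on_subset[OF cont2_slice_y[OF p] cell_sub[OF j]]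
        continuous_on_subset[OF cont2_slice_y[OF G[OF N] UNIV_I] cell_sub[OF j]]) simp
  have "T3x (glob (PP k K K' p)) v = (\<Sum>j=1..N. integral {xs (j-1)..xs j} (lineR (PP k K K' p) V j))"
    by (rule T3x_lines[OF repr_glob famc_VN[OF P] v])
  also have "\<dots> = (\<Sum>j=1..N. - integral {xs (j-1)..xs j} (\<lambda>y. \<Sum>i=1..N. integral {xs (i-1)..xs i} (\<lambda>x. px x y * v x y)) +
      integral {xs (j-1)..xs j} (\<lambda>y. (p 1 y - G N 1 y) * V N j (xs N) y))"
  proof (rule sum.cong[OF refl])
    fix j assume j: "j \<in> {1..N}"
    have "integral {xs (j-1)..xs j} (lineR (PP k K K' p) V j) =
      integral {xs (j-1)..xs j} (\<lambda>y. - (\<Sum>i=1..N. integral {xs (i-1)..xs i} (\<lambda>x. px x y * v x y)) +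
      (p 1 y - G N 1 y) * V N j (xs N) y)"
      unfolding A[OF j] by (rule integral_cong_open) (rule B[OF j])
    also have "\<dots> = integral {xs (j-1)..xs j} (\<lambda>y. - (\<Sum>i=1..N. integral {xs (i-1)..xs i} (\<lambda>x. px x y * v x y))) +
      integral {xs (j-1)..xs j} (\<lambda>y. (p 1 y - G N 1 y) * V N j (xs N) y)"
      by (rule integral_add[OF integrable_neg[OF IP_lines(2)[OF PCpv j]] integrable_continuous_interval[OF tc[OF j]]])
    finally show "integral {xs (j-1)..xs j} (lineR (PP k K K' p) V j) =
      - integral {xs (j-1)..xs j} (\<lambda>y. \<Sum>i=1..N. integral {xs (i-1)..xs i} (\<lambda>x. px x y * v x y)) +
      integral {xs (j-1)..xs j} (\<lambda>y. (p 1 y - G N 1 y) * V N j (xs N) y)" by (simp only: integral_neg)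
  qed
  also have "\<dots> = - IP (\<lambda>x y. px x y * v x y) + edge (\<lambda>y. p 1 y - G N 1 y) v"
    unfolding IP_lines(1)[OF PCpv] edge_VN[OF v] sum.distrib sum_negf ..
  finally show ?thesis unfolding bip_IP G_def xN .
qed

end

section \<open>Reflection at the diagonal and the energy identity\<close>

lemma jmpy_swp: "jmpy xs N v x j = jmpx xs N (swp v) j x"
  by (simp add: jmpy_def jmpx_def tryp_def trym_def trxp_def trxm_def)

lemma trym_swp: "trym xs v x j = trxm xs (swp v) j x"
  by (simp add: trym_def trxm_def)

lemma tryp_swp: "tryp xs v x j = trxp xs (swp v) j x"
  by (simp add: tryp_def trxp_def)

context mesh
begin

definition T4x :: "(nat \<Rightarrow> real) \<Rightarrow> (real \<Rightarrow> real \<Rightarrow> real) \<Rightarrow> (real \<Rightarrow> real \<Rightarrow> real) \<Rightarrow> real" where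
  "T4x lam U v = (\<Sum>j=1..N. \<Sum>i=0..N. eip xs j (\<lambda>y. lam i * jmpx xs N U i y) (jmpx xs N v i))"

text \<open>Only i = N carries a weight, and the two minus signs in the jumps there cancel.\<close>

lemma T4x_stab: "T4x (stab \<epsilon> N) U v = sqrt \<epsilon> * edge (trxm xs U N) v"
proof -
  have "(\<Sum>i=0..N. eip xs j (\<lambda>y. stab \<epsilon> N i * jmpx xs N U i y) (jmpx xs N v i)) =
      sqrt \<epsilon> * integral {xs (j-1)..xs j} (\<lambda>y. trxm xs U N y * trxm xs v N y)" for j
  proof -
    have "(\<Sum>i=0..N. eip xs j (\<lambda>y. stab \<epsilon> N i * jmpx xs N U i y) (jmpx xs N v i)) =
        (\<Sum>i\<in>{N}. eip xs j (\<lambda>y. stab \<epsilon> N i * jmpx xs N U i y) (jmpx xs N v i))"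
      by (rule sum.mono_neutral_right) (auto simp: stab_def eip_def)
    also have "\<dots> = integral {xs (j-1)..xs j} (\<lambda>y. sqrt \<epsilon> * (trxm xs U N y * trxm xs v N y))"
      using N1 by (simp add: eip_def stab_def jmpx_def mult.assoc)
    finally show ?thesis by simp
  qed
  then show ?thesis unfolding T4x_def edge_def by (simp add: sum_distrib_left)
qed

lemma bip_swp:
  assumes "PC g" "PC h" shows "bip xs N (swp g) (swp h) = bip xs N g h"
  unfolding bip_IP using IP_swp[OF PC_intros(3)[OF assms]] .

lemma PC_pdy:
  assumes "VN k v V" shows "PC (pdy v)"
proof -
  have "PC (swp (pdx (swp v)))" by (rule PC_swp[OF PC_VN[OF VN_pdx[OF VN_swp[OF assms]]]])
  then show ?thesis by (simp add: pdx_def pdy_def[abs_def])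
qed

lemma bip_pdy:
  assumes "PC g" "VN k v V" shows "bip xs N g (pdy v) = bip xs N (swp g) (pdx (swp v))"
  using bip_swp[OF assms(1) PC_pdy[OF assms(2)]] by (simp add: pdx_def[abs_def] pdy_def)

lemma LDG_B_eq:
  assumes U: "VN k U UF" and Q: "VN k Q QF" and v: "VN k v V" and r: "VN k r R"
  shows "LDG_B \<epsilon> b lv lv xs N (U, P, Q) (v, s, r) =
    bip xs N P s / \<epsilon> + bip xs N Q r / \<epsilon> + bip xs N (\<lambda>x y. b x y * U x y) v +
    (T2x U s + T2x (swp U) (swp r)) + (T3x P v + T3x (swp Q) (swp v)) +
    (T4x lv U v + T4x lv (swp U) (swp v))"
  unfolding LDG_B_def Let_def prod.case T2x_def T3x_def T4x_def jmpy_swp trym_swp tryp_swp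
    bip_pdy[OF PC_VN[OF U] r] bip_pdy[OF PC_VN[OF Q] v]
  by simp

lemma bip_diff_left:
  assumes "PC g" "PC h" "PC w"
  shows "bip xs N (\<lambda>x y. g x y - h x y) w = bip xs N g w - bip xs N h w"
  unfolding bip_IP left_diff_distrib by (intro IP_diff PC_intros assms)

lemma bip_cmult_left: "bip xs N (\<lambda>x y. c * g x y) w = c * bip xs N g w"
  unfolding bip_IP mult.assoc by (rule IP_cmult)

lemma bip_divide_left: "bip xs N (\<lambda>x y. g x y / c) w = bip xs N g w / c"
  using bip_cmult_left[of "1 / c" g w] by simp

lemma edge_cong:
  assumes "\<And>j y. j \<in> {1..N} \<Longrightarrow> y \<in> {xs (j-1)<..<xs j} \<Longrightarrow> g y * trxm xs v N y = h y * trxm xs w N y"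
  shows "edge g v = edge h w"
  unfolding edge_def by (intro sum.cong refl integral_cong_open assms)

lemma trxm_VN:
  assumes v: "VN k v V" and j: "j \<in> {1..N}" and y: "y \<in> {xs (j-1)<..<xs j}"
  shows "trxm xs v N y = V N j (xs N) y"
proof -
  have N: "N \<in> {1..N}" using N1 by simp
  have r: "repr v V" using v by (simp add: VN_def)
  show ?thesis
    by (rule trxm_eq[OF r N j y cont2_slice_x[OF isQ_cont[OF VN_isQ[OF v N j], where Y = UNIV] UNIV_I]])
qed

text \<open>The projection inherits the zero boundary value of \<open>u\<close>, so the
  stabilisation sees the discrete solution and the discrete error as the same function on this
  edge.\<close>

lemma trxm_diff_zero:
  assumes U: "VN k U UF" and W: "VN k W WF" and z: "\<And>j y. j \<in> {1..N} \<Longrightarrow> y \<in> {xs (j-1)<..<xs j} \<Longrightarrow> WF N j (xs N) y = 0"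
    and j: "j \<in> {1..N}" and y: "y \<in> {xs (j-1)<..<xs j}"
  shows "trxm xs (\<lambda>x y. U x y - W x y) N y = trxm xs U N y"
  unfolding trxm_VN[OF U j y] trxm_VN[OF VN_diff[OF U W] j y] using z[OF j y] by simp

text \<open>The scheme is tested with the discrete error (v, s, r). Its own flux terms cancel by
  \<open>T23x_cancel\<close>; the terms with \<open>px\<close> and \<open>qy\<close> from the
  projected fluxes cancel those in \<open>f\<close> by the differential equation. What remains pairs
  projection errors with v, s, r, plus the two edge terms.\<close>

lemma energy_identity:
  assumes e: "\<epsilon> > 0"
    and b: "PC b" and u: "PC u" and px: "PC px" and qy: "PC qy" and A: "PC A" and B: "PC B"
    and f: "\<And>x y. in_open_sq x y \<Longrightarrow> f x y = b x y * u x y - px x y - qy x y"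
    and sol: "is_LDG_solution k \<epsilon> b f (stab \<epsilon> N) (stab \<epsilon> N) xs N U P Q"
    and Pu: "VN k Pu PuF" and Pp: "VN k Pp PpF" and Pq: "VN k Pq PqF"
    and T2: "\<And>s S. VN k s S \<Longrightarrow> T2x Pu s = - bip xs N A s"
    and T2': "\<And>r R. VN k r R \<Longrightarrow> T2x (swp Pu) (swp r) = - bip xs N B r"
    and T3: "\<And>v V. VN k v V \<Longrightarrow> T3x Pp v = - bip xs N px v + edge gx v"
    and T3': "\<And>v V. VN k v V \<Longrightarrow> T3x (swp Pq) (swp v) = - bip xs N qy v + edge gy (swp v)"
    and z: "\<And>j y. j \<in> {1..N} \<Longrightarrow> y \<in> {xs (j-1)<..<xs j} \<Longrightarrow> PuF N j (xs N) y = 0"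
    and z': "\<And>j y. j \<in> {1..N} \<Longrightarrow> y \<in> {xs (j-1)<..<xs j} \<Longrightarrow> PuF j N y (xs N) = 0"
    and vsr: "v = (\<lambda>x y. U x y - Pu x y)" "s = (\<lambda>x y. P x y - Pp x y)" "r = (\<lambda>x y. Q x y - Pq x y)"
  shows "bip xs N s s / \<epsilon> + bip xs N r r / \<epsilon> + bip xs N (\<lambda>x y. b x y * v x y) v +
      sqrt \<epsilon> * (edge (trxm xs v N) v + edge (trxm xs (swp v) N) (swp v)) =
    bip xs N (\<lambda>x y. b x y * (u x y - Pu x y)) v + bip xs N (\<lambda>x y. A x y - Pp x y / \<epsilon>) s +
      bip xs N (\<lambda>x y. B x y - Pq x y / \<epsilon>) r - edge gx v - edge gy (swp v)"
proof -
  obtain UF PF QF where U: "VN k U UF" and P: "VN k P PF" and Q: "VN k Q QF"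
    using sol unfolding is_LDG_solution_def in_VN_iff by blast
  have v: "VN k v (\<lambda>i j x y. UF i j x y - PuF i j x y)" unfolding vsr by (rule VN_diff[OF U Pu])
  have s: "VN k s (\<lambda>i j x y. PF i j x y - PpF i j x y)" unfolding vsr by (rule VN_diff[OF P Pp])
  have r: "VN k r (\<lambda>i j x y. QF i j x y - PqF i j x y)" unfolding vsr by (rule VN_diff[OF Q Pq])
  note PCv = PC_VN[OF v] and PCs = PC_VN[OF s] and PCr = PC_VN[OF r]
  note PCU = PC_VN[OF U] and PCP = PC_VN[OF P] and PCQ = PC_VN[OF Q]
  note PCPu = PC_VN[OF Pu] and PCPp = PC_VN[OF Pp] and PCPq = PC_VN[OF Pq]
  have eq: "LDG_B \<epsilon> b (stab \<epsilon> N) (stab \<epsilon> N) xs N (U, P, Q) (v, s, r) = bip xs N f v"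
    using sol v s r unfolding is_LDG_solution_def in_VN_iff by blast
  have bf: "bip xs N f v = bip xs N (\<lambda>x y. b x y * u x y) v - bip xs N px v - bip xs N qy v"
  proof -
    have "bip xs N f v = IP (\<lambda>x y. ((b x y * u x y - px x y) - qy x y) * v x y)"
      unfolding bip_IP
    proof (rule IP_cong)
      fix i j x y assume "i \<in> {1..N}" "j \<in> {1..N}" "x \<in> {xs (i-1)<..<xs i}" "y \<in> {xs (j-1)<..<xs j}"
      then have "x \<in> {0<..<1}" "y \<in> {0<..<1}" using cell_sub_open by blast+
      then have "in_open_sq x y" by (simp add: in_open_sq_def)
      then show "f x y * v x y = ((b x y * u x y - px x y) - qy x y) * v x y" by (simp add: f)
    qed
    also have "\<dots> = bip xs N (\<lambda>x y. (b x y * u x y - px x y) - qy x y) v" unfolding bip_IP ..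
    also have "\<dots> = bip xs N (\<lambda>x y. b x y * u x y) v - bip xs N px v - bip xs N qy v"
      using bip_diff_left[OF PC_intros(2)[OF PC_intros(3)[OF b u] px] qy PCv]
        bip_diff_left[OF PC_intros(3)[OF b u] px PCv] by simp
    finally show ?thesis .
  qed
  have s2: "T2x U s = T2x v s + T2x Pu s"
    using T2x_diff[OF U Pu s] unfolding vsr(1) by simp
  have s2': "T2x (swp U) (swp r) = T2x (swp v) (swp r) + T2x (swp Pu) (swp r)"
    using T2x_diff[OF VN_swp[OF U] VN_swp[OF Pu] VN_swp[OF r]] unfolding vsr(1) by simp
  have s3: "T3x P v = T3x s v + T3x Pp v"
    using T3x_diff[OF P Pp v] unfolding vsr(2) by simp
  have s3': "T3x (swp Q) (swp v) = T3x (swp r) (swp v) + T3x (swp Pq) (swp v)"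
    using T3x_diff[OF VN_swp[OF Q] VN_swp[OF Pq] VN_swp[OF v]] unfolding vsr(3) by simp
  have c: "T2x v s + T3x s v = 0" by (rule T23x_cancel[OF v s])
  have c': "T2x (swp v) (swp r) + T3x (swp r) (swp v) = 0"
    by (rule T23x_cancel[OF VN_swp[OF v] VN_swp[OF r]])
  have t4: "T4x (stab \<epsilon> N) U v = sqrt \<epsilon> * edge (trxm xs v N) v"
    unfolding T4x_stab using trxm_diff_zero[OF U Pu z] unfolding vsr(1)
    by (intro arg_cong2[of _ _ _ _ "(*)"] refl edge_cong) simp
  have t4': "T4x (stab \<epsilon> N) (swp U) (swp v) = sqrt \<epsilon> * edge (trxm xs (swp v) N) (swp v)"
    unfolding T4x_stab using trxm_diff_zero[OF VN_swp[OF U] VN_swp[OF Pu] z'] unfolding vsr(1)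
    by (intro arg_cong2[of _ _ _ _ "(*)"] refl edge_cong) simp
  have main: "bip xs N P s / \<epsilon> + bip xs N Q r / \<epsilon> + bip xs N (\<lambda>x y. b x y * U x y) v -
      bip xs N A s - bip xs N B r + edge gx v + edge gy (swp v) +
      sqrt \<epsilon> * (edge (trxm xs v N) v + edge (trxm xs (swp v) N) (swp v)) = bip xs N (\<lambda>x y. b x y * u x y) v"
    using eq[unfolded LDG_B_eq[OF U Q v r]] bf s2 s2' s3 s3' c c' t4 t4' T2[OF s] T2'[OF r] T3[OF v] T3'[OF v]
    by (simp add: algebra_simps)
  have d1: "bip xs N s s / \<epsilon> = bip xs N P s / \<epsilon> - bip xs N Pp s / \<epsilon>"
    using bip_diff_left[OF PCP PCPp PCs] unfolding vsr(2) by (simp add: diff_divide_distrib)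
  have d2: "bip xs N r r / \<epsilon> = bip xs N Q r / \<epsilon> - bip xs N Pq r / \<epsilon>"
    using bip_diff_left[OF PCQ PCPq PCr] unfolding vsr(3) by (simp add: diff_divide_distrib)
  have d3: "bip xs N (\<lambda>x y. b x y * v x y) v = bip xs N (\<lambda>x y. b x y * U x y) v - bip xs N (\<lambda>x y. b x y * Pu x y) v"
    using bip_diff_left[OF PC_intros(3)[OF b PCU] PC_intros(3)[OF b PCPu] PCv]
    unfolding vsr(1) by (simp add: right_diff_distrib)
  have d4: "bip xs N (\<lambda>x y. b x y * (u x y - Pu x y)) v = bip xs N (\<lambda>x y. b x y * u x y) v - bip xs N (\<lambda>x y. b x y * Pu x y) v"
    using bip_diff_left[OF PC_intros(3)[OF b u] PC_intros(3)[OF b PCPu] PCv] by (simp add: right_diff_distrib)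
  have PCe: "PC (\<lambda>x y. Pp x y / \<epsilon>)" "PC (\<lambda>x y. Pq x y / \<epsilon>)"
    using PC_intros(3)[OF PCPp PC_intros(4)[of "1 / \<epsilon>"]] PC_intros(3)[OF PCPq PC_intros(4)[of "1 / \<epsilon>"]] by simp_all
  have d5: "bip xs N (\<lambda>x y. A x y - Pp x y / \<epsilon>) s = bip xs N A s - bip xs N Pp s / \<epsilon>"
    using bip_diff_left[OF A PCe(1) PCs] by (simp add: bip_divide_left)
  have d6: "bip xs N (\<lambda>x y. B x y - Pq x y / \<epsilon>) r = bip xs N B r - bip xs N Pq r / \<epsilon>"
    using bip_diff_left[OF B PCe(2) PCr] by (simp add: bip_divide_left)
  show ?thesis using main d1 d2 d3 d4 d5 d6 by linarith
qed

end

section \<open>Energy estimate\<close>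

lemma young_ineq: "c > 0 \<Longrightarrow> g * h \<le> c * (g * g) + h * h / (4 * c)" for c g h :: real
proof -
  assume c: "c > 0"
  have "0 \<le> (2 * c * g - h)\<^sup>2" by simp
  then have "4 * c * (g * h) \<le> 4 * c * (c * (g * g)) + h * h"
    by (simp add: power2_eq_square algebra_simps)
  then have "4 * c * (g * h) \<le> 4 * c * (c * (g * g) + h * h / (4 * c))"
    using c by (simp add: algebra_simps)
  from mult_left_le_imp_le[OF this] show ?thesis using c by simp
qed

context mesh
begin

lemma bip_young:
  assumes w: "PC w" and g: "PC g" and h: "PC h" and c: "c > 0"
    and w0: "\<And>i j x y. i \<in> {1..N} \<Longrightarrow> j \<in> {1..N} \<Longrightarrow> x \<in> {xs (i-1)<..<xs i} \<Longrightarrow> y \<in> {xs (j-1)<..<xs j} \<Longrightarrow> 0 \<le> w x y"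
  shows "bip xs N (\<lambda>x y. w x y * g x y) h \<le>
    c * bip xs N (\<lambda>x y. w x y * g x y) g + bip xs N (\<lambda>x y. w x y * h x y) h / (4 * c)"
proof -
  have e: "c * bip xs N (\<lambda>x y. w x y * g x y) g + bip xs N (\<lambda>x y. w x y * h x y) h / (4 * c) =
     IP (\<lambda>x y. c * (w x y * g x y * g x y) + 1 / (4 * c) * (w x y * h x y * h x y))"
    unfolding bip_IP
    using IP_add[OF PC_intros(3)[OF PC_intros(4)[of c] PC_intros(3)[OF PC_intros(3)[OF w g] g]]
        PC_intros(3)[OF PC_intros(4)[of "1 / (4 * c)"] PC_intros(3)[OF PC_intros(3)[OF w h] h]]]
    unfolding IP_cmult by simp
  show ?thesis unfolding e unfolding bip_IP
  proof (rule IP_mono)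
    fix i j x y assume "i \<in> {1..N}" "j \<in> {1..N}" "x \<in> {xs (i-1)<..<xs i}" "y \<in> {xs (j-1)<..<xs j}"
    from w0[OF this] have "w x y * (g x y * h x y) \<le> w x y * (c * (g x y * g x y) + h x y * h x y / (4 * c))"
      using young_ineq[OF c] by (intro mult_left_mono)
    then show "w x y * g x y * h x y \<le> c * (w x y * g x y * g x y) + 1 / (4 * c) * (w x y * h x y * h x y)"
      by (simp add: algebra_simps)
  qed (intro PC_intros w g h)+
qed

lemma bip_young1:
  assumes g: "PC g" and h: "PC h" and c: "c > 0"
  shows "bip xs N g h \<le> c * bip xs N g g + bip xs N h h / (4 * c)"
  using bip_young[OF PC_intros(4)[of 1] g h c] by simp

lemma bip_weighted_diff_sq:
  assumes w: "PC w" and g: "PC g" and h: "PC h"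
    and w0: "\<And>i j x y. i \<in> {1..N} \<Longrightarrow> j \<in> {1..N} \<Longrightarrow> x \<in> {xs (i-1)<..<xs i} \<Longrightarrow> y \<in> {xs (j-1)<..<xs j} \<Longrightarrow> 0 \<le> w x y"
    and e: "\<And>i j x y. i \<in> {1..N} \<Longrightarrow> j \<in> {1..N} \<Longrightarrow> x \<in> {xs (i-1)<..<xs i} \<Longrightarrow> y \<in> {xs (j-1)<..<xs j} \<Longrightarrow> e x y = g x y - h x y"
  shows "bip xs N (\<lambda>x y. w x y * e x y) e \<le>
    2 * bip xs N (\<lambda>x y. w x y * g x y) g + 2 * bip xs N (\<lambda>x y. w x y * h x y) h"
proof -
  have 1: "2 * bip xs N (\<lambda>x y. w x y * g x y) g + 2 * bip xs N (\<lambda>x y. w x y * h x y) h =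
     IP (\<lambda>x y. 2 * (w x y * g x y * g x y) + 2 * (w x y * h x y * h x y))"
    unfolding bip_IP
    using IP_add[OF PC_intros(3)[OF PC_intros(4)[of 2] PC_intros(3)[OF PC_intros(3)[OF w g] g]]
        PC_intros(3)[OF PC_intros(4)[of 2] PC_intros(3)[OF PC_intros(3)[OF w h] h]]]
    unfolding IP_cmult by simp
  have 2: "bip xs N (\<lambda>x y. w x y * e x y) e = IP (\<lambda>x y. w x y * (g x y - h x y) * (g x y - h x y))"
    unfolding bip_IP by (rule IP_cong) (simp add: e)
  show ?thesis unfolding 1 2
  proof (rule IP_mono)
    fix i j x y assume "i \<in> {1..N}" "j \<in> {1..N}" "x \<in> {xs (i-1)<..<xs i}" "y \<in> {xs (j-1)<..<xs j}"
    from w0[OF this] have "0 \<le> w x y * (g x y + h x y)\<^sup>2" by simp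
    then show "w x y * (g x y - h x y) * (g x y - h x y) \<le> 2 * (w x y * g x y * g x y) + 2 * (w x y * h x y * h x y)"
      by (simp add: power2_eq_square algebra_simps)
  qed (intro PC_intros w g h)+
qed

lemma bip_diff_sq:
  assumes g: "PC g" and h: "PC h"
    and e: "\<And>i j x y. i \<in> {1..N} \<Longrightarrow> j \<in> {1..N} \<Longrightarrow> x \<in> {xs (i-1)<..<xs i} \<Longrightarrow> y \<in> {xs (j-1)<..<xs j} \<Longrightarrow> e x y = g x y - h x y"
  shows "bip xs N e e \<le> 2 * bip xs N g g + 2 * bip xs N h h"
  using bip_weighted_diff_sq[OF PC_intros(4)[of 1] g h _ e] by simp

definition cell_len :: "nat \<Rightarrow> real" where "cell_len i = xs i - xs (i - 1)"

lemma cell_len_pos: "i \<in> {1..N} \<Longrightarrow> 0 < cell_len i"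
  using xs_less by (simp add: cell_len_def)

lemma sum_cell_len: "(\<Sum>i=1..N. cell_len i) = 1"
proof -
  have "(\<Sum>i=1..n. cell_len i) = xs n - xs 0" for n
    by (induction n) (auto simp: cell_len_def)
  then show ?thesis by (simp add: x0 xN)
qed

lemma IP_bound:
  assumes g: "PC g" and M: "\<And>i j x y. i \<in> {1..N} \<Longrightarrow> j \<in> {1..N} \<Longrightarrow> x \<in> {xs (i-1)<..<xs i} \<Longrightarrow> y \<in> {xs (j-1)<..<xs j} \<Longrightarrow> g x y \<le> M i j"
  shows "IP g \<le> (\<Sum>i=1..N. \<Sum>j=1..N. M i j * (cell_len i * cell_len j))"
  unfolding IP_def
proof (intro sum_mono)
  fix i j assume ij: "i \<in> {1..N}" "j \<in> {1..N}"
  let ?B = "box (xs (i-1), xs (j-1)) (xs i, xs j)" and ?C = "cbox (xs (i-1), xs (j-1)) (xs i, xs j)"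
  have "integral ?B (\<lambda>z. g (fst z) (snd z)) \<le> integral ?B (\<lambda>z. M i j)"
    using IP_integrable[OF g ij] M[OF ij]
    by (intro integral_le) (auto simp: integrable_on_open_interval, auto simp: box_Pair_real)
  then have "integral ?C (\<lambda>z. g (fst z) (snd z)) \<le> integral ?C (\<lambda>z. M i j)"
    by (simp only: integral_open_interval)
  also have "\<dots> = M i j * (cell_len i * cell_len j)"
    using xs_less[OF ij(1)] xs_less[OF ij(2)] by (simp add: content_Pair cell_len_def)
  finally show "integral ?C (\<lambda>z. g (fst z) (snd z)) \<le> M i j * (cell_len i * cell_len j)" .
qed

text \<open>The squared \<open>L2\<close> norm of the step function with value \<open>A i\<close> on
  cell \<open>i\<close>.\<close>

definition wsum :: "(nat \<Rightarrow> real) \<Rightarrow> real" where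
  "wsum A = (\<Sum>i=1..N. cell_len i * (A i)\<^sup>2)"

text \<open>The widths add up to 1, so in each of the two terms the sum over the other direction
  disappears. The factor 4 is 2 from the square of a sum times 2 directions.\<close>

lemma bip_sq_bound:
  assumes g: "PC g" and M: "\<And>i j x y. i \<in> {1..N} \<Longrightarrow> j \<in> {1..N} \<Longrightarrow> x \<in> {xs (i-1)<..<xs i} \<Longrightarrow> y \<in> {xs (j-1)<..<xs j} \<Longrightarrow> \<bar>g x y\<bar> \<le> m * (A i + A j)"
  shows "bip xs N g g \<le> 4 * m\<^sup>2 * wsum A"
proof -
  have "bip xs N g g \<le> (\<Sum>i=1..N. \<Sum>j=1..N. (2 * m\<^sup>2 * ((A i)\<^sup>2 + (A j)\<^sup>2)) * (cell_len i * cell_len j))"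
    unfolding bip_IP
  proof (rule IP_bound[OF PC_intros(3)[OF g g]])
    fix i j x y assume *: "i \<in> {1..N}" "j \<in> {1..N}" "x \<in> {xs (i-1)<..<xs i}" "y \<in> {xs (j-1)<..<xs j}"
    have "(g x y)\<^sup>2 \<le> (m * (A i + A j))\<^sup>2" using M[OF *] by (metis abs_ge_zero power2_abs power_mono)
    also have "\<dots> = m\<^sup>2 * (A i + A j)\<^sup>2" by (simp add: power_mult_distrib)
    also have "\<dots> \<le> m\<^sup>2 * (2 * ((A i)\<^sup>2 + (A j)\<^sup>2))"
    proof (rule mult_left_mono)
      have "0 \<le> (A i - A j)\<^sup>2" by simp
      then show "(A i + A j)\<^sup>2 \<le> 2 * ((A i)\<^sup>2 + (A j)\<^sup>2)" by (simp add: power2_eq_square algebra_simps)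
    qed simp
    finally show "g x y * g x y \<le> 2 * m\<^sup>2 * ((A i)\<^sup>2 + (A j)\<^sup>2)" by (simp add: power2_eq_square algebra_simps)
  qed
  also have "\<dots> = 2 * m\<^sup>2 * ((\<Sum>i=1..N. \<Sum>j=1..N. cell_len i * (A i)\<^sup>2 * cell_len j) + (\<Sum>i=1..N. \<Sum>j=1..N. cell_len i * (cell_len j * (A j)\<^sup>2)))"
    unfolding sum.distrib[symmetric] sum_distrib_left by (intro sum.cong refl) (simp add: algebra_simps)
  also have "(\<Sum>i=1..N. \<Sum>j=1..N. cell_len i * (A i)\<^sup>2 * cell_len j) = wsum A"
    unfolding sum_distrib_left[symmetric] sum_cell_len wsum_def by simp
  also have "(\<Sum>i=1..N. \<Sum>j=1..N. cell_len i * (cell_len j * (A j)\<^sup>2)) = wsum A"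
    unfolding sum_distrib_left[symmetric] sum_distrib_right[symmetric] sum_cell_len wsum_def by simp
  finally show ?thesis by simp
qed

lemma bip_weighted_sq_bound:
  assumes w: "PC w" and g: "PC g"
    and wB: "\<And>i j x y. i \<in> {1..N} \<Longrightarrow> j \<in> {1..N} \<Longrightarrow> x \<in> {xs (i-1)<..<xs i} \<Longrightarrow> y \<in> {xs (j-1)<..<xs j} \<Longrightarrow> w x y \<le> B"
  shows "bip xs N (\<lambda>x y. w x y * g x y) g \<le> B * bip xs N g g"
  unfolding bip_IP IP_cmult[symmetric]
proof (rule IP_mono)
  fix i j x y assume "i \<in> {1..N}" "j \<in> {1..N}" "x \<in> {xs (i-1)<..<xs i}" "y \<in> {xs (j-1)<..<xs j}"
  from mult_right_mono[OF wB[OF this], of "g x y * g x y"]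
  show "w x y * g x y * g x y \<le> B * (g x y * g x y)" by (simp add: mult.assoc)
qed (intro PC_intros w g)+

lemma edge_young:
  assumes v: "VN k v V" and g: "continuous_on {0..1} g" and c: "c > 0"
    and m: "\<And>y. y \<in> {0<..<1} \<Longrightarrow> \<bar>g y\<bar> \<le> m"
  shows "- edge g v \<le> c * m\<^sup>2 + edge (trxm xs v N) v / (4 * c)"
proof -
  have N: "N \<in> {1..N}" using N1 by simp
  define t where "t j = V N j (xs N)" for j
  have tc: "continuous_on {xs (j-1)..xs j} (t j)" if "j \<in> {1..N}" for j
    unfolding t_def by (rule famc_right[OF famc_VN[OF v] N that])
  have gc: "continuous_on {xs (j-1)..xs j} g" if "j \<in> {1..N}" for j
    by (rule continuous_on_subset[OF g cell_sub[OF that]])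
  have e1: "edge g v = (\<Sum>j=1..N. integral {xs (j-1)..xs j} (\<lambda>y. g y * t j y))"
    unfolding t_def by (rule edge_VN[OF v])
  have e2: "edge (trxm xs v N) v = (\<Sum>j=1..N. integral {xs (j-1)..xs j} (\<lambda>y. t j y * t j y))"
    unfolding edge_def t_def
  proof (rule sum.cong[OF refl], rule integral_cong_open)
    fix j y assume "j \<in> {1..N}" "y \<in> {xs (j-1)<..<xs j}"
    from trxm_VN[OF v this] show "trxm xs v N y * trxm xs v N y = V N j (xs N) y * V N j (xs N) y" by simp
  qed
  have "- integral {xs (j-1)..xs j} (\<lambda>y. g y * t j y) \<le>
      c * m\<^sup>2 * cell_len j + integral {xs (j-1)..xs j} (\<lambda>y. t j y * t j y) / (4 * c)" if j: "j \<in> {1..N}" for j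
  proof -
    have mm: "\<bar>g y\<bar> \<le> m" if "y \<in> {xs (j-1)..xs j}" for y
      by (rule le_on_closed_of_open[of 0 1 g m]) (use g m cell_mem[OF j that] in auto)
    have "integral {xs (j-1)..xs j} (\<lambda>y. - (g y * t j y)) \<le>
        integral {xs (j-1)..xs j} (\<lambda>y. c * m\<^sup>2 + 1 / (4 * c) * (t j y * t j y))"
    proof (rule integral_le)
      show "(\<lambda>y. - (g y * t j y)) integrable_on {xs (j-1)..xs j}"
        by (intro integrable_continuous_interval continuous_on_minus continuous_on_mult gc tc j)
      show "(\<lambda>y. c * m\<^sup>2 + 1 / (4 * c) * (t j y * t j y)) integrable_on {xs (j-1)..xs j}"
        by (intro integrable_continuous_interval continuous_on_add continuous_on_mult continuous_on_const tc j)
      fix y assume y: "y \<in> {xs (j-1)..xs j}"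
      have "(- g y) * t j y \<le> c * ((- g y) * (- g y)) + t j y * t j y / (4 * c)" by (rule young_ineq[OF c])
      moreover have "(- g y) * (- g y) \<le> m\<^sup>2"
        using power_mono[OF mm[OF y], of 2] by (simp add: power2_eq_square)
      moreover from this have "c * ((- g y) * (- g y)) \<le> c * m\<^sup>2" using c by (intro mult_left_mono) auto
      ultimately show "- (g y * t j y) \<le> c * m\<^sup>2 + 1 / (4 * c) * (t j y * t j y)" by simp
    qed
    also have "\<dots> = integral {xs (j-1)..xs j} (\<lambda>y. c * m\<^sup>2) + integral {xs (j-1)..xs j} (\<lambda>y. 1 / (4 * c) * (t j y * t j y))"
      by (intro integral_add integrable_continuous_interval continuous_on_mult continuous_on_const tc j)
    also have "\<dots> = c * m\<^sup>2 * cell_len j + integral {xs (j-1)..xs j} (\<lambda>y. t j y * t j y) / (4 * c)"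
      using xs_less[OF j] by (simp add: cell_len_def)
    finally show ?thesis by simp
  qed
  from sum_mono[OF this]
  have "(\<Sum>j=1..N. - integral {xs (j-1)..xs j} (\<lambda>y. g y * t j y)) \<le>
    (\<Sum>j=1..N. c * m\<^sup>2 * cell_len j + integral {xs (j-1)..xs j} (\<lambda>y. t j y * t j y) / (4 * c))" .
  also have "\<dots> = c * m\<^sup>2 + (\<Sum>j=1..N. integral {xs (j-1)..xs j} (\<lambda>y. t j y * t j y)) / (4 * c)"
    unfolding sum.distrib sum_distrib_left[symmetric] sum_cell_len sum_divide_distrib by simp
  finally show ?thesis unfolding e1 e2 by (simp add: sum_negf)
qed

end

context mesh
begin

lemma edge_self_nonneg:
  assumes "VN k v V" shows "0 \<le> edge (trxm xs v N) v"
  unfolding edge_def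
proof (rule sum_nonneg)
  fix j assume j: "j \<in> {1..N}"
  show "0 \<le> integral {xs (j-1)..xs j} (\<lambda>y. trxm xs v N y * trxm xs v N y)"
    \<comment> \<open>The integral of a function that is not integrable is 0 by convention, so no
      continuity of the trace is needed.\<close>
    by (cases "(\<lambda>y. trxm xs v N y * trxm xs v N y) integrable_on {xs (j-1)..xs j}")
      (auto intro: integral_nonneg simp: not_integrable_integral)
qed

text \<open>Both \<open>u\<close> and its projection vanish on the edge, so the jump of the full
  error has the same square as that of the discrete error and no projection term appears.\<close>

lemma jump_error:
  assumes u: "cont2 {0..1} {0..1} u" and bd: "\<And>y. y \<in> {0..1} \<Longrightarrow> u 1 y = 0"
    and U: "VN k U UF" and Pu: "VN k Pu PuF"
    and z: "\<And>j y. j \<in> {1..N} \<Longrightarrow> y \<in> {xs (j-1)<..<xs j} \<Longrightarrow> PuF N j (xs N) y = 0"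
  shows "(\<Sum>j=1..N. \<Sum>i=0..N. integral {xs (j-1)..xs j} (\<lambda>y. stab \<epsilon> N i * (jmpx xs N (\<lambda>x y. u x y - U x y) i y)\<^sup>2)) =
    sqrt \<epsilon> * edge (trxm xs (\<lambda>x y. U x y - Pu x y) N) (\<lambda>x y. U x y - Pu x y)"
proof -
  let ?v = "\<lambda>x y. U x y - Pu x y"
  have N: "N \<in> {1..N}" using N1 by simp
  have "(\<Sum>i=0..N. integral {xs (j-1)..xs j} (\<lambda>y. stab \<epsilon> N i * (jmpx xs N (\<lambda>x y. u x y - U x y) i y)\<^sup>2)) =
      sqrt \<epsilon> * integral {xs (j-1)..xs j} (\<lambda>y. trxm xs ?v N y * trxm xs ?v N y)" if j: "j \<in> {1..N}" for j
  proof -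
    have "(\<Sum>i=0..N. integral {xs (j-1)..xs j} (\<lambda>y. stab \<epsilon> N i * (jmpx xs N (\<lambda>x y. u x y - U x y) i y)\<^sup>2)) =
        (\<Sum>i\<in>{N}. integral {xs (j-1)..xs j} (\<lambda>y. stab \<epsilon> N i * (jmpx xs N (\<lambda>x y. u x y - U x y) i y)\<^sup>2))"
      by (rule sum.mono_neutral_right) (auto simp: stab_def)
    also have "\<dots> = integral {xs (j-1)..xs j} (\<lambda>y. sqrt \<epsilon> * (trxm xs (\<lambda>x y. u x y - U x y) N y)\<^sup>2)"
      using N1 by (simp add: stab_def jmpx_def)
    also have "\<dots> = sqrt \<epsilon> * integral {xs (j-1)..xs j} (\<lambda>y. (trxm xs (\<lambda>x y. u x y - U x y) N y)\<^sup>2)"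
      by simp
    also have "integral {xs (j-1)..xs j} (\<lambda>y. (trxm xs (\<lambda>x y. u x y - U x y) N y)\<^sup>2) =
        integral {xs (j-1)..xs j} (\<lambda>y. trxm xs ?v N y * trxm xs ?v N y)"
    proof (rule integral_cong_open)
      fix y assume y: "y \<in> {xs (j-1)<..<xs j}"
      then have y01: "y \<in> {0..1}" using cell_mem[OF j, of y] by auto
      have r: "repr (\<lambda>x y. u x y - U x y) (\<lambda>i j x y. u x y - UF i j x y)"
        using U unfolding VN_def repr_def by auto
      have c: "continuous_on {xs (N-1)..xs N} (\<lambda>x. u x y - UF N j x y)"
        by (intro continuous_on_diff continuous_on_subset[OF cont2_slice_x[OF u y01] cell_sub[OF N]]
            cont2_slice_x[OF isQ_cont[OF VN_isQ[OF U N j], where Y = UNIV] UNIV_I])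
      have "trxm xs (\<lambda>x y. u x y - U x y) N y = u (xs N) y - UF N j (xs N) y"
        by (rule trxm_eq[OF r N j y c])
      moreover have "u (xs N) y = 0" unfolding xN by (rule bd[OF y01])
      ultimately show "(trxm xs (\<lambda>x y. u x y - U x y) N y)\<^sup>2 = trxm xs ?v N y * trxm xs ?v N y"
        unfolding trxm_VN[OF VN_diff[OF U Pu] j y] z[OF j y] by (simp add: power2_eq_square)
    qed
    finally show ?thesis .
  qed
  then show ?thesis unfolding edge_def by (simp add: sum_distrib_left)
qed

text \<open>The five projection errors enter as hypotheses with one cellwise majorant
  \<open>A\<close>, scaled by 1 for \<open>u\<close>, by sqrt \<epsilon> for the fluxes and by 1 /
  sqrt \<epsilon> for the consistency errors. In the energy norm all these scalings become the same
  m^2 \<open>wsum A\<close>; only the edge terms keep a factor sqrt \<epsilon>.\<close>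

lemma energy_estimate:
  assumes e: "\<epsilon> > 0"
    and b: "PC b" and u: "cont2 {0..1} {0..1} u" and p: "PC p" and q: "PC q"
    and px: "PC px" and qy: "PC qy" and Ax: "PC Ax" and By: "PC By"
    and f: "\<And>x y. in_open_sq x y \<Longrightarrow> f x y = b x y * u x y - px x y - qy x y"
    and dp: "\<And>x y. in_open_sq x y \<Longrightarrow> p x y = \<epsilon> * pdx u x y" "\<And>x y. in_open_sq x y \<Longrightarrow> q x y = \<epsilon> * pdy u x y"
    and bd: "\<And>y. y \<in> {0..1} \<Longrightarrow> u 1 y = 0" "\<And>x. x \<in> {0..1} \<Longrightarrow> u x 1 = 0"
    and sol: "is_LDG_solution k \<epsilon> b f (stab \<epsilon> N) (stab \<epsilon> N) xs N U P Q"
    and Pu: "VN k Pu PuF" and Pp: "VN k Pp PpF" and Pq: "VN k Pq PqF"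
    and T2: "\<And>s S. VN k s S \<Longrightarrow> T2x Pu s = - bip xs N Ax s"
    and T2': "\<And>r R. VN k r R \<Longrightarrow> T2x (swp Pu) (swp r) = - bip xs N By r"
    and T3: "\<And>v V. VN k v V \<Longrightarrow> T3x Pp v = - bip xs N px v + edge gx v"
    and T3': "\<And>v V. VN k v V \<Longrightarrow> T3x (swp Pq) (swp v) = - bip xs N qy v + edge gy (swp v)"
    and z: "\<And>j y. j \<in> {1..N} \<Longrightarrow> y \<in> {xs (j-1)<..<xs j} \<Longrightarrow> PuF N j (xs N) y = 0"
    and z': "\<And>j y. j \<in> {1..N} \<Longrightarrow> y \<in> {xs (j-1)<..<xs j} \<Longrightarrow> PuF j N y (xs N) = 0"
    and bB: "\<And>x y. in_open_sq x y \<Longrightarrow> 0 \<le> b x y" "\<And>x y. in_open_sq x y \<Longrightarrow> b x y \<le> B"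
    and eu: "\<And>i j x y. i \<in> {1..N} \<Longrightarrow> j \<in> {1..N} \<Longrightarrow> x \<in> {xs (i-1)<..<xs i} \<Longrightarrow> y \<in> {xs (j-1)<..<xs j} \<Longrightarrow>
        \<bar>u x y - Pu x y\<bar> \<le> m * (A i + A j)"
    and ep: "\<And>i j x y. i \<in> {1..N} \<Longrightarrow> j \<in> {1..N} \<Longrightarrow> x \<in> {xs (i-1)<..<xs i} \<Longrightarrow> y \<in> {xs (j-1)<..<xs j} \<Longrightarrow>
        \<bar>p x y - Pp x y\<bar> \<le> sqrt \<epsilon> * m * (A i + A j)"
    and eq: "\<And>i j x y. i \<in> {1..N} \<Longrightarrow> j \<in> {1..N} \<Longrightarrow> x \<in> {xs (i-1)<..<xs i} \<Longrightarrow> y \<in> {xs (j-1)<..<xs j} \<Longrightarrow>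
        \<bar>q x y - Pq x y\<bar> \<le> sqrt \<epsilon> * m * (A i + A j)"
    and eA: "\<And>i j x y. i \<in> {1..N} \<Longrightarrow> j \<in> {1..N} \<Longrightarrow> x \<in> {xs (i-1)<..<xs i} \<Longrightarrow> y \<in> {xs (j-1)<..<xs j} \<Longrightarrow>
        \<bar>Ax x y - Pp x y / \<epsilon>\<bar> \<le> 2 * m / sqrt \<epsilon> * (A i + A j)"
    and eB: "\<And>i j x y. i \<in> {1..N} \<Longrightarrow> j \<in> {1..N} \<Longrightarrow> x \<in> {xs (i-1)<..<xs i} \<Longrightarrow> y \<in> {xs (j-1)<..<xs j} \<Longrightarrow>
        \<bar>By x y - Pq x y / \<epsilon>\<bar> \<le> 2 * m / sqrt \<epsilon> * (A i + A j)"
    and gx: "continuous_on {0..1} gx" "\<And>y. y \<in> {0<..<1} \<Longrightarrow> \<bar>gx y\<bar> \<le> sqrt \<epsilon> * m * A N"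
    and gy: "continuous_on {0..1} gy" "\<And>y. y \<in> {0<..<1} \<Longrightarrow> \<bar>gy y\<bar> \<le> sqrt \<epsilon> * m * A N"
  shows "energy_norm \<epsilon> b (stab \<epsilon> N) (stab \<epsilon> N) xs N (\<lambda>x y. u x y - U x y)
      (\<lambda>x y. \<epsilon> * pdx u x y - P x y) (\<lambda>x y. \<epsilon> * pdy u x y - Q x y)
    \<le> sqrt ((102 + 19 * B) * m\<^sup>2 * (wsum A + sqrt \<epsilon> * (A N)\<^sup>2))"
proof -
  obtain UF PF QF where U: "VN k U UF" and P: "VN k P PF" and Q: "VN k Q QF"
    using sol unfolding is_LDG_solution_def in_VN_iff by blast
  define v where "v = (\<lambda>x y. U x y - Pu x y)"
  define s where "s = (\<lambda>x y. P x y - Pp x y)"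
  define r where "r = (\<lambda>x y. Q x y - Pq x y)"
  define VF where "VF i j x y = UF i j x y - PuF i j x y" for i j x y
  have v: "VN k v VF" unfolding v_def VF_def by (rule VN_diff[OF U Pu])
  have PCv: "PC v" by (rule PC_VN[OF v])
  have PCs: "PC s" unfolding s_def by (rule PC_VN[OF VN_diff[OF P Pp]])
  have PCr: "PC r" unfolding r_def by (rule PC_VN[OF VN_diff[OF Q Pq]])
  have PCu: "PC u" by (rule PC_cont2[OF u])
  note PCPu = PC_VN[OF Pu] and PCPp = PC_VN[OF Pp] and PCPq = PC_VN[OF Pq]
  have in_sq: "in_open_sq x y" if "i \<in> {1..N}" "j \<in> {1..N}" "x \<in> {xs (i-1)<..<xs i}" "y \<in> {xs (j-1)<..<xs j}" for i j x y
    using subsetD[OF cell_sub_open[OF that(1)] that(3)] subsetD[OF cell_sub_open[OF that(2)] that(4)]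
    by (simp add: in_open_sq_def)
  have B0: "0 \<le> B" using bB[of "1/2" "1/2"] by (simp add: in_open_sq_def)
  have W0: "0 \<le> wsum A" unfolding wsum_def
    by (rule sum_nonneg) (rule mult_nonneg_nonneg[OF less_imp_le[OF cell_len_pos] zero_le_power2])
  define e0 where "e0 = sqrt \<epsilon>"
  have e0: "e0 > 0" "e0 * e0 = \<epsilon>" using e by (auto simp: e0_def)
  define Sx where "Sx = edge (trxm xs v N) v"
  define Sy where "Sy = edge (trxm xs (swp v) N) (swp v)"
  have S0: "0 \<le> Sx" "0 \<le> Sy" unfolding Sx_def Sy_def by (rule edge_self_nonneg[OF v], rule edge_self_nonneg[OF VN_swp[OF v]])
  define bs where "bs = bip xs N s s / \<epsilon>"
  define br where "br = bip xs N r r / \<epsilon>"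
  define bv where "bv = bip xs N (\<lambda>x y. b x y * v x y) v"
  define T where "T = m\<^sup>2 * wsum A"
  define TN where "TN = e0 * (m * A N)\<^sup>2"
  have T0: "0 \<le> T" unfolding T_def using W0 by simp
  have TN0: "0 \<le> TN" unfolding TN_def using e0 by simp
  have id: "bs + br + bv + e0 * (Sx + Sy) =
     bip xs N (\<lambda>x y. b x y * (u x y - Pu x y)) v + bip xs N (\<lambda>x y. Ax x y - Pp x y / \<epsilon>) s +
      bip xs N (\<lambda>x y. By x y - Pq x y / \<epsilon>) r - edge gx v - edge gy (swp v)"
    unfolding bs_def br_def bv_def Sx_def Sy_def e0_def
    by (rule energy_identity[OF e b PCu px qy Ax By f sol Pu Pp Pq T2 T2' T3 T3' z z' v_def s_def r_def])
  have PCe: "PC (\<lambda>x y. Pp x y / \<epsilon>)" "PC (\<lambda>x y. Pq x y / \<epsilon>)"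
    using PC_intros(3)[OF PCPp PC_intros(4)[of "1 / \<epsilon>"]] PC_intros(3)[OF PCPq PC_intros(4)[of "1 / \<epsilon>"]] by simp_all
  have eu2: "bip xs N (\<lambda>x y. b x y * (u x y - Pu x y)) (\<lambda>x y. u x y - Pu x y) \<le> 4 * B * T"
  proof -
    have "bip xs N (\<lambda>x y. b x y * (u x y - Pu x y)) (\<lambda>x y. u x y - Pu x y) \<le> B * bip xs N (\<lambda>x y. u x y - Pu x y) (\<lambda>x y. u x y - Pu x y)"
      by (rule bip_weighted_sq_bound[OF b PC_intros(2)[OF PCu PCPu] bB(2)[OF in_sq]])
    also have "\<dots> \<le> B * (4 * m\<^sup>2 * wsum A)"
      by (rule mult_left_mono[OF bip_sq_bound[OF PC_intros(2)[OF PCu PCPu] eu] B0])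
    finally show ?thesis by (simp add: T_def mult_ac)
  qed
  have t1: "bip xs N (\<lambda>x y. b x y * (u x y - Pu x y)) v \<le> 4 * B * T + bv / 4"
    using bip_young[OF b PC_intros(2)[OF PCu PCPu] PCv, of 1] bB(1)[OF in_sq] eu2 unfolding bv_def by fastforce
  \<comment> \<open>The factor \<epsilon> from Young's inequality cancels the 1 / \<epsilon> in the
    squared consistency error.\<close>
  have D: "\<epsilon> * (4 * (2 * m / e0)\<^sup>2 * wsum A) = 16 * T"
    using e0 unfolding T_def e0(2)[symmetric] by (simp add: power2_eq_square field_simps)
  have t2: "bip xs N (\<lambda>x y. Ax x y - Pp x y / \<epsilon>) s \<le> 16 * T + bs / 4"
  proof -
    have "bip xs N (\<lambda>x y. Ax x y - Pp x y / \<epsilon>) s \<le>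
        \<epsilon> * bip xs N (\<lambda>x y. Ax x y - Pp x y / \<epsilon>) (\<lambda>x y. Ax x y - Pp x y / \<epsilon>) + bip xs N s s / (4 * \<epsilon>)"
      by (rule bip_young1[OF PC_intros(2)[OF Ax PCe(1)] PCs e])
    also have "\<epsilon> * bip xs N (\<lambda>x y. Ax x y - Pp x y / \<epsilon>) (\<lambda>x y. Ax x y - Pp x y / \<epsilon>) \<le> \<epsilon> * (4 * (2 * m / e0)\<^sup>2 * wsum A)"
      unfolding e0_def by (rule mult_left_mono[OF bip_sq_bound[OF PC_intros(2)[OF Ax PCe(1)] eA]]) (use e in auto)
    finally show ?thesis unfolding D bs_def by (simp add: mult.commute)
  qed
  have t3: "bip xs N (\<lambda>x y. By x y - Pq x y / \<epsilon>) r \<le> 16 * T + br / 4"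
  proof -
    have "bip xs N (\<lambda>x y. By x y - Pq x y / \<epsilon>) r \<le>
        \<epsilon> * bip xs N (\<lambda>x y. By x y - Pq x y / \<epsilon>) (\<lambda>x y. By x y - Pq x y / \<epsilon>) + bip xs N r r / (4 * \<epsilon>)"
      by (rule bip_young1[OF PC_intros(2)[OF By PCe(2)] PCr e])
    also have "\<epsilon> * bip xs N (\<lambda>x y. By x y - Pq x y / \<epsilon>) (\<lambda>x y. By x y - Pq x y / \<epsilon>) \<le> \<epsilon> * (4 * (2 * m / e0)\<^sup>2 * wsum A)"
      unfolding e0_def by (rule mult_left_mono[OF bip_sq_bound[OF PC_intros(2)[OF By PCe(2)] eB]]) (use e in auto)
    finally show ?thesis unfolding D br_def by (simp add: mult.commute)
  qed
  have DN: "1 / e0 * (e0 * m * A N)\<^sup>2 = TN" using e0(1) unfolding TN_def by (simp add: power2_eq_square field_simps)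
  \<comment> \<open>Young's inequality with weight 1 / sqrt \<epsilon>: the quarter of the edge term
    that appears carries exactly the stabilisation weight and can be absorbed.\<close>
  have t4: "- edge gx v \<le> TN + e0 * Sx / 4"
    using edge_young[OF v gx(1) _ gx(2), of "1 / e0"] e0(1) unfolding DN e0_def[symmetric] Sx_def by (simp add: DN[simplified] field_simps)
  have t5: "- edge gy (swp v) \<le> TN + e0 * Sy / 4"
    using edge_young[OF VN_swp[OF v] gy(1) _ gy(2), of "1 / e0"] e0(1) unfolding DN e0_def[symmetric] Sy_def by (simp add: DN[simplified] field_simps)
  define E where "E = bs + br + bv + e0 * (Sx + Sy)"
  \<comment> \<open>Each of the estimates above returns a quarter of one term of \<open>E\<close>;
    absorbing them leaves 3/4 of \<open>E\<close> on the left.\<close>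
  have E: "E \<le> 4 / 3 * (4 * B * T + 32 * T + 2 * TN)"
    using id t1 t2 t3 t4 t5 unfolding E_def by (simp add: algebra_simps)
  have n1: "bip xs N (\<lambda>x y. \<epsilon> * pdx u x y - P x y) (\<lambda>x y. \<epsilon> * pdx u x y - P x y) / \<epsilon> \<le> 8 * T + 2 * bs"
  proof -
    have "bip xs N (\<lambda>x y. \<epsilon> * pdx u x y - P x y) (\<lambda>x y. \<epsilon> * pdx u x y - P x y) \<le>
       2 * bip xs N (\<lambda>x y. p x y - Pp x y) (\<lambda>x y. p x y - Pp x y) + 2 * bip xs N s s"
      by (rule bip_diff_sq[OF PC_intros(2)[OF p PCPp] PCs]) (use dp(1)[OF in_sq] in \<open>simp add: s_def\<close>)
    also have "bip xs N (\<lambda>x y. p x y - Pp x y) (\<lambda>x y. p x y - Pp x y) \<le> 4 * (sqrt \<epsilon> * m)\<^sup>2 * wsum A"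
      by (rule bip_sq_bound[OF PC_intros(2)[OF p PCPp] ep])
    finally have "bip xs N (\<lambda>x y. \<epsilon> * pdx u x y - P x y) (\<lambda>x y. \<epsilon> * pdx u x y - P x y) \<le> 2 * (4 * (\<epsilon> * T)) + 2 * bip xs N s s"
      using e by (simp add: power_mult_distrib T_def mult_ac)
    from divide_right_mono[OF this, of \<epsilon>] e show ?thesis unfolding bs_def by (simp add: add_divide_distrib)
  qed
  have n2: "bip xs N (\<lambda>x y. \<epsilon> * pdy u x y - Q x y) (\<lambda>x y. \<epsilon> * pdy u x y - Q x y) / \<epsilon> \<le> 8 * T + 2 * br"
  proof -
    have "bip xs N (\<lambda>x y. \<epsilon> * pdy u x y - Q x y) (\<lambda>x y. \<epsilon> * pdy u x y - Q x y) \<le>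
       2 * bip xs N (\<lambda>x y. q x y - Pq x y) (\<lambda>x y. q x y - Pq x y) + 2 * bip xs N r r"
      by (rule bip_diff_sq[OF PC_intros(2)[OF q PCPq] PCr]) (use dp(2)[OF in_sq] in \<open>simp add: r_def\<close>)
    also have "bip xs N (\<lambda>x y. q x y - Pq x y) (\<lambda>x y. q x y - Pq x y) \<le> 4 * (sqrt \<epsilon> * m)\<^sup>2 * wsum A"
      by (rule bip_sq_bound[OF PC_intros(2)[OF q PCPq] eq])
    finally have "bip xs N (\<lambda>x y. \<epsilon> * pdy u x y - Q x y) (\<lambda>x y. \<epsilon> * pdy u x y - Q x y) \<le> 2 * (4 * (\<epsilon> * T)) + 2 * bip xs N r r"
      using e by (simp add: power_mult_distrib T_def mult_ac)
    from divide_right_mono[OF this, of \<epsilon>] e show ?thesis unfolding br_def by (simp add: add_divide_distrib)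
  qed
  have n3: "bip xs N (\<lambda>x y. b x y * (u x y - U x y)) (\<lambda>x y. u x y - U x y) \<le> 8 * B * T + 2 * bv"
  proof -
    have "bip xs N (\<lambda>x y. b x y * (u x y - U x y)) (\<lambda>x y. u x y - U x y) \<le>
      2 * bip xs N (\<lambda>x y. b x y * (u x y - Pu x y)) (\<lambda>x y. u x y - Pu x y) + 2 * bip xs N (\<lambda>x y. b x y * v x y) v"
      by (rule bip_weighted_diff_sq[OF b PC_intros(2)[OF PCu PCPu] PCv bB(1)[OF in_sq]]) (simp_all add: v_def)
    then show ?thesis using eu2 unfolding bv_def by simp
  qed
  have n4: "(\<Sum>j=1..N. \<Sum>i=0..N. integral {xs (j-1)..xs j} (\<lambda>y. stab \<epsilon> N i * (jmpx xs N (\<lambda>x y. u x y - U x y) i y)\<^sup>2)) = e0 * Sx"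
    unfolding e0_def Sx_def v_def by (rule jump_error[OF u bd(1) U Pu z])
  have n5: "(\<Sum>i=1..N. \<Sum>j=0..N. integral {xs (i-1)..xs i} (\<lambda>x. stab \<epsilon> N j * (jmpy xs N (\<lambda>x y. u x y - U x y) x j)\<^sup>2)) = e0 * Sy"
    unfolding e0_def Sy_def v_def jmpy_swp by (rule jump_error[OF cont2_swp[OF u] bd(2) VN_swp[OF U] VN_swp[OF Pu] z'])
  \<comment> \<open>Inserting the bound for \<open>E\<close> gives 16 + 256/3 and 8 + 32/3 as
    coefficients of \<open>T\<close> and B T, rounded up to 102 and 19.\<close>
  have "16 * T + 8 * B * T + 2 * E \<le> (102 + 19 * B) * (T + TN)"
  proof -
    have "0 \<le> B * T" "0 \<le> B * TN" using B0 T0 TN0 by auto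
    then show ?thesis using E T0 TN0 by (simp add: algebra_simps)
  qed
  moreover have "0 \<le> e0 * Sx" "0 \<le> e0 * Sy" using e0 S0 by auto
  ultimately have "bip xs N (\<lambda>x y. \<epsilon> * pdx u x y - P x y) (\<lambda>x y. \<epsilon> * pdx u x y - P x y) / \<epsilon> +
      bip xs N (\<lambda>x y. \<epsilon> * pdy u x y - Q x y) (\<lambda>x y. \<epsilon> * pdy u x y - Q x y) / \<epsilon> +
      bip xs N (\<lambda>x y. b x y * (u x y - U x y)) (\<lambda>x y. u x y - U x y) + e0 * Sx + e0 * Sy
    \<le> (102 + 19 * B) * (T + TN)"
    using n1 n2 n3 unfolding E_def by (simp add: algebra_simps)
  also have "\<dots> = (102 + 19 * B) * m\<^sup>2 * (wsum A + sqrt \<epsilon> * (A N)\<^sup>2)"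
    unfolding T_def TN_def e0_def by (simp add: algebra_simps power_mult_distrib)
  finally show ?thesis unfolding energy_norm_def n4 n5 by (rule real_sqrt_le_mono)
qed

end

section \<open>Layer-adapted meshes\<close>

definition layer_left :: "nat \<Rightarrow> real \<Rightarrow> real \<Rightarrow> (nat \<Rightarrow> real) \<Rightarrow> nat \<Rightarrow> real" where
  "layer_left k \<beta> \<delta> xs i = min 1 (((xs i - xs (i - 1)) / \<delta>) ^ Suc k) * exp (- \<beta> * xs (i - 1) / \<delta>)"

definition layer_right :: "nat \<Rightarrow> real \<Rightarrow> real \<Rightarrow> (nat \<Rightarrow> real) \<Rightarrow> nat \<Rightarrow> real" where
  "layer_right k \<beta> \<delta> xs i = min 1 (((xs i - xs (i - 1)) / \<delta>) ^ Suc k) * exp (- \<beta> * (1 - xs i) / \<delta>)"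

definition layer_sum :: "nat \<Rightarrow> real \<Rightarrow> real \<Rightarrow> (nat \<Rightarrow> real) \<Rightarrow> nat \<Rightarrow> real" where
  "layer_sum k \<beta> \<delta> xs i = (xs i - xs (i - 1)) ^ Suc k + layer_left k \<beta> \<delta> xs i + layer_right k \<beta> \<delta> xs i"

lemma sum_three_sq: "(a + b + c)\<^sup>2 \<le> 3 * (a\<^sup>2 + b\<^sup>2 + c\<^sup>2)" for a b c :: real
proof -
  have "0 \<le> (a - b)\<^sup>2 + (b - c)\<^sup>2 + (a - c)\<^sup>2" by simp
  then show ?thesis by (simp add: power2_eq_square algebra_simps)
qed

text \<open>\<open>L i\<close> stands for the mesh generating function at i / N, \<kappa> for
  \<sigma> / \<beta> and \<delta> for sqrt \<epsilon>. The three formulas for the mesh points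
  overlap at the two transition points, so that both ends of a cell can always be computed by the
  same formula.\<close>

locale graded_mesh =
  fixes xs L :: "nat \<Rightarrow> real" and N :: nat and \<kappa> \<delta> \<tau> :: real
  assumes N4: "4 \<le> N" "4 dvd N" and pos: "\<kappa> > 0" "\<delta> > 0" and \<tau>: "\<tau> = \<kappa> * \<delta> * L (N div 4)" "\<tau> \<le> 1 / 4"
    and L0: "L 0 = 0" and L_step: "\<And>i. 4 * Suc i \<le> N \<Longrightarrow> L i < L (Suc i)"
    and xs_a: "\<And>i. 4 * i \<le> N \<Longrightarrow> xs i = \<kappa> * \<delta> * L i"
    and xs_b: "\<And>i. N \<le> 4 * i \<Longrightarrow> 4 * i \<le> 3 * N \<Longrightarrow> xs i = \<tau> + 2 * (1 - 2 * \<tau>) * (real i / real N - 1 / 4)"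
    and xs_c: "\<And>i. 3 * N \<le> 4 * i \<Longrightarrow> i \<le> N \<Longrightarrow> xs i = 1 - \<kappa> * \<delta> * L (N - i)"
begin

lemma step_a: "4 * Suc i \<le> N \<Longrightarrow> xs (Suc i) - xs i = \<kappa> * \<delta> * (L (Suc i) - L i)"
  using xs_a[of i] xs_a[of "Suc i"] by (simp add: algebra_simps)

lemma step_b:
  assumes "N \<le> 4 * i" "4 * Suc i \<le> 3 * N" shows "xs (Suc i) - xs i = 2 * (1 - 2 * \<tau>) / real N"
  using xs_b[of i] xs_b[of "Suc i"] assms N4 by (simp add: field_simps)

lemma step_c:
  assumes "3 * N \<le> 4 * i" "Suc i \<le> N"
  shows "xs (Suc i) - xs i = \<kappa> * \<delta> * (L (Suc (N - Suc i)) - L (N - Suc i))"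
proof -
  have "Suc (N - Suc i) = N - i" using assms by simp
  then show ?thesis using xs_c[of i] xs_c[of "Suc i"] assms by (simp add: algebra_simps)
qed

text \<open>As \<open>N\<close> is a multiple of 4, both transition points are mesh points and no
  cell straddles them.\<close>

lemma step_cases:
  assumes "i < N"
  obtains "4 * Suc i \<le> N" | "N \<le> 4 * i" "4 * Suc i \<le> 3 * N" | "3 * N \<le> 4 * i"
proof -
  obtain n where n: "N = 4 * n" using N4(2) by (rule dvdE)
  show thesis
  proof (cases "i < n")
    case True then show ?thesis using that(1) n by simp
  next
    case False then show ?thesis using that(2,3) n by (cases "i < 3 * n") simp_all
  qed
qed

lemma is_mesh: "mesh xs N"
proof
  show "1 \<le> N" using N4 by simp
  show "xs 0 = 0" using xs_a[of 0] L0 by simp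
  show "xs N = 1" using xs_c[of N] L0 by simp
  fix i assume i: "i < N"
  from this show "xs i < xs (Suc i)"
  proof (cases rule: step_cases)
    case 1
    have "0 < \<kappa> * \<delta> * (L (Suc i) - L i)" using pos L_step[OF 1] by simp
    then show ?thesis using step_a[OF 1] by simp
  next
    case 2
    have "0 < 2 * (1 - 2 * \<tau>) / real N" using \<tau>(2) N4 by (intro divide_pos_pos) auto
    then show ?thesis using step_b[OF 2] by simp
  next
    case 3
    have "Suc (N - Suc i) = N - i" using i by simp
    then have "4 * Suc (N - Suc i) \<le> N" using 3 by simp
    from L_step[OF this] have "0 < \<kappa> * \<delta> * (L (Suc (N - Suc i)) - L (N - Suc i))" using pos by simp
    then show ?thesis using step_c[OF 3] i by simp
  qed
qed

text \<open>Reduces every bound for the right layer to the left layer.\<close>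

lemma symmetric: assumes "i \<le> N" shows "xs (N - i) = 1 - xs i"
proof -
  consider "4 * i \<le> N" | "N \<le> 4 * i" "4 * i \<le> 3 * N" | "3 * N \<le> 4 * i" by linarith
  then show ?thesis
  proof cases
    case 1
    then show ?thesis using xs_a[of i] xs_c[of "N - i"] assms by simp
  next
    case 2
    then have "xs (N - i) = \<tau> + 2 * (1 - 2 * \<tau>) * (real (N - i) / real N - 1 / 4)"
      using assms by (intro xs_b) auto
    moreover have "real (N - i) / real N = 1 - real i / real N"
      using assms N4 by (simp add: of_nat_diff diff_divide_distrib)
    ultimately show ?thesis unfolding xs_b[OF 2] by (simp add: algebra_simps)
  next
    case 3
    then show ?thesis using xs_a[of "N - i"] xs_c[OF 3 assms] assms by simp
  qed
qed

sublocale mesh xs N by (rule is_mesh)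

lemma layer_right_reflect:
  assumes "i \<in> {1..N}" shows "layer_right k \<beta> \<delta> xs i = layer_left k \<beta> \<delta> xs (N + 1 - i)"
proof -
  obtain j where j: "i = Suc j" "Suc j \<le> N" using assms by (cases i) auto
  have "xs (N + 1 - i) = 1 - xs (i - 1)" using symmetric[of j] j by simp
  moreover have "xs (N + 1 - i - 1) = 1 - xs i" using symmetric[of i] j by simp
  ultimately show ?thesis by (simp add: layer_right_def layer_left_def)
qed

lemma cell_len_reflect:
  assumes "i \<in> {1..N}" shows "cell_len (N + 1 - i) = cell_len i"
proof -
  obtain j where "i = Suc j" "Suc j \<le> N" using assms by (cases i) auto
  then show ?thesis using symmetric[of j] symmetric[of i] by (simp add: cell_len_def)
qed

text \<open>The coarse cells have width at most 2 / N because \<tau> is nonnegative, which explains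
  the requirement on \<open>c\<close>.\<close>

lemma cell_len_le:
  assumes c: "\<And>i. 4 * Suc i \<le> N \<Longrightarrow> \<kappa> * \<delta> * (L (Suc i) - L i) \<le> c / real N" and c2: "2 \<le> c" and i: "i \<in> {1..N}"
  shows "cell_len i \<le> c / real N"
proof -
  obtain j where j: "i = Suc j" "j < N" using i by (cases i) auto
  from j(2) have "xs (Suc j) - xs j \<le> c / real N"
  proof (cases rule: step_cases)
    case 1 then show ?thesis using step_a c by simp
  next
    case 2
    have "0 \<le> L (N div 4)"
    proof -
      have "xs (N div 4) \<ge> 0" using xs_mem[of "N div 4"] by simp
      moreover have "4 * (N div 4) \<le> N" by simp
      moreover have "0 < \<kappa> * \<delta>" using pos by simp
      ultimately show ?thesis using xs_a[of "N div 4"] by (auto simp: zero_le_mult_iff)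
    qed
    then have "0 \<le> \<tau>" using \<tau>(1) pos by simp
    then have "2 * (1 - 2 * \<tau>) / real N \<le> c / real N" using c2 by (intro divide_right_mono) auto
    then show ?thesis using step_b[OF 2] by simp
  next
    case 3
    have "Suc (N - Suc j) = N - j" using j by simp
    then have "4 * Suc (N - Suc j) \<le> N" using 3 by simp
    from c[OF this] show ?thesis using step_c[OF 3] j by simp
  qed
  then show ?thesis by (simp add: j cell_len_def)
qed

text \<open>At the transition point the exponential is at most N to the power - \<kappa> \<beta>,
  and \<kappa> \<beta> is at least k + 1. Beyond it no help from the cell width is needed.\<close>

lemma layer_left_far:
  assumes \<beta>: "\<beta> > 0" and \<sigma>: "\<kappa> * \<beta> \<ge> real (Suc k)" and Ln: "L (N div 4) \<ge> ln (real N)"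
    and i: "i \<in> {1..N}" "N < 4 * i"
  shows "layer_left k \<beta> \<delta> xs i \<le> 1 / real N ^ Suc k"
proof -
  obtain n where n: "N = 4 * n" using N4(2) by (rule dvdE)
  have "xs n \<le> xs (i - 1)" using i n by (intro xs_mono) auto
  moreover have "xs n = \<kappa> * \<delta> * L n" using n by (intro xs_a) simp
  ultimately have "\<beta> * (\<kappa> * \<delta> * L n) \<le> \<beta> * xs (i - 1)" using \<beta> by simp
  then have "\<beta> * (\<kappa> * \<delta> * L n) / \<delta> \<le> \<beta> * xs (i - 1) / \<delta>" using pos by (intro divide_right_mono) auto
  then have 1: "\<kappa> * \<beta> * L n \<le> \<beta> * xs (i - 1) / \<delta>" using pos by (simp add: field_simps)
  have "real (Suc k) * ln (real N) \<le> \<kappa> * \<beta> * L n"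
    using \<sigma> Ln n N4 by (intro mult_mono) auto
  with 1 have "- \<beta> * xs (i - 1) / \<delta> \<le> - (real (Suc k) * ln (real N))" by simp
  then have "exp (- \<beta> * xs (i - 1) / \<delta>) \<le> exp (- (real (Suc k) * ln (real N)))" by simp
  also have "\<dots> = 1 / real N ^ Suc k"
    using N4 by (simp only: exp_minus exp_of_nat_mult exp_ln inverse_eq_divide of_nat_0_less_iff)
  finally have "exp (- \<beta> * xs (i - 1) / \<delta>) \<le> 1 / real N ^ Suc k" .
  moreover have "layer_left k \<beta> \<delta> xs i \<le> 1 * exp (- \<beta> * xs (i - 1) / \<delta>)"
    unfolding layer_left_def by (rule mult_right_mono) auto
  ultimately show ?thesis by simp
qed

lemma layer_left_nonneg: "i \<in> {1..N} \<Longrightarrow> 0 \<le> layer_left k \<beta> \<delta> xs i"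
proof -
  assume "i \<in> {1..N}"
  then have "0 \<le> (xs i - xs (i - 1)) / \<delta>" using xs_less[of i] pos by (intro divide_nonneg_pos) auto
  from zero_le_power[OF this, of "Suc k"] show ?thesis
    unfolding layer_left_def by (intro mult_nonneg_nonneg) (auto simp del: power_Suc)
qed

lemma wsum_layer_sum:
  assumes c: "\<And>i. i \<in> {1..N} \<Longrightarrow> cell_len i \<le> c / real N"
    and E: "(\<Sum>i=1..N. cell_len i * (layer_left k \<beta> \<delta> xs i)\<^sup>2) \<le> D"
  shows "wsum (layer_sum k \<beta> \<delta> xs) \<le> 3 * (((c / real N) ^ Suc k)\<^sup>2 + 2 * D)"
proof -
  have "wsum (layer_sum k \<beta> \<delta> xs) \<le> (\<Sum>i=1..N. 3 * (cell_len i * ((c / real N) ^ Suc k)\<^sup>2 +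
      cell_len i * (layer_left k \<beta> \<delta> xs i)\<^sup>2 + cell_len i * (layer_right k \<beta> \<delta> xs i)\<^sup>2))"
    unfolding wsum_def
  proof (rule sum_mono)
    fix i assume i: "i \<in> {1..N}"
    have "(layer_sum k \<beta> \<delta> xs i)\<^sup>2 \<le> 3 * ((cell_len i ^ Suc k)\<^sup>2 + (layer_left k \<beta> \<delta> xs i)\<^sup>2 + (layer_right k \<beta> \<delta> xs i)\<^sup>2)"
      unfolding layer_sum_def cell_len_def[symmetric] by (rule sum_three_sq)
    also have "\<dots> \<le> 3 * (((c / real N) ^ Suc k)\<^sup>2 + (layer_left k \<beta> \<delta> xs i)\<^sup>2 + (layer_right k \<beta> \<delta> xs i)\<^sup>2)"
      using c[OF i] cell_len_pos[OF i] by (intro mult_left_mono add_right_mono power_mono) auto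
    finally have "cell_len i * (layer_sum k \<beta> \<delta> xs i)\<^sup>2 \<le> cell_len i * (3 * (((c / real N) ^ Suc k)\<^sup>2 + (layer_left k \<beta> \<delta> xs i)\<^sup>2 + (layer_right k \<beta> \<delta> xs i)\<^sup>2))"
      using cell_len_pos[OF i] by (intro mult_left_mono) auto
    then show "cell_len i * (layer_sum k \<beta> \<delta> xs i)\<^sup>2 \<le> 3 * (cell_len i * ((c / real N) ^ Suc k)\<^sup>2 +
      cell_len i * (layer_left k \<beta> \<delta> xs i)\<^sup>2 + cell_len i * (layer_right k \<beta> \<delta> xs i)\<^sup>2)"
      by (simp add: algebra_simps)
  qed
  also have "\<dots> = 3 * ((\<Sum>i=1..N. cell_len i * ((c / real N) ^ Suc k)\<^sup>2) +
      (\<Sum>i=1..N. cell_len i * (layer_left k \<beta> \<delta> xs i)\<^sup>2) + (\<Sum>i=1..N. cell_len i * (layer_right k \<beta> \<delta> xs i)\<^sup>2))"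
    unfolding sum_distrib_left[symmetric] sum.distrib ..
  also have "(\<Sum>i=1..N. cell_len i * ((c / real N) ^ Suc k)\<^sup>2) = ((c / real N) ^ Suc k)\<^sup>2"
    unfolding sum_distrib_right[symmetric] sum_cell_len by simp
  also have "(\<Sum>i=1..N. cell_len i * (layer_right k \<beta> \<delta> xs i)\<^sup>2) = (\<Sum>i=1..N. cell_len i * (layer_left k \<beta> \<delta> xs i)\<^sup>2)"
  proof -
    have "(\<Sum>i=1..N. cell_len i * (layer_right k \<beta> \<delta> xs i)\<^sup>2) = (\<Sum>i=1..N. cell_len (N + 1 - i) * (layer_left k \<beta> \<delta> xs (N + 1 - i))\<^sup>2)"
      by (intro sum.cong refl) (simp only: layer_right_reflect cell_len_reflect)
    then show ?thesis using sum.atLeastAtMost_rev[of "\<lambda>i. cell_len i * (layer_left k \<beta> \<delta> xs i)\<^sup>2" 1 N] by simp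
  qed
  finally show ?thesis using E by simp
qed

text \<open>In the last cell the left layer has died out, and the right layer looks like the left
  one in the first cell. Only the latter contribution needs the factor \<delta>.\<close>

lemma layer_sum_last:
  assumes c: "\<And>i. i \<in> {1..N} \<Longrightarrow> cell_len i \<le> c / real N"
    and \<beta>: "\<beta> > 0" and \<sigma>: "\<kappa> * \<beta> \<ge> real (Suc k)" and Ln: "L (N div 4) \<ge> ln (real N)"
    and E1: "\<delta> * (layer_left k \<beta> \<delta> xs 1)\<^sup>2 \<le> D" and \<delta>1: "\<delta> \<le> 1"
  shows "\<delta> * (layer_sum k \<beta> \<delta> xs N)\<^sup>2 \<le> 3 * (((c / real N) ^ Suc k)\<^sup>2 + (1 / real N ^ Suc k)\<^sup>2 + D)"
proof -
  have N: "N \<in> {1..N}" using N4 by simp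
  have "layer_right k \<beta> \<delta> xs N = layer_left k \<beta> \<delta> xs 1" using layer_right_reflect[OF N] by simp
  then have "(layer_sum k \<beta> \<delta> xs N)\<^sup>2 \<le> 3 * ((cell_len N ^ Suc k)\<^sup>2 + (layer_left k \<beta> \<delta> xs N)\<^sup>2 + (layer_left k \<beta> \<delta> xs 1)\<^sup>2)"
    using sum_three_sq[of "cell_len N ^ Suc k"] unfolding layer_sum_def cell_len_def[symmetric] by simp
  also have "\<dots> \<le> 3 * (((c / real N) ^ Suc k)\<^sup>2 + (1 / real N ^ Suc k)\<^sup>2 + (layer_left k \<beta> \<delta> xs 1)\<^sup>2)"
    using c[OF N] cell_len_pos[OF N] layer_left_far[OF \<beta> \<sigma> Ln N] layer_left_nonneg[OF N, of k \<beta>] layer_left_nonneg[of 1 k \<beta>] N4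
    by (intro mult_left_mono add_mono power_mono) auto
  finally have "\<delta> * (layer_sum k \<beta> \<delta> xs N)\<^sup>2 \<le> \<delta> * (3 * (((c / real N) ^ Suc k)\<^sup>2 + (1 / real N ^ Suc k)\<^sup>2 + (layer_left k \<beta> \<delta> xs 1)\<^sup>2))"
    using pos by (intro mult_left_mono) auto
  also have "\<dots> = 3 * (\<delta> * (((c / real N) ^ Suc k)\<^sup>2 + (1 / real N ^ Suc k)\<^sup>2) + \<delta> * (layer_left k \<beta> \<delta> xs 1)\<^sup>2)"
    by (simp add: algebra_simps)
  also have "\<delta> * (((c / real N) ^ Suc k)\<^sup>2 + (1 / real N ^ Suc k)\<^sup>2) \<le> 1 * (((c / real N) ^ Suc k)\<^sup>2 + (1 / real N ^ Suc k)\<^sup>2)"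
    using \<delta>1 by (intro mult_right_mono) auto
  finally show ?thesis using E1 by simp
qed

end

lemma graded_mesh_mesh_pt:
  assumes \<sigma>: "\<sigma> > 0" and \<beta>: "\<beta> > 0" and \<epsilon>: "\<epsilon> > 0" and N: "4 \<le> N" "4 dvd N" and \<tau>: "mesh_tau mt \<sigma> \<beta> \<epsilon> N \<le> 1 / 4"
    and step: "\<And>i. 4 * Suc i \<le> N \<Longrightarrow> mesh_phi mt N \<epsilon> (real i / real N) < mesh_phi mt N \<epsilon> (real (Suc i) / real N)"
  shows "graded_mesh (mesh_pt mt \<sigma> \<beta> \<epsilon> N) (\<lambda>i. mesh_phi mt N \<epsilon> (real i / real N)) N (\<sigma> / \<beta>) (sqrt \<epsilon>) (mesh_tau mt \<sigma> \<beta> \<epsilon> N)"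
proof
  have q: "real (N div 4) / real N = 1 / 4" using N by (auto elim!: dvdE)
  show "mesh_tau mt \<sigma> \<beta> \<epsilon> N = \<sigma> / \<beta> * sqrt \<epsilon> * mesh_phi mt N \<epsilon> (real (N div 4) / real N)"
    unfolding q by (simp add: mesh_tau_def)
  show "mesh_pt mt \<sigma> \<beta> \<epsilon> N i = \<sigma> / \<beta> * sqrt \<epsilon> * mesh_phi mt N \<epsilon> (real i / real N)" if "4 * i \<le> N" for i
    using that by (simp add: mesh_pt_def)
  show "mesh_pt mt \<sigma> \<beta> \<epsilon> N i = 1 - \<sigma> / \<beta> * sqrt \<epsilon> * mesh_phi mt N \<epsilon> (real (N - i) / real N)"
    if "3 * N \<le> 4 * i" "i \<le> N" for i
  proof -
    have "real (N - i) / real N = 1 - real i / real N"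
      using that N by (simp add: of_nat_diff diff_divide_distrib)
    then show ?thesis using that N by (simp add: mesh_pt_def)
  qed
  show "mesh_pt mt \<sigma> \<beta> \<epsilon> N i = mesh_tau mt \<sigma> \<beta> \<epsilon> N + 2 * (1 - 2 * mesh_tau mt \<sigma> \<beta> \<epsilon> N) * (real i / real N - 1 / 4)"
    if i: "N \<le> 4 * i" "4 * i \<le> 3 * N" for i
  proof -
    consider "4 * i = N" | "4 * i = 3 * N" | "N < 4 * i" "4 * i < 3 * N" using i by linarith
    then show ?thesis
    proof cases
      case 1
      then have t: "real i / real N = 1 / 4" using N by (auto simp: field_simps)
      have "4 * i \<le> N" using 1 by simp
      then show ?thesis unfolding mesh_pt_def mesh_tau_def t by simp
    next
      \<comment> \<open>At the second transition point the mesh is defined by its third branch; both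
        formulas give 1 - \<tau> there.\<close>
      case 2
      then have "4 * real i = 3 * real N" by (metis of_nat_mult of_nat_numeral)
      then have t: "real i / real N = 3 / 4" using N by (simp add: field_simps)
      have "\<not> 4 * i \<le> N" "\<not> 4 * i < 3 * N" using 2 N by auto
      then show ?thesis unfolding mesh_pt_def mesh_tau_def t using \<beta> by (simp add: field_simps)
    next
      case 3
      then show ?thesis by (simp add: mesh_pt_def)
    qed
  qed
qed (use assms in \<open>auto simp: mesh_phi_def split: meshtype.split\<close>)

section \<open>Bakhvalov-type meshes\<close>

text \<open>Covers the BS-mesh with c = 1 / N and the B-type mesh with c = sqrt \<epsilon>; all that
  is used of them is that \<open>c\<close> lies between \<delta> and 1 / N.\<close>

locale log_graded_mesh = graded_mesh +
  fixes c \<beta> :: real and k :: nat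
  assumes c: "0 < c" "c \<le> 1 / real N" "\<delta> \<le> c" and \<beta>0: "\<beta> > 0" and \<sigma>k: "\<kappa> * \<beta> \<ge> real (Suc k)"
    and L_log: "\<And>i. L i = - ln (1 - 4 * (1 - c) * (real i / real N))"
begin

text \<open>The mesh characterising function exp (- L i). It is linear in \<open>i\<close>, and the
  layer exponential at \<open>xs i\<close> is its power with exponent \<kappa> \<beta>.\<close>

definition \<psi> :: "nat \<Rightarrow> real" where "\<psi> i = 1 - 4 * (1 - c) * (real i / real N)"

lemma c_le1: "c \<le> 1 / 4"
proof -
  have "1 / real N \<le> 1 / 4" using N4 by (intro divide_left_mono) auto
  then show ?thesis using c by linarith
qed

lemma \<psi>_ge: assumes "4 * i \<le> N" shows "c \<le> \<psi> i"
proof -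
  define t where "t = real i / real N"
  have "4 * t \<le> 1" using assms N4 by (simp add: t_def field_simps)
  then have "(1 - c) * (4 * t) \<le> (1 - c) * 1" using c_le1 by (intro mult_left_mono) auto
  then show ?thesis unfolding \<psi>_def t_def[symmetric] by (simp add: algebra_simps)
qed

lemma \<psi>_le1: "\<psi> i \<le> 1"
  using c_le1 by (simp add: \<psi>_def)

lemma \<psi>_step: "\<psi> i - \<psi> (Suc i) \<le> 4 / real N" "0 \<le> \<psi> i - \<psi> (Suc i)"
proof -
  have e: "\<psi> i - \<psi> (Suc i) = 4 * (1 - c) / real N"
    using N4 by (simp add: \<psi>_def field_simps)
  show "\<psi> i - \<psi> (Suc i) \<le> 4 / real N" unfolding e using c by (intro divide_right_mono) auto
  show "0 \<le> \<psi> i - \<psi> (Suc i)" unfolding e using c_le1 by auto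
qed

lemma L_\<psi>: "L i = - ln (\<psi> i)"
  unfolding L_log \<psi>_def ..

lemma L_diff:
  assumes "4 * Suc i \<le> N" shows "L (Suc i) - L i \<le> 4 / real N / \<psi> (Suc i)"
proof -
  have p: "0 < \<psi> (Suc i)" "0 < \<psi> i" using \<psi>_ge[of i] \<psi>_ge[of "Suc i"] assms c by auto
  have "L (Suc i) - L i = ln (\<psi> i / \<psi> (Suc i))"
    using p by (simp add: L_\<psi> ln_div)
  also have "\<dots> \<le> \<psi> i / \<psi> (Suc i) - 1" using p by (intro ln_le_minus_one) simp
  also have "\<dots> = (\<psi> i - \<psi> (Suc i)) / \<psi> (Suc i)" using p by (simp add: diff_divide_distrib)
  also have "\<dots> \<le> 4 / real N / \<psi> (Suc i)" using p \<psi>_step(1) by (intro divide_right_mono) auto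
  finally show ?thesis .
qed

text \<open>The steepest step of \<open>L\<close> is of size 4 / (N c), since \<open>\<psi>\<close>
  does not fall below \<open>c\<close>; the factor \<delta> \<le> c compensates it.\<close>

lemma fine_step:
  assumes "4 * Suc i \<le> N" shows "\<kappa> * \<delta> * (L (Suc i) - L i) \<le> (2 + 4 * \<kappa>) / real N"
proof -
  have "L (Suc i) - L i \<le> 4 / real N / c"
    using L_diff[OF assms] \<psi>_ge[OF assms] c N4
    by (rule_tac order.trans[OF _ divide_left_mono]) (auto intro!: mult_pos_pos)
  then have "\<kappa> * \<delta> * (L (Suc i) - L i) \<le> \<kappa> * \<delta> * (4 / real N / c)" using pos by (intro mult_left_mono) auto
  also have "\<dots> = \<kappa> * 4 / real N * (\<delta> / c)" by simp
  also have "\<dots> \<le> \<kappa> * 4 / real N * 1" using c pos by (intro mult_left_mono) auto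
  also have "\<dots> \<le> (2 + 4 * \<kappa>) / real N" by (simp add: divide_right_mono)
  finally show ?thesis .
qed

lemma L_end: "L (N div 4) \<ge> ln (real N)"
proof -
  have "real (N div 4) / real N = 1 / 4" using N4 by (auto elim!: dvdE)
  then have "\<psi> (N div 4) = c" unfolding \<psi>_def by (simp add: field_simps)
  then have "L (N div 4) = ln (1 / c)" using c by (simp add: L_\<psi> ln_div)
  moreover have "real N \<le> 1 / c" using c N4 by (simp add: field_simps)
  ultimately show ?thesis using N4 c by simp
qed

text \<open>On these meshes the bound holds in every cell, without a logarithm: a fine cell has
  relative width of order 1 / (N \<psi>) while the exponential is at most \<psi> to the power k + 1,
  and the powers of \<psi> cancel. Close to the transition point \<psi> itself is of order 1 /
  N.\<close>

lemma layer_left_bound: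
  assumes i: "i \<in> {1..N}" shows "layer_left k \<beta> \<delta> xs i \<le> (8 * (1 + \<kappa>) / real N) ^ Suc k"
proof (cases "4 * i \<le> N")
  case False
  then have "layer_left k \<beta> \<delta> xs i \<le> 1 / real N ^ Suc k"
    by (intro layer_left_far[OF \<beta>0 \<sigma>k L_end i]) simp
  also have "\<dots> = (1 / real N) ^ Suc k" by (simp add: power_one_over)
  also have "\<dots> \<le> (8 * (1 + \<kappa>) / real N) ^ Suc k"
    using pos by (intro power_mono divide_right_mono) auto
  finally show ?thesis .
next
  case True
  obtain j where j: "i = Suc j" using i by (cases i) auto
  have J: "4 * Suc j \<le> N" using True j by simp
  have p: "0 < \<psi> j" "0 < \<psi> (Suc j)" using \<psi>_ge[of j] \<psi>_ge[of "Suc j"] J c by auto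
  have xj: "xs j = \<kappa> * \<delta> * L j" using J by (intro xs_a) simp
  have Lj: "L j = - ln (\<psi> j)" by (simp add: L_log \<psi>_def)
  have "- \<beta> * xs j / \<delta> = \<kappa> * \<beta> * ln (\<psi> j)" unfolding xj Lj using pos by simp
  \<comment> \<open>\<open>ln (\<psi> j)\<close> is not positive, so the lower bound on \<kappa>
    \<beta> yields an upper bound here.\<close>
  also have "\<dots> \<le> real (Suc k) * ln (\<psi> j)" using \<sigma>k p \<psi>_le1[of j] by (intro mult_right_mono_neg) auto
  finally have "exp (- \<beta> * xs j / \<delta>) \<le> exp (real (Suc k) * ln (\<psi> j))" by simp
  then have ex: "exp (- \<beta> * xs j / \<delta>) \<le> \<psi> j ^ Suc k" using p by (simp only: exp_of_nat_mult exp_ln)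
  have hx: "(xs (Suc j) - xs j) / \<delta> = \<kappa> * (L (Suc j) - L j)" using step_a[OF J] pos by simp
  have h0: "0 \<le> \<kappa> * (L (Suc j) - L j)" using L_step[OF J] pos by simp
  have m0: "0 \<le> min 1 ((\<kappa> * (L (Suc j) - L j)) ^ Suc k)" using zero_le_power[OF h0, of "Suc k"] by (simp del: power_Suc)
  have le: "layer_left k \<beta> \<delta> xs i \<le> min 1 ((\<kappa> * (L (Suc j) - L j)) ^ Suc k) * \<psi> j ^ Suc k"
    unfolding layer_left_def j diff_Suc_1 hx by (rule mult_left_mono[OF ex m0])
  \<comment> \<open>The threshold 8 / N is twice the largest step of \<psi>: above it \<psi> at most
    halves across the cell and its values at the two ends are comparable; below it the exponential
    alone suffices.\<close>
  show ?thesis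
  proof (cases "\<psi> j \<le> 8 / real N")
    case True
    have "layer_left k \<beta> \<delta> xs i \<le> 1 * \<psi> j ^ Suc k"
      by (rule order.trans[OF le mult_right_mono]) (use p in auto)
    also have "\<dots> \<le> 1 * (8 / real N) ^ Suc k" using True p by (intro mult_left_mono power_mono) auto
    also have "\<dots> \<le> (8 * (1 + \<kappa>) / real N) ^ Suc k"
      unfolding mult_1 using pos by (intro power_mono divide_right_mono) auto
    finally show ?thesis .
  next
    case False
    then have half: "\<psi> j / 2 \<le> \<psi> (Suc j)" using \<psi>_step(1)[of j] by simp
    have "(L (Suc j) - L j) * \<psi> j \<le> 4 / real N / \<psi> (Suc j) * \<psi> j"
      using L_diff[OF J] p by (intro mult_right_mono) auto
    also have "\<dots> = 4 / real N * (\<psi> j / \<psi> (Suc j))" by simp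
    also have "\<dots> \<le> 4 / real N * 2"
      using half p by (intro mult_left_mono) (auto simp: divide_simps)
    finally have "\<kappa> * ((L (Suc j) - L j) * \<psi> j) \<le> \<kappa> * (4 / real N * 2)" using pos by (intro mult_left_mono) auto
    also have "\<dots> = 8 * \<kappa> / real N" by simp
    also have "\<dots> \<le> 8 * (1 + \<kappa>) / real N" by (intro divide_right_mono) auto
    finally have b: "\<kappa> * (L (Suc j) - L j) * \<psi> j \<le> 8 * (1 + \<kappa>) / real N" by (simp add: mult.assoc)
    have "layer_left k \<beta> \<delta> xs i \<le> (\<kappa> * (L (Suc j) - L j)) ^ Suc k * \<psi> j ^ Suc k"
      by (rule order.trans[OF le mult_right_mono]) (use p in auto)
    also have "\<dots> = (\<kappa> * (L (Suc j) - L j) * \<psi> j) ^ Suc k" by (simp only: power_mult_distrib)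
    also have "\<dots> \<le> (8 * (1 + \<kappa>) / real N) ^ Suc k"
      by (rule power_mono[OF b mult_nonneg_nonneg[OF h0 less_imp_le[OF p(1)]]])
    finally show ?thesis .
  qed
qed

text \<open>The bound is the same in every cell and the widths add up to 1, so nothing has to be
  summed over the layer.\<close>

lemma log_mesh_bounds:
  defines "R \<equiv> 21 * ((8 * (1 + \<kappa>)) ^ Suc k)\<^sup>2"
  shows "wsum (layer_sum k \<beta> \<delta> xs) \<le> R * (1 / real N ^ Suc k)\<^sup>2"
    and "\<delta> * (layer_sum k \<beta> \<delta> xs N)\<^sup>2 \<le> R * (1 / real N ^ Suc k)\<^sup>2"
proof -
  let ?c = "2 + 4 * \<kappa>" and ?E = "(8 * (1 + \<kappa>) / real N) ^ Suc k"
  have cl: "cell_len i \<le> ?c / real N" if "i \<in> {1..N}" for i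
    using pos by (intro cell_len_le[OF fine_step _ that]) auto
  have sq: "(layer_left k \<beta> \<delta> xs i)\<^sup>2 \<le> ?E\<^sup>2" if "i \<in> {1..N}" for i
    by (intro power_mono layer_left_bound layer_left_nonneg that)
  have cE: "((?c / real N) ^ Suc k)\<^sup>2 \<le> ?E\<^sup>2"
    using pos by (intro power_mono divide_right_mono) auto
  have oE: "(1 / real N ^ Suc k)\<^sup>2 \<le> ?E\<^sup>2"
  proof -
    have "(1 / real N) ^ Suc k \<le> ?E" using pos by (intro power_mono divide_right_mono) auto
    then have "1 / real N ^ Suc k \<le> ?E" by (simp only: power_one_over)
    then show ?thesis by (intro power_mono) auto
  qed
  have aux1: "3 * (p + 2 * r) \<le> 21 * r" if "p \<le> r" "0 \<le> r" for p r :: real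
    using that by simp
  have aux2: "3 * (p + q + r) \<le> 21 * r" if "p \<le> r" "q \<le> r" "0 \<le> r" for p q r :: real
    using that by simp
  have RE: "21 * ?E\<^sup>2 = R * (1 / real N ^ Suc k)\<^sup>2"
    unfolding R_def by (simp only: power_divide power_one_over mult.assoc) (simp add: power_divide)
  have "(\<Sum>i=1..N. cell_len i * (layer_left k \<beta> \<delta> xs i)\<^sup>2) \<le> (\<Sum>i=1..N. cell_len i * ?E\<^sup>2)"
    using sq cell_len_pos by (intro sum_mono mult_left_mono) (auto intro: less_imp_le)
  also have "\<dots> = ?E\<^sup>2" unfolding sum_distrib_right[symmetric] sum_cell_len by simp
  finally have "(\<Sum>i=1..N. cell_len i * (layer_left k \<beta> \<delta> xs i)\<^sup>2) \<le> ?E\<^sup>2" .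
  from wsum_layer_sum[OF cl this]
  have "wsum (layer_sum k \<beta> \<delta> xs) \<le> 3 * (((?c / real N) ^ Suc k)\<^sup>2 + 2 * ?E\<^sup>2)" .
  also have "\<dots> \<le> 21 * ?E\<^sup>2" by (rule aux1[OF cE zero_le_power2])
  finally show "wsum (layer_sum k \<beta> \<delta> xs) \<le> R * (1 / real N ^ Suc k)\<^sup>2" unfolding RE .
  have \<delta>1: "\<delta> \<le> 1" using c c_le1 by linarith
  have "\<delta> * (layer_left k \<beta> \<delta> xs 1)\<^sup>2 \<le> 1 * ?E\<^sup>2"
    using sq[of 1] \<delta>1 pos N4 by (intro mult_mono) auto
  then have "\<delta> * (layer_left k \<beta> \<delta> xs 1)\<^sup>2 \<le> ?E\<^sup>2" by simp
  from layer_sum_last[OF cl \<beta>0 \<sigma>k L_end this \<delta>1]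
  have "\<delta> * (layer_sum k \<beta> \<delta> xs N)\<^sup>2 \<le> 3 * (((?c / real N) ^ Suc k)\<^sup>2 + (1 / real N ^ Suc k)\<^sup>2 + ?E\<^sup>2)" .
  also have "\<dots> \<le> 21 * ?E\<^sup>2" by (rule aux2[OF cE oE zero_le_power2])
  finally show "\<delta> * (layer_sum k \<beta> \<delta> xs N)\<^sup>2 \<le> R * (1 / real N ^ Suc k)\<^sup>2" unfolding RE .
qed

end

section \<open>The S-mesh\<close>

text \<open>A Riemann sum of the exponential with step \<open>t\<close>, bounded uniformly in
  \<open>n\<close>. This prevents the logarithmic width of the layer region from entering the
  squared norm. It follows from t \<le> (1 - exp (- t)) (1 + t).\<close>

lemma geometric_layer_sum:
  fixes t :: real assumes t: "t > 0"
  shows "t * (\<Sum>i<n. exp (- t) ^ i) \<le> 1 + t"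
proof -
  let ?q = "exp (- t)"
  have q: "0 < ?q" "?q < 1" using t by auto
  have "(\<Sum>i<n. ?q ^ i) * (1 - ?q) = 1 - ?q ^ n"
    using q by (simp add: sum_gp_strict)
  also have "\<dots> \<le> 1" by simp
  finally have 1: "(\<Sum>i<n. ?q ^ i) * (1 - ?q) \<le> 1" .
  have "1 + t \<le> exp t" by (rule exp_ge_add_one_self)
  then have "?q * (1 + t) \<le> ?q * exp t" by (intro mult_left_mono) auto
  then have "?q * (1 + t) \<le> 1" by (simp add: exp_minus)
  then have "t \<le> (1 - ?q) * (1 + t)" by (simp add: algebra_simps)
  then have "t * (\<Sum>i<n. ?q ^ i) \<le> ((1 - ?q) * (1 + t)) * (\<Sum>i<n. ?q ^ i)"
    by (intro mult_right_mono sum_nonneg) auto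
  also have "\<dots> = (1 + t) * ((\<Sum>i<n. ?q ^ i) * (1 - ?q))" by simp
  also have "\<dots> \<le> (1 + t) * 1" using 1 t by (intro mult_left_mono) auto
  finally show ?thesis by simp
qed

locale uniform_graded_mesh = graded_mesh +
  fixes \<beta> :: real and k :: nat
  assumes \<delta>N: "\<delta> \<le> 1 / real N" and \<beta>0: "\<beta> > 0" and \<sigma>k: "\<kappa> * \<beta> \<ge> real (Suc k)"
    and L_lin: "\<And>i. L i = 4 * (real i / real N) * ln (real N)"
begin

definition a :: real where "a = 4 * ln (real N) / real N"

lemma a_pos: "0 < a" using N4 by (simp add: a_def)

lemma a_le: "a \<le> 4"
proof -
  have "ln (real N) \<le> real N" using N4 ln_le_minus_one[of "real N"] by simp
  then show ?thesis using N4 by (simp add: a_def field_simps)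
qed

lemma L_a: "L i = a * real i" by (simp add: L_lin a_def)

lemma fine_step: "4 * Suc i \<le> N \<Longrightarrow> \<kappa> * \<delta> * (L (Suc i) - L i) \<le> (2 + 4 * \<kappa>) / real N"
proof -
  have "\<kappa> * \<delta> * a \<le> \<kappa> * (1 / real N) * 4" using \<delta>N a_le a_pos pos by (intro mult_mono) auto
  also have "\<dots> = 4 * \<kappa> / real N" by simp
  also have "\<dots> \<le> (2 + 4 * \<kappa>) / real N" by (intro divide_right_mono) auto
  finally show ?thesis by (simp add: L_a algebra_simps)
qed

lemma L_end: "L (N div 4) \<ge> ln (real N)"
proof -
  have "real (N div 4) / real N = 1 / 4" using N4 by (auto elim!: dvdE)
  then show ?thesis by (simp add: L_lin)
qed

lemma layer_left_bound:
  assumes J: "4 * Suc j \<le> N"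
  shows "layer_left k \<beta> \<delta> xs (Suc j) \<le> (\<kappa> * a) ^ Suc k * exp (- (\<kappa> * \<beta> * a)) ^ j"
proof -
  have xj: "xs j = \<kappa> * \<delta> * L j" using J by (intro xs_a) simp
  have "- \<beta> * xs j / \<delta> = real j * (- (\<kappa> * \<beta> * a))" unfolding xj L_a using pos by simp
  then have ex: "exp (- \<beta> * xs j / \<delta>) = exp (- (\<kappa> * \<beta> * a)) ^ j" by (simp only: exp_of_nat_mult)
  have hx: "(xs (Suc j) - xs j) / \<delta> = \<kappa> * a" using step_a[OF J] pos by (simp add: L_a algebra_simps)
  show ?thesis
    unfolding layer_left_def diff_Suc_1 hx ex by (intro mult_right_mono) auto
qed

text \<open>In the fine region every cell has the same relative width \<kappa> a, so the squared
  contributions form a geometric series with the factor \<delta> from the cell width in front. The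
  cells beyond the transition point contribute only the square of N to the power - (k + 1).\<close>

lemma uniform_mesh_bounds:
  defines "R \<equiv> 6 * ((2 + 4 * \<kappa>) ^ Suc k)\<^sup>2 + 6 + 6 * ((4 * \<kappa>) ^ Suc k)\<^sup>2 * (1 + \<kappa> * (1 + 8 * (\<kappa> * \<beta>)) / (2 * (\<kappa> * \<beta>)))"
    and "e \<equiv> \<delta> * ((ln (real N) / real N) ^ Suc k)\<^sup>2 + (1 / real N ^ Suc k)\<^sup>2"
  shows "wsum (layer_sum k \<beta> \<delta> xs) \<le> R * e"
    and "\<delta> * (layer_sum k \<beta> \<delta> xs N)\<^sup>2 \<le> R * e"
proof -
  let ?c = "2 + 4 * \<kappa>"
  define n where "n = N div 4"
  have n: "N = 4 * n" using N4 by (simp add: n_def)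
  define s where "s = \<kappa> * \<beta>"
  have s: "0 < s" using pos \<beta>0 by (simp add: s_def)
  define X where "X = \<delta> * ((ln (real N) / real N) ^ Suc k)\<^sup>2"
  define Y where "Y = (1 / real N ^ Suc k)\<^sup>2"
  define K where "K = \<kappa> * (1 + 8 * s) / (2 * s)"
  define G where "G = ((4 * \<kappa>) ^ Suc k)\<^sup>2"
  have X0: "0 \<le> X" unfolding X_def using pos by simp
  have Y0: "0 \<le> Y" unfolding Y_def by simp
  have K0: "0 \<le> K" unfolding K_def using s pos by (intro divide_nonneg_pos mult_nonneg_nonneg) auto
  have G0: "0 \<le> G" unfolding G_def by simp
  have cl: "cell_len i \<le> ?c / real N" if "i \<in> {1..N}" for i
    using pos by (intro cell_len_le[OF fine_step _ that]) auto
  have ka: "\<delta> * ((\<kappa> * a) ^ Suc k)\<^sup>2 = G * X"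
  proof -
    have "\<kappa> * a = 4 * \<kappa> * (ln (real N) / real N)" by (simp add: a_def)
    then show ?thesis unfolding G_def X_def by (simp only: power_mult_distrib mult_ac)
  qed
  define H where "H = (?c ^ Suc k)\<^sup>2"
  have Ycl: "((?c / real N) ^ Suc k)\<^sup>2 = H * Y"
    unfolding Y_def H_def by (simp add: power_divide)
  have near: "(\<Sum>i=1..n. cell_len i * (layer_left k \<beta> \<delta> xs i)\<^sup>2) \<le> G * X * K"
  proof -
    have "(\<Sum>i=1..n. cell_len i * (layer_left k \<beta> \<delta> xs i)\<^sup>2) = (\<Sum>j<n. cell_len (Suc j) * (layer_left k \<beta> \<delta> xs (Suc j))\<^sup>2)"
      using sum.atLeast1_atMost_eq[of "\<lambda>i. cell_len i * (layer_left k \<beta> \<delta> xs i)\<^sup>2" n] by simp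
    also have "\<dots> \<le> (\<Sum>j<n. (\<kappa> * \<delta> * a) * (((\<kappa> * a) ^ Suc k)\<^sup>2 * exp (- (2 * s * a)) ^ j))"
    proof (rule sum_mono)
      fix j assume "j \<in> {..<n}"
      then have J: "4 * Suc j \<le> N" using n by simp
      have c: "cell_len (Suc j) = \<kappa> * \<delta> * a"
        using step_a[OF J] by (simp add: cell_len_def L_a algebra_simps)
      have "(layer_left k \<beta> \<delta> xs (Suc j))\<^sup>2 \<le> ((\<kappa> * a) ^ Suc k * exp (- (\<kappa> * \<beta> * a)) ^ j)\<^sup>2"
        using J by (intro power_mono layer_left_bound layer_left_nonneg) auto
      also have "\<dots> = ((\<kappa> * a) ^ Suc k)\<^sup>2 * exp (- (2 * s * a)) ^ j"
      proof -
        have "(exp (- (\<kappa> * \<beta> * a)) ^ j)\<^sup>2 = (exp (- (\<kappa> * \<beta> * a)) * exp (- (\<kappa> * \<beta> * a))) ^ j"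
          by (simp add: power2_eq_square power_mult_distrib)
        also have "exp (- (\<kappa> * \<beta> * a)) * exp (- (\<kappa> * \<beta> * a)) = exp (- (2 * s * a))"
          by (simp add: exp_add[symmetric] s_def)
        finally show ?thesis by (simp only: power_mult_distrib)
      qed
      finally show "cell_len (Suc j) * (layer_left k \<beta> \<delta> xs (Suc j))\<^sup>2 \<le> (\<kappa> * \<delta> * a) * (((\<kappa> * a) ^ Suc k)\<^sup>2 * exp (- (2 * s * a)) ^ j)"
        unfolding c using pos a_pos by (intro mult_left_mono) auto
    qed
    \<comment> \<open>The width is rewritten so that the series is multiplied by its own step 2 s a,
      as the geometric bound requires; a \<le> 4 then yields 1 + 8 s.\<close>
    also have "\<dots> = (\<delta> * ((\<kappa> * a) ^ Suc k)\<^sup>2) * (\<kappa> / (2 * s) * ((2 * s * a) * (\<Sum>j<n. exp (- (2 * s * a)) ^ j)))"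
      using s by (simp add: sum_distrib_left[symmetric])
    also have "\<dots> \<le> (\<delta> * ((\<kappa> * a) ^ Suc k)\<^sup>2) * (\<kappa> / (2 * s) * (1 + 8 * s))"
    proof (intro mult_left_mono)
      have "(2 * s * a) * (\<Sum>j<n. exp (- (2 * s * a)) ^ j) \<le> 1 + 2 * s * a"
        using s a_pos by (intro geometric_layer_sum) simp
      also have "\<dots> \<le> 1 + 8 * s" using s a_le by simp
      finally show "(2 * s * a) * (\<Sum>j<n. exp (- (2 * s * a)) ^ j) \<le> 1 + 8 * s" .
    qed (use pos s in auto)
    finally show ?thesis unfolding ka K_def by simp
  qed
  have far: "(\<Sum>i=Suc n..N. cell_len i * (layer_left k \<beta> \<delta> xs i)\<^sup>2) \<le> Y"
  proof -
    have "(\<Sum>i=Suc n..N. cell_len i * (layer_left k \<beta> \<delta> xs i)\<^sup>2) \<le> (\<Sum>i=Suc n..N. cell_len i * Y)"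
    proof (rule sum_mono)
      fix i assume i: "i \<in> {Suc n..N}"
      then have i': "i \<in> {1..N}" by auto
      have "(layer_left k \<beta> \<delta> xs i)\<^sup>2 \<le> Y" unfolding Y_def
        using i n by (intro power_mono layer_left_far[OF \<beta>0 \<sigma>k L_end i'] layer_left_nonneg[OF i']) auto
      then show "cell_len i * (layer_left k \<beta> \<delta> xs i)\<^sup>2 \<le> cell_len i * Y"
        using cell_len_pos[OF i'] by (intro mult_left_mono) auto
    qed
    also have "\<dots> \<le> (\<Sum>i=1..N. cell_len i * Y)"
    proof (rule sum_mono2)
      fix i assume "i \<in> {1..N} - {Suc n..N}"
      then have "i \<in> {1..N}" by blast
      from mult_nonneg_nonneg[OF less_imp_le[OF cell_len_pos[OF this]] Y0] show "0 \<le> cell_len i * Y" .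
    qed auto
    also have "\<dots> = Y" unfolding sum_distrib_right[symmetric] sum_cell_len by simp
    finally show ?thesis .
  qed
  have "(\<Sum>i=1..N. cell_len i * (layer_left k \<beta> \<delta> xs i)\<^sup>2) =
      (\<Sum>i=1..n. cell_len i * (layer_left k \<beta> \<delta> xs i)\<^sup>2) + (\<Sum>i=Suc n..N. cell_len i * (layer_left k \<beta> \<delta> xs i)\<^sup>2)"
    using sum.ub_add_nat[of 1 n "\<lambda>i. cell_len i * (layer_left k \<beta> \<delta> xs i)\<^sup>2" "3 * n"] n by simp
  then have "(\<Sum>i=1..N. cell_len i * (layer_left k \<beta> \<delta> xs i)\<^sup>2) \<le> G * X * K + Y" using near far by simp
  from wsum_layer_sum[OF cl this]
  have w: "wsum (layer_sum k \<beta> \<delta> xs) \<le> 3 * (H * Y + 2 * (G * X * K + Y))" unfolding Ycl .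
  have R: "R * e = (6 * H + 6 + 6 * G * (1 + K)) * (X + Y)"
    unfolding R_def e_def G_def H_def K_def s_def X_def Y_def by simp
  have "0 \<le> H" unfolding H_def by simp
  then have nn: "0 \<le> H * X" "0 \<le> H * Y" "0 \<le> G * X" "0 \<le> G * Y" "0 \<le> G * X * K" "0 \<le> G * Y * K"
    using X0 Y0 K0 G0 by (simp_all del: power_Suc)
  have exp: "(6 * H + 6 + 6 * G * (1 + K)) * (X + Y) =
    6 * (H * X) + 6 * (H * Y) + 6 * X + 6 * Y + 6 * (G * X) + 6 * (G * Y) + 6 * (G * X * K) + 6 * (G * Y * K)"
    by (simp add: algebra_simps del: power_Suc)
  have w': "3 * (H * Y + 2 * (G * X * K + Y)) = 3 * (H * Y) + 6 * (G * X * K) + 6 * Y"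
    by (simp add: algebra_simps)
  have w'': "3 * (H * Y + Y + G * X) = 3 * (H * Y) + 3 * Y + 3 * (G * X)" by (simp add: algebra_simps)
  show "wsum (layer_sum k \<beta> \<delta> xs) \<le> R * e" unfolding R exp using w[unfolded w'] nn X0 Y0 by linarith
  have \<delta>1: "\<delta> \<le> 1" using \<delta>N N4 by (simp add: order.trans[OF \<delta>N])
  have "(layer_left k \<beta> \<delta> xs 1)\<^sup>2 \<le> ((\<kappa> * a) ^ Suc k)\<^sup>2"
    using layer_left_bound[of 0] layer_left_nonneg[of 1 k \<beta>] N4 by (intro power_mono) auto
  then have "\<delta> * (layer_left k \<beta> \<delta> xs 1)\<^sup>2 \<le> G * X" unfolding ka[symmetric] using pos by (intro mult_left_mono) auto
  from layer_sum_last[OF cl \<beta>0 \<sigma>k L_end this \<delta>1]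
  have "\<delta> * (layer_sum k \<beta> \<delta> xs N)\<^sup>2 \<le> 3 * (H * Y + Y + G * X)" unfolding Ycl Y_def .
  then show "\<delta> * (layer_sum k \<beta> \<delta> xs N)\<^sup>2 \<le> R * e" unfolding R exp w'' using nn X0 Y0 by linarith
qed

end

section \<open>The three meshes together\<close>

lemma mesh_bounds:
  assumes \<sigma>: "\<sigma> \<ge> real k + 3/2" and \<beta>: "\<beta> > 0"
  shows "\<exists>R>0. \<forall>\<epsilon> N. \<epsilon> > 0 \<and> N \<ge> 4 \<and> 4 dvd N \<and> sqrt \<epsilon> \<le> 1 / real N \<and> mesh_tau mt \<sigma> \<beta> \<epsilon> N \<le> 1/4 \<longrightarrow>
    mesh (mesh_pt mt \<sigma> \<beta> \<epsilon> N) N \<and>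
    mesh.wsum (mesh_pt mt \<sigma> \<beta> \<epsilon> N) N (layer_sum k \<beta> (sqrt \<epsilon>) (mesh_pt mt \<sigma> \<beta> \<epsilon> N)) \<le> R * (err_bound mt k \<epsilon> N)\<^sup>2 \<and>
    sqrt \<epsilon> * (layer_sum k \<beta> (sqrt \<epsilon>) (mesh_pt mt \<sigma> \<beta> \<epsilon> N) N)\<^sup>2 \<le> R * (err_bound mt k \<epsilon> N)\<^sup>2"
proof -
  define \<kappa> where "\<kappa> = \<sigma> / \<beta>"
  have s0: "\<sigma> > 0" using \<sigma> by linarith
  have \<kappa>: "\<kappa> > 0" using s0 \<beta> by (simp add: \<kappa>_def)
  have \<kappa>\<beta>: "\<kappa> * \<beta> = \<sigma>" using \<beta> by (simp add: \<kappa>_def)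
  have \<sigma>k: "\<sigma> / \<beta> * \<beta> \<ge> real (Suc k)" using \<sigma> \<beta> by simp
  show ?thesis
  proof (cases "mt = S_mesh")
    case True
    define R where "R = 6 * ((2 + 4 * \<kappa>) ^ Suc k)\<^sup>2 + 6 + 6 * ((4 * \<kappa>) ^ Suc k)\<^sup>2 * (1 + \<kappa> * (1 + 8 * (\<kappa> * \<beta>)) / (2 * (\<kappa> * \<beta>)))"
    have R: "R > 0"
    proof -
      have "0 \<le> 6 * ((4 * \<kappa>) ^ Suc k)\<^sup>2 * (1 + \<kappa> * (1 + 8 * (\<kappa> * \<beta>)) / (2 * (\<kappa> * \<beta>)))"
        using \<kappa> \<beta> by (intro mult_nonneg_nonneg add_nonneg_nonneg divide_nonneg_nonneg) auto
      moreover have "0 \<le> 6 * ((2 + 4 * \<kappa>) ^ Suc k)\<^sup>2" by simp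
      ultimately show ?thesis unfolding R_def by linarith
    qed
    show ?thesis
    proof (intro exI[of _ R] conjI[OF R] allI impI)
      fix \<epsilon> N
      assume *: "\<epsilon> > 0 \<and> N \<ge> 4 \<and> 4 dvd N \<and> sqrt \<epsilon> \<le> 1 / real N \<and> mesh_tau mt \<sigma> \<beta> \<epsilon> N \<le> 1/4"
      interpret graded_mesh "mesh_pt mt \<sigma> \<beta> \<epsilon> N" "\<lambda>i. mesh_phi mt N \<epsilon> (real i / real N)" N "\<sigma> / \<beta>" "sqrt \<epsilon>" "mesh_tau mt \<sigma> \<beta> \<epsilon> N"
        using * s0 \<beta> by (intro graded_mesh_mesh_pt) (auto simp: mesh_phi_def True divide_strict_right_mono)
      interpret uniform_graded_mesh "mesh_pt mt \<sigma> \<beta> \<epsilon> N" "\<lambda>i. mesh_phi mt N \<epsilon> (real i / real N)" N "\<sigma> / \<beta>" "sqrt \<epsilon>" "mesh_tau mt \<sigma> \<beta> \<epsilon> N" \<beta> k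
        by standard (use * \<beta> \<sigma>k in \<open>auto simp: mesh_phi_def True\<close>)
      define X where "X = (ln (real N) / real N) ^ Suc k"
      define Y where "Y = 1 / real N ^ Suc k"
      have X0: "0 \<le> X" "0 \<le> Y" unfolding X_def Y_def using * by simp_all
      have "err_bound mt k \<epsilon> N = \<epsilon> powr (1/4) * X + Y" unfolding X_def Y_def by (simp add: err_bound_def True)
      moreover have "(\<epsilon> powr (1/4))\<^sup>2 = sqrt \<epsilon>"
        using * by (simp add: power2_eq_square powr_add[symmetric] powr_half_sqrt)
      \<comment> \<open>The square of the error bound exceeds the left side by a nonnegative cross
        term.\<close>
      ultimately have "sqrt \<epsilon> * X\<^sup>2 + Y\<^sup>2 \<le> (err_bound mt k \<epsilon> N)\<^sup>2"
        using X0 by (simp add: power2_sum power_mult_distrib)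
      then have le: "R * (sqrt \<epsilon> * X\<^sup>2 + Y\<^sup>2) \<le> R * (err_bound mt k \<epsilon> N)\<^sup>2" using R by (intro mult_left_mono) auto
      note b = uniform_mesh_bounds[folded \<kappa>_def, folded R_def X_def Y_def]
      show "mesh (mesh_pt mt \<sigma> \<beta> \<epsilon> N) N \<and>
        mesh.wsum (mesh_pt mt \<sigma> \<beta> \<epsilon> N) N (layer_sum k \<beta> (sqrt \<epsilon>) (mesh_pt mt \<sigma> \<beta> \<epsilon> N)) \<le> R * (err_bound mt k \<epsilon> N)\<^sup>2 \<and>
        sqrt \<epsilon> * (layer_sum k \<beta> (sqrt \<epsilon>) (mesh_pt mt \<sigma> \<beta> \<epsilon> N) N)\<^sup>2 \<le> R * (err_bound mt k \<epsilon> N)\<^sup>2"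
        using is_mesh order.trans[OF b(1) le] order.trans[OF b(2) le] by blast
    qed
  next
    case False
    define R where "R = 21 * ((8 * (1 + \<kappa>)) ^ Suc k)\<^sup>2"
    have R: "R > 0" unfolding R_def using \<kappa> by simp
    show ?thesis
    proof (intro exI[of _ R] conjI[OF R] allI impI)
      fix \<epsilon> N
      assume *: "\<epsilon> > 0 \<and> N \<ge> 4 \<and> 4 dvd N \<and> sqrt \<epsilon> \<le> 1 / real N \<and> mesh_tau mt \<sigma> \<beta> \<epsilon> N \<le> 1/4"
      \<comment> \<open>The value of the argument of the logarithm at t = 1/4, the only point in
        which the two meshes differ.\<close>
      define c where "c = (if mt = BS_mesh then 1 / real N else sqrt \<epsilon>)"
      have c: "0 < c" "c \<le> 1 / real N" "sqrt \<epsilon> \<le> c" using * by (auto simp: c_def)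
      have "1 / real N \<le> 1 / 4" using * by (intro divide_left_mono) auto
      then have c1: "c \<le> 1 / 4" using c by linarith
      have phi: "mesh_phi mt N \<epsilon> t = - ln (1 - 4 * (1 - c) * t)" for t
        using False by (cases mt) (auto simp: mesh_phi_def c_def)
      have err: "err_bound mt k \<epsilon> N = 1 / real N ^ Suc k"
        using False by (cases mt) (auto simp: err_bound_def)
      have step: "mesh_phi mt N \<epsilon> (real i / real N) < mesh_phi mt N \<epsilon> (real (Suc i) / real N)" if "4 * Suc i \<le> N" for i
      proof -
        define t where "t = real (Suc i) / real N"
        have "4 * t \<le> 1" using that * by (simp add: t_def field_simps)
        then have "(1 - c) * (4 * t) \<le> (1 - c) * 1" using c1 by (intro mult_left_mono) auto
        then have "0 < 1 - 4 * (1 - c) * t" using c by (simp add: algebra_simps)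
        then have "0 < 1 - 4 * (1 - c) * (real (Suc i) / real N)" unfolding t_def .
        moreover have "1 - 4 * (1 - c) * (real (Suc i) / real N) < 1 - 4 * (1 - c) * (real i / real N)"
          using c1 * by (simp add: divide_strict_right_mono)
        ultimately show ?thesis unfolding phi by simp
      qed
      interpret graded_mesh "mesh_pt mt \<sigma> \<beta> \<epsilon> N" "\<lambda>i. mesh_phi mt N \<epsilon> (real i / real N)" N "\<sigma> / \<beta>" "sqrt \<epsilon>" "mesh_tau mt \<sigma> \<beta> \<epsilon> N"
        using * s0 \<beta> step by (intro graded_mesh_mesh_pt) auto
      interpret log_graded_mesh "mesh_pt mt \<sigma> \<beta> \<epsilon> N" "\<lambda>i. mesh_phi mt N \<epsilon> (real i / real N)" N "\<sigma> / \<beta>" "sqrt \<epsilon>" "mesh_tau mt \<sigma> \<beta> \<epsilon> N" c \<beta> k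
        by standard (use c \<beta> \<sigma>k phi in auto)
      note b = log_mesh_bounds[folded \<kappa>_def, folded R_def err]
      show "mesh (mesh_pt mt \<sigma> \<beta> \<epsilon> N) N \<and>
        mesh.wsum (mesh_pt mt \<sigma> \<beta> \<epsilon> N) N (layer_sum k \<beta> (sqrt \<epsilon>) (mesh_pt mt \<sigma> \<beta> \<epsilon> N)) \<le> R * (err_bound mt k \<epsilon> N)\<^sup>2 \<and>
        sqrt \<epsilon> * (layer_sum k \<beta> (sqrt \<epsilon>) (mesh_pt mt \<sigma> \<beta> \<epsilon> N) N)\<^sup>2 \<le> R * (err_bound mt k \<epsilon> N)\<^sup>2"
        using is_mesh b by blast
    qed
  qed
qed

section \<open>Decomposition of the solution\<close>

text \<open>A version of Schwarz's theorem in which the derivative of \<open>Fx\<close> in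
  \<open>y\<close> is not assumed to exist. \<open>F\<close> is an integral of \<open>Fy\<close> in
  \<open>y\<close>; differentiating it in \<open>x\<close> under the integral shows that
  \<open>Fx\<close> is an integral of the continuous \<open>Fxy\<close>. A compact interval around
  \<open>y\<close> keeps the integrals inside the open square.\<close>

lemma mixed_partial_derivative:
  assumes x: "x \<in> {0<..<1}" and y: "y \<in> {0<..<1}"
    and Fx: "\<And>x y. x \<in> {0<..<1} \<Longrightarrow> y \<in> {0<..<1} \<Longrightarrow> ((\<lambda>t. F t y) has_real_derivative Fx x y) (at x)"
    and Fy: "\<And>x y. x \<in> {0<..<1} \<Longrightarrow> y \<in> {0<..<1} \<Longrightarrow> (F x has_real_derivative Fy x y) (at y)"
    and Fxy: "\<And>x y. x \<in> {0<..<1} \<Longrightarrow> y \<in> {0<..<1} \<Longrightarrow> ((\<lambda>t. Fy t y) has_real_derivative Fxy x y) (at x)"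
    and cFy: "cont2 {0<..<1} {0<..<1} Fy" and cFxy: "cont2 {0<..<1} {0<..<1} Fxy"
  shows "(Fx x has_real_derivative Fxy x y) (at y)"
proof -
  define c where "c = y / 2"
  define d where "d = (1 + y) / 2"
  have cd: "0 < c" "c < y" "y < d" "d < 1" using y by (auto simp: c_def d_def)
  have F: "Fx x t - Fx x c = integral {c..t} (Fxy x)" if t: "t \<in> {c..d}" for t
  proof -
    have sub: "{c..t} \<subseteq> {0<..<1}" using cd t by auto
    have I: "F z t - F z c = integral (cbox c t) (Fy z)" if z: "z \<in> {0<..<1}" for z
    proof -
      have "(F z has_vector_derivative Fy z s) (at s within {c..t})" if "s \<in> {c..t}" for s
        unfolding has_real_derivative_iff_has_vector_derivative[symmetric]
        by (rule has_field_derivative_at_within[OF Fy[OF z]]) (use that sub in blast)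
      then have "(Fy z has_integral (F z t - F z c)) {c..t}"
        using t by (intro fundamental_theorem_of_calculus) auto
      then show ?thesis by (simp add: integral_unique)
    qed
    have "((\<lambda>z. integral (cbox c t) (Fy z)) has_real_derivative integral (cbox c t) (Fxy x)) (at x within {0<..<1})"
    proof (rule leibniz_rule_field_derivative[where U = "{0<..<1}" and f = Fy and fx = Fxy])
      show "((\<lambda>z. Fy z s) has_real_derivative Fxy z s) (at z within {0<..<1})"
        if "z \<in> {0<..<1}" "s \<in> cbox c t" for z s
        by (rule has_field_derivative_at_within[OF Fxy[OF that(1)]]) (use that(2) sub in auto)
      show "Fy z integrable_on cbox c t" if "z \<in> {0<..<1}" for z
        using integrable_continuous_interval[OF continuous_on_subset[OF cont2_slice_y[OF cFy that] sub]] by simp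
      show "continuous_on ({0<..<1} \<times> cbox c t) (\<lambda>(x, t). Fxy x t)"
        using cont2_subset[OF cFxy subset_refl sub] unfolding cont2_def by (simp add: split_beta)
    qed (use x in \<open>auto simp: convex_real_interval\<close>)
    then have 1: "((\<lambda>z. integral (cbox c t) (Fy z)) has_real_derivative integral (cbox c t) (Fxy x)) (at x)"
      using x at_within_open[of x "{0<..<1}"] by simp
    have "((\<lambda>z. F z t - F z c) has_real_derivative Fx x t - Fx x c) (at x)"
      using sub t cd x by (intro DERIV_diff Fx) auto
    moreover have "eventually (\<lambda>z. z \<in> {0<..<1}) (nhds x)" using x by (intro eventually_nhds_in_open) auto
    then have "eventually (\<lambda>z. F z t - F z c = integral (cbox c t) (Fy z)) (nhds x)"
      by eventually_elim (rule I)
    ultimately have "((\<lambda>z. integral (cbox c t) (Fy z)) has_real_derivative Fx x t - Fx x c) (at x)"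
      by (subst (asm) DERIV_cong_ev[OF refl _ refl])
    from DERIV_unique[OF this 1] show ?thesis by simp
  qed
  have cs: "continuous_on {c..d} (Fxy x)"
    by (rule continuous_on_subset[OF cont2_slice_y[OF cFxy x]]) (use cd in auto)
  have "((\<lambda>t. Fx x c + integral {c..t} (Fxy x)) has_real_derivative 0 + Fxy x y) (at y within {c..d})"
    using cd by (intro DERIV_add DERIV_const integral_has_real_derivative[OF cs]) auto
  then have *: "((\<lambda>t. Fx x c + integral {c..t} (Fxy x)) has_real_derivative Fxy x y) (at y within {c..d})" by simp
  have e: "Fx x c + integral {c..t} (Fxy x) = Fx x t" if "t \<in> {c..d}" for t
    using F[OF that] by linarith
  have m: "y \<in> {c..d}" using cd by simp
  have "(Fx x has_real_derivative Fxy x y) (at y within {c..d})"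
    using has_field_derivative_transform_within[where d = 1, OF * _ m e] by simp
  then show ?thesis using cd at_within_Icc_at[of c y d] by simp
qed

text \<open>Bounded first derivatives make \<open>F\<close> Lipschitz, hence uniformly continuous,
  and such a function extends to the closure. Needed because the projections on cells at the
  boundary use values there.\<close>

lemma continuous_extension_square:
  assumes Fx: "\<And>x y. x \<in> {0<..<1} \<Longrightarrow> y \<in> {0<..<1} \<Longrightarrow> ((\<lambda>t. F t y) has_real_derivative Fx x y) (at x)"
    and Fy: "\<And>x y. x \<in> {0<..<1} \<Longrightarrow> y \<in> {0<..<1} \<Longrightarrow> (F x has_real_derivative Fy x y) (at y)"
    and bx: "\<And>x y. x \<in> {0<..<1} \<Longrightarrow> y \<in> {0<..<1} \<Longrightarrow> \<bar>Fx x y\<bar> \<le> M"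
    and b_y: "\<And>x y. x \<in> {0<..<1} \<Longrightarrow> y \<in> {0<..<1} \<Longrightarrow> \<bar>Fy x y\<bar> \<le> M"
  shows "\<exists>H. cont2 {0..1} {0..1} H \<and> (\<forall>x\<in>{0<..<1}. \<forall>y\<in>{0<..<1}. H x y = F x y)"
proof -
  let ?O = "{0<..<1::real} \<times> {0<..<1::real}" and ?f = "\<lambda>z. F (fst z) (snd z)"
  have M0: "0 \<le> M" using bx[of "1/2" "1/2"] by auto
  have lx: "\<bar>F x1 y - F x2 y\<bar> \<le> M * \<bar>x1 - x2\<bar>" if "x1 \<in> {0<..<1}" "x2 \<in> {0<..<1}" "y \<in> {0<..<1}" for x1 x2 y
    using field_differentiable_bound[of "{0<..<1}" "\<lambda>t. F t y" "\<lambda>t. Fx t y" M x1 x2] that Fx bx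
    by (auto simp: convex_real_interval intro: has_field_derivative_at_within)
  have ly: "\<bar>F x y1 - F x y2\<bar> \<le> M * \<bar>y1 - y2\<bar>" if "y1 \<in> {0<..<1}" "y2 \<in> {0<..<1}" "x \<in> {0<..<1}" for y1 y2 x
    using field_differentiable_bound[of "{0<..<1}" "F x" "Fy x" M y1 y2] that Fy b_y
    by (auto simp: convex_real_interval intro: has_field_derivative_at_within)
  have "(2 * M)-lipschitz_on ?O ?f"
  proof (rule lipschitz_onI)
    fix z w assume zw: "z \<in> ?O" "w \<in> ?O"
    have "\<bar>?f z - ?f w\<bar> \<le> \<bar>F (fst z) (snd z) - F (fst w) (snd z)\<bar> + \<bar>F (fst w) (snd z) - F (fst w) (snd w)\<bar>" by linarith
    also have "\<dots> \<le> M * \<bar>fst z - fst w\<bar> + M * \<bar>snd z - snd w\<bar>"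
      using zw by (intro add_mono lx ly) auto
    also have "\<dots> \<le> M * dist z w + M * dist z w"
      using M0 dist_fst_le[of z w] dist_snd_le[of z w] by (intro add_mono mult_left_mono) (auto simp: dist_real_def)
    finally show "dist (?f z) (?f w) \<le> 2 * M * dist z w" by (simp add: dist_real_def)
  qed (use M0 in simp)
  then have "uniformly_continuous_on ?O ?f" by (rule lipschitz_on_uniformly_continuous)
  then obtain g where g: "uniformly_continuous_on (closure ?O) g" "\<And>z. z \<in> ?O \<Longrightarrow> ?f z = g z"
    using uniformly_continuous_on_extension_on_closure[of ?O ?f] by metis
  have cl: "closure ?O = {0..1} \<times> {0..1}" by (simp add: closure_Times)
  have "cont2 {0..1} {0..1} (\<lambda>x y. g (x, y))"
    using uniformly_continuous_imp_continuous[OF g(1)] unfolding cl cont2_def by simp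
  moreover have "\<forall>x\<in>{0<..<1}. \<forall>y\<in>{0<..<1}. g (x, y) = F x y" using g(2)[of "(_, _)"] by auto
  ultimately show ?thesis by (intro exI[of _ "\<lambda>x y. g (x, y)"]) blast
qed

lemma cont2_eq_on_closed:
  assumes g: "cont2 {0..1} {0..1} g" and h: "cont2 {0..1} {0..1} h"
    and e: "\<And>x y. x \<in> {0<..<1} \<Longrightarrow> y \<in> {0<..<1} \<Longrightarrow> g x y = h x y" and xy: "x \<in> {0..1}" "y \<in> {0..1}"
  shows "g x y = h x y"
proof -
  have 1: "\<bar>g s y - h s y\<bar> \<le> 0" if s: "s \<in> {0<..<1}" for s
  proof (rule le_on_closed_of_open[of 0 1 "\<lambda>t. g s t - h s t"])
    have "s \<in> {0..1}" using s by simp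
    then show "continuous_on {0..1} (\<lambda>t. g s t - h s t)"
      by (intro continuous_on_diff cont2_slice_y[OF g] cont2_slice_y[OF h])
  qed (use s e xy in auto)
  have "\<bar>g x y - h x y\<bar> \<le> 0"
  proof (rule le_on_closed_of_open[of 0 1 "\<lambda>s. g s y - h s y"])
    show "continuous_on {0..1} (\<lambda>s. g s y - h s y)"
      by (intro continuous_on_diff cont2_slice_x[OF g] cont2_slice_x[OF h] xy)
  qed (use 1 xy in auto)
  then show ?thesis by simp
qed

text \<open>On interior lines \<open>u\<close> is the integral of \<open>ux\<close>; by continuity
  this persists on the lines y = 0 and y = 1 and up to the ends. It is applied where a projection in
  \<open>y\<close> evaluates \<open>u\<close> and \<open>ux\<close> on the boundary.\<close>

lemma tangential_derivative_closed:
  assumes u: "cont2 {0..1} {0..1} u" and ux: "cont2 {0..1} {0..1} ux"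
    and d: "\<And>x y. x \<in> {0<..<1} \<Longrightarrow> y \<in> {0<..<1} \<Longrightarrow> ((\<lambda>t. u t y) has_real_derivative ux x y) (at x)"
    and xy: "x \<in> {0..1}" "y \<in> {0..1}"
  shows "((\<lambda>t. u t y) has_real_derivative ux x y) (at x within {0..1})"
proof -
  have F: "u t y - u 0 y = integral {0..t} (\<lambda>s. ux s y)" if t: "t \<in> {0..1}" for t
  proof -
    have "\<bar>u t y - u 0 y - integral {0..t} (\<lambda>s. ux s y)\<bar> \<le> 0"
    proof (rule le_on_closed_of_open[of 0 1 "\<lambda>y. u t y - u 0 y - integral {0..t} (\<lambda>s. ux s y)"])
      have "continuous_on {0..1} (\<lambda>y. integral {0..t} (\<lambda>s. ux s y))"
        by (rule integral_slice_continuous[OF cont2_subset[OF ux]]) (use t in auto)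
      then show "continuous_on {0..1} (\<lambda>y. u t y - u 0 y - integral {0..t} (\<lambda>s. ux s y))"
        by (intro continuous_on_diff cont2_slice_y[OF u] t) auto
      fix z :: real assume z: "z \<in> {0<..<1}"
      then have z': "z \<in> {0..1}" by auto
      have "((\<lambda>s. ux s z) has_integral (u t z - u 0 z)) {0..t}"
        using t z by (intro fundamental_theorem_of_calculus_interior continuous_on_subset[OF cont2_slice_x[OF u z']])
          (auto simp: has_real_derivative_iff_has_vector_derivative[symmetric] intro!: d)
      then show "\<bar>u t z - u 0 z - integral {0..t} (\<lambda>s. ux s z)\<bar> \<le> 0" by (simp add: integral_unique)
    qed (use xy in auto)
    then show ?thesis by simp
  qed
  have "((\<lambda>t. u 0 y + integral {0..t} (\<lambda>s. ux s y)) has_real_derivative 0 + ux x y) (at x within {0..1})"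
    by (intro DERIV_add DERIV_const integral_has_real_derivative[OF cont2_slice_x[OF ux xy(2)] xy(1)])
  then have *: "((\<lambda>t. u 0 y + integral {0..t} (\<lambda>s. ux s y)) has_real_derivative ux x y) (at x within {0..1})" by simp
  have e: "u 0 y + integral {0..t} (\<lambda>s. ux s y) = u t y" if "t \<in> {0..1}" for t
    using F[OF that] by linarith
  show ?thesis using has_field_derivative_transform_within[where d = 1, OF * _ xy(1) e] by simp
qed

text \<open>The kind \<open>d\<close> of a component in one variable: \<open>d = 0\<close> is smooth, \<open>d = 1\<close> and \<open>d = 2\<close> are
  boundary layers at the left and the right end point.\<close>

definition lay_mu :: "nat \<Rightarrow> real \<Rightarrow> real" where
  "lay_mu d \<delta> = (if d = 0 then 1 else 1 / \<delta>)"

definition lay_om :: "nat \<Rightarrow> real \<Rightarrow> real \<Rightarrow> real \<Rightarrow> real" where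
  "lay_om d \<beta> \<delta> t = (if d = 0 then 1 else if d = 1 then exp (- \<beta> * t / \<delta>) else exp (- \<beta> * (1 - t) / \<delta>))"

text \<open>Concerns the first variable only; the other direction is this property of the reflected
  function. The bound on \<open>g\<close> serves the stability estimate and the one on the
  derivative of order k + 1 the Taylor estimate.\<close>

definition layer_reg :: "nat \<Rightarrow> real \<Rightarrow> real \<Rightarrow> nat \<Rightarrow> real \<Rightarrow> (real \<Rightarrow> real \<Rightarrow> real) \<Rightarrow> bool" where
  "layer_reg k \<beta> \<delta> d M g \<longleftrightarrow> cont2 {0..1} {0..1} g \<and> (\<exists>f. \<forall>x\<in>{0<..<1}. \<forall>y\<in>{0<..<1}.
     f 0 x y = g x y \<and> (\<forall>m\<le>k. ((\<lambda>t. f m t y) has_real_derivative f (Suc m) x y) (at x)) \<and>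
     \<bar>g x y\<bar> \<le> M * lay_om d \<beta> \<delta> x \<and> \<bar>f (Suc k) x y\<bar> \<le> M * lay_mu d \<delta> ^ Suc k * lay_om d \<beta> \<delta> x)"

text \<open>Two bounds hold in the same cell: the approximation order, useful where the cell is
  finer than the layer, and plain stability, useful where it is coarser. Taking the smaller one
  produces the minimum in \<open>layer_left\<close> and \<open>layer_right\<close>.\<close>

lemma (in mesh) layer_reg_error:
  assumes K: "kern_ok k K" and C: "proj_stable k K C" and g: "layer_reg k \<beta> \<delta> d M g"
    and \<beta>: "\<beta> > 0" and \<delta>: "\<delta> > 0" and M: "0 \<le> M"
    and i: "i \<in> {1..N}" and x: "x \<in> {xs (i-1)..xs i}" and y: "y \<in> {0<..<1}"
  shows "\<bar>g x y - projx k K (xs (i-1)) (xs i) g x y\<bar> \<le> (1 + C) * M * layer_sum k \<beta> \<delta> xs i"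
proof -
  obtain f where gc: "cont2 {0..1} {0..1} g"
    and f: "\<And>x. x \<in> {0<..<1} \<Longrightarrow> f 0 x y = g x y"
      "\<And>x m. x \<in> {0<..<1} \<Longrightarrow> m \<le> k \<Longrightarrow> ((\<lambda>t. f m t y) has_real_derivative f (Suc m) x y) (at x)"
      "\<And>x. x \<in> {0<..<1} \<Longrightarrow> \<bar>g x y\<bar> \<le> M * lay_om d \<beta> \<delta> x"
      "\<And>x. x \<in> {0<..<1} \<Longrightarrow> \<bar>f (Suc k) x y\<bar> \<le> M * lay_mu d \<delta> ^ Suc k * lay_om d \<beta> \<delta> x"
    using g y unfolding layer_reg_def by blast
  define a where "a = xs (i - 1)"
  define b where "b = xs i"
  have ab: "a < b" unfolding a_def b_def by (rule xs_less[OF i])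
  have sub: "{a<..<b} \<subseteq> {0<..<1}" unfolding a_def b_def by (rule cell_sub_open[OF i])
  have x': "x \<in> {a..b}" using x by (simp add: a_def b_def)
  have y': "y \<in> {0..1}" using y by auto
  have cg: "continuous_on {a..b} (\<lambda>t. g t y)"
    unfolding a_def b_def by (rule continuous_on_subset[OF cont2_slice_x[OF gc y'] cell_sub[OF i]])
  have C0: "0 \<le> C" using C by (simp add: proj_stable_def)
  \<comment> \<open>An upper bound of the layer weight in the cell, attained at the end nearest to
    the layer.\<close>
  define \<Omega> where "\<Omega> = (if d = 0 then 1 else if d = 1 then exp (- \<beta> * a / \<delta>) else exp (- \<beta> * (1 - b) / \<delta>))"
  have \<Omega>: "lay_om d \<beta> \<delta> t \<le> \<Omega>" if "t \<in> {a<..<b}" for t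
    using that \<beta> \<delta> unfolding lay_om_def \<Omega>_def by (auto intro!: divide_right_mono)
  have \<mu>: "0 \<le> lay_mu d \<delta>" using \<delta> by (simp add: lay_mu_def)
  have e1: "\<bar>g x y - proj k K a b (\<lambda>t. g t y) x\<bar> \<le> (1 + C) * ((b - a) ^ Suc k * (M * lay_mu d \<delta> ^ Suc k * \<Omega>))"
  proof (rule proj_error[OF K C ab cg, where f = "\<lambda>m t. f m t y"])
    fix t assume t: "t \<in> {a<..<b}"
    then have t': "t \<in> {0<..<1}" using sub by blast
    show "\<bar>f (Suc k) t y\<bar> \<le> M * lay_mu d \<delta> ^ Suc k * \<Omega>"
      using M \<mu> by (intro order.trans[OF f(4)[OF t'] mult_left_mono[OF \<Omega>[OF t]]] mult_nonneg_nonneg zero_le_power)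
    show "f 0 t y = g t y" by (rule f(1)[OF t'])
    show "((\<lambda>t. f m t y) has_real_derivative f (Suc m) t y) (at t)" if "m \<le> k" for m by (rule f(2)[OF t' that])
  qed (rule x')
  have bnd: "\<bar>g t y\<bar> \<le> M * \<Omega>" if t: "t \<in> {a<..<b}" for t
    using sub t by (intro order.trans[OF f(3) mult_left_mono[OF \<Omega>[OF t] M]]) auto
  have "\<bar>proj k K a b (\<lambda>t. g t y) x\<bar> \<le> C * (M * \<Omega>)"
    using C ab cg bnd x' unfolding proj_stable_def by blast
  moreover have "\<bar>g x y\<bar> \<le> M * \<Omega>" by (rule le_on_closed_of_open[OF ab cg bnd x'])
  ultimately have e2: "\<bar>g x y - proj k K a b (\<lambda>t. g t y) x\<bar> \<le> (1 + C) * (M * \<Omega>)"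
    by (simp add: algebra_simps)
  define h where "h = b - a"
  have h: "0 < h" using ab by (simp add: h_def)
  have e1': "(1 + C) * ((b - a) ^ Suc k * (M * lay_mu d \<delta> ^ Suc k * \<Omega>)) = (1 + C) * M * ((h * lay_mu d \<delta>) ^ Suc k * \<Omega>)"
    unfolding h_def by (simp only: power_mult_distrib mult_ac)
  have CM: "0 \<le> (1 + C) * M" using C0 M by simp
  have "\<bar>g x y - proj k K a b (\<lambda>t. g t y) x\<bar> \<le> (1 + C) * M * (min 1 ((h * lay_mu d \<delta>) ^ Suc k) * \<Omega>)"
    using e1 e2 unfolding e1' by (simp add: min_def del: power_Suc)
  also have "\<dots> \<le> (1 + C) * M * layer_sum k \<beta> \<delta> xs i"
  proof (rule mult_left_mono[OF _ CM])
    have ls: "layer_sum k \<beta> \<delta> xs i = h ^ Suc k + min 1 ((h / \<delta>) ^ Suc k) * exp (- \<beta> * a / \<delta>) + min 1 ((h / \<delta>) ^ Suc k) * exp (- \<beta> * (1 - b) / \<delta>)"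
      unfolding layer_sum_def layer_left_def layer_right_def h_def a_def b_def ..
    have nn: "0 \<le> h ^ Suc k" "0 \<le> min 1 ((h / \<delta>) ^ Suc k) * exp (- \<beta> * a / \<delta>)" "0 \<le> min 1 ((h / \<delta>) ^ Suc k) * exp (- \<beta> * (1 - b) / \<delta>)"
      using h \<delta> by (simp_all del: power_Suc)
    consider "d = 0" | "d = 1" | "d \<noteq> 0" "d \<noteq> 1" by blast
    then show "min 1 ((h * lay_mu d \<delta>) ^ Suc k) * \<Omega> \<le> layer_sum k \<beta> \<delta> xs i"
    proof cases
      case 1
      then have "min 1 ((h * lay_mu d \<delta>) ^ Suc k) * \<Omega> \<le> h ^ Suc k" by (simp add: lay_mu_def \<Omega>_def del: power_Suc)
      then show ?thesis unfolding ls using nn by linarith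
    next
      case 2
      then have "min 1 ((h * lay_mu d \<delta>) ^ Suc k) * \<Omega> = min 1 ((h / \<delta>) ^ Suc k) * exp (- \<beta> * a / \<delta>)"
        by (simp add: lay_mu_def \<Omega>_def del: power_Suc)
      then show ?thesis unfolding ls using nn by linarith
    next
      case 3
      then have "min 1 ((h * lay_mu d \<delta>) ^ Suc k) * \<Omega> = min 1 ((h / \<delta>) ^ Suc k) * exp (- \<beta> * (1 - b) / \<delta>)"
        by (simp add: lay_mu_def \<Omega>_def del: power_Suc)
      then show ?thesis unfolding ls using nn by linarith
    qed
  qed
  finally show ?thesis unfolding projx_def a_def b_def .
qed

definition layer_decomp :: "nat \<Rightarrow> real \<Rightarrow> real \<Rightarrow> real \<Rightarrow> (real \<Rightarrow> real \<Rightarrow> real) \<Rightarrow> bool" where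
  "layer_decomp k \<beta> \<delta> M g \<longleftrightarrow> (\<exists>d G. (\<forall>c<9. layer_reg k \<beta> \<delta> (d c) M (G c)) \<and>
     (\<forall>x\<in>{0..1}. \<forall>y\<in>{0..1}. g x y = (\<Sum>c<9::nat. G c x y)))"

lemma (in mesh) layer_decomp_error:
  assumes K: "kern_ok k K" and C: "proj_stable k K C" and g: "layer_decomp k \<beta> \<delta> M g"
    and \<beta>: "\<beta> > 0" and \<delta>: "\<delta> > 0" and M: "0 \<le> M"
    and i: "i \<in> {1..N}" and x: "x \<in> {xs (i-1)..xs i}" and y: "y \<in> {0<..<1}"
  shows "\<bar>g x y - projx k K (xs (i-1)) (xs i) g x y\<bar> \<le> 9 * ((1 + C) * M * layer_sum k \<beta> \<delta> xs i)"
proof -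
  obtain d G where G: "\<And>c. c < 9 \<Longrightarrow> layer_reg k \<beta> \<delta> (d c) M (G c)"
    and e: "\<And>x y. x \<in> {0..1} \<Longrightarrow> y \<in> {0..1} \<Longrightarrow> g x y = (\<Sum>c<9::nat. G c x y)"
    using g unfolding layer_decomp_def by blast
  have y': "y \<in> {0..1}" using y by auto
  have Kc: "kern_cont K" using K by (simp add: kern_ok_def)
  have cG: "continuous_on {xs (i-1)..xs i} (\<lambda>t. G c t y)" if "c \<in> {..<9}" for c
  proof -
    have "cont2 {0..1} {0..1} (G c)" using G that unfolding layer_reg_def by blast
    from continuous_on_subset[OF cont2_slice_x[OF this y'] cell_sub[OF i]] show ?thesis .
  qed
  have "projx k K (xs (i-1)) (xs i) g x y = proj k K (xs (i-1)) (xs i) (\<lambda>t. \<Sum>c<9. G c t y) x"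
    unfolding projx_def by (rule proj_cong[OF xs_less[OF i]]) (rule e[OF cell_mem[OF i] y'])
  also have "\<dots> = (\<Sum>c<9. projx k K (xs (i-1)) (xs i) (G c) x y)"
    unfolding projx_def by (rule proj_sum[OF Kc xs_less[OF i] cG finite_lessThan])
  finally have "\<bar>g x y - projx k K (xs (i-1)) (xs i) g x y\<bar> = \<bar>\<Sum>c<9. G c x y - projx k K (xs (i-1)) (xs i) (G c) x y\<bar>"
    by (simp add: e[OF cell_mem[OF i x] y'] sum_subtractf)
  also have "\<dots> \<le> (\<Sum>c<9::nat. \<bar>G c x y - projx k K (xs (i-1)) (xs i) (G c) x y\<bar>)" by (rule sum_abs)
  also have "\<dots> \<le> (\<Sum>c<9::nat. (1 + C) * M * layer_sum k \<beta> \<delta> xs i)"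
    by (rule sum_mono) (rule layer_reg_error[OF K C G \<beta> \<delta> M i x y], simp)
  finally show ?thesis by simp
qed

section \<open>Derivatives and layer bounds of the components\<close>

lemma pd_Suc_left: "pd (Suc i) j g = pdx (pd i j g)"
  by (simp add: pd_def)

lemma pd_Suc_right: "pd 0 (Suc j) g = pdy (pd 0 j g)"
  by (simp add: pd_def)

lemma C_mixed_dx:
  assumes "C_mixed n g" "i < n" "j \<le> n" "x \<in> {0<..<1}" "y \<in> {0<..<1}"
  shows "((\<lambda>t. pd i j g t y) has_real_derivative pd (Suc i) j g x y) (at x)"
proof -
  have "(\<lambda>t. pd i j g t y) differentiable (at x)"
    using assms unfolding C_mixed_def in_open_sq_def by auto
  then show ?thesis unfolding pd_Suc_left pdx_def by (simp add: DERIV_deriv_iff_real_differentiable)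
qed

lemma C_mixed_cont:
  assumes "C_mixed n g" "i \<le> n" "j \<le> n"
  shows "cont2 {0<..<1} {0<..<1} (pd i j g)"
  unfolding cont2_def
proof (rule continuous_at_imp_continuous_on, rule ballI)
  fix z :: "real \<times> real" assume "z \<in> {0<..<1} \<times> {0<..<1}"
  then have "in_open_sq (fst z) (snd z)" by (auto simp: in_open_sq_def)
  then have "continuous (at (fst z, snd z)) (\<lambda>z. pd i j g (fst z) (snd z))"
    using assms unfolding C_mixed_def by blast
  then show "isCont (\<lambda>z. pd i j g (fst z) (snd z)) z" by simp
qed

text \<open>\<open>pd\<close> applies the derivatives in \<open>y\<close> first, and
  differentiability in \<open>y\<close> is given only when no derivative in \<open>x\<close> has
  been taken. Each further derivative in \<open>x\<close> is exchanged by
  \<open>mixed_partial_derivative\<close>.\<close>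

lemma C_mixed_dy:
  assumes g: "C_mixed n g" and j: "j < n"
  shows "i \<le> n \<Longrightarrow> x \<in> {0<..<1} \<Longrightarrow> y \<in> {0<..<1} \<Longrightarrow> (pd i j g x has_real_derivative pd i (Suc j) g x y) (at y)"
proof (induction i arbitrary: x y)
  case 0
  have "(\<lambda>t. pd 0 j g x t) differentiable (at y)"
    using g j 0 unfolding C_mixed_def in_open_sq_def by auto
  then show ?case unfolding pd_Suc_right pdy_def by (simp add: DERIV_deriv_iff_real_differentiable)
next
  case (Suc i)
  show ?case
  proof (rule mixed_partial_derivative[OF Suc.prems(2,3), where F = "pd i j g" and Fy = "pd i (Suc j) g"])
    show "((\<lambda>t. pd i j g t y) has_real_derivative pd (Suc i) j g x y) (at x)" if "x \<in> {0<..<1}" "y \<in> {0<..<1}" for x y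
      by (rule C_mixed_dx[OF g _ _ that]) (use Suc.prems j in auto)
    show "(pd i j g x has_real_derivative pd i (Suc j) g x y) (at y)" if "x \<in> {0<..<1}" "y \<in> {0<..<1}" for x y
      by (rule Suc.IH[OF _ that]) (use Suc.prems in auto)
    show "((\<lambda>t. pd i (Suc j) g t y) has_real_derivative pd (Suc i) (Suc j) g x y) (at x)" if "x \<in> {0<..<1}" "y \<in> {0<..<1}" for x y
      by (rule C_mixed_dx[OF g _ _ that]) (use Suc.prems j in auto)
  qed (rule C_mixed_cont[OF g]; use Suc.prems j in simp)+
qed

text \<open>A common format for all components: a smooth direction contributes factors 1, a layer
  direction costs 1 / \<delta> for each derivative and carries its exponential.\<close>

definition layer_bound :: "nat \<Rightarrow> real \<Rightarrow> real \<Rightarrow> real \<Rightarrow> nat \<Rightarrow> nat \<Rightarrow> (real \<Rightarrow> real \<Rightarrow> real) \<Rightarrow> bool" where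
  "layer_bound n \<beta> \<delta> C dx dy h \<longleftrightarrow> C_mixed n h \<and> (\<forall>i\<le>n. \<forall>j\<le>n. \<forall>x\<in>{0<..<1}. \<forall>y\<in>{0<..<1}.
     \<bar>pd i j h x y\<bar> \<le> C * lay_mu dx \<delta> ^ i * lay_mu dy \<delta> ^ j * (lay_om dx \<beta> \<delta> x * lay_om dy \<beta> \<delta> y))"

lemma lay_om_bounds:
  assumes "\<beta> > 0" "\<delta> > 0" "x \<in> {0<..<1}" shows "0 \<le> lay_om d \<beta> \<delta> x" "lay_om d \<beta> \<delta> x \<le> 1"
  using assms by (auto simp: lay_om_def divide_nonneg_pos)

lemma lay_mu_bounds:
  assumes "\<delta> > 0" "\<delta> \<le> 1" shows "0 \<le> lay_mu d \<delta>" "\<delta> * lay_mu d \<delta> \<le> 1"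
  using assms by (auto simp: lay_mu_def)

lemma layer_bound_le:
  assumes h: "layer_bound n \<beta> \<delta> C dx dy h" and \<beta>: "\<beta> > 0" and \<delta>: "\<delta> > 0" "\<delta> \<le> 1" and C: "0 \<le> C"
    and ij: "i \<le> n" "j \<le> n" and xy: "x \<in> {0<..<1}" "y \<in> {0<..<1}"
  shows "\<bar>pd i j h x y\<bar> \<le> C * lay_mu dx \<delta> ^ i * lay_mu dy \<delta> ^ j * lay_om dx \<beta> \<delta> x"
    and "\<bar>pd i j h x y\<bar> \<le> C * lay_mu dx \<delta> ^ i * lay_mu dy \<delta> ^ j * lay_om dy \<beta> \<delta> y"
    and "\<bar>pd i j h x y\<bar> \<le> C * lay_mu dx \<delta> ^ i * lay_mu dy \<delta> ^ j"
proof -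
  let ?c = "C * lay_mu dx \<delta> ^ i * lay_mu dy \<delta> ^ j"
  have b: "\<bar>pd i j h x y\<bar> \<le> ?c * (lay_om dx \<beta> \<delta> x * lay_om dy \<beta> \<delta> y)"
    using h ij xy unfolding layer_bound_def by blast
  have c: "0 \<le> ?c" using C lay_mu_bounds(1)[OF \<delta>] by simp
  note ox = lay_om_bounds[OF \<beta> \<delta>(1) xy(1), of dx] and oy = lay_om_bounds[OF \<beta> \<delta>(1) xy(2), of dy]
  have "lay_om dx \<beta> \<delta> x * lay_om dy \<beta> \<delta> y \<le> lay_om dx \<beta> \<delta> x * 1" by (rule mult_left_mono[OF oy(2) ox(1)])
  from order.trans[OF b mult_left_mono[OF this c]] show 1: "\<bar>pd i j h x y\<bar> \<le> ?c * lay_om dx \<beta> \<delta> x" by simp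
  have "lay_om dx \<beta> \<delta> x * lay_om dy \<beta> \<delta> y \<le> 1 * lay_om dy \<beta> \<delta> y" by (rule mult_right_mono[OF ox(2) oy(1)])
  from order.trans[OF b mult_left_mono[OF this c]] show "\<bar>pd i j h x y\<bar> \<le> ?c * lay_om dy \<beta> \<delta> y" by simp
  from order.trans[OF 1 mult_left_mono[OF ox(2) c]] show "\<bar>pd i j h x y\<bar> \<le> ?c" by simp
qed

text \<open>The Lipschitz constant behind this grows like a power of 1 / \<delta>, which does no
  harm because only the existence of the extension matters.\<close>

lemma layer_bound_extension:
  assumes h: "layer_bound (k + 2) \<beta> \<delta> C dx dy h" and \<beta>: "\<beta> > 0" and \<delta>: "\<delta> > 0" "\<delta> \<le> 1" and C: "0 \<le> C"
    and ab: "a \<le> 1" "b \<le> 1"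
  shows "\<exists>H. cont2 {0..1} {0..1} H \<and> (\<forall>x\<in>{0<..<1}. \<forall>y\<in>{0<..<1}. H x y = pd a b h x y)"
proof (rule continuous_extension_square[where Fx = "pd (Suc a) b h" and Fy = "pd a (Suc b) h"
      and M = "C * lay_mu dx \<delta> ^ Suc a * lay_mu dy \<delta> ^ b + C * lay_mu dx \<delta> ^ a * lay_mu dy \<delta> ^ Suc b"])
  have m: "C_mixed (k + 2) h" using h by (simp add: layer_bound_def)
  note mu = lay_mu_bounds(1)[OF \<delta>]
  have nn: "0 \<le> C * lay_mu dx \<delta> ^ i * lay_mu dy \<delta> ^ j" for i j
    using C mu by (intro mult_nonneg_nonneg zero_le_power) auto
  fix x y :: real assume xy: "x \<in> {0<..<1}" "y \<in> {0<..<1}"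
  show "((\<lambda>t. pd a b h t y) has_real_derivative pd (Suc a) b h x y) (at x)"
    by (rule C_mixed_dx[OF m _ _ xy]) (use ab in auto)
  show "(pd a b h x has_real_derivative pd a (Suc b) h x y) (at y)"
    by (rule C_mixed_dy[OF m _ _ xy]) (use ab in auto)
  have "\<bar>pd (Suc a) b h x y\<bar> \<le> C * lay_mu dx \<delta> ^ Suc a * lay_mu dy \<delta> ^ b"
    by (rule layer_bound_le(3)[OF h \<beta> \<delta> C _ _ xy]) (use ab in auto)
  then show "\<bar>pd (Suc a) b h x y\<bar> \<le> C * lay_mu dx \<delta> ^ Suc a * lay_mu dy \<delta> ^ b + C * lay_mu dx \<delta> ^ a * lay_mu dy \<delta> ^ Suc b"
    using nn[of a "Suc b"] by linarith
  have "\<bar>pd a (Suc b) h x y\<bar> \<le> C * lay_mu dx \<delta> ^ a * lay_mu dy \<delta> ^ Suc b"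
    by (rule layer_bound_le(3)[OF h \<beta> \<delta> C _ _ xy]) (use ab in auto)
  then show "\<bar>pd a (Suc b) h x y\<bar> \<le> C * lay_mu dx \<delta> ^ Suc a * lay_mu dy \<delta> ^ b + C * lay_mu dx \<delta> ^ a * lay_mu dy \<delta> ^ Suc b"
    using nn[of "Suc a" b] by linarith
qed

text \<open>A first derivative has order up to k + 2 after k + 1 further differentiations, which is
  the order provided by the regularity assumption. The factor \<open>c\<close> will be 1 for
  \<open>u\<close> and \<epsilon> for the fluxes, where it outweighs the one power of 1 / \<delta>
  lost by differentiating.\<close>

lemma layer_reg_pd:
  assumes h: "layer_bound (k + 2) \<beta> \<delta> C dx dy h" and \<beta>: "\<beta> > 0" and \<delta>: "\<delta> > 0" "\<delta> \<le> 1" and C: "0 \<le> C"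
    and ab: "a \<le> 1" "b \<le> 1" and H: "cont2 {0..1} {0..1} H" and e: "\<And>x y. x \<in> {0<..<1} \<Longrightarrow> y \<in> {0<..<1} \<Longrightarrow> H x y = pd a b h x y"
    and c: "0 \<le> c" and M: "c * (C * lay_mu dx \<delta> ^ a * lay_mu dy \<delta> ^ b) \<le> M"
  shows "layer_reg k \<beta> \<delta> dx M (\<lambda>x y. c * H x y)" and "layer_reg k \<beta> \<delta> dy M (\<lambda>x y. c * H y x)"
proof -
  have m: "C_mixed (k + 2) h" using h by (simp add: layer_bound_def)
  note mu = lay_mu_bounds(1)[OF \<delta>]
  have s: "c * (C * lay_mu dx \<delta> ^ a * lay_mu dy \<delta> ^ b) * t \<le> M * t" if "0 \<le> t" for t
    by (rule mult_right_mono[OF M that])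
  show "layer_reg k \<beta> \<delta> dx M (\<lambda>x y. c * H x y)"
    unfolding layer_reg_def
  proof (intro conjI exI[of _ "\<lambda>m x y. c * pd (a + m) b h x y"] ballI allI impI)
    show "cont2 {0..1} {0..1} (\<lambda>x y. c * H x y)" by (intro cont2_intros H)
    fix x y :: real assume xy: "x \<in> {0<..<1}" "y \<in> {0<..<1}"
    note om = lay_om_bounds(1)[OF \<beta> \<delta>(1) xy(1), of dx]
    show "c * pd (a + 0) b h x y = c * H x y" using e[OF xy] by simp
    show "((\<lambda>t. c * pd (a + j) b h t y) has_real_derivative c * pd (a + Suc j) b h x y) (at x)" if "j \<le> k" for j
      unfolding add_Suc_right by (rule DERIV_cmult[OF C_mixed_dx[OF m _ _ xy]]) (use ab that in auto)
    have "\<bar>c * H x y\<bar> \<le> c * (C * lay_mu dx \<delta> ^ a * lay_mu dy \<delta> ^ b * lay_om dx \<beta> \<delta> x)"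
      unfolding abs_mult e[OF xy] using c
      by (simp, intro mult_left_mono layer_bound_le(1)[OF h \<beta> \<delta> C _ _ xy]) (use ab in auto)
    with s[OF om] show "\<bar>c * H x y\<bar> \<le> M * lay_om dx \<beta> \<delta> x" by (simp add: mult.assoc)
    have "\<bar>c * pd (a + Suc k) b h x y\<bar> \<le> c * (C * lay_mu dx \<delta> ^ (a + Suc k) * lay_mu dy \<delta> ^ b * lay_om dx \<beta> \<delta> x)"
      unfolding abs_mult using c
      by (simp only: abs_of_nonneg, intro mult_left_mono layer_bound_le(1)[OF h \<beta> \<delta> C _ _ xy]) (use ab in auto)
    also have "\<dots> = c * (C * lay_mu dx \<delta> ^ a * lay_mu dy \<delta> ^ b) * (lay_mu dx \<delta> ^ Suc k * lay_om dx \<beta> \<delta> x)"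
      by (simp only: power_add mult_ac)
    also have "\<dots> \<le> M * (lay_mu dx \<delta> ^ Suc k * lay_om dx \<beta> \<delta> x)"
      by (rule s) (intro mult_nonneg_nonneg zero_le_power mu om)
    finally show "\<bar>c * pd (a + Suc k) b h x y\<bar> \<le> M * lay_mu dx \<delta> ^ Suc k * lay_om dx \<beta> \<delta> x" by (simp only: mult.assoc)
  qed
  show "layer_reg k \<beta> \<delta> dy M (\<lambda>x y. c * H y x)"
    unfolding layer_reg_def
  proof (intro conjI exI[of _ "\<lambda>m x y. c * pd a (b + m) h y x"] ballI allI impI)
    show "cont2 {0..1} {0..1} (\<lambda>x y. c * H y x)" by (intro cont2_intros cont2_swp[OF H])
    fix x y :: real assume yx: "x \<in> {0<..<1}" "y \<in> {0<..<1}"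
    note xy = yx(2,1)
    note om = lay_om_bounds(1)[OF \<beta> \<delta>(1) xy(2), of dy]
    show "c * pd a (b + 0) h y x = c * H y x" using e[OF xy] by simp
    show "((\<lambda>t. c * pd a (b + j) h y t) has_real_derivative c * pd a (b + Suc j) h y x) (at x)" if "j \<le> k" for j
      unfolding add_Suc_right by (rule DERIV_cmult[OF C_mixed_dy[OF m _ _ xy]]) (use ab that in auto)
    have "\<bar>c * H y x\<bar> \<le> c * (C * lay_mu dx \<delta> ^ a * lay_mu dy \<delta> ^ b * lay_om dy \<beta> \<delta> x)"
      unfolding abs_mult e[OF xy] using c
      by (simp, intro mult_left_mono layer_bound_le(2)[OF h \<beta> \<delta> C _ _ xy]) (use ab in auto)
    with s[OF om] show "\<bar>c * H y x\<bar> \<le> M * lay_om dy \<beta> \<delta> x" by (simp add: mult.assoc)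
    have "\<bar>c * pd a (b + Suc k) h y x\<bar> \<le> c * (C * lay_mu dx \<delta> ^ a * lay_mu dy \<delta> ^ (b + Suc k) * lay_om dy \<beta> \<delta> x)"
      unfolding abs_mult using c
      by (simp only: abs_of_nonneg, intro mult_left_mono layer_bound_le(2)[OF h \<beta> \<delta> C _ _ xy]) (use ab in auto)
    also have "\<dots> = c * (C * lay_mu dx \<delta> ^ a * lay_mu dy \<delta> ^ b) * (lay_mu dy \<delta> ^ Suc k * lay_om dy \<beta> \<delta> x)"
      by (simp only: power_add mult_ac)
    also have "\<dots> \<le> M * (lay_mu dy \<delta> ^ Suc k * lay_om dy \<beta> \<delta> x)"
      by (rule s) (intro mult_nonneg_nonneg zero_le_power mu om)
    finally show "\<bar>c * pd a (b + Suc k) h y x\<bar> \<le> M * lay_mu dy \<delta> ^ Suc k * lay_om dy \<beta> \<delta> x" by (simp only: mult.assoc)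
  qed
qed

lemma powr_layer: "\<epsilon> > 0 \<Longrightarrow> \<epsilon> powr (- real i / 2) = (1 / sqrt \<epsilon>) ^ i"
proof -
  assume e: "\<epsilon> > 0"
  have "(1 / sqrt \<epsilon>) ^ i = (\<epsilon> powr (- (1 / 2))) ^ i"
    using e by (simp add: powr_half_sqrt powr_minus inverse_eq_divide)
  also have "\<dots> = \<epsilon> powr (- (1 / 2) * real i)" using e by (simp add: powr_power)
  finally show ?thesis by simp
qed

text \<open>The nine components in the order \<open>S, W\<^sub>1, \<dots>, W\<^sub>4, Z\<^sub>1, \<dots>, Z\<^sub>4\<close>; the lists in
  \<open>regularity_layer_bound\<close> give the layer kinds of each in \<open>x\<close> and in \<open>y\<close>.\<close>

definition reg_comp :: "(real \<Rightarrow> real \<Rightarrow> real) \<Rightarrow> (nat \<Rightarrow> real \<Rightarrow> real \<Rightarrow> real) \<Rightarrow> (nat \<Rightarrow> real \<Rightarrow> real \<Rightarrow> real) \<Rightarrow>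
    nat \<Rightarrow> real \<Rightarrow> real \<Rightarrow> real" where
  "reg_comp S W Z c = (if c = 0 then S else if c \<le> 4 then W c else Z (c - 4))"

lemma regularity_layer_bound:
  assumes r: "regularity k \<beta> C0 \<epsilon> u S W Z" and \<epsilon>: "\<epsilon> > 0" and c: "c < (9::nat)"
  shows "layer_bound (k + 2) \<beta> (sqrt \<epsilon>) C0 ([0,1,0,2,0,1,2,2,1] ! c) ([0,0,1,0,2,1,1,2,2] ! c) (reg_comp S W Z c)"
proof -
  have cc: "c = 0 \<or> c = 1 \<or> c = 2 \<or> c = 3 \<or> c = 4 \<or> c = 5 \<or> c = 6 \<or> c = 7 \<or> c = 8" using c by presburger
  note R = r[unfolded regularity_def]
  note mS = R[THEN conjunct2, THEN conjunct1]
  note mW = R[THEN conjunct2, THEN conjunct2, THEN conjunct1, rule_format]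
  note RB = R[THEN conjunct2, THEN conjunct2, THEN conjunct2, rule_format]
  have m: "C_mixed (k + 2) (reg_comp S W Z c)"
    using cc by (elim disjE) (use mS mW[of 1] mW[of 2] mW[of 3] mW[of 4] in \<open>simp_all add: reg_comp_def\<close>)
  have pw: "\<epsilon> powr (- real (i + j) / 2) = (1 / sqrt \<epsilon>) ^ i * (1 / sqrt \<epsilon>) ^ j" for i j
    unfolding powr_layer[OF \<epsilon>] by (rule power_add)
  have ex: "exp (- \<beta> * (s + t) / sqrt \<epsilon>) = exp (- \<beta> * s / sqrt \<epsilon>) * exp (- \<beta> * t / sqrt \<epsilon>)" for s t
    by (simp add: exp_add[symmetric] add_divide_distrib[symmetric] algebra_simps)
  show ?thesis
    unfolding layer_bound_def
  proof (intro conjI m allI impI ballI)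
    fix i j and x y :: real assume ij: "i \<le> k + 2" "j \<le> k + 2" and xy: "x \<in> {0<..<1}" "y \<in> {0<..<1}"
    have o: "in_open_sq x y" using xy by (simp add: in_open_sq_def)
    define G where "G = (\<lambda>d t. lay_om d \<beta> (sqrt \<epsilon>) t)"
    define H where "H = (\<lambda>d (n::nat). lay_mu d (sqrt \<epsilon>) ^ n)"
    have G: "exp (- \<beta> * t / sqrt \<epsilon>) = G 1 t" "exp (- \<beta> * (1 - t) / sqrt \<epsilon>) = G 2 t" "G 0 t = 1" for t
      by (simp_all add: G_def lay_om_def)
    have H: "(1 / sqrt \<epsilon>) ^ n = H (Suc 0) n" "H 2 n = H (Suc 0) n" "H 0 n = 1" for n by (simp_all add: H_def lay_mu_def)
    note B = RB[OF ij o, unfolded pw ex, unfolded powr_layer[OF \<epsilon>], unfolded G(2), unfolded G(1) H(1)]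
    show "\<bar>pd i j (reg_comp S W Z c) x y\<bar> \<le> C0 * lay_mu ([0,1,0,2,0,1,2,2,1] ! c) (sqrt \<epsilon>) ^ i *
      lay_mu ([0,0,1,0,2,1,1,2,2] ! c) (sqrt \<epsilon>) ^ j *
      (lay_om ([0,1,0,2,0,1,2,2,1] ! c) \<beta> (sqrt \<epsilon>) x * lay_om ([0,0,1,0,2,1,1,2,2] ! c) \<beta> (sqrt \<epsilon>) y)"
      unfolding fun_cong[OF fun_cong[OF G_def], symmetric] fun_cong[OF fun_cong[OF H_def], symmetric]
      using cc by (elim disjE) (use B in \<open>simp_all add: reg_comp_def G H mult.assoc\<close>)
  qed
qed

lemma sum_reg_comp:
  "(\<Sum>c<9. reg_comp S W Z c x y) = S x y + (\<Sum>m=1..4. W m x y) + (\<Sum>m=1..4. Z m x y)"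
proof -
  have 9: "{..<9::nat} = {0,1,2,3,4,5,6,7,8}" by auto
  have 4: "{1..4::nat} = {1,2,3,4}" by auto
  show ?thesis unfolding 9 4 by (simp add: reg_comp_def)
qed

lemma bc2_sum: "(\<And>c. c < n \<Longrightarrow> bc2 X Y (g c)) \<Longrightarrow> bc2 X Y (\<lambda>x y. \<Sum>c<(n::nat). g c x y)"
proof (induction n)
  case 0
  show ?case using bc2_intros(4)[of X Y 0] by simp
next
  case (Suc n)
  then have "bc2 X Y (\<lambda>x y. (\<Sum>c<n. g c x y) + g n x y)" by (intro bc2_intros) auto
  then show ?case by simp
qed

text \<open>The sign of the constant is not assumed in the theorem; it follows from the bound at the
  centre of the square, where the weights are positive.\<close>

lemma layer_bound_nonneg:
  assumes "layer_bound n \<beta> \<delta> C dx dy h" shows "0 \<le> C"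
proof -
  have m: "(1/2::real) \<in> {0<..<1}" by simp
  define P where "P = lay_om dx \<beta> \<delta> (1/2) * lay_om dy \<beta> \<delta> (1/2)"
  have P: "0 < P" by (simp add: P_def lay_om_def)
  have "\<bar>pd 0 0 h (1/2) (1/2)\<bar> \<le> C * lay_mu dx \<delta> ^ 0 * lay_mu dy \<delta> ^ 0 * P"
    unfolding P_def by (rule assms(1)[unfolded layer_bound_def, THEN conjunct2, rule_format]) (simp_all add: m)
  then have "0 * P \<le> C * P" by simp
  then show ?thesis by (simp only: mult_le_cancel_right_pos[OF P])
qed

text \<open>Translates the regularity assumption into what the error analysis needs. The derivatives
  of \<open>u\<close> are obtained as sums over the components, and these sums, extended to the
  closed square, serve as \<open>ux\<close> and \<open>uy\<close>.\<close>

lemma regularity_decomp: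
  fixes b :: "real \<Rightarrow> real \<Rightarrow> real"
  assumes r: "regularity k \<beta> C0 \<epsilon> u S W Z" and s: "solves_problem \<epsilon> b f u"
    and \<epsilon>: "\<epsilon> > 0" "sqrt \<epsilon> \<le> 1" and \<beta>: "\<beta> > 0"
  obtains ux uy uxx uyy where "0 \<le> C0"
    "cont2 {0..1} {0..1} u" "cont2 {0..1} {0..1} ux" "cont2 {0..1} {0..1} uy"
    "\<And>x y. x \<in> {0<..<1} \<Longrightarrow> y \<in> {0<..<1} \<Longrightarrow> ((\<lambda>t. u t y) has_real_derivative ux x y) (at x)"
    "\<And>x y. x \<in> {0<..<1} \<Longrightarrow> y \<in> {0<..<1} \<Longrightarrow> (u x has_real_derivative uy x y) (at y)"
    "\<And>x y. x \<in> {0<..<1} \<Longrightarrow> y \<in> {0<..<1} \<Longrightarrow> ((\<lambda>t. ux t y) has_real_derivative uxx x y) (at x)"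
    "\<And>x y. x \<in> {0<..<1} \<Longrightarrow> y \<in> {0<..<1} \<Longrightarrow> (uy x has_real_derivative uyy x y) (at y)"
    "bc2 {0<..<1} {0<..<1} uxx" "bc2 {0<..<1} {0<..<1} uyy"
    "\<And>x y. in_open_sq x y \<Longrightarrow> f x y = b x y * u x y - \<epsilon> * uxx x y - \<epsilon> * uyy x y"
    "layer_decomp k \<beta> (sqrt \<epsilon>) C0 u" "layer_decomp k \<beta> (sqrt \<epsilon>) C0 (swp u)"
    "layer_decomp k \<beta> (sqrt \<epsilon>) (sqrt \<epsilon> * C0) (\<lambda>x y. \<epsilon> * ux x y)" "layer_decomp k \<beta> (sqrt \<epsilon>) (sqrt \<epsilon> * C0) (\<lambda>x y. \<epsilon> * ux y x)"
    "layer_decomp k \<beta> (sqrt \<epsilon>) (sqrt \<epsilon> * C0) (\<lambda>x y. \<epsilon> * uy x y)" "layer_decomp k \<beta> (sqrt \<epsilon>) (sqrt \<epsilon> * C0) (\<lambda>x y. \<epsilon> * uy y x)"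
proof -
  define \<delta> where "\<delta> = sqrt \<epsilon>"
  have \<delta>: "\<delta> > 0" "\<delta> \<le> 1" and \<delta>2: "\<epsilon> = \<delta> * \<delta>" using \<epsilon> by (auto simp: \<delta>_def)
  define h where "h = reg_comp S W Z"
  define dx :: "nat \<Rightarrow> nat" where "dx c = [0,1,0,2,0,1,2,2,1] ! c" for c
  define dy :: "nat \<Rightarrow> nat" where "dy c = [0,0,1,0,2,1,1,2,2] ! c" for c
  have L: "layer_bound (k + 2) \<beta> \<delta> C0 (dx c) (dy c) (h c)" if "c < 9" for c
    unfolding dx_def dy_def h_def \<delta>_def by (rule regularity_layer_bound[OF r \<epsilon>(1) that])
  have Cm: "C_mixed (k + 2) (h c)" if "c < 9" for c using L[OF that] by (simp add: layer_bound_def)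
  have C: "0 \<le> C0" by (rule layer_bound_nonneg[OF L[of 0]]) simp
  define isH where "isH c a b H \<longleftrightarrow> cont2 {0..1} {0..1} H \<and> (\<forall>x\<in>{0<..<1}. \<forall>y\<in>{0<..<1}. H x y = pd a b (h c) x y)"
    for c a b H
  \<comment> \<open>A chosen continuous extension to the closed square of each derivative of order
    at most one in each variable.\<close>
  define H where "H c a b = (SOME H. isH c a b H)" for c a b
  have isH: "isH c a b (H c a b)" if "c < 9" "a \<le> 1" "b \<le> 1" for c a b
  proof -
    have "\<exists>H. isH c a b H"
      unfolding isH_def by (rule layer_bound_extension[OF L[OF that(1)] \<beta> \<delta> C that(2,3)])
    then show ?thesis unfolding H_def by (rule someI_ex)
  qed
  have Hc: "cont2 {0..1} {0..1} (H c a b)" if "c < 9" "a \<le> 1" "b \<le> 1" for c a b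
    using isH[OF that] by (simp add: isH_def)
  have He: "H c a b x y = pd a b (h c) x y" if "c < 9" "a \<le> 1" "b \<le> 1" "x \<in> {0<..<1}" "y \<in> {0<..<1}" for c a b x y
    using isH[OF that(1-3)] that(4,5) by (simp add: isH_def)
  define SH where "SH a b x y = (\<Sum>c<9. H c a b x y)" for a b x y
  have SHc: "cont2 {0..1} {0..1} (SH a b)" if "a \<le> 1" "b \<le> 1" for a b
    unfolding SH_def by (rule cont2_sum) (use Hc that in simp)
  have SHe: "SH a b x y = (\<Sum>c<9. pd a b (h c) x y)" if "a \<le> 1" "b \<le> 1" "x \<in> {0<..<1}" "y \<in> {0<..<1}" for a b x y
    unfolding SH_def by (rule sum.cong[OF refl]) (use He that in simp)
  have cl: "cbox (0, 0) (1, 1) = {0..1::real} \<times> {0..1::real}" by (subst cbox_Pair_eq) (simp only: cbox_interval)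
  have uc: "cont2 {0..1} {0..1} u" using s unfolding solves_problem_def cont2_def cl by blast
  have uo: "u x y = SH 0 0 x y" if xy: "x \<in> {0<..<1}" "y \<in> {0<..<1}" for x y
  proof -
    have "u x y = (\<Sum>c<9. h c x y)"
      unfolding h_def sum_reg_comp using r[unfolded regularity_def, THEN conjunct1, rule_format, of x y] xy
      by (simp add: in_closed_sq_def)
    then show ?thesis by (simp add: SHe[OF _ _ xy] pd_def)
  qed
  \<comment> \<open>The components themselves need not be continuous up to the boundary;
    \<open>u\<close> is, and therefore agrees with the extended sum.\<close>
  have ucl: "u x y = SH 0 0 x y" if xy: "x \<in> {0..1}" "y \<in> {0..1}" for x y
    by (rule cont2_eq_on_closed[OF uc SHc uo xy]) auto
  have dX: "((\<lambda>t. SH a b t y) has_real_derivative (\<Sum>c<9. pd (Suc a) b (h c) x y)) (at x)"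
    if ab: "a \<le> 1" "b \<le> 1" and xy: "x \<in> {0<..<1}" "y \<in> {0<..<1}" for a b x y
  proof (rule has_field_derivative_transform_within_open[where S = "{0<..<1}"])
    show "((\<lambda>t. \<Sum>c<9. pd a b (h c) t y) has_real_derivative (\<Sum>c<9. pd (Suc a) b (h c) x y)) (at x)"
      by (rule DERIV_sum, rule C_mixed_dx[OF Cm _ _ xy]) (use ab in auto)
  qed (use xy SHe ab in auto)
  have dY: "(SH a b x has_real_derivative (\<Sum>c<9. pd a (Suc b) (h c) x y)) (at y)"
    if ab: "a \<le> 1" "b \<le> 1" and xy: "x \<in> {0<..<1}" "y \<in> {0<..<1}" for a b x y
  proof (rule has_field_derivative_transform_within_open[where S = "{0<..<1}"])
    show "((\<lambda>t. \<Sum>c<9. pd a b (h c) x t) has_real_derivative (\<Sum>c<9. pd a (Suc b) (h c) x y)) (at y)"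
      by (rule DERIV_sum, rule C_mixed_dy[OF Cm _ _ xy]) (use ab in auto)
  qed (use xy SHe ab in auto)
  have ux: "((\<lambda>t. u t y) has_real_derivative SH 1 0 x y) (at x)" if xy: "x \<in> {0<..<1}" "y \<in> {0<..<1}" for x y
  proof (rule has_field_derivative_transform_within_open[where S = "{0<..<1}"])
    show "((\<lambda>t. SH 0 0 t y) has_real_derivative SH 1 0 x y) (at x)"
      using dX[of 0 0 x y] SHe[of 1 0 x y] xy by simp
  qed (use xy uo in auto)
  have uy: "(u x has_real_derivative SH 0 1 x y) (at y)" if xy: "x \<in> {0<..<1}" "y \<in> {0<..<1}" for x y
  proof (rule has_field_derivative_transform_within_open[where S = "{0<..<1}"])
    show "(SH 0 0 x has_real_derivative SH 0 1 x y) (at y)"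
      using dY[of 0 0 x y] SHe[of 0 1 x y] xy by simp
  qed (use xy uo in auto)
  define uxx where "uxx x y = (\<Sum>c<9. pd 2 0 (h c) x y)" for x y
  define uyy where "uyy x y = (\<Sum>c<9. pd 0 2 (h c) x y)" for x y
  have uxx: "((\<lambda>t. SH 1 0 t y) has_real_derivative uxx x y) (at x)" if xy: "x \<in> {0<..<1}" "y \<in> {0<..<1}" for x y
    using dX[of 1 0 x y] xy unfolding uxx_def by (simp add: numeral_2_eq_2)
  have uyy: "(SH 0 1 x has_real_derivative uyy x y) (at y)" if xy: "x \<in> {0<..<1}" "y \<in> {0<..<1}" for x y
    using dY[of 0 1 x y] xy unfolding uyy_def by (simp add: numeral_2_eq_2)
  have bc: "bc2 {0<..<1} {0<..<1} (\<lambda>x y. \<Sum>c<9. pd a b (h c) x y)" if ab: "a \<le> 2" "b \<le> 2" for a b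
  proof (rule bc2_sum)
    fix c :: nat assume c: "c < 9"
    have "\<bar>pd a b (h c) x y\<bar> \<le> C0 * lay_mu (dx c) \<delta> ^ a * lay_mu (dy c) \<delta> ^ b" if "x \<in> {0<..<1}" "y \<in> {0<..<1}" for x y
      by (rule layer_bound_le(3)[OF L[OF c] \<beta> \<delta> C _ _ that]) (use ab in auto)
    then show "bc2 {0<..<1} {0<..<1} (pd a b (h c))"
      unfolding bc2_def
      by (intro conjI exI[of _ "C0 * lay_mu (dx c) \<delta> ^ a * lay_mu (dy c) \<delta> ^ b"] ballI C_mixed_cont[OF Cm[OF c]])
        (use ab in auto)
  qed
  have pX: "pdx u x y = SH 1 0 x y" if "x \<in> {0<..<1}" "y \<in> {0<..<1}" for x y
    unfolding pdx_def by (rule DERIV_imp_deriv[OF ux[OF that]])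
  have pY: "pdy u x y = SH 0 1 x y" if "x \<in> {0<..<1}" "y \<in> {0<..<1}" for x y
    unfolding pdy_def by (rule DERIV_imp_deriv[OF uy[OF that]])
  \<comment> \<open>The second derivative in the equation is a \<open>deriv\<close> of a
    \<open>deriv\<close>, so the identification of the first one is needed in a whole
    neighbourhood.\<close>
  have p2: "pd 2 0 u x y = uxx x y" "pd 0 2 u x y = uyy x y" if xy: "x \<in> {0<..<1}" "y \<in> {0<..<1}" for x y
  proof -
    have "((\<lambda>t. pdx u t y) has_real_derivative uxx x y) (at x)"
      by (rule has_field_derivative_transform_within_open[OF uxx[OF xy] open_greaterThanLessThan[of 0 1] xy(1)])
        (rule pX[OF _ xy(2), symmetric])
    from DERIV_imp_deriv[OF this] show "pd 2 0 u x y = uxx x y" by (simp add: pd_def numeral_2_eq_2 pdx_def)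
    have "(pdy u x has_real_derivative uyy x y) (at y)"
      by (rule has_field_derivative_transform_within_open[OF uyy[OF xy] open_greaterThanLessThan[of 0 1] xy(2)])
        (rule pY[OF xy(1), symmetric])
    from DERIV_imp_deriv[OF this] show "pd 0 2 u x y = uyy x y" by (simp add: pd_def numeral_2_eq_2 pdy_def)
  qed
  have rearr: "- \<epsilon> * (v + w) + z = d \<Longrightarrow> d = z - \<epsilon> * v - \<epsilon> * w" for v w z d :: real by (simp add: algebra_simps)
  have F: "f x y = b x y * u x y - \<epsilon> * uxx x y - \<epsilon> * uyy x y" if o: "in_open_sq x y" for x y
  proof -
    have "- \<epsilon> * (pd 2 0 u x y + pd 0 2 u x y) + b x y * u x y = f x y"
      using s o unfolding solves_problem_def by blast
    moreover have "x \<in> {0<..<1}" "y \<in> {0<..<1}" using o by (auto simp: in_open_sq_def)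
    ultimately have "- \<epsilon> * (uxx x y + uyy x y) + b x y * u x y = f x y" by (simp only: p2)
    then show ?thesis by (rule rearr)
  qed
  \<comment> \<open>One pattern for the six decompositions: c = 1 with a = b = 0 for
    \<open>u\<close>, and c = \<epsilon> with one first derivative for each flux, each together with
    its reflection.\<close>
  have D: "layer_decomp k \<beta> \<delta> M g" "layer_decomp k \<beta> \<delta> M (swp g)"
    if ab: "a \<le> 1" "b \<le> 1" and c: "0 \<le> c" and M: "\<And>d d'. c * (C0 * lay_mu d \<delta> ^ a * lay_mu d' \<delta> ^ b) \<le> M"
      and g: "\<And>x y. x \<in> {0..1} \<Longrightarrow> y \<in> {0..1} \<Longrightarrow> g x y = c * SH a b x y" for a b c M g
  proof -
    have e: "H n a b x y = pd a b (h n) x y" if "n < 9" "x \<in> {0<..<1}" "y \<in> {0<..<1}" for n x y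
      by (rule He[OF that(1) ab that(2,3)])
    show "layer_decomp k \<beta> \<delta> M g"
      unfolding layer_decomp_def
    proof (intro exI[of _ dx] exI[of _ "\<lambda>n x y. c * H n a b x y"] conjI allI impI ballI)
      show "layer_reg k \<beta> \<delta> (dx n) M (\<lambda>x y. c * H n a b x y)" if n: "n < 9" for n
        by (rule layer_reg_pd(1)[OF L[OF n] \<beta> \<delta> C ab Hc[OF n ab] e[OF n] c M])
      show "g x y = (\<Sum>n<9. c * H n a b x y)" if "x \<in> {0..1}" "y \<in> {0..1}" for x y
        unfolding g[OF that] SH_def by (rule sum_distrib_left)
    qed
    show "layer_decomp k \<beta> \<delta> M (swp g)"
      unfolding layer_decomp_def
    proof (intro exI[of _ dy] exI[of _ "\<lambda>n x y. c * H n a b y x"] conjI allI impI ballI)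
      show "layer_reg k \<beta> \<delta> (dy n) M (\<lambda>x y. c * H n a b y x)" if n: "n < 9" for n
        by (rule layer_reg_pd(2)[OF L[OF n] \<beta> \<delta> C ab Hc[OF n ab] e[OF n] c M])
      show "g y x = (\<Sum>n<9. c * H n a b y x)" if "x \<in> {0..1}" "y \<in> {0..1}" for x y
        unfolding g[OF that(2,1)] SH_def by (rule sum_distrib_left)
    qed
  qed
  \<comment> \<open>Here \<epsilon> times the factor 1 / \<delta> of a first derivative becomes
    \<delta>, the scaling sqrt \<epsilon> of the fluxes.\<close>
  have M: "\<epsilon> * (C0 * lay_mu d \<delta>) \<le> \<delta> * C0" for d
  proof -
    have "\<delta> * C0 * (\<delta> * lay_mu d \<delta>) \<le> \<delta> * C0 * 1"
      by (rule mult_left_mono[OF lay_mu_bounds(2)[OF \<delta>] mult_nonneg_nonneg[OF less_imp_le[OF \<delta>(1)] C]])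
    then show ?thesis unfolding \<delta>2 by (simp only: mult_ac mult_1_right)
  qed
  have e0: "0 \<le> \<epsilon>" using \<epsilon> by simp
  have du: "layer_decomp k \<beta> \<delta> C0 u" "layer_decomp k \<beta> \<delta> C0 (swp u)"
    using D[of 0 0 1 C0 u] by (simp_all add: ucl)
  have dux: "layer_decomp k \<beta> \<delta> (\<delta> * C0) (\<lambda>x y. \<epsilon> * SH 1 0 x y)" "layer_decomp k \<beta> \<delta> (\<delta> * C0) (\<lambda>x y. \<epsilon> * SH 1 0 y x)"
    using D[of 1 0 \<epsilon> "\<delta> * C0" "\<lambda>x y. \<epsilon> * SH 1 0 x y"] M e0 by simp_all
  have duy: "layer_decomp k \<beta> \<delta> (\<delta> * C0) (\<lambda>x y. \<epsilon> * SH 0 1 x y)" "layer_decomp k \<beta> \<delta> (\<delta> * C0) (\<lambda>x y. \<epsilon> * SH 0 1 y x)"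
    using D[of 0 1 \<epsilon> "\<delta> * C0" "\<lambda>x y. \<epsilon> * SH 0 1 x y"] M e0 by simp_all
  have bx: "bc2 {0<..<1} {0<..<1} uxx" using bc[of 2 0] unfolding uxx_def by simp
  have b_y: "bc2 {0<..<1} {0<..<1} uyy" using bc[of 0 2] unfolding uyy_def by simp
  have c1: "cont2 {0..1} {0..1} (SH 1 0)" by (rule SHc) simp_all
  have c2: "cont2 {0..1} {0..1} (SH 0 1)" by (rule SHc) simp_all
  show thesis
    by (rule that[OF C uc c1 c2 ux uy uxx uyy bx b_y F du[unfolded \<delta>_def] dux[unfolded \<delta>_def] duy[unfolded \<delta>_def]])
qed

section \<open>Projection errors\<close>

lemma proj_stable_mono: "proj_stable k K C \<Longrightarrow> C \<le> C' \<Longrightarrow> proj_stable k K C'"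
  unfolding proj_stable_def
proof (elim conjE, intro conjI allI impI)
  fix a b :: real and g :: "real \<Rightarrow> real" and M x
  assume C: "0 \<le> C" "C \<le> C'"
    and st: "\<forall>a b g M x. a < b \<and> continuous_on {a..b} g \<and> (\<forall>t\<in>{a<..<b}. \<bar>g t\<bar> \<le> M) \<and> x \<in> {a..b} \<longrightarrow> \<bar>proj k K a b g x\<bar> \<le> C * M"
    and p: "a < b \<and> continuous_on {a..b} g \<and> (\<forall>t\<in>{a<..<b}. \<bar>g t\<bar> \<le> M) \<and> x \<in> {a..b}"
  have "(a + b) / 2 \<in> {a<..<b}" using p by auto
  then have "\<bar>g ((a + b) / 2)\<bar> \<le> M" using p by blast
  then have M: "0 \<le> M" by linarith
  have "\<bar>proj k K a b g x\<bar> \<le> C * M" using st p by blast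
  also have "\<dots> \<le> C' * M" by (rule mult_right_mono[OF C(2) M])
  finally show "\<bar>proj k K a b g x\<bar> \<le> C' * M" .
qed simp

lemma (in mesh) layer_sum_nonneg:
  assumes "i \<in> {1..N}" "\<delta> > 0" shows "0 \<le> layer_sum k \<beta> \<delta> xs i"
proof -
  have h: "0 \<le> xs i - xs (i - 1)" using xs_less[OF assms(1)] by simp
  have "0 \<le> min 1 (((xs i - xs (i - 1)) / \<delta>) ^ Suc k)"
    using zero_le_power[OF divide_nonneg_pos[OF h assms(2)], of "Suc k"] by simp
  then show ?thesis
    unfolding layer_sum_def layer_left_def layer_right_def using zero_le_power[OF h, of "Suc k"] by simp
qed

text \<open>The error splits into the one-dimensional error in \<open>x\<close> and the projection
  in \<open>x\<close> of the one-dimensional error in \<open>y\<close>. The second part is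
  controlled by stability, whence the squared constant.\<close>

lemma (in mesh) tensor_projection_error:
  assumes K1: "kern_ok k K1" "proj_stable k K1 C" and K2: "kern_ok k K2" "proj_stable k K2 C"
    and gc: "cont2 {0..1} {0..1} g" and g: "layer_decomp k \<beta> \<delta> M g" "layer_decomp k \<beta> \<delta> M (swp g)"
    and \<beta>: "\<beta> > 0" and \<delta>: "\<delta> > 0" and M: "0 \<le> M"
    and i: "i \<in> {1..N}" and j: "j \<in> {1..N}" and x: "x \<in> {xs (i-1)..xs i}" and y: "y \<in> {xs (j-1)<..<xs j}"
  shows "\<bar>g x y - projx k K1 (xs (i-1)) (xs i) (projy k K2 (xs (j-1)) (xs j) g) x y\<bar>
    \<le> 9 * (1 + C)\<^sup>2 * M * (layer_sum k \<beta> \<delta> xs i + layer_sum k \<beta> \<delta> xs j)"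
proof -
  define A where "A = layer_sum k \<beta> \<delta> xs"
  have A: "0 \<le> A i" "0 \<le> A j" unfolding A_def by (rule layer_sum_nonneg[OF i \<delta>], rule layer_sum_nonneg[OF j \<delta>])
  have C: "0 \<le> C" using K1(2) by (simp add: proj_stable_def)
  have Kc: "kern_cont K1" "kern_cont K2" using K1(1) K2(1) by (simp_all add: kern_ok_def)
  define G where "G = projy k K2 (xs (j-1)) (xs j) g"
  have yo: "y \<in> {0<..<1}" by (rule subsetD[OF cell_sub_open[OF j] y])
  have yc: "y \<in> {xs (j-1)..xs j}" "y \<in> {0..1}" using y yo by auto
  have Gc: "cont2 {0..1} {0..1} G"
    unfolding G_def by (rule cont2_projy[OF Kc(2) xs_less[OF j] cont2_subset[OF gc subset_refl cell_sub[OF j]]])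
  have c1: "continuous_on {xs (i-1)..xs i} (\<lambda>t. g t y)"
    by (rule continuous_on_subset[OF cont2_slice_x[OF gc yc(2)] cell_sub[OF i]])
  have c2: "continuous_on {xs (i-1)..xs i} (\<lambda>t. G t y)"
    by (rule continuous_on_subset[OF cont2_slice_x[OF Gc yc(2)] cell_sub[OF i]])
  have e1: "\<bar>g x y - projx k K1 (xs (i-1)) (xs i) g x y\<bar> \<le> 9 * ((1 + C) * M * A i)"
    unfolding A_def by (rule layer_decomp_error[OF K1 g(1) \<beta> \<delta> M i x yo])
  have e2: "\<bar>g t y - G t y\<bar> \<le> 9 * ((1 + C) * M * A j)" if t: "t \<in> {xs (i-1)<..<xs i}" for t
    unfolding A_def G_def projy_swp
    by (rule layer_decomp_error[OF K2 g(2) \<beta> \<delta> M j yc(1) subsetD[OF cell_sub_open[OF i] t]])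
  have "\<bar>proj k K1 (xs (i-1)) (xs i) (\<lambda>t. g t y - G t y) x\<bar> \<le> C * (9 * ((1 + C) * M * A j))"
    by (rule K1(2)[unfolded proj_stable_def, THEN conjunct2, rule_format])
      (use xs_less[OF i] continuous_on_diff[OF c1 c2] e2 x in blast)
  then have e3: "\<bar>projx k K1 (xs (i-1)) (xs i) g x y - projx k K1 (xs (i-1)) (xs i) G x y\<bar> \<le> C * (9 * ((1 + C) * M * A j))"
    unfolding projx_def proj_diff[OF Kc(1) xs_less[OF i] c1 c2] .
  have "\<bar>g x y - projx k K1 (xs (i-1)) (xs i) G x y\<bar> \<le> 9 * ((1 + C) * M * A i) + C * (9 * ((1 + C) * M * A j))"
    using e1 e3 by linarith
  also have "\<dots> \<le> (1 + C) * (9 * ((1 + C) * M * A i)) + (1 + C) * (9 * ((1 + C) * M * A j))"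
  proof (rule add_mono)
    show "9 * ((1 + C) * M * A i) \<le> (1 + C) * (9 * ((1 + C) * M * A i))"
      using mult_right_mono[of 1 "1 + C" "9 * ((1 + C) * M * A i)"] C M A by simp
    show "C * (9 * ((1 + C) * M * A j)) \<le> (1 + C) * (9 * ((1 + C) * M * A j))"
      by (rule mult_right_mono) (use C M A in simp_all)
  qed
  also have "\<dots> = 9 * (1 + C)\<^sup>2 * M * (A i + A j)" by (simp add: power2_eq_square algebra_simps)
  finally show ?thesis unfolding G_def A_def .
qed

text \<open>The consistency error is not treated as a difference of projections: both terms are
  compared with \<open>g\<close>, each at distance of order m / sqrt \<epsilon>, which explains the
  factor 2. On the edge only the projection in \<open>x\<close> occurs, since the \<open>L2\<close>
  projection in \<open>y\<close> has already been removed.\<close>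

lemma (in mesh) flux_projection_error:
  assumes Kp: "kern_ok k Kp" "proj_stable k Kp C" and KL: "kern_ok k KL" "proj_stable k KL C" and Km: "kern_ok k Km" "proj_stable k Km C"
    and \<epsilon>: "\<epsilon> > 0" and C0: "0 \<le> C0" and \<beta>: "\<beta> > 0"
    and gc: "cont2 {0..1} {0..1} g" and p_def: "p = (\<lambda>x y. \<epsilon> * g x y)"
    and g: "layer_decomp k \<beta> (sqrt \<epsilon>) (sqrt \<epsilon> * C0) p" "layer_decomp k \<beta> (sqrt \<epsilon>) (sqrt \<epsilon> * C0) (swp p)"
    and A_def: "A = layer_sum k \<beta> (sqrt \<epsilon>) xs" and m_def: "m = 9 * (1 + C)\<^sup>2 * C0"
  shows "\<And>i j x y. i \<in> {1..N} \<Longrightarrow> j \<in> {1..N} \<Longrightarrow> x \<in> {xs (i-1)<..<xs i} \<Longrightarrow> y \<in> {xs (j-1)<..<xs j} \<Longrightarrow>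
        \<bar>p x y - glob (PP k Kp KL p) x y\<bar> \<le> sqrt \<epsilon> * m * (A i + A j)"
    and "\<And>i j x y. i \<in> {1..N} \<Longrightarrow> j \<in> {1..N} \<Longrightarrow> x \<in> {xs (i-1)<..<xs i} \<Longrightarrow> y \<in> {xs (j-1)<..<xs j} \<Longrightarrow>
        \<bar>glob (PY k Km g) x y - glob (PP k Kp KL p) x y / \<epsilon>\<bar> \<le> 2 * m / sqrt \<epsilon> * (A i + A j)"
    and "continuous_on {0..1} (\<lambda>y. p 1 y - projx k Kp (xs (N-1)) 1 p 1 y)"
    and "\<And>y. y \<in> {0<..<1} \<Longrightarrow> \<bar>p 1 y - projx k Kp (xs (N-1)) 1 p 1 y\<bar> \<le> sqrt \<epsilon> * m * A N"
proof -
  define \<delta> where "\<delta> = sqrt \<epsilon>"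
  have \<delta>: "\<delta> > 0" and \<delta>2: "\<epsilon> = \<delta> * \<delta>" using \<epsilon> by (auto simp: \<delta>_def)
  have pc: "cont2 {0..1} {0..1} p" unfolding p_def by (intro cont2_intros gc)
  have C: "0 \<le> C" using Kp(2) by (simp add: proj_stable_def)
  have Kc: "kern_cont Kp" using Kp(1) by (simp add: kern_ok_def)
  have M: "0 \<le> \<delta> * C0" using \<delta> C0 by simp
  have m: "0 \<le> m" using C0 by (simp add: m_def)
  have An: "0 \<le> A i" if "i \<in> {1..N}" for i unfolding A_def by (rule layer_sum_nonneg[OF that]) (use \<epsilon> in simp)
  have mm: "9 * (1 + C)\<^sup>2 * (\<delta> * C0) * a = \<delta> * m * a" for a by (simp add: m_def)
  have m1: "9 * ((1 + C) * (\<delta> * C0) * a) \<le> \<delta> * m * a" if a: "0 \<le> a" for a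
  proof -
    have "1 * (1 + C) \<le> (1 + C) * (1 + C)" by (rule mult_right_mono) (use C in simp_all)
    then have "(1 + C) * (\<delta> * C0 * a) \<le> (1 + C)\<^sup>2 * (\<delta> * C0 * a)"
      unfolding power2_eq_square mult_1_left by (rule mult_right_mono) (use M a in simp)
    then have "9 * ((1 + C) * (\<delta> * C0 * a)) \<le> 9 * ((1 + C)\<^sup>2 * (\<delta> * C0 * a))" by (rule mult_left_mono) simp
    then show ?thesis by (simp only: m_def mult_ac)
  qed
  note g' = g[folded \<delta>_def]
  have eP: "\<bar>p x y - glob (PP k Kp KL p) x y\<bar> \<le> \<delta> * m * (A i + A j)"
    if i: "i \<in> {1..N}" and j: "j \<in> {1..N}" and x: "x \<in> {xs (i-1)<..<xs i}" and y: "y \<in> {xs (j-1)<..<xs j}" for i j x y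
  proof -
    \<comment> \<open>\<open>PP\<close> projects in \<open>y\<close> last, so the tensor estimate is
      applied to the reflected function, with the roles of the two kernels exchanged.\<close>
    have "glob (PP k Kp KL p) x y = projx k KL (xs (j-1)) (xs j) (projy k Kp (xs (i-1)) (xs i) (swp p)) y x"
      unfolding glob_def idx_eq[OF i x] idx_eq[OF j y] PP_def projy_swp ..
    moreover have "y \<in> {xs (j-1)..xs j}" using y by simp
    ultimately have "\<bar>p x y - glob (PP k Kp KL p) x y\<bar> \<le> 9 * (1 + C)\<^sup>2 * (\<delta> * C0) * (A j + A i)"
      using tensor_projection_error[OF KL Kp cont2_swp[OF pc] g'(2) g'(1) \<beta> \<delta> M j i _ x]
      unfolding A_def \<delta>_def by simp
    then show ?thesis unfolding mm by (simp only: add.commute)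
  qed
  then show "\<bar>p x y - glob (PP k Kp KL p) x y\<bar> \<le> sqrt \<epsilon> * m * (A i + A j)"
    if "i \<in> {1..N}" "j \<in> {1..N}" "x \<in> {xs (i-1)<..<xs i}" "y \<in> {xs (j-1)<..<xs j}" for i j x y
    using that unfolding \<delta>_def by blast
  show "\<bar>glob (PY k Km g) x y - glob (PP k Kp KL p) x y / \<epsilon>\<bar> \<le> 2 * m / sqrt \<epsilon> * (A i + A j)"
    if i: "i \<in> {1..N}" and j: "j \<in> {1..N}" and x: "x \<in> {xs (i-1)<..<xs i}" and y: "y \<in> {xs (j-1)<..<xs j}" for i j x y
  proof -
    define a where "a = glob (PY k Km g) x y"
    define c where "c = glob (PP k Kp KL p) x y"
    have "\<epsilon> * a = projx k Km (xs (j-1)) (xs j) (swp p) y x"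
      unfolding a_def glob_def idx_eq[OF i x] idx_eq[OF j y] PY_def projy_swp projx_def p_def by (rule proj_cmult[symmetric])
    moreover have "y \<in> {xs (j-1)..xs j}" using y by simp
    ultimately have "\<bar>p x y - \<epsilon> * a\<bar> \<le> 9 * ((1 + C) * (\<delta> * C0) * A j)"
      using layer_decomp_error[OF Km g'(2) \<beta> \<delta> M j _ subsetD[OF cell_sub_open[OF i] x]] unfolding A_def \<delta>_def by simp
    also have "\<dots> \<le> \<delta> * m * A j" by (rule m1[OF An[OF j]])
    also have "\<dots> \<le> \<delta> * m * (A i + A j)" by (rule mult_left_mono) (use An[OF i] \<delta> m in simp_all)
    finally have e: "\<bar>\<epsilon> * a - c\<bar> \<le> 2 * (\<delta> * m * (A i + A j))" using eP[OF i j x y] unfolding c_def by linarith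
    have "\<bar>a - c / \<epsilon>\<bar> = \<bar>\<epsilon> * a - c\<bar> / \<epsilon>" 
    proof -
      have "a - c / \<epsilon> = (\<epsilon> * a - c) / \<epsilon>" using \<epsilon> by (simp add: diff_divide_distrib)
      then show ?thesis by (simp only: abs_divide abs_of_pos[OF \<epsilon>])
    qed
    also have "\<dots> \<le> 2 * (\<delta> * m * (A i + A j)) / \<epsilon>" by (rule divide_right_mono[OF e]) (use \<epsilon> in simp)
    also have "\<dots> = 2 * m / \<delta> * (A i + A j)" unfolding \<delta>2 using \<delta> by simp
    finally show ?thesis unfolding a_def c_def \<delta>_def .
  qed
  have Nm: "N \<in> {1..N}" using N1 by simp
  have x1: "1 \<in> {xs (N-1)..xs N}" using xs_less[OF Nm] xN by simp
  have px: "cont2 {0..1} {0..1} (projx k Kp (xs (N-1)) 1 p)"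
    by (rule cont2_projx[OF Kc]) (use xs_less[OF Nm] cont2_subset[OF pc cell_sub[OF Nm] subset_refl] xN in simp_all)
  show "continuous_on {0..1} (\<lambda>y. p 1 y - projx k Kp (xs (N-1)) 1 p 1 y)"
    by (intro continuous_on_diff cont2_slice_y[OF pc] cont2_slice_y[OF px]) simp_all
  show "\<bar>p 1 y - projx k Kp (xs (N-1)) 1 p 1 y\<bar> \<le> sqrt \<epsilon> * m * A N" if y: "y \<in> {0<..<1}" for y
  proof -
    have "\<bar>p 1 y - projx k Kp (xs (N-1)) (xs N) p 1 y\<bar> \<le> 9 * ((1 + C) * (\<delta> * C0) * A N)"
      unfolding A_def \<delta>_def[symmetric] by (rule layer_decomp_error[OF Kp g'(1) \<beta> \<delta> M Nm x1 y])
    also have "\<dots> \<le> \<delta> * m * A N" by (rule m1[OF An[OF Nm]])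
    finally show ?thesis unfolding xN \<delta>_def .
  qed
qed

text \<open>The same kernel is used in both directions and the two projections commute, so
  projecting and reflecting can be interchanged. One projection of \<open>u\<close> thus serves both
  flux directions.\<close>

lemma (in mesh) PU_swp:
  assumes K: "kern_cont K" and u: "cont2 {0..1} {0..1} u" and i: "i \<in> {1..N}" and j: "j \<in> {1..N}"
  shows "PU k K u j i y x = PU k K (swp u) i j x y"
proof -
  have e: "projy k K (xs (j-1)) (xs j) (swp u) = (\<lambda>x y. projx k K (xs (j-1)) (xs j) u y x)"
    by (intro ext) (rule projy_swp)
  show ?thesis
    unfolding PU_def e proj_commute[OF K K xs_less[OF j] xs_less[OF i] cont2_cell[OF u j i]] by (rule projy_swp)
qed

lemma (in mesh) PU_boundary:
  assumes K: "radau k 1 K" and u: "cont2 {0..1} {0..1} u" and z: "\<And>y. y \<in> {0..1} \<Longrightarrow> u 1 y = 0" and j: "j \<in> {1..N}"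
    and y: "y \<in> {xs (j-1)<..<xs j}"
  shows "PU k K u N j (xs N) y = 0"
proof -
  have Nm: "N \<in> {1..N}" using N1 by simp
  have y': "y \<in> {0..1}" using subsetD[OF cell_sub_open[OF j] y] by simp
  define G where "G = projy k K (xs (j-1)) (xs j) u"
  have "cont2 {0..1} {0..1} G"
    unfolding G_def by (rule cont2_projy[OF radau_cont[OF K] xs_less[OF j] cont2_subset[OF u subset_refl cell_sub[OF j]]])
  from continuous_on_subset[OF cont2_slice_x[OF this y'] cell_sub[OF Nm]]
  have "PU k K u N j (xs N) y = G (xs N) y"
    unfolding PU_def projx_def G_def[symmetric] by (rule radau_right[OF K xs_less[OF Nm]])
  also have "\<dots> = proj k K (xs (j-1)) (xs j) (\<lambda>t. 0 * 0) y"
    unfolding G_def projy_def xN by (rule proj_cong[OF xs_less[OF j]]) (simp add: z[OF cell_mem[OF j]])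
  also have "\<dots> = 0" unfolding proj_cmult by simp
  finally show ?thesis .
qed

text \<open>Assembles the hypotheses of \<open>energy_estimate\<close>. Everything that concerns
  \<open>q\<close> is the result for \<open>p\<close> applied to the reflected solution.\<close>

lemma (in mesh) ldg_energy_error:
  assumes Km: "radau k 1 Km" "proj_stable k Km C" and Kp: "radau k 0 Kp" "proj_stable k Kp C"
    and KL: "L2kern k KL" "proj_stable k KL C"
    and \<epsilon>: "\<epsilon> > 0" "sqrt \<epsilon> \<le> 1" and \<beta>: "\<beta> > 0"
    and bc: "cont2 {0..1} {0..1} b" and bB: "\<And>x y. in_open_sq x y \<Longrightarrow> 0 \<le> b x y" "\<And>x y. in_open_sq x y \<Longrightarrow> b x y \<le> B"
    and s: "solves_problem \<epsilon> b f u" and r: "regularity k \<beta> C0 \<epsilon> u S W Z"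
    and sol: "is_LDG_solution k \<epsilon> b f (stab \<epsilon> N) (stab \<epsilon> N) xs N U P Q"
    and A_def: "A = layer_sum k \<beta> (sqrt \<epsilon>) xs" and m_def: "m = 9 * (1 + C)\<^sup>2 * C0"
  shows "energy_norm \<epsilon> b (stab \<epsilon> N) (stab \<epsilon> N) xs N (\<lambda>x y. u x y - U x y)
      (\<lambda>x y. \<epsilon> * pdx u x y - P x y) (\<lambda>x y. \<epsilon> * pdy u x y - Q x y)
    \<le> sqrt ((102 + 19 * B) * m\<^sup>2 * (wsum A + sqrt \<epsilon> * (A N)\<^sup>2))"
proof -
  have ok: "kern_ok k Km" "kern_ok k Kp" "kern_ok k KL" using Km Kp KL by (simp_all add: radau_def L2kern_def)
  note kc = radau_cont[OF Km(1)] radau_cont[OF Kp(1)] L2kern_cont[OF KL(1)]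
  have \<delta>: "sqrt \<epsilon> > 0" using \<epsilon> by simp
  obtain ux uy uxx uyy where C0: "0 \<le> C0"
    and uc: "cont2 {0..1} {0..1} u" and uxc: "cont2 {0..1} {0..1} ux" and uyc: "cont2 {0..1} {0..1} uy"
    and ux: "\<And>x y. x \<in> {0<..<1} \<Longrightarrow> y \<in> {0<..<1} \<Longrightarrow> ((\<lambda>t. u t y) has_real_derivative ux x y) (at x)"
    and uy: "\<And>x y. x \<in> {0<..<1} \<Longrightarrow> y \<in> {0<..<1} \<Longrightarrow> (u x has_real_derivative uy x y) (at y)"
    and uxx: "\<And>x y. x \<in> {0<..<1} \<Longrightarrow> y \<in> {0<..<1} \<Longrightarrow> ((\<lambda>t. ux t y) has_real_derivative uxx x y) (at x)"
    and uyy: "\<And>x y. x \<in> {0<..<1} \<Longrightarrow> y \<in> {0<..<1} \<Longrightarrow> (uy x has_real_derivative uyy x y) (at y)"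
    and bx: "bc2 {0<..<1} {0<..<1} uxx" and b_y: "bc2 {0<..<1} {0<..<1} uyy"
    and F: "\<And>x y. in_open_sq x y \<Longrightarrow> f x y = b x y * u x y - \<epsilon> * uxx x y - \<epsilon> * uyy x y"
    and du: "layer_decomp k \<beta> (sqrt \<epsilon>) C0 u" "layer_decomp k \<beta> (sqrt \<epsilon>) C0 (swp u)"
    and dux: "layer_decomp k \<beta> (sqrt \<epsilon>) (sqrt \<epsilon> * C0) (\<lambda>x y. \<epsilon> * ux x y)" "layer_decomp k \<beta> (sqrt \<epsilon>) (sqrt \<epsilon> * C0) (\<lambda>x y. \<epsilon> * ux y x)"
    and duy: "layer_decomp k \<beta> (sqrt \<epsilon>) (sqrt \<epsilon> * C0) (\<lambda>x y. \<epsilon> * uy x y)" "layer_decomp k \<beta> (sqrt \<epsilon>) (sqrt \<epsilon> * C0) (\<lambda>x y. \<epsilon> * uy y x)"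
  proof (rule regularity_decomp[OF r s \<epsilon> \<beta>], goal_cases)
    case (1 ux uy uxx uyy)
    show ?case by (rule 1(1)[OF 1(2-)])
  qed
  have bd: "u x y = 0" if "x \<in> {0..1}" "y \<in> {0..1}" "x = 0 \<or> x = 1 \<or> y = 0 \<or> y = 1" for x y
    using s that unfolding solves_problem_def in_closed_sq_def by auto
  have dX: "((\<lambda>t. u t y) has_real_derivative ux x y) (at x within {0..1})" if "x \<in> {0..1}" "y \<in> {0..1}" for x y
    by (rule tangential_derivative_closed[OF uc uxc ux that])
  have dY: "((\<lambda>t. u y t) has_real_derivative uy y x) (at x within {0..1})" if "x \<in> {0..1}" "y \<in> {0..1}" for x y
    by (rule tangential_derivative_closed[OF cont2_swp[OF uc] cont2_swp[OF uyc] uy that])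
  define p where "p = (\<lambda>x y. \<epsilon> * ux x y)"
  define q where "q = (\<lambda>x y. \<epsilon> * uy x y)"
  define px where "px = (\<lambda>x y. \<epsilon> * uxx x y)"
  define qy where "qy = (\<lambda>x y. \<epsilon> * uyy x y)"
  have pc: "cont2 {0..1} {0..1} p" and qc: "cont2 {0..1} {0..1} q"
    unfolding p_def q_def by (intro cont2_intros uxc uyc)+
  have bpx: "bc2 {0<..<1} {0<..<1} px" and bqy: "bc2 {0<..<1} {0<..<1} qy"
    unfolding px_def qy_def by (intro bc2_intros bx b_y)+
  have dp: "((\<lambda>t. p t y) has_real_derivative px x y) (at x)" if "x \<in> {0<..<1}" "y \<in> {0<..<1}" for x y
    unfolding p_def px_def by (rule DERIV_cmult[OF uxx[OF that]])
  have dq: "((\<lambda>t. q y t) has_real_derivative qy y x) (at x)" if "x \<in> {0<..<1}" "y \<in> {0<..<1}" for x y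
    unfolding q_def qy_def by (rule DERIV_cmult[OF uyy[OF that(2,1)]])
  define Pu where "Pu = glob (PU k Km u)"
  define Pp where "Pp = glob (PP k Kp KL p)"
  \<comment> \<open>Primed objects live in exchanged coordinates: they project \<open>swp q\<close>
    and \<open>swp uy\<close> as if these were the flux and the derivative in
    \<open>x\<close>.\<close>
  define Pq' where "Pq' = glob (PP k Kp KL (swp q))"
  define Ax where "Ax = glob (PY k Km ux)"
  define By' where "By' = glob (PY k Km (swp uy))"
  define gx where "gx = (\<lambda>y. p 1 y - projx k Kp (xs (N-1)) 1 p 1 y)"
  define gy where "gy = (\<lambda>y. q y 1 - projx k Kp (xs (N-1)) 1 (swp q) 1 y)"
  have vPu: "VN k Pu (PU k Km u)" unfolding Pu_def by (rule VN_PU[OF kc(1) uc])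
  have vPp: "VN k Pp (PP k Kp KL p)" unfolding Pp_def by (rule VN_PP[OF kc(2,3) pc])
  have vPq': "VN k Pq' (PP k Kp KL (swp q))" unfolding Pq'_def by (rule VN_PP[OF kc(2,3) cont2_swp[OF qc]])
  have PCAx: "PC Ax" unfolding Ax_def by (rule PC_PY[OF kc(1) uxc])
  have PCBy': "PC By'" unfolding By'_def by (rule PC_PY[OF kc(1) cont2_swp[OF uyc]])
  \<comment> \<open>Reflecting the projection of \<open>u\<close> gives a representative of the
    projection of the reflected \<open>u\<close>, as \<open>T2x_projection\<close> requires.\<close>
  have rsw: "repr (swp Pu) (PU k Km (swp u))"
    unfolding repr_def Pu_def glob_def by (intro ballI) (simp only: idx_eq PU_swp[OF kc(1) uc])
  have T2: "T2x Pu v = - bip xs N Ax v" if v: "VN k v V" for v V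
    unfolding Ax_def by (rule T2x_projection[OF Km(1) uc uxc dX _ _ v]) (simp_all add: bd Pu_def repr_glob)
  have T2': "T2x (swp Pu) (swp v) = - bip xs N (swp By') v" if v: "VN k v V" for v V
  proof -
    have "T2x (swp Pu) (swp v) = - bip xs N By' (swp v)"
      unfolding By'_def by (rule T2x_projection[OF Km(1) cont2_swp[OF uc] cont2_swp[OF uyc] dY _ _ VN_swp[OF v] rsw]) (simp_all add: bd)
    then show ?thesis using bip_swp[OF PCBy' PC_swp[OF PC_VN[OF v]]] by simp
  qed
  have T3: "T3x Pp v = - bip xs N px v + edge gx v" if v: "VN k v V" for v V
    unfolding Pp_def gx_def by (rule T3x_projection[OF Kp(1) KL(1) pc dp bpx v])
  have T3': "T3x (swp (swp Pq')) (swp v) = - bip xs N qy v + edge gy (swp v)" if v: "VN k v V" for v V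
  proof -
    have "T3x Pq' (swp v) = - bip xs N (swp qy) (swp v) + edge gy (swp v)"
      unfolding Pq'_def gy_def by (rule T3x_projection[OF Kp(1) KL(1) cont2_swp[OF qc] dq bc2_swp[OF bqy] VN_swp[OF v]])
    then show ?thesis using bip_swp[OF PC_bc2[OF bqy] PC_VN[OF v]] by simp
  qed
  have z: "PU k Km u N j (xs N) y = 0" if "j \<in> {1..N}" "y \<in> {xs (j-1)<..<xs j}" for j y
    by (rule PU_boundary[OF Km(1) uc _ that]) (simp add: bd)
  have Nm: "N \<in> {1..N}" using N1 by simp
  have z': "PU k Km u j N y (xs N) = 0" if "j \<in> {1..N}" "y \<in> {xs (j-1)<..<xs j}" for j y
    unfolding PU_swp[OF kc(1) uc Nm that(1)] by (rule PU_boundary[OF Km(1) cont2_swp[OF uc] _ that]) (simp add: bd)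
  have eu: "\<bar>u x y - Pu x y\<bar> \<le> m * (A i + A j)"
    if i: "i \<in> {1..N}" and j: "j \<in> {1..N}" and x: "x \<in> {xs (i-1)<..<xs i}" and y: "y \<in> {xs (j-1)<..<xs j}" for i j x y
  proof -
    have "x \<in> {xs (i-1)..xs i}" using x by simp
    from tensor_projection_error[OF ok(1) Km(2) ok(1) Km(2) uc du \<beta> \<delta> C0 i j this y]
    show ?thesis unfolding Pu_def glob_def idx_eq[OF i x] idx_eq[OF j y] PU_def A_def m_def .
  qed
  have dup: "layer_decomp k \<beta> (sqrt \<epsilon>) (sqrt \<epsilon> * C0) p" "layer_decomp k \<beta> (sqrt \<epsilon>) (sqrt \<epsilon> * C0) (swp p)"
    using dux by (simp_all add: p_def)
  have swq: "(\<lambda>x y. q y x) = (\<lambda>x y. \<epsilon> * uy y x)" by (simp add: q_def)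
  note ex = flux_projection_error[OF ok(2) Kp(2) ok(3) KL(2) ok(1) Km(2) \<epsilon>(1) C0 \<beta> uxc p_def dup A_def m_def,
      folded Pp_def Ax_def gx_def]
  have duq: "layer_decomp k \<beta> (sqrt \<epsilon>) (sqrt \<epsilon> * C0) (swp q)" "layer_decomp k \<beta> (sqrt \<epsilon>) (sqrt \<epsilon> * C0) q"
    using duy by (simp_all add: q_def)
  note ey = flux_projection_error[OF ok(2) Kp(2) ok(3) KL(2) ok(1) Km(2) \<epsilon>(1) C0 \<beta> cont2_swp[OF uyc] swq duq A_def m_def,
      folded Pq'_def By'_def gy_def]
  have pX: "p x y = \<epsilon> * pdx u x y" "q x y = \<epsilon> * pdy u x y" if "in_open_sq x y" for x y
    using that DERIV_imp_deriv[OF ux[of x y]] DERIV_imp_deriv[OF uy[of x y]]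
    unfolding p_def q_def pdx_def pdy_def in_open_sq_def by simp_all
  have F': "f x y = b x y * u x y - px x y - qy x y" if "in_open_sq x y" for x y
    unfolding px_def qy_def by (rule F[OF that])
  have eq: "\<bar>q x y - swp Pq' x y\<bar> \<le> sqrt \<epsilon> * m * (A i + A j)"
    if "i \<in> {1..N}" "j \<in> {1..N}" "x \<in> {xs (i-1)<..<xs i}" "y \<in> {xs (j-1)<..<xs j}" for i j x y
    using ey(1)[OF that(2,1,4,3)] by (simp only: add.commute)
  have eB: "\<bar>swp By' x y - swp Pq' x y / \<epsilon>\<bar> \<le> 2 * m / sqrt \<epsilon> * (A i + A j)"
    if "i \<in> {1..N}" "j \<in> {1..N}" "x \<in> {xs (i-1)<..<xs i}" "y \<in> {xs (j-1)<..<xs j}" for i j x y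
    using ey(2)[OF that(2,1,4,3)] by (simp only: add.commute)
  have gxb: "\<bar>gx y\<bar> \<le> sqrt \<epsilon> * m * A N" and gyb: "\<bar>gy y\<bar> \<le> sqrt \<epsilon> * m * A N" if "y \<in> {0<..<1}" for y
    unfolding gx_def gy_def by (rule ex(4)[OF that], rule ey(4)[OF that])
  have bd1: "u 1 y = 0" "u y 1 = 0" if "y \<in> {0..1}" for y using that by (simp_all add: bd)
  show ?thesis
    by (rule energy_estimate[where \<epsilon> = \<epsilon> and b = b and u = u and p = p and q = q and px = px and qy = qy and f = f and k = k
          and U = U and P = P and Q = Q and A = A and m = m and B = B and Ax = Ax and By = "swp By'" and Pu = Pu and PuF = "PU k Km u" and Pp = Pp
          and PpF = "PP k Kp KL p" and Pq = "swp Pq'" and PqF = "\<lambda>i j. swp (PP k Kp KL (swp q) j i)" and gx = gx and gy = gy,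
        OF \<epsilon>(1) PC_cont2[OF bc] uc PC_cont2[OF pc] PC_cont2[OF qc] PC_bc2[OF bpx] PC_bc2[OF bqy] PCAx PC_swp[OF PCBy'] F' pX bd1
          sol vPu vPp VN_swp[OF vPq'] T2 T2' T3 T3' z z' bB eu ex(1) eq ex(2) eB ex(3) gxb ey(3) gyb])
qed

section \<open>The error bound with a uniform constant\<close>

theorem theorem4p5:
  fixes k :: nat and \<sigma> \<beta> C0 :: real and b f :: "real \<Rightarrow> real \<Rightarrow> real" and mt :: meshtype
  assumes "\<sigma> \<ge> real k + 3/2"
    and "\<beta> > 0"
    and "smooth_closed b"
    and "\<forall>x y. in_closed_sq x y \<longrightarrow> b x y \<ge> 2 * \<beta>\<^sup>2"
  shows "\<exists>C>0. \<forall>\<epsilon> N u S W Z U P Q.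
     \<epsilon> > 0 \<and> N \<ge> 4 \<and> 4 dvd N \<and> sqrt \<epsilon> \<le> 1 / real N \<and> mesh_tau mt \<sigma> \<beta> \<epsilon> N \<le> 1/4 \<and>
     solves_problem \<epsilon> b f u \<and> regularity k \<beta> C0 \<epsilon> u S W Z \<and>
     is_LDG_solution k \<epsilon> b f (stab \<epsilon> N) (stab \<epsilon> N) (mesh_pt mt \<sigma> \<beta> \<epsilon> N) N U P Q
     \<longrightarrow> energy_norm \<epsilon> b (stab \<epsilon> N) (stab \<epsilon> N) (mesh_pt mt \<sigma> \<beta> \<epsilon> N) N
           (\<lambda>x y. u x y - U x y) (\<lambda>x y. \<epsilon> * pdx u x y - P x y) (\<lambda>x y. \<epsilon> * pdy u x y - Q x y)
         \<le> C * err_bound mt k \<epsilon> N"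
proof -
  obtain Km where Km: "radau k 1 Km"
    using radau_exists[of 1 k] unfolding radau_def proj_moments_def by blast
  obtain Kp where Kp: "radau k 0 Kp"
    using radau_exists[of 0 k] unfolding radau_def proj_moments_def by blast
  obtain KL where KL: "L2kern k KL"
    using L2_exists[of k] unfolding L2kern_def proj_moments_def less_Suc_eq_le by blast
  obtain c1 c2 c3 where c: "proj_stable k Km c1" "proj_stable k Kp c2" "proj_stable k KL c3"
    using proj_stable_exists[OF radau_cont[OF Km], of k] proj_stable_exists[OF radau_cont[OF Kp], of k]
      proj_stable_exists[OF L2kern_cont[OF KL], of k] by blast
  \<comment> \<open>One stability constant for the three kernels; they are fixed by \<open>k\<close>
    before \<epsilon> and \<open>N\<close> are chosen.\<close>
  define C where "C = max c1 (max c2 c3)"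
  have st: "proj_stable k Km C" "proj_stable k Kp C" "proj_stable k KL C"
    by (rule proj_stable_mono[OF c(1)], simp add: C_def, rule proj_stable_mono[OF c(2)], simp add: C_def,
        rule proj_stable_mono[OF c(3)], simp add: C_def)
  have cl: "cbox (0, 0) (1, 1) = {0..1::real} \<times> {0..1::real}" by (subst cbox_Pair_eq) (simp only: cbox_interval)
  have bc: "cont2 {0..1} {0..1} b"
    using assms(3)[unfolded smooth_closed_def, THEN conjunct2, THEN conjunct2] unfolding cont2_def cl .
  obtain B where B: "\<And>x y. x \<in> {0..1} \<Longrightarrow> y \<in> {0..1} \<Longrightarrow> \<bar>b x y\<bar> \<le> B"
    using cont2_compact_bc2[OF bc] unfolding bc2_def by blast
  have B0: "0 \<le> B" using B[of 0 0] by simp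
  have b0: "0 \<le> b x y" and bB: "b x y \<le> B" if "in_open_sq x y" for x y
  proof -
    have x: "x \<in> {0..1}" "y \<in> {0..1}" and "in_closed_sq x y" using that by (auto simp: in_open_sq_def in_closed_sq_def)
    then have "2 * \<beta>\<^sup>2 \<le> b x y" using assms(4) by blast
    then show "0 \<le> b x y" using zero_le_power2[of \<beta>] by linarith
    show "b x y \<le> B" using B[OF x] by linarith
  qed
  obtain R where R: "R > 0" and mesh: "\<And>\<epsilon> N. \<epsilon> > 0 \<Longrightarrow> N \<ge> 4 \<Longrightarrow> 4 dvd N \<Longrightarrow> sqrt \<epsilon> \<le> 1 / real N \<Longrightarrow> mesh_tau mt \<sigma> \<beta> \<epsilon> N \<le> 1/4 \<Longrightarrow>
    mesh (mesh_pt mt \<sigma> \<beta> \<epsilon> N) N \<and>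
    mesh.wsum (mesh_pt mt \<sigma> \<beta> \<epsilon> N) N (layer_sum k \<beta> (sqrt \<epsilon>) (mesh_pt mt \<sigma> \<beta> \<epsilon> N)) \<le> R * (err_bound mt k \<epsilon> N)\<^sup>2 \<and>
    sqrt \<epsilon> * (layer_sum k \<beta> (sqrt \<epsilon>) (mesh_pt mt \<sigma> \<beta> \<epsilon> N) N)\<^sup>2 \<le> R * (err_bound mt k \<epsilon> N)\<^sup>2"
    using mesh_bounds[OF assms(1,2), of mt] by blast
  define m where "m = 9 * (1 + C)\<^sup>2 * C0"
  define L where "L = (102 + 19 * B) * m\<^sup>2"
  have L: "0 \<le> L" using B0 by (simp add: L_def)
  \<comment> \<open>The summand 1 keeps the constant positive even if \<open>L\<close> vanishes, as
    it does for C0 = 0.\<close>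
  define D where "D = sqrt (L * (2 * R)) + 1"
  have "0 \<le> sqrt (L * (2 * R))" using L R by simp
  then have D: "D > 0" unfolding D_def by linarith
  show ?thesis
  proof (intro exI[of _ D] conjI D allI impI; elim conjE)
    fix \<epsilon> :: real and N :: nat and u S W Z U P Q
    assume e: "\<epsilon> > 0" and N: "N \<ge> 4" "4 dvd N" and eN: "sqrt \<epsilon> \<le> 1 / real N" and t: "mesh_tau mt \<sigma> \<beta> \<epsilon> N \<le> 1/4"
      and s: "solves_problem \<epsilon> b f u" and r: "regularity k \<beta> C0 \<epsilon> u S W Z"
      and sol: "is_LDG_solution k \<epsilon> b f (stab \<epsilon> N) (stab \<epsilon> N) (mesh_pt mt \<sigma> \<beta> \<epsilon> N) N U P Q"
    define xs where "xs = mesh_pt mt \<sigma> \<beta> \<epsilon> N"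
    define A where "A = layer_sum k \<beta> (sqrt \<epsilon>) xs"
    define E where "E = err_bound mt k \<epsilon> N"
    have E: "0 \<le> E" using N by (cases mt) (simp_all add: E_def err_bound_def)
    have ms: "mesh xs N" and w: "mesh.wsum xs N A \<le> R * E\<^sup>2" and a: "sqrt \<epsilon> * (A N)\<^sup>2 \<le> R * E\<^sup>2"
      using mesh[OF e N eN t] unfolding xs_def A_def E_def by blast+
    have "1 / real N \<le> 1" using N by simp
    with eN have e1: "sqrt \<epsilon> \<le> 1" by linarith
    have "energy_norm \<epsilon> b (stab \<epsilon> N) (stab \<epsilon> N) xs N (\<lambda>x y. u x y - U x y)
        (\<lambda>x y. \<epsilon> * pdx u x y - P x y) (\<lambda>x y. \<epsilon> * pdy u x y - Q x y)
      \<le> sqrt ((102 + 19 * B) * m\<^sup>2 * (mesh.wsum xs N A + sqrt \<epsilon> * (A N)\<^sup>2))"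
      by (rule mesh.ldg_energy_error[OF ms Km st(1) Kp st(2) KL st(3) e e1 assms(2) bc b0 bB s r sol[folded xs_def] A_def m_def])
    also have "\<dots> \<le> sqrt (L * (2 * R) * E\<^sup>2)"
    proof (rule real_sqrt_le_mono)
      have "L * (mesh.wsum xs N A + sqrt \<epsilon> * (A N)\<^sup>2) \<le> L * (2 * R * E\<^sup>2)"
        by (rule mult_left_mono[OF _ L]) (use w a in linarith)
      then show "(102 + 19 * B) * m\<^sup>2 * (mesh.wsum xs N A + sqrt \<epsilon> * (A N)\<^sup>2) \<le> L * (2 * R) * E\<^sup>2"
        unfolding L_def by (simp only: mult.assoc)
    qed
    also have "\<dots> = sqrt (L * (2 * R)) * E" using E by (simp only: real_sqrt_mult real_sqrt_abs abs_of_nonneg)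
    also have "\<dots> \<le> D * E" by (rule mult_right_mono[OF _ E]) (simp add: D_def)
    finally show "energy_norm \<epsilon> b (stab \<epsilon> N) (stab \<epsilon> N) (mesh_pt mt \<sigma> \<beta> \<epsilon> N) N (\<lambda>x y. u x y - U x y)
        (\<lambda>x y. \<epsilon> * pdx u x y - P x y) (\<lambda>x y. \<epsilon> * pdy u x y - Q x y) \<le> D * err_bound mt k \<epsilon> N"
      unfolding xs_def E_def .
  qed
qed

end
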